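(* For $i\in\{1,2,3,4\}$ let $\mathsf{PBR}_i$ be the category of preBoolean restriction semigroups with local units and morphisms of type $i$, and let $\mathsf{AC}_i$ be the category of ample topological categories and cofunctors of type $i$. Let $\mathsf{S}_i\colon \mathsf{AC}_i\to\mathsf{PBR}_i$ be the functor $C\mapsto C^a$, $F\mapsto F_*$, and let $\mathsf{C}_i\colon\mathsf{PBR}_i\to\mathsf{AC}_i$ be the functor sending $S$ to its category of germs and a morphism $f\colon S\to T$ to the cofunctor $(\mu,\bar f,\rho)$ described in the context. (1) For each $i=1,2,3,4$ the functors $\mathsf{C}_i\colon \mathsf{PBR}_i\rightleftarrows\mathsf{AC}_i\colon\mathsf{S}_i$ establish an adjunction $\mathsf{C}_i\dashv\mathsf{S}_i$. The component at an object $S$ of the unit $\eta\colon 1_{\mathsf{PBR}_i}\to\mathsf{S}_i\mathsf{C}_i$ is the morphism $\eta_S\colon S\to\mathsf{S}_i\mathsf{C}_i(S)$, $s\mapsto\Theta(s)$. The component at an object $C$ of the counit $\varepsilon\colon \mathsf{C}_i\mathsf{S}_i\to 1_{\mathsf{AC}_i}$ is the cofunctor $\varepsilon_C=(\mu,f,\rho)\colon\mathsf{C}_i\mathsf{S}_i(C)\rightsquigarrow C$ given by $$\mu([A,\varphi_x],x)=r(A1_x),\quad f(x)=\varphi_x,\quad \rho_1([A,\varphi_x],x)=A1_x,\quad \rho_0(x)=x,$$ where for $x\in C_0$ the prime character $\varphi_x$ of $P(C^a)$ is given by $\varphi_x(1_U)=1\Leftrightarrow x\in U$ ($U\subseteq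 C_0$ compact-open), and $A1_x$ denotes the unique element of the slice $A$ with domain $x$. Moreover, $\varepsilon_C$ is an isomorphism for every object $C$ of $\mathsf{AC}_i$. (2) For each $i=1,2,3,4$ the adjunction $\mathsf{C}_i\dashv\mathsf{S}_i$ restricts to an adjunction between the category of preBoolean range semigroups (with morphisms of type $i$) and the category of strongly ample categories (with cofunctors of type $i$), and furthermore to an adjunction between the category of étale preBoolean range semigroups (with morphisms of type $i$) and the category of biample categories (with cofunctors of type $i$).
   Context: **Algebra.** A restriction semigroup is an algebra $(S;\cdot,{}^* )$ where $(S;\cdot)$ is a semigroup and ${}^*$ is unary with $xx^*=x$, $x^*y^*=y^*x^*=(x^*y^* )^*$, $(xy)^*=(x^*y)^*$, $x^*y=y(xy)^*$. Projections: $P(S)=\{s^*:s\in S\}$, a semilattice. Natural partial order: $s\le t$ iff $s=ts^*$. $s\vee t$ denotes the least upper bound with respect to $\le$, if it exists. A generalized Boolean algebra is a relatively complemented distributive lattice with bottom $0$. A restriction semigroup with a left zero $0$ that is a projection (then $0$ is a zero and the minimum) is preBoolean if: (BR1') any $s,t\in S$ with a common upper bound have a join $s\vee t$; (BR2) $(P(S),\le)$ is a generalized Boolean algebra; (BR3) $(s\vee t)u=su\vee tu$ whenever $s\vee t$ exists. $S$ has local units if for every $s\in S$ there is $e\in P(S)$ with $es=s$. A range semigroup is an algebra $(S;\cdot,{}^*,{}^+)$ with $(S;\cdot,{}^* )$ a restriction semigroup and $x^+x=x$, $x^+y^+=y^+x^+=(x^+y^+)^+$, $(xy)^+=(xy^+)^+$,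 $(x^+)^*=x^+$, $(x^* )^+=x^*$. It is a preBoolean range semigroup if $(S;\cdot,{}^* )$ is preBoolean. An element $s$ of a range semigroup is bideterministic if $es=s(es)^*$ and $se=(se)^+s$ for all $e\in P(S)$. A preBoolean range semigroup is étale if every element is a finite join of bideterministic elements. **Morphisms of semigroups.** A morphism $f\colon S\to T$ of preBoolean restriction semigroups is a map preserving $\cdot$ and ${}^*$ whose restriction $P(S)\to P(T)$ is a morphism of generalized Boolean algebras that is proper (for every $q\in P(T)$ there is $p\in P(S)$ with $f(p)\ge q$). The morphism $f$ is proper if for every $t\in T$ there are $n\ge1$, $t_1,\dots,t_n\in T$, $s_1,\dots,s_n\in S$ with $t\le t_1\vee\dots\vee t_n$ and $f(s_j)\ge t_j$ for all $j$. It is weakly meet-preserving if for all $s,t\in S$, $u\in T$ with $u\le f(s),f(t)$ there is $v\le s,t$ with $u\le f(v)$. Types: 1 = morphisms; 2 = weakly meet-preserving morphisms; 3 = proper morphisms; 4 = proper and weakly meet-preserving morphisms. For range semigroups the same morphisms are used. **Topological categories.** A topological category $C=(C_1,C_0,u,d,r,m)$ is a small category internal to topological spaces: arrows $C_1$, objects $C_0$, continuous unit $u$, domain $d$, range $r$ and multiplication $m\colon C_2\to C_1$, $C_2=\{(x,y)\in C_1\times C_1: r(y)=d(x)\}$ (subspace topology), $d(xy)=d(y)$, $r(xy)=r(x)$. Write $1_x=u(x)$ and $1_X=u(X)$ for $X\subseteq C_0$. $C$ is étale if $C_0$ is locally compact Hausdorff and $d$ is a local homeomorphism; bi-étale if moreover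 $r$ is a local homeomorphism. A slice is an open $A\subseteq C_1$ with $d|_A$ injective; a bislice is a slice with $r|_A$ injective too. $C$ is ample if it is étale and compact slices form a basis of $C_1$; strongly ample if ample and $r$ is open; biample if bi-étale and compact bislices form a basis of $C_1$. For $C$ ample, $C^a$ is the set of compact slices with $AB=\{ab: a\in A,b\in B,(a,b)\in C_2\}$, $A^*=1_{d(A)}$ and, when $r$ is open, $A^+=1_{r(A)}$. The projections of $C^a$ are the sets $1_U$, $U\subseteq C_0$ compact-open. **Cofunctors.** An action of $C$ on a space $X$ is a pair $(\mu,f)$ of continuous maps $f\colon X\to C_0$ and $\mu\colon C_1\times_{d,f}X=\{(s,x):d(s)=f(x)\}\to X$, $(s,x)\mapsto s\cdot x$, with $f(s\cdot x)=r(s)$, $s\cdot(t\cdot x)=st\cdot x$ when both sides are defined, and $1_{f(x)}\cdot x=x$. The transformation category $C\rtimes X$ has objects $X$, arrows $C_1\times_{d,f}X$, $u(x)=(1_{f(x)},x)$, $d(s,x)=x$, $r(s,x)=s\cdot x$, $(s,t\cdot x)(t,x)=(st,x)$. A cofunctor $F=(\mu,f,\rho)\colon C\rightsquigarrow D$ of ample categories consists of an action $(\mu,f)$ of $C$ on $D_0$ with $f$ proper (preimages of compact sets are compact) and a continuous functor $\rho=(\rho_1,\rho_0)\colon C\rtimes D_0\to D$ that is the identity on objects, such that for each compact slice $A\subseteq C_1$ the set $F_*(A)=\{\rho_1(s,x):s\in A,(s,x)\in C\rtimes D_0\}$ is compact-open. The composition of $F=(\bar\mu,\bar f,\bar\rho)\colon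 C\rightsquigarrow D$ and $G=(\tilde\mu,\tilde f,\tilde\rho)\colon D\rightsquigarrow E$ is $G\circ F=(\mu,f,\rho)$ with $f=\bar f\tilde f$, $\mu(s,x)=\tilde\mu(\bar\rho_1(s,\tilde f(x)),x)$, $\rho_0(x)=x$, $\rho_1(s,x)=\tilde\rho_1(\bar\rho_1(s,\tilde f(x)),x)$. $F$ is injective on arrows if $\rho_1(s,x)=\rho_1(t,x)$ implies $s=t$; surjective on arrows if for all $t\in D_1$ with $d(t)=x$ there is $(s,x)\in C_1\times_{d,f}D_0$ with $\rho_1(s,x)=t$; bijective on arrows if both. Types of cofunctors: 1 = all; 2 = injective on arrows; 3 = surjective on arrows; 4 = bijective on arrows. A cofunctor $(\mu,f,\rho)\colon C\rightsquigarrow D$ is an isomorphism if $f\colon D_0\to C_0$ is a homeomorphism, the action on $D_0$ is equivalent via $f$ to the natural action $(s,d(s))\mapsto r(s)$ of $C$ on $C_0$, and $\rho\colon C\rtimes D_0\to D$ is an isomorphism of topological categories (a functor that is a homeomorphism on arrows and on objects). **Category of germs.** Let $S$ be a preBoolean restriction semigroup with local units. A prime character of $P(S)$ is a non-zero morphism of generalized Boolean algebras $P(S)\to\mathbb B=\{0,1\}$; $\widehat{P(S)}$ is the set of prime characters with basis of topology $D_e=\{\varphi:\varphi(e)=1\}$, $e\in P(S)$. If $\varphi(s^* )=1$, $(s\circ\varphi)(e)=\varphi((es)^* )$ defines a prime character. On $\Omega=\{(s,\varphi)\in S\times\widehat{P(S)}:\varphi(s^* )=1\}$ put $(s,\varphi)\sim(t,\psi)$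 iff $\varphi=\psi$ and there is $u\le s,t$ with $\varphi(u^* )=1$; the class of $(s,\varphi)$ is the germ $[s,\varphi]$. The category of germs has $C_1=\Omega/{\sim}$, $C_0=\widehat{P(S)}$, $d([s,\varphi])=\varphi$, $r([s,\varphi])=s\circ\varphi$, $u(\varphi)=[e,\varphi]$ for any $e\in P(S)$ with $\varphi(e)=1$, $[s,t\circ\psi][t,\psi]=[st,\psi]$; $C_1$ has as basis the sets $\Theta(s)=\{[s,\varphi]:\varphi(s^* )=1\}$, $s\in S$. For a morphism $f\colon S\to T$ the cofunctor $(\mu,\bar f,\rho)$ between the categories of germs is given by $\bar f(\psi)=\psi f|_{P(S)}$, $\mu([s,\psi f|_{P(S)}],\psi)=f(s)\circ\psi$, $\rho_0(x)=x$, $\rho_1([s,\psi f|_{P(S)}],\psi)=[f(s),\psi]$. *)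

theory Defs
  imports "HOL-Analysis.Analysis" "HOL-Algebra.Lattice"
begin

section \<open>Generalized Boolean algebras\<close>

locale gen_boolean_algebra = Lattice.lattice L for L (structure) +
  assumes distributive:
    "\<lbrakk>x \<in> carrier L; y \<in> carrier L; z \<in> carrier L\<rbrakk> \<Longrightarrow> x \<sqinter> (y \<squnion> z) = (x \<sqinter> y) \<squnion> (x \<sqinter> z)"
  and has_bottom: "\<exists>z. least L z (carrier L)"
  and relatively_complemented:
    "\<lbrakk>a \<in> carrier L; b \<in> carrier L; x \<in> carrier L; a \<sqsubseteq> x; x \<sqsubseteq> b\<rbrakk>
      \<Longrightarrow> \<exists>y \<in> carrier L. x \<sqinter> y = a \<and> x \<squnion> y = b"

text \<open>Relative complements are unique in a distributive lattice, hence they are preserved by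
  every map that preserves the bottom and binary meets and joins.\<close>

definition gba_hom :: "'a gorder \<Rightarrow> 'b gorder \<Rightarrow> ('a \<Rightarrow> 'b) \<Rightarrow> bool" where
  "gba_hom L M h \<longleftrightarrow> h \<in> carrier L \<rightarrow> carrier M \<and> join_pres L M h \<and> meet_pres L M h
     \<and> h \<bottom>\<^bsub>L\<^esub> = \<bottom>\<^bsub>M\<^esub>"

definition bool_lattice :: "bool gorder" where
  "bool_lattice = \<lparr>carrier = UNIV, eq = (=), le = (\<le>)\<rparr>"


section \<open>Restriction and range semigroups\<close>

record 'a rsg = "'a partial_object" +
  smult :: "'a \<Rightarrow> 'a \<Rightarrow> 'a" (infixl \<open>\<odot>\<index>\<close> 70)
  star :: "'a \<Rightarrow> 'a" (\<open>_\<^sup>\<star>\<index>\<close> [1000] 999)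

locale restriction_semigroup =
  fixes S :: "'a rsg" (structure)
  assumes mult_closed: "\<lbrakk>x \<in> carrier S; y \<in> carrier S\<rbrakk> \<Longrightarrow> x \<odot> y \<in> carrier S"
    and star_closed: "x \<in> carrier S \<Longrightarrow> x\<^sup>\<star> \<in> carrier S"
    and mult_assoc: "\<lbrakk>x \<in> carrier S; y \<in> carrier S; z \<in> carrier S\<rbrakk>
      \<Longrightarrow> (x \<odot> y) \<odot> z = x \<odot> (y \<odot> z)"
    and mult_star: "x \<in> carrier S \<Longrightarrow> x \<odot> x\<^sup>\<star> = x"
    and star_commute: "\<lbrakk>x \<in> carrier S; y \<in> carrier S\<rbrakk> \<Longrightarrow> x\<^sup>\<star> \<odot> y\<^sup>\<star> = y\<^sup>\<star> \<odot> x\<^sup>\<star>"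
    and star_star_mult: "\<lbrakk>x \<in> carrier S; y \<in> carrier S\<rbrakk> \<Longrightarrow> x\<^sup>\<star> \<odot> y\<^sup>\<star> = (x\<^sup>\<star> \<odot> y\<^sup>\<star>)\<^sup>\<star>"
    and star_mult: "\<lbrakk>x \<in> carrier S; y \<in> carrier S\<rbrakk> \<Longrightarrow> (x \<odot> y)\<^sup>\<star> = (x\<^sup>\<star> \<odot> y)\<^sup>\<star>"
    and ample_law: "\<lbrakk>x \<in> carrier S; y \<in> carrier S\<rbrakk> \<Longrightarrow> x\<^sup>\<star> \<odot> y = y \<odot> (x \<odot> y)\<^sup>\<star>"

definition projs :: "'a rsg \<Rightarrow> 'a set" where
  "projs S = star S ` carrier S"

definition nle :: "'a rsg \<Rightarrow> 'a \<Rightarrow> 'a \<Rightarrow> bool" where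
  "nle S s t \<longleftrightarrow> s = t \<odot>\<^bsub>S\<^esub> s\<^sup>\<star>\<^bsub>S\<^esub>"

definition nposet :: "'a rsg \<Rightarrow> 'a gorder" where
  "nposet S = \<lparr>carrier = carrier S, eq = (=), le = nle S\<rparr>"

definition pposet :: "'a rsg \<Rightarrow> 'a gorder" where
  "pposet S = \<lparr>carrier = projs S, eq = (=), le = nle S\<rparr>"

definition is_join :: "'a rsg \<Rightarrow> 'a set \<Rightarrow> 'a \<Rightarrow> bool" where
  "is_join S X j \<longleftrightarrow> X \<subseteq> carrier S \<and> least (nposet S) j (Upper (nposet S) X)"

locale preBoolean = restriction_semigroup +
  assumes zero: "\<exists>z \<in> projs S. \<forall>s \<in> carrier S. z \<odot> s = z"
    and BR1: "\<lbrakk>s \<in> carrier S; t \<in> carrier S; w \<in> carrier S; nle S s w; nle S t w\<rbrakk>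
      \<Longrightarrow> \<exists>j. is_join S {s, t} j"
    and BR2: "gen_boolean_algebra (pposet S)"
    and BR3: "\<lbrakk>s \<in> carrier S; t \<in> carrier S; u \<in> carrier S; is_join S {s, t} j\<rbrakk>
      \<Longrightarrow> is_join S {s \<odot> u, t \<odot> u} (j \<odot> u)"

locale preBoolean_lu = preBoolean +
  assumes local_units: "s \<in> carrier S \<Longrightarrow> \<exists>e \<in> projs S. e \<odot> s = s"

text \<open>A range semigroup is given by a restriction semigroup \<open>S\<close> together with the
  operation \<open>p\<close>, usually written \<open>x \<mapsto> x\<^sup>+\<close>.\<close>

locale range_semigroup = restriction_semigroup S for S :: "'a rsg" (structure) +
  fixes p :: "'a \<Rightarrow> 'a"
  assumes plus_closed: "x \<in> carrier S \<Longrightarrow> p x \<in> carrier S"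
    and plus_mult: "x \<in> carrier S \<Longrightarrow> p x \<odot> x = x"
    and plus_commute: "\<lbrakk>x \<in> carrier S; y \<in> carrier S\<rbrakk> \<Longrightarrow> p x \<odot> p y = p y \<odot> p x"
    and plus_plus_mult: "\<lbrakk>x \<in> carrier S; y \<in> carrier S\<rbrakk> \<Longrightarrow> p x \<odot> p y = p (p x \<odot> p y)"
    and plus_of_mult: "\<lbrakk>x \<in> carrier S; y \<in> carrier S\<rbrakk> \<Longrightarrow> p (x \<odot> y) = p (x \<odot> p y)"
    and plus_star: "x \<in> carrier S \<Longrightarrow> (p x)\<^sup>\<star> = p x"
    and star_plus: "x \<in> carrier S \<Longrightarrow> p (x\<^sup>\<star>) = x\<^sup>\<star>"

locale preBoolean_range = range_semigroup + preBoolean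

definition bideterministic :: "'a rsg \<Rightarrow> ('a \<Rightarrow> 'a) \<Rightarrow> 'a \<Rightarrow> bool" where
  "bideterministic S p s \<longleftrightarrow> s \<in> carrier S \<and>
     (\<forall>e \<in> projs S. e \<odot>\<^bsub>S\<^esub> s = s \<odot>\<^bsub>S\<^esub> (e \<odot>\<^bsub>S\<^esub> s)\<^sup>\<star>\<^bsub>S\<^esub> \<and> s \<odot>\<^bsub>S\<^esub> e = p (s \<odot>\<^bsub>S\<^esub> e) \<odot>\<^bsub>S\<^esub> s)"

locale etale_preBoolean_range = preBoolean_range +
  assumes etale: "s \<in> carrier S
    \<Longrightarrow> \<exists>B. finite B \<and> (\<forall>b \<in> B. bideterministic S p b) \<and> is_join S B s"


section \<open>Morphisms of preBoolean restriction semigroups\<close>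

text \<open>Morphisms are extensional functions (\<open>undefined\<close> off the carrier), so that equality of
  morphisms is equality of functions.\<close>

definition pbr_mor :: "'s rsg \<Rightarrow> 't rsg \<Rightarrow> ('s \<Rightarrow> 't) \<Rightarrow> bool" where
  "pbr_mor S T f \<longleftrightarrow> f \<in> carrier S \<rightarrow>\<^sub>E carrier T
     \<and> (\<forall>x \<in> carrier S. \<forall>y \<in> carrier S. f (x \<odot>\<^bsub>S\<^esub> y) = f x \<odot>\<^bsub>T\<^esub> f y)
     \<and> (\<forall>x \<in> carrier S. f (x\<^sup>\<star>\<^bsub>S\<^esub>) = (f x)\<^sup>\<star>\<^bsub>T\<^esub>)
     \<and> gba_hom (pposet S) (pposet T) f
     \<and> (\<forall>q \<in> projs T. \<exists>e \<in> projs S. nle T q (f e))"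

definition proper_mor :: "'s rsg \<Rightarrow> 't rsg \<Rightarrow> ('s \<Rightarrow> 't) \<Rightarrow> bool" where
  "proper_mor S T f \<longleftrightarrow> (\<forall>t \<in> carrier T. \<exists>n \<ge> (1::nat). \<exists>ts ss j.
     (\<forall>k \<in> {1..n}. ts k \<in> carrier T \<and> ss k \<in> carrier S \<and> nle T (ts k) (f (ss k)))
     \<and> is_join T (ts ` {1..n}) j \<and> nle T t j)"

definition weakly_meet_preserving :: "'s rsg \<Rightarrow> 't rsg \<Rightarrow> ('s \<Rightarrow> 't) \<Rightarrow> bool" where
  "weakly_meet_preserving S T f \<longleftrightarrow> (\<forall>s \<in> carrier S. \<forall>t \<in> carrier S. \<forall>u \<in> carrier T.
     nle T u (f s) \<and> nle T u (f t)
       \<longrightarrow> (\<exists>v \<in> carrier S. nle S v s \<and> nle S v t \<and> nle T u (f v)))"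

definition pbr_hom :: "nat \<Rightarrow> 's rsg \<Rightarrow> 't rsg \<Rightarrow> ('s \<Rightarrow> 't) set" where
  "pbr_hom i S T = {f. pbr_mor S T f
     \<and> (i \<in> {2, 4} \<longrightarrow> weakly_meet_preserving S T f)
     \<and> (i \<in> {3, 4} \<longrightarrow> proper_mor S T f)}"

definition pbr_id :: "'s rsg \<Rightarrow> 's \<Rightarrow> 's" where
  "pbr_id S = (\<lambda>s \<in> carrier S. s)"

text \<open>The composite \<open>g \<circ> f\<close> of \<open>f : S \<rightarrow> T\<close> and \<open>g : T \<rightarrow> U\<close>.\<close>

abbreviation pbr_comp :: "'s rsg \<Rightarrow> ('t \<Rightarrow> 'u) \<Rightarrow> ('s \<Rightarrow> 't) \<Rightarrow> 's \<Rightarrow> 'u" where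
  "pbr_comp S g f \<equiv> compose (carrier S) g f"


section \<open>Topological categories\<close>

text \<open>The composite \<open>xy\<close> is defined iff \<open>src x = tgt y\<close>.  The fields are only meaningful on
  the topspaces of \<open>arr\<close> and \<open>obj\<close> (and \<open>cmp\<close> on \<open>cmp_pairs\<close>).\<close>

record ('a, 'o) topcat =
  arr :: "'a topology"
  obj :: "'o topology"
  idt :: "'o \<Rightarrow> 'a"
  src :: "'a \<Rightarrow> 'o"
  tgt :: "'a \<Rightarrow> 'o"
  cmp :: "'a \<times> 'a \<Rightarrow> 'a"

abbreviation arrs :: "('a, 'o) topcat \<Rightarrow> 'a set" where "arrs C \<equiv> topspace (arr C)"
abbreviation objs :: "('a, 'o) topcat \<Rightarrow> 'o set" where "objs C \<equiv> topspace (obj C)"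

definition cmp_pairs :: "('a, 'o) topcat \<Rightarrow> ('a \<times> 'a) set" where
  "cmp_pairs C = {(x, y). x \<in> arrs C \<and> y \<in> arrs C \<and> tgt C y = src C x}"

locale topological_category =
  fixes C :: "('a, 'o) topcat"
  assumes idt_continuous: "continuous_map (obj C) (arr C) (idt C)"
    and src_continuous: "continuous_map (arr C) (obj C) (src C)"
    and tgt_continuous: "continuous_map (arr C) (obj C) (tgt C)"
    and cmp_continuous:
      "continuous_map (subtopology (prod_topology (arr C) (arr C)) (cmp_pairs C)) (arr C) (cmp C)"
    and src_idt: "x \<in> objs C \<Longrightarrow> src C (idt C x) = x"
    and tgt_idt: "x \<in> objs C \<Longrightarrow> tgt C (idt C x) = x"
    and src_cmp: "(s, t) \<in> cmp_pairs C \<Longrightarrow> src C (cmp C (s, t)) = src C t"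
    and tgt_cmp: "(s, t) \<in> cmp_pairs C \<Longrightarrow> tgt C (cmp C (s, t)) = tgt C s"
    and cmp_idt_right: "s \<in> arrs C \<Longrightarrow> cmp C (s, idt C (src C s)) = s"
    and cmp_idt_left: "s \<in> arrs C \<Longrightarrow> cmp C (idt C (tgt C s), s) = s"
    and cmp_assoc: "\<lbrakk>(s, t) \<in> cmp_pairs C; (t, v) \<in> cmp_pairs C\<rbrakk>
      \<Longrightarrow> cmp C (cmp C (s, t), v) = cmp C (s, cmp C (t, v))"

definition local_homeomorphism :: "'a topology \<Rightarrow> 'b topology \<Rightarrow> ('a \<Rightarrow> 'b) \<Rightarrow> bool" where
  "local_homeomorphism X Y f \<longleftrightarrow> (\<forall>x \<in> topspace X. \<exists>U. openin X U \<and> x \<in> U \<and> openin Y (f ` U)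
     \<and> homeomorphic_map (subtopology X U) (subtopology Y (f ` U)) f)"

definition slice :: "('a, 'o) topcat \<Rightarrow> 'a set \<Rightarrow> bool" where
  "slice C A \<longleftrightarrow> openin (arr C) A \<and> inj_on (src C) A"

definition bislice :: "('a, 'o) topcat \<Rightarrow> 'a set \<Rightarrow> bool" where
  "bislice C A \<longleftrightarrow> slice C A \<and> inj_on (tgt C) A"

definition compact_slices :: "('a, 'o) topcat \<Rightarrow> 'a set set" where
  "compact_slices C = {A. slice C A \<and> compactin (arr C) A}"

definition compact_bislices :: "('a, 'o) topcat \<Rightarrow> 'a set set" where
  "compact_bislices C = {A. bislice C A \<and> compactin (arr C) A}"

definition is_basis :: "'a topology \<Rightarrow> 'a set set \<Rightarrow> bool" where
  "is_basis X \<B> \<longleftrightarrow> openin X = arbitrary union_of (\<lambda>A. A \<in> \<B>)"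

locale etale_category = topological_category +
  assumes obj_locally_compact: "locally_compact_space (obj C)"
    and obj_Hausdorff: "Hausdorff_space (obj C)"
    and src_local_homeo: "local_homeomorphism (arr C) (obj C) (src C)"

locale bietale_category = etale_category +
  assumes tgt_local_homeo: "local_homeomorphism (arr C) (obj C) (tgt C)"

locale ample_category = etale_category +
  assumes compact_slices_basis: "is_basis (arr C) (compact_slices C)"

locale strongly_ample_category = ample_category +
  assumes tgt_open: "open_map (arr C) (obj C) (tgt C)"

locale biample_category = bietale_category +
  assumes compact_bislices_basis: "is_basis (arr C) (compact_bislices C)"


section \<open>Actions and cofunctors\<close>

definition act_dom :: "('a, 'o) topcat \<Rightarrow> 'x topology \<Rightarrow> ('x \<Rightarrow> 'o) \<Rightarrow> ('a \<times> 'x) set" where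
  "act_dom C X f = {(s, x). s \<in> arrs C \<and> x \<in> topspace X \<and> src C s = f x}"

definition act_top :: "('a, 'o) topcat \<Rightarrow> 'x topology \<Rightarrow> ('x \<Rightarrow> 'o) \<Rightarrow> ('a \<times> 'x) topology" where
  "act_top C X f = subtopology (prod_topology (arr C) X) (act_dom C X f)"

definition is_action ::
  "('a, 'o) topcat \<Rightarrow> 'x topology \<Rightarrow> ('a \<times> 'x \<Rightarrow> 'x) \<Rightarrow> ('x \<Rightarrow> 'o) \<Rightarrow> bool" where
  "is_action C X \<mu> f \<longleftrightarrow> continuous_map X (obj C) f \<and> continuous_map (act_top C X f) X \<mu>
     \<and> (\<forall>(s, x) \<in> act_dom C X f. f (\<mu> (s, x)) = tgt C s)
     \<and> (\<forall>s t x. (s, t) \<in> cmp_pairs C \<and> (t, x) \<in> act_dom C X f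
           \<longrightarrow> \<mu> (s, \<mu> (t, x)) = \<mu> (cmp C (s, t), x))
     \<and> (\<forall>x \<in> topspace X. \<mu> (idt C (f x), x) = x)"

definition transf_cat :: "('a, 'o) topcat \<Rightarrow> 'x topology \<Rightarrow> ('a \<times> 'x \<Rightarrow> 'x) \<Rightarrow> ('x \<Rightarrow> 'o)
    \<Rightarrow> ('a \<times> 'x, 'x) topcat" where
  "transf_cat C X \<mu> f = \<lparr>arr = act_top C X f, obj = X,
     idt = (\<lambda>x. (idt C (f x), x)), src = snd, tgt = \<mu>,
     cmp = (\<lambda>((s, y), (t, x)). (cmp C (s, t), x))\<rparr>"

definition continuous_functor ::
  "('a, 'o) topcat \<Rightarrow> ('b, 'p) topcat \<Rightarrow> ('a \<Rightarrow> 'b) \<Rightarrow> ('o \<Rightarrow> 'p) \<Rightarrow> bool" where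
  "continuous_functor C D \<rho>1 \<rho>0 \<longleftrightarrow>
     continuous_map (arr C) (arr D) \<rho>1 \<and> continuous_map (obj C) (obj D) \<rho>0
     \<and> (\<forall>x \<in> objs C. \<rho>1 (idt C x) = idt D (\<rho>0 x))
     \<and> (\<forall>s \<in> arrs C. src D (\<rho>1 s) = \<rho>0 (src C s) \<and> tgt D (\<rho>1 s) = \<rho>0 (tgt C s))
     \<and> (\<forall>(s, t) \<in> cmp_pairs C. \<rho>1 (cmp C (s, t)) = cmp D (\<rho>1 s, \<rho>1 t))"

definition topcat_iso ::
  "('a, 'o) topcat \<Rightarrow> ('b, 'p) topcat \<Rightarrow> ('a \<Rightarrow> 'b) \<Rightarrow> ('o \<Rightarrow> 'p) \<Rightarrow> bool" where
  "topcat_iso C D \<rho>1 \<rho>0 \<longleftrightarrow> continuous_functor C D \<rho>1 \<rho>0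
     \<and> homeomorphic_map (arr C) (arr D) \<rho>1 \<and> homeomorphic_map (obj C) (obj D) \<rho>0"

text \<open>A cofunctor from \<open>C : ('a, 'o) topcat\<close> to \<open>D : ('b, 'p) topcat\<close>.\<close>

record ('a, 'o, 'b, 'p) cof =
  act :: "'a \<times> 'p \<Rightarrow> 'p"
  anc :: "'p \<Rightarrow> 'o"
  rho1 :: "'a \<times> 'p \<Rightarrow> 'b"
  rho0 :: "'p \<Rightarrow> 'p"

abbreviation cof_dom ::
  "('a, 'o) topcat \<Rightarrow> ('b, 'p) topcat \<Rightarrow> ('a, 'o, 'b, 'p) cof \<Rightarrow> ('a \<times> 'p) set" where
  "cof_dom C D F \<equiv> act_dom C (obj D) (anc F)"

definition cof_image ::
  "('a, 'o) topcat \<Rightarrow> ('b, 'p) topcat \<Rightarrow> ('a, 'o, 'b, 'p) cof \<Rightarrow> 'a set \<Rightarrow> 'b set" where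
  "cof_image C D F A = {rho1 F (s, x) | s x. s \<in> A \<and> (s, x) \<in> cof_dom C D F}"

text \<open>The components are extensional, so that equality of cofunctors is equality of records.\<close>

locale cofunctor =
  fixes C :: "('a, 'o) topcat" and D :: "('b, 'p) topcat" and F :: "('a, 'o, 'b, 'p) cof"
  assumes action: "is_action C (obj D) (act F) (anc F)"
    and anc_proper: "compactin (obj C) K \<Longrightarrow> compactin (obj D) {x \<in> objs D. anc F x \<in> K}"
    and rho_functor:
      "continuous_functor (transf_cat C (obj D) (act F) (anc F)) D (rho1 F) (rho0 F)"
    and rho0_identity: "x \<in> objs D \<Longrightarrow> rho0 F x = x"
    and image_compact_open: "A \<in> compact_slices C
      \<Longrightarrow> compactin (arr D) (cof_image C D F A) \<and> openin (arr D) (cof_image C D F A)"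
    and act_extensional: "act F \<in> extensional (cof_dom C D F)"
    and anc_extensional: "anc F \<in> extensional (objs D)"
    and rho1_extensional: "rho1 F \<in> extensional (cof_dom C D F)"
    and rho0_extensional: "rho0 F \<in> extensional (objs D)"

definition injective_on_arrows ::
  "('a, 'o) topcat \<Rightarrow> ('b, 'p) topcat \<Rightarrow> ('a, 'o, 'b, 'p) cof \<Rightarrow> bool" where
  "injective_on_arrows C D F \<longleftrightarrow> (\<forall>s t x. (s, x) \<in> cof_dom C D F \<and> (t, x) \<in> cof_dom C D F
     \<and> rho1 F (s, x) = rho1 F (t, x) \<longrightarrow> s = t)"

definition surjective_on_arrows ::
  "('a, 'o) topcat \<Rightarrow> ('b, 'p) topcat \<Rightarrow> ('a, 'o, 'b, 'p) cof \<Rightarrow> bool" where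
  "surjective_on_arrows C D F \<longleftrightarrow>
     (\<forall>t \<in> arrs D. \<exists>s. (s, src D t) \<in> cof_dom C D F \<and> rho1 F (s, src D t) = t)"

definition cof_hom ::
  "nat \<Rightarrow> ('a, 'o) topcat \<Rightarrow> ('b, 'p) topcat \<Rightarrow> ('a, 'o, 'b, 'p) cof set" where
  "cof_hom i C D = {F. cofunctor C D F
     \<and> (i \<in> {2, 4} \<longrightarrow> injective_on_arrows C D F)
     \<and> (i \<in> {3, 4} \<longrightarrow> surjective_on_arrows C D F)}"

definition cof_id :: "('a, 'o) topcat \<Rightarrow> ('a, 'o, 'a, 'o) cof" where
  "cof_id C = \<lparr>act = restrict (\<lambda>(s, x). tgt C s) (act_dom C (obj C) (\<lambda>x. x)),
     anc = restrict (\<lambda>x. x) (objs C),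
     rho1 = restrict (\<lambda>(s, x). s) (act_dom C (obj C) (\<lambda>x. x)),
     rho0 = restrict (\<lambda>x. x) (objs C)\<rparr>"

text \<open>The composite \<open>G \<circ> F\<close> of \<open>F : C \<leadsto> D\<close> and \<open>G : D \<leadsto> E\<close>.\<close>

definition cof_comp :: "('a, 'o) topcat \<Rightarrow> ('c, 'q) topcat \<Rightarrow> ('b, 'p, 'c, 'q) cof
    \<Rightarrow> ('a, 'o, 'b, 'p) cof \<Rightarrow> ('a, 'o, 'c, 'q) cof" where
  "cof_comp C E G F = (let f = (\<lambda>x. anc F (anc G x)); dom = act_dom C (obj E) f in
     \<lparr>act = restrict (\<lambda>(s, x). act G (rho1 F (s, anc G x), x)) dom,
      anc = restrict f (objs E),
      rho1 = restrict (\<lambda>(s, x). rho1 G (rho1 F (s, anc G x), x)) dom,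
      rho0 = restrict (\<lambda>x. x) (objs E)\<rparr>)"

definition natural_action_equiv ::
  "('a, 'o) topcat \<Rightarrow> 'x topology \<Rightarrow> ('a \<times> 'x \<Rightarrow> 'x) \<Rightarrow> ('x \<Rightarrow> 'o) \<Rightarrow> ('x \<Rightarrow> 'o) \<Rightarrow> bool" where
  \<comment> \<open>the action \<open>(\<mu>, f)\<close> on \<open>X\<close> corresponds along \<open>h\<close> to the action
    \<open>(s, src s) \<mapsto> tgt s\<close> on the objects of \<open>C\<close>, whose anchor is the identity\<close>
  "natural_action_equiv C X \<mu> f h \<longleftrightarrow> (\<forall>x \<in> topspace X. h x = f x)
     \<and> (\<forall>(s, x) \<in> act_dom C X f. h (\<mu> (s, x)) = act (cof_id C) (s, h x))"

definition cof_iso ::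
  "('a, 'o) topcat \<Rightarrow> ('b, 'p) topcat \<Rightarrow> ('a, 'o, 'b, 'p) cof \<Rightarrow> bool" where
  "cof_iso C D F \<longleftrightarrow> cofunctor C D F \<and> homeomorphic_map (obj D) (obj C) (anc F)
     \<and> natural_action_equiv C (obj D) (act F) (anc F) (anc F)
     \<and> topcat_iso (transf_cat C (obj D) (act F) (anc F)) D (rho1 F) (rho0 F)"


section \<open>The semigroup of compact slices\<close>

definition slice_sg :: "('a, 'o) topcat \<Rightarrow> 'a set rsg" where
  "slice_sg C = \<lparr>carrier = compact_slices C,
     smult = (\<lambda>A B. cmp C ` (A \<times> B \<inter> cmp_pairs C)),
     star = (\<lambda>A. idt C ` src C ` A)\<rparr>"

definition slice_plus :: "('a, 'o) topcat \<Rightarrow> 'a set \<Rightarrow> 'a set" where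
  "slice_plus C A = idt C ` tgt C ` A"

definition slice_map ::
  "('a, 'o) topcat \<Rightarrow> ('b, 'p) topcat \<Rightarrow> ('a, 'o, 'b, 'p) cof \<Rightarrow> 'a set \<Rightarrow> 'b set" where
  "slice_map C D F = (\<lambda>A \<in> compact_slices C. cof_image C D F A)"


section \<open>The category of germs\<close>

definition prime_chars :: "'s rsg \<Rightarrow> ('s \<Rightarrow> bool) set" where
  "prime_chars S = {\<phi> \<in> extensional (projs S).
     gba_hom (pposet S) bool_lattice \<phi> \<and> (\<exists>e \<in> projs S. \<phi> e)}"

definition char_basic :: "'s rsg \<Rightarrow> 's \<Rightarrow> ('s \<Rightarrow> bool) set" where
  "char_basic S e = {\<phi> \<in> prime_chars S. \<phi> e}"

definition char_act :: "'s rsg \<Rightarrow> 's \<Rightarrow> ('s \<Rightarrow> bool) \<Rightarrow> 's \<Rightarrow> bool" where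
  "char_act S s \<phi> = (\<lambda>e \<in> projs S. \<phi> ((e \<odot>\<^bsub>S\<^esub> s)\<^sup>\<star>\<^bsub>S\<^esub>))"

definition pre_germs :: "'s rsg \<Rightarrow> ('s \<times> ('s \<Rightarrow> bool)) set" where
  "pre_germs S = {(s, \<phi>). s \<in> carrier S \<and> \<phi> \<in> prime_chars S \<and> \<phi> (s\<^sup>\<star>\<^bsub>S\<^esub>)}"

definition germ_rel :: "'s rsg \<Rightarrow> (('s \<times> ('s \<Rightarrow> bool)) \<times> ('s \<times> ('s \<Rightarrow> bool))) set" where
  "germ_rel S = {((s, \<phi>), (t, \<psi>)). (s, \<phi>) \<in> pre_germs S \<and> (t, \<psi>) \<in> pre_germs S \<and> \<phi> = \<psi>
     \<and> (\<exists>u \<in> carrier S. nle S u s \<and> nle S u t \<and> \<phi> (u\<^sup>\<star>\<^bsub>S\<^esub>))}"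

type_synonym 's germ = "('s \<times> ('s \<Rightarrow> bool)) set"

definition germ :: "'s rsg \<Rightarrow> 's \<Rightarrow> ('s \<Rightarrow> bool) \<Rightarrow> 's germ" where
  "germ S s \<phi> = germ_rel S `` {(s, \<phi>)}"

definition Theta :: "'s rsg \<Rightarrow> 's \<Rightarrow> 's germ set" where
  "Theta S s = {germ S s \<phi> | \<phi>. (s, \<phi>) \<in> pre_germs S}"

text \<open>Operations on germs are defined by representatives: \<open>the_elem\<close> extracts the value that all
  choices of representatives have in common.  The sets \<open>char_basic\<close> and \<open>Theta\<close> are
  bases of the topologies that they generate; the underlying sets of these topologies are
  \<open>prime_chars S\<close> and the quotient of \<open>pre_germs S\<close> by \<open>germ_rel S\<close>.\<close>

definition germ_cat :: "'s rsg \<Rightarrow> ('s germ, 's \<Rightarrow> bool) topcat" where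
  "germ_cat S = \<lparr>
     arr = topology_generated_by (Theta S ` carrier S),
     obj = topology_generated_by (char_basic S ` projs S),
     idt = (\<lambda>\<phi>. the_elem {germ S e \<phi> | e. e \<in> projs S \<and> \<phi> e}),
     src = (\<lambda>g. the_elem {\<phi> | s \<phi>. (s, \<phi>) \<in> g}),
     tgt = (\<lambda>g. the_elem {char_act S s \<phi> | s \<phi>. (s, \<phi>) \<in> g}),
     cmp = (\<lambda>(g, h). the_elem {germ S (s \<odot>\<^bsub>S\<^esub> t) \<psi> | s t \<psi>. (s, char_act S t \<psi>) \<in> g \<and> (t, \<psi>) \<in> h})\<rparr>"

definition germ_cof :: "'s rsg \<Rightarrow> 't rsg \<Rightarrow> ('s \<Rightarrow> 't)
    \<Rightarrow> ('s germ, 's \<Rightarrow> bool, 't germ, 't \<Rightarrow> bool) cof" where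
  "germ_cof S T f = (let
       pull = (\<lambda>\<psi>. \<lambda>e \<in> projs S. \<psi> (f e));
       dom = act_dom (germ_cat S) (obj (germ_cat T)) pull in
     \<lparr>act = restrict (\<lambda>(g, \<psi>). the_elem {char_act T (f s) \<psi> | s. (s, pull \<psi>) \<in> g}) dom,
      anc = restrict pull (prime_chars T),
      rho1 = restrict (\<lambda>(g, \<psi>). the_elem {germ T (f s) \<psi> | s. (s, pull \<psi>) \<in> g}) dom,
      rho0 = restrict (\<lambda>\<psi>. \<psi>) (prime_chars T)\<rparr>)"


section \<open>Unit and counit\<close>

definition unit :: "'s rsg \<Rightarrow> 's \<Rightarrow> 's germ set" where
  "unit S = (\<lambda>s \<in> carrier S. Theta S s)"

definition point_char :: "('a, 'o) topcat \<Rightarrow> 'o \<Rightarrow> 'a set \<Rightarrow> bool" where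
  "point_char C x = (\<lambda>E \<in> projs (slice_sg C).
     \<exists>U. compactin (obj C) U \<and> openin (obj C) U \<and> E = idt C ` U \<and> x \<in> U)"

definition slice_at :: "('a, 'o) topcat \<Rightarrow> 'a set \<Rightarrow> 'o \<Rightarrow> 'a" where
  "slice_at C A x = (THE a. a \<in> A \<and> src C a = x)"

definition counit :: "('a, 'o) topcat \<Rightarrow> ('a set germ, 'a set \<Rightarrow> bool, 'a, 'o) cof" where
  "counit C = (let dom = act_dom (germ_cat (slice_sg C)) (obj C) (point_char C) in
     \<lparr>act = restrict
        (\<lambda>(g, x). the_elem {tgt C (slice_at C A x) | A. (A, point_char C x) \<in> g}) dom,
      anc = restrict (point_char C) (objs C),
      rho1 = restrict (\<lambda>(g, x). the_elem {slice_at C A x | A. (A, point_char C x) \<in> g}) dom,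
      rho0 = restrict (\<lambda>x. x) (objs C)\<rparr>)"


section \<open>The laws of the adjunction\<close>

text \<open>No type is closed under the formation of compact slices and germs, so there is no single
  HOL type whose elements are all objects of one of the categories.  The categories are therefore
  represented by polymorphic predicates for objects and polymorphic hom sets, and their laws are
  stated for objects on arbitrary, possibly different types.  The categories of (etale) range
  semigroups and of strongly ample (biample) categories have the hom sets \<open>pbr_hom\<close> and
  \<open>cof_hom\<close> as well: a morphism need not preserve \<open>x \<mapsto> x\<^sup>+\<close>.\<close>

definition pbr_category_laws ::
  "nat \<Rightarrow> 's rsg \<Rightarrow> 't rsg \<Rightarrow> 'u rsg \<Rightarrow> 'v rsg \<Rightarrow> bool" where
  "pbr_category_laws i S T U V \<longleftrightarrow>
     pbr_id S \<in> pbr_hom i S S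
     \<and> (\<forall>f \<in> pbr_hom i S T. pbr_comp S f (pbr_id S) = f \<and> pbr_comp S (pbr_id T) f = f)
     \<and> (\<forall>f \<in> pbr_hom i S T. \<forall>g \<in> pbr_hom i T U. pbr_comp S g f \<in> pbr_hom i S U)
     \<and> (\<forall>f \<in> pbr_hom i S T. \<forall>g \<in> pbr_hom i T U. \<forall>h \<in> pbr_hom i U V.
           pbr_comp S h (pbr_comp S g f) = pbr_comp S (pbr_comp T h g) f)"

definition ac_category_laws ::
  "nat \<Rightarrow> ('a, 'o) topcat \<Rightarrow> ('b, 'p) topcat \<Rightarrow> ('c, 'q) topcat \<Rightarrow> ('d, 'r) topcat \<Rightarrow> bool" where
  "ac_category_laws i C D E B \<longleftrightarrow>
     cof_id C \<in> cof_hom i C C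
     \<and> (\<forall>F \<in> cof_hom i C D. cof_comp C D F (cof_id C) = F \<and> cof_comp C D (cof_id D) F = F)
     \<and> (\<forall>F \<in> cof_hom i C D. \<forall>G \<in> cof_hom i D E. cof_comp C E G F \<in> cof_hom i C E)
     \<and> (\<forall>F \<in> cof_hom i C D. \<forall>G \<in> cof_hom i D E. \<forall>H \<in> cof_hom i E B.
           cof_comp C B H (cof_comp C E G F) = cof_comp C B (cof_comp D B H G) F)"

definition germ_functor_laws :: "nat \<Rightarrow> 's rsg \<Rightarrow> 't rsg \<Rightarrow> 'u rsg \<Rightarrow> bool" where
  "germ_functor_laws i S T U \<longleftrightarrow>
     (\<forall>f \<in> pbr_hom i S T. germ_cof S T f \<in> cof_hom i (germ_cat S) (germ_cat T))
     \<and> germ_cof S S (pbr_id S) = cof_id (germ_cat S)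
     \<and> (\<forall>f \<in> pbr_hom i S T. \<forall>g \<in> pbr_hom i T U. germ_cof S U (pbr_comp S g f)
           = cof_comp (germ_cat S) (germ_cat U) (germ_cof T U g) (germ_cof S T f))"

definition slice_functor_laws ::
  "nat \<Rightarrow> ('a, 'o) topcat \<Rightarrow> ('b, 'p) topcat \<Rightarrow> ('c, 'q) topcat \<Rightarrow> bool" where
  "slice_functor_laws i C D E \<longleftrightarrow>
     (\<forall>F \<in> cof_hom i C D. slice_map C D F \<in> pbr_hom i (slice_sg C) (slice_sg D))
     \<and> slice_map C C (cof_id C) = pbr_id (slice_sg C)
     \<and> (\<forall>F \<in> cof_hom i C D. \<forall>G \<in> cof_hom i D E. slice_map C E (cof_comp C E G F)
           = pbr_comp (slice_sg C) (slice_map D E G) (slice_map C D F))"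

definition unit_laws :: "nat \<Rightarrow> 's rsg \<Rightarrow> 't rsg \<Rightarrow> bool" where
  "unit_laws i S T \<longleftrightarrow>
     unit S \<in> pbr_hom i S (slice_sg (germ_cat S))
     \<and> (\<forall>f \<in> pbr_hom i S T. pbr_comp S (unit T) f
           = pbr_comp S (slice_map (germ_cat S) (germ_cat T) (germ_cof S T f)) (unit S))"

definition counit_laws :: "nat \<Rightarrow> ('a, 'o) topcat \<Rightarrow> ('b, 'p) topcat \<Rightarrow> bool" where
  "counit_laws i C D \<longleftrightarrow>
     counit C \<in> cof_hom i (germ_cat (slice_sg C)) C
     \<and> (\<forall>F \<in> cof_hom i C D. cof_comp (germ_cat (slice_sg C)) D F (counit C)
           = cof_comp (germ_cat (slice_sg C)) D (counit D)
               (germ_cof (slice_sg C) (slice_sg D) (slice_map C D F)))"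

definition triangle_laws :: "'s rsg \<Rightarrow> ('a, 'o) topcat \<Rightarrow> bool" where
  "triangle_laws S C \<longleftrightarrow>
     cof_comp (germ_cat S) (germ_cat S) (counit (germ_cat S))
       (germ_cof S (slice_sg (germ_cat S)) (unit S)) = cof_id (germ_cat S)
     \<and> pbr_comp (slice_sg C) (slice_map (germ_cat (slice_sg C)) C (counit C)) (unit (slice_sg C))
         = pbr_id (slice_sg C)"

definition adjunction_laws :: "nat \<Rightarrow> 's rsg \<Rightarrow> 't rsg \<Rightarrow> 'u rsg \<Rightarrow> 'v rsg
    \<Rightarrow> ('a, 'o) topcat \<Rightarrow> ('b, 'p) topcat \<Rightarrow> ('c, 'q) topcat \<Rightarrow> ('d, 'r) topcat \<Rightarrow> bool" where
  "adjunction_laws i S T U V C D E B \<longleftrightarrow>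
     pbr_category_laws i S T U V \<and> ac_category_laws i C D E B
     \<and> germ_functor_laws i S T U \<and> slice_functor_laws i C D E
     \<and> unit_laws i S T \<and> counit_laws i C D \<and> triangle_laws S C"

end

theory Submission
  imports Defs
begin

text \<open>Prime characters of a generalized Boolean algebra form a locally compact space: those not
  vanishing at \<open>e\<close> are closed in a product of two-point spaces.  The sets \<open>\<Theta>(s)\<close> are compact
  slices that form a basis of the category of germs, \<open>\<Theta>(s)\<Theta>(t) = \<Theta>(st)\<close>, and each compact slice
  is a finite union of sets \<open>\<Theta>(s)\<close>; so \<open>s \<mapsto> \<Theta>(s)\<close> is a morphism of every type.  Conversely, the
  prime characters of the compact open sets of a locally compact Hausdorff space with a basis of
  such sets are its points, and two compact slices have the same germ at \<open>x\<close> iff they contain the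
  same arrow with domain \<open>x\<close>; so the counit is an isomorphism.  All remaining laws are checked on
  germs, because a cofunctor is determined by its anchor map and by \<open>\<rho>\<^sub>1\<close>.\<close>

section \<open>Restriction semigroups\<close>

text \<open>Joins exist only for elements with a common upper bound, while characters see only
  projections. The bridge is that stars commute with existing joins and that an element below a
  given bound is determined by its star. So a prime character with value 1 at the star of a finite
  join has value 1 at the star of one member: finite joins become finite unions of sets
  \<open>Theta\<close>, and compactness turns finite covers back into joins, which exist because the
  pieces lie below one element. The conditions of types 2 and 3 are such finite versions of
  injectivity and surjectivity on arrows, which are conditions at single points. Local units
  guarantee that the character at the range of a germ is non-zero. In the range case the hom sets
  stay the same, so the laws are inherited and only the objects are examined: the operation
  \<open>p\<close> makes the range map open, and bideterministic elements give bislices. Openness of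
  the range map is where enough prime characters must exist, since the ranges of the germs in
  \<open>Theta S s\<close> have to fill all of \<open>char_basic S (p s)\<close>.\<close>

lemma nposet_simps [simp]:
  "carrier (nposet S) = carrier S" "le (nposet S) = nle S" "eq (nposet S) = (=)"
  by (simp_all add: nposet_def)

lemma pposet_simps [simp]:
  "carrier (pposet S) = projs S" "le (pposet S) = nle S" "eq (pposet S) = (=)"
  by (simp_all add: pposet_def)

lemma is_join_iff:
  "is_join S X j \<longleftrightarrow> X \<subseteq> carrier S \<and> j \<in> carrier S \<and> (\<forall>x \<in> X. nle S x j)
     \<and> (\<forall>w \<in> carrier S. (\<forall>x \<in> X. nle S x w) \<longrightarrow> nle S j w)"
  unfolding is_join_def least_def Upper_def by (auto 4 4)

lemma is_joinI:
  assumes "X \<subseteq> carrier S" "j \<in> carrier S" "\<And>x. x \<in> X \<Longrightarrow> nle S x j"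
    "\<And>w. \<lbrakk>w \<in> carrier S; \<And>x. x \<in> X \<Longrightarrow> nle S x w\<rbrakk> \<Longrightarrow> nle S j w"
  shows "is_join S X j"
  using assms unfolding is_join_iff by blast

lemma is_joinD:
  assumes "is_join S X j"
  shows "X \<subseteq> carrier S" "j \<in> carrier S" "\<And>x. x \<in> X \<Longrightarrow> nle S x j"
    "\<And>w. \<lbrakk>w \<in> carrier S; \<And>x. x \<in> X \<Longrightarrow> nle S x w\<rbrakk> \<Longrightarrow> nle S j w"
  using assms unfolding is_join_iff by blast+

lemma nle_eqD: "nle S s t \<Longrightarrow> t \<odot>\<^bsub>S\<^esub> s\<^sup>\<star>\<^bsub>S\<^esub> = s"
  by (simp add: nle_def)

context restriction_semigroup
begin

abbreviation le_S (infix \<open>\<preceq>\<close> 50) where "x \<preceq> y \<equiv> nle S x y"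

lemma star_idem: "x \<in> carrier S \<Longrightarrow> (x\<^sup>\<star>)\<^sup>\<star> = x\<^sup>\<star>"
proof -
  assume x: "x \<in> carrier S"
  have "x\<^sup>\<star> \<odot> x\<^sup>\<star> = x\<^sup>\<star>"
    using star_mult [of x "x\<^sup>\<star>"] star_star_mult [of x x] mult_star [of x] x star_closed by simp
  then show ?thesis using star_star_mult [OF x x] by simp
qed

lemma star_in_projs [simp, intro]: "x \<in> carrier S \<Longrightarrow> x\<^sup>\<star> \<in> projs S"
  by (simp add: projs_def)

lemma projs_closed [simp, intro]: "e \<in> projs S \<Longrightarrow> e \<in> carrier S"
  by (auto simp: projs_def star_closed)

lemma proj_star [simp]: "e \<in> projs S \<Longrightarrow> e\<^sup>\<star> = e"
  by (auto simp: projs_def star_idem)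

lemma proj_mult [simp, intro]: "\<lbrakk>e \<in> projs S; f \<in> projs S\<rbrakk> \<Longrightarrow> e \<odot> f \<in> projs S"
  using star_star_mult [of e f] star_in_projs [of "e \<odot> f"] mult_closed [of e f] by simp

lemma proj_commute: "\<lbrakk>e \<in> projs S; f \<in> projs S\<rbrakk> \<Longrightarrow> e \<odot> f = f \<odot> e"
  by (metis proj_star projs_closed star_commute)

lemma proj_idem [simp]: "e \<in> projs S \<Longrightarrow> e \<odot> e = e"
  by (metis mult_star proj_star projs_closed)

lemma star_mult_proj: "\<lbrakk>x \<in> carrier S; e \<in> projs S\<rbrakk> \<Longrightarrow> (x \<odot> e)\<^sup>\<star> = x\<^sup>\<star> \<odot> e"
  by (metis proj_mult proj_star projs_closed star_in_projs star_mult)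

lemma proj_move: "\<lbrakk>e \<in> projs S; y \<in> carrier S\<rbrakk> \<Longrightarrow> e \<odot> y = y \<odot> (e \<odot> y)\<^sup>\<star>"
  by (metis ample_law proj_star projs_closed)

lemma mult_closed' [simp, intro]: "\<lbrakk>x \<in> carrier S; y \<in> carrier S\<rbrakk> \<Longrightarrow> x \<odot> y \<in> carrier S"
  by (rule mult_closed)

lemma star_closed' [simp, intro]: "x \<in> carrier S \<Longrightarrow> x\<^sup>\<star> \<in> carrier S"
  by (rule star_closed)

text \<open>Since \<open>(te)* = t* e\<close>, the product \<open>t (te)*\<close> equals
  \<open>t t* e = te\<close>. So any projection may serve as a witness, not only the star of the
  smaller element.\<close>

lemma nleI: "\<lbrakk>t \<in> carrier S; e \<in> projs S\<rbrakk> \<Longrightarrow> t \<odot> e \<preceq> t"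
  unfolding nle_def
  by (metis mult_assoc mult_star proj_commute projs_closed star_closed' star_in_projs star_mult_proj)

lemma nleI': "\<lbrakk>s = t \<odot> e; t \<in> carrier S; e \<in> projs S\<rbrakk> \<Longrightarrow> s \<preceq> t"
  using nleI by blast

text \<open>By the ample law a restriction on the left is also one on the right, by the projection
  \<open>(e \<odot> t)\<^sup>\<star>\<close>.\<close>

lemma proj_mult_le: "\<lbrakk>e \<in> projs S; t \<in> carrier S\<rbrakk> \<Longrightarrow> e \<odot> t \<preceq> t"
  by (metis mult_closed nleI proj_move projs_closed star_in_projs)

lemma nle_refl [simp, intro]: "s \<in> carrier S \<Longrightarrow> s \<preceq> s"
  by (simp add: nle_def mult_star)

lemma nle_antisym: "\<lbrakk>s \<preceq> t; t \<preceq> s; s \<in> carrier S; t \<in> carrier S\<rbrakk> \<Longrightarrow> s = t"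
  unfolding nle_def by (metis mult_assoc mult_star proj_commute star_closed' star_in_projs)

lemma nle_trans:
  assumes "s \<preceq> t" "t \<preceq> w" "s \<in> carrier S" "t \<in> carrier S" "w \<in> carrier S"
  shows "s \<preceq> w"
proof (rule nleI')
  show "s = w \<odot> (t\<^sup>\<star> \<odot> s\<^sup>\<star>)"
    using assms by (metis mult_assoc nle_def star_closed')
qed (use assms in auto)

lemma proj_nle_iff: "\<lbrakk>e \<in> projs S; f \<in> projs S\<rbrakk> \<Longrightarrow> e \<preceq> f \<longleftrightarrow> e = f \<odot> e"
  by (simp add: nle_def)

lemma star_mono: "\<lbrakk>s \<preceq> t; s \<in> carrier S; t \<in> carrier S\<rbrakk> \<Longrightarrow> s\<^sup>\<star> \<preceq> t\<^sup>\<star>"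
  by (metis nle_def nleI star_closed' star_in_projs star_mult_proj)

lemma proj_of_nle: "\<lbrakk>s \<preceq> e; s \<in> carrier S; e \<in> projs S\<rbrakk> \<Longrightarrow> s \<in> projs S"
  by (metis nle_def proj_mult star_in_projs)

text \<open>An element below \<open>w\<close> equals \<open>w\<close> times its own star. Elements
  below a common bound are compared through this.\<close>

lemma nle_restrict_unique: "\<lbrakk>s \<preceq> w; t \<preceq> w; s\<^sup>\<star> = t\<^sup>\<star>\<rbrakk> \<Longrightarrow> s = t"
  by (metis nle_def)

lemma nle_proj_glb:
  assumes "e \<in> projs S" "f \<in> projs S" "g \<in> projs S"
  shows "g \<preceq> e \<odot> f \<longleftrightarrow> g \<preceq> e \<and> g \<preceq> f"
proof
  assume g: "g \<preceq> e \<odot> f"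
  have "e \<odot> f \<preceq> e" "e \<odot> f \<preceq> f" using assms by (auto intro: nleI proj_mult_le)
  then show "g \<preceq> e \<and> g \<preceq> f"
    using nle_trans [OF g] assms by blast
next
  assume "g \<preceq> e \<and> g \<preceq> f"
  then have "e \<odot> (f \<odot> g) = g" using assms by (metis proj_nle_iff)
  then show "g \<preceq> e \<odot> f" using assms by (simp add: nle_def mult_assoc)
qed

lemma is_join_unique: "\<lbrakk>is_join S X j; is_join S X k\<rbrakk> \<Longrightarrow> j = k"
  by (simp add: is_join_iff nle_antisym)

lemma is_join_singleton [simp, intro]: "s \<in> carrier S \<Longrightarrow> is_join S {s} s"
  by (auto intro: is_joinI)

lemma is_join_absorb: "\<lbrakk>s \<preceq> t; s \<in> carrier S; t \<in> carrier S\<rbrakk> \<Longrightarrow> is_join S {s, t} t"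
  by (auto intro: is_joinI)

text \<open>Associativity of joins, in the form that refines a decomposition. Composites of proper
  morphisms are handled with it.\<close>

lemma is_join_Union:
  assumes "is_join S Y u" "\<And>y. y \<in> Y \<Longrightarrow> is_join S (F y) y"
  shows "is_join S (\<Union>y \<in> Y. F y) u"
proof (rule is_joinI)
  show "(\<Union>y \<in> Y. F y) \<subseteq> carrier S" by (rule UN_least) (rule is_joinD(1) [OF assms(2)])
  show u: "u \<in> carrier S" by (rule is_joinD(2) [OF assms(1)])
  have Y: "Y \<subseteq> carrier S" by (rule is_joinD(1) [OF assms(1)])
  show "x \<preceq> u" if "x \<in> (\<Union>y \<in> Y. F y)" for x
  proof -
    obtain y where y: "y \<in> Y" "x \<in> F y" using \<open>x \<in> (\<Union>y \<in> Y. F y)\<close> by blast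
    note Fy = is_joinD [OF assms(2) [OF y(1)]]
    show ?thesis
      using nle_trans [OF Fy(3) [OF y(2)] is_joinD(3) [OF assms(1) y(1)]] Fy y u by blast
  qed
  show "u \<preceq> w" if w: "w \<in> carrier S" and *: "\<And>x. x \<in> (\<Union>y \<in> Y. F y) \<Longrightarrow> x \<preceq> w" for w
  proof (rule is_joinD(4) [OF assms(1) w])
    show "y \<preceq> w" if "y \<in> Y" for y
      using is_joinD(4) [OF assms(2) [OF that] w] * that by blast
  qed
qed

text \<open>\<open>X\<close> and its join \<open>k\<close> have the same upper bounds, so finite
  joins reduce to binary ones.\<close>

lemma is_join_insert:
  assumes "is_join S X k" "x \<in> carrier S"
  shows "is_join S (insert x X) j \<longleftrightarrow> is_join S {x, k} j"
proof -
  note k = is_joinD [OF assms(1)]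
  have "(\<forall>y \<in> X. y \<preceq> w) \<longleftrightarrow> k \<preceq> w" if w: "w \<in> carrier S" for w
  proof
    assume "k \<preceq> w"
    then show "\<forall>y \<in> X. y \<preceq> w" using nle_trans [OF k(3) \<open>k \<preceq> w\<close>] k w by blast
  qed (use k w in blast)
  then show ?thesis using assms k(1,2) unfolding is_join_iff by auto
qed

text \<open>The element \<open>j \<odot> e\<close> is again an upper bound of \<open>X\<close>,
  because each \<open>x\<close> in \<open>X\<close> is \<open>j \<odot> x\<^sup>\<star> = j \<odot>
  e \<odot> x\<^sup>\<star>\<close>. Minimality gives \<open>j \<preceq> j \<odot> e\<close>, and
  the star of \<open>j \<odot> e\<close> lies below \<open>e\<close>.\<close>

lemma is_join_star_le:
  assumes "is_join S X j" "e \<in> projs S" "\<And>x. x \<in> X \<Longrightarrow> x\<^sup>\<star> \<preceq> e"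
  shows "j\<^sup>\<star> \<preceq> e"
proof -
  note j = is_joinD [OF assms(1)]
  have "j \<preceq> j \<odot> e"
  proof (rule j(4))
    fix x assume x: "x \<in> X"
    have "x = j \<odot> x\<^sup>\<star>" using j(3) [OF x] by (simp add: nle_def)
    also have "\<dots> = j \<odot> (e \<odot> x\<^sup>\<star>)"
      using assms(3) [OF x] x j(1) assms(2) by (metis proj_nle_iff star_in_projs subsetD)
    finally show "x \<preceq> j \<odot> e"
      using nleI' [of x "j \<odot> e" "x\<^sup>\<star>"] x j(1,2) assms(2) by (metis mult_assoc mult_closed' projs_closed star_closed' star_in_projs subsetD)
  qed (use j assms in auto)
  then have le: "j\<^sup>\<star> \<preceq> (j \<odot> e)\<^sup>\<star>" using j(2) assms(2) by (intro star_mono) auto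
  have eq: "(j \<odot> e)\<^sup>\<star> = e \<odot> j\<^sup>\<star>"
    using j(2) assms(2) by (metis proj_commute star_in_projs star_mult_proj)
  have "e \<odot> j\<^sup>\<star> \<preceq> e" using j(2) assms(2) by (auto intro: nleI)
  with le show ?thesis unfolding eq
    using nle_trans [of "j\<^sup>\<star>" "e \<odot> j\<^sup>\<star>" e] j(2) assms(2) by auto
qed

lemma partial_order_pposet: "partial_order (pposet S)"
proof unfold_locales
  show "x \<sqsubseteq>\<^bsub>pposet S\<^esub> z" if "x \<sqsubseteq>\<^bsub>pposet S\<^esub> y" "y \<sqsubseteq>\<^bsub>pposet S\<^esub> z"
    "x \<in> carrier (pposet S)" "y \<in> carrier (pposet S)" "z \<in> carrier (pposet S)" for x y z
    using nle_trans [of x y z] that by simp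
qed (simp_all add: nle_antisym)

lemma greatest_pposet:
  assumes "e \<in> projs S" "f \<in> projs S"
  shows "greatest (pposet S) (e \<odot> f) (Lower (pposet S) {e, f})"
  using assms by (auto simp: greatest_def Lower_def nle_proj_glb nle_refl intro: nleI proj_mult_le)

lemma meet_pposet: "\<lbrakk>e \<in> projs S; f \<in> projs S\<rbrakk> \<Longrightarrow> e \<sqinter>\<^bsub>pposet S\<^esub> f = e \<odot> f"
  unfolding meet_def inf_def
  using greatest_pposet partial_order.greatest_unique [OF partial_order_pposet]
  by (intro some_equality) blast+

end

section \<open>PreBoolean restriction semigroups\<close>

text \<open>\<open>zero_of\<close> and \<open>jn\<close> are taken from the lattice of projections,
  because \<open>gba_hom\<close> speaks of the bottom and the join there. That they agree with the
  zero of the semigroup and with its joins is proved below.\<close>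

definition zero_of :: "'s rsg \<Rightarrow> 's" where "zero_of S = \<bottom>\<^bsub>pposet S\<^esub>"

definition jn :: "'s rsg \<Rightarrow> 's \<Rightarrow> 's \<Rightarrow> 's" where "jn S e f = e \<squnion>\<^bsub>pposet S\<^esub> f"

context preBoolean
begin

sublocale P: gen_boolean_algebra "pposet S" by (rule BR2)

lemma lattice_pposet: "Lattice.lattice (pposet S)"
  by (rule P.lattice_axioms)

lemma zero_unique:
  assumes "z \<in> projs S" "\<And>s. s \<in> carrier S \<Longrightarrow> z \<odot> s = z"
  shows "zero_of S = z"
proof -
  have "least (pposet S) z (carrier (pposet S))"
    using assms by (auto simp: least_def nle_def) (metis proj_commute projs_closed)
  moreover have "\<And>x. least (pposet S) x (carrier (pposet S)) \<Longrightarrow> x = z"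
    using calculation P.least_unique by blast
  ultimately show ?thesis
    unfolding zero_of_def bottom_def by (rule some_equality)
qed

lemma zero_proj [simp, intro]: "zero_of S \<in> projs S"
  and zero_left [simp]: "s \<in> carrier S \<Longrightarrow> zero_of S \<odot> s = zero_of S"
  using zero zero_unique by metis+

lemma zero_right [simp]: "s \<in> carrier S \<Longrightarrow> s \<odot> zero_of S = zero_of S"
  using proj_move [OF zero_proj, of s] by simp

lemma zero_closed [simp, intro]: "zero_of S \<in> carrier S"
  by (rule projs_closed) simp

lemma zero_least [simp, intro]: "s \<in> carrier S \<Longrightarrow> zero_of S \<preceq> s"
  by (simp add: nle_def)

lemma is_join_empty [simp, intro]: "is_join S {} (zero_of S)"
  by (auto intro: is_joinI)

lemma jn_closed [simp, intro]: "\<lbrakk>e \<in> projs S; f \<in> projs S\<rbrakk> \<Longrightarrow> jn S e f \<in> projs S"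
  using P.join_closed by (simp add: jn_def)

lemma jn_least_projs:
  assumes "e \<in> projs S" "f \<in> projs S"
  shows "e \<preceq> jn S e f" "f \<preceq> jn S e f"
    "\<And>g. \<lbrakk>g \<in> projs S; e \<preceq> g; f \<preceq> g\<rbrakk> \<Longrightarrow> jn S e f \<preceq> g"
  using P.join_left [of e f] P.join_right [of e f] P.join_le [of e _ f] assms
  by (simp_all add: jn_def)

text \<open>The join in \<open>S\<close> might a priori be smaller than the join in the lattice of
  projections. But it lies below the projection \<open>jn S e f\<close>, and everything below a
  projection is a projection, so the two agree.\<close>

lemma is_join_jn:
  assumes "e \<in> projs S" "f \<in> projs S"
  shows "is_join S {e, f} (jn S e f)"
proof -
  obtain j where j: "is_join S {e, f} j"
    using BR1 [of e f "jn S e f"] assms jn_least_projs by auto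
  have le: "j \<preceq> jn S e f" using is_joinD(4) [OF j, of "jn S e f"] assms jn_least_projs by auto
  then have "j \<in> projs S" using is_joinD(2) [OF j] assms proj_of_nle jn_closed by auto
  then have "jn S e f \<preceq> j" using jn_least_projs(3) assms is_joinD(3) [OF j] by auto
  then have "j = jn S e f" using le assms nle_antisym is_joinD(2) [OF j] by auto
  with j show ?thesis by simp
qed

lemma is_join_projs: "\<lbrakk>is_join S {e, f} j; e \<in> projs S; f \<in> projs S\<rbrakk> \<Longrightarrow> j = jn S e f"
  using is_join_jn is_join_unique by blast

lemma star_is_join:
  assumes "is_join S {s, t} j"
  shows "j\<^sup>\<star> = jn S (s\<^sup>\<star>) (t\<^sup>\<star>)"
proof -
  have c: "s \<in> carrier S" "t \<in> carrier S" "j \<in> carrier S" "s \<preceq> j" "t \<preceq> j"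
    using is_joinD [OF assms] by auto
  show ?thesis
  proof (rule nle_antisym)
    show "j\<^sup>\<star> \<preceq> jn S (s\<^sup>\<star>) (t\<^sup>\<star>)"
      using c jn_least_projs [of "s\<^sup>\<star>" "t\<^sup>\<star>"] by (intro is_join_star_le [OF assms]) auto
    show "jn S (s\<^sup>\<star>) (t\<^sup>\<star>) \<preceq> j\<^sup>\<star>"
      using c by (intro jn_least_projs) (auto intro: star_mono)
  qed (use c in auto)
qed

text \<open>The join \<open>k\<close> of \<open>s\<close> and \<open>t\<close> exists by
  \<open>BR1\<close> and lies below the bound \<open>j\<close>. It has the same star as
  \<open>j\<close>, and elements below \<open>j\<close> with equal stars are equal.\<close>

lemma is_join_of_star:
  assumes "s \<preceq> j" "t \<preceq> j" "s \<in> carrier S" "t \<in> carrier S" "j \<in> carrier S" "j\<^sup>\<star> = jn S (s\<^sup>\<star>) (t\<^sup>\<star>)"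
  shows "is_join S {s, t} j"
proof -
  obtain k where k: "is_join S {s, t} k" using BR1 assms by blast
  have "k \<preceq> j" using is_joinD(4) [OF k, of j] assms by auto
  moreover have "k\<^sup>\<star> = j\<^sup>\<star>" using star_is_join [OF k] assms by simp
  ultimately have "k = j" using nle_restrict_unique nle_refl assms(5) by blast
  with k show ?thesis by simp
qed

lemma jn_mult_distrib:
  assumes "e \<in> projs S" "f \<in> projs S" "g \<in> projs S"
  shows "jn S e f \<odot> g = jn S (e \<odot> g) (f \<odot> g)"
  using BR3 [OF _ _ _ is_join_jn] assms by (intro is_join_projs) auto

lemma fin_join_exists:
  assumes "finite X" "X \<subseteq> carrier S" "w \<in> carrier S" "\<And>x. x \<in> X \<Longrightarrow> x \<preceq> w"
  shows "\<exists>j. is_join S X j"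
  using assms
proof (induction X)
  case (insert x X)
  then obtain k where k: "is_join S X k" by auto
  then have "k \<preceq> w" "k \<in> carrier S" using insert.prems by (auto simp: is_join_iff)
  then obtain j where "is_join S {x, k} j" using BR1 [of x k w] insert.prems by auto
  then show ?case using is_join_insert [OF k] insert.prems by auto
qed auto

text \<open>Every subset of \<open>X\<close> is bounded by \<open>j\<close>, so it has a join of its
  own by \<open>BR1\<close>. This allows one element to be split off at a time although joins are
  only partially defined.\<close>

lemma fin_join_induct [consumes 2, case_names empty insert]:
  assumes "finite X" "is_join S X j" and "P {} (zero_of S)"
    and step: "\<And>x X k j. \<lbrakk>finite X; is_join S X k; is_join S {x, k} j; is_join S (insert x X) j; P X k\<rbrakk>
      \<Longrightarrow> P (insert x X) j"
  shows "P X j"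
  using assms(1,2)
proof (induction X arbitrary: j)
  case empty
  then show ?case using assms(3) is_join_unique is_join_empty by blast
next
  case (insert x X)
  note j = is_joinD [OF insert.prems]
  obtain k where k: "is_join S X k"
    using fin_join_exists [of X j] insert.hyps j by auto
  then show ?case
    using step insert is_join_insert [OF k] j(1) by blast
qed

lemma fin_join_mult:
  assumes "finite X" "is_join S X j" "u \<in> carrier S"
  shows "is_join S ((\<lambda>x. x \<odot> u) ` X) (j \<odot> u)"
  using assms(1,2)
proof (induction rule: fin_join_induct)
  case (insert x X k j)
  then have c: "x \<in> carrier S" "k \<in> carrier S" by (simp_all add: is_join_iff)
  have "is_join S {x \<odot> u, k \<odot> u} (j \<odot> u)" by (rule BR3) (use c assms insert in auto)
  then show ?case using is_join_insert [OF insert(5)] c assms by simp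
qed (use assms in auto)

text \<open>\<open>g\<close> is the complement of \<open>e \<odot> f\<close> in the interval from
  zero to \<open>e\<close>, that is, the difference of \<open>e\<close> and \<open>f\<close>. As
  \<open>g\<close> lies below \<open>e\<close>, being disjoint from \<open>e \<odot> f\<close> means
  being disjoint from \<open>f\<close>.\<close>

lemma relative_complement:
  assumes "e \<in> projs S" "f \<in> projs S"
  shows "\<exists>g \<in> projs S. g \<odot> f = zero_of S \<and> jn S (e \<odot> f) g = e"
proof -
  obtain g where g: "g \<in> projs S" "(e \<odot> f) \<sqinter>\<^bsub>pposet S\<^esub> g = zero_of S" "(e \<odot> f) \<squnion>\<^bsub>pposet S\<^esub> g = e"
    using P.relatively_complemented [of "zero_of S" e "e \<odot> f"] assms
    by (auto simp: nleI)
  have "g \<preceq> e" using g assms jn_least_projs(2) [of "e \<odot> f" g] by (simp add: jn_def)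
  then have "g \<odot> f = (e \<odot> f) \<odot> g"
    using g(1) assms by (metis mult_assoc proj_commute proj_nle_iff projs_closed)
  then show ?thesis using g assms by (auto simp: meet_pposet jn_def)
qed

lemma zero_cong_star: "\<lbrakk>s \<in> carrier S; s\<^sup>\<star> = zero_of S\<rbrakk> \<Longrightarrow> s = zero_of S"
  by (metis mult_star zero_right)

end

lemma gba_hom_pposet_iff:
  assumes "preBoolean S" "preBoolean T"
  shows "gba_hom (pposet S) (pposet T) f \<longleftrightarrow> f \<in> projs S \<rightarrow> projs T
    \<and> (\<forall>e \<in> projs S. \<forall>g \<in> projs S. f (e \<odot>\<^bsub>S\<^esub> g) = f e \<odot>\<^bsub>T\<^esub> f g)
    \<and> (\<forall>e \<in> projs S. \<forall>g \<in> projs S. f (jn S e g) = jn T (f e) (f g))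
    \<and> f (zero_of S) = zero_of T"
proof -
  interpret S: preBoolean S by fact
  interpret T: preBoolean T by fact
  show ?thesis
    using S.lattice_pposet T.lattice_pposet
    by (auto simp: gba_hom_def join_pres_def meet_pres_def jn_def zero_of_def S.meet_pposet
        T.meet_pposet Pi_iff)
qed

section \<open>Morphisms\<close>

locale pbr_morphism = S: preBoolean S + T: preBoolean T
  for S :: "'s rsg" and T :: "'t rsg" +
  fixes f :: "'s \<Rightarrow> 't"
  assumes mor: "pbr_mor S T f"
begin

lemma f_closed [simp, intro]: "s \<in> carrier S \<Longrightarrow> f s \<in> carrier T"
  and f_ext: "f \<in> extensional (carrier S)"
  and f_mult: "\<lbrakk>x \<in> carrier S; y \<in> carrier S\<rbrakk> \<Longrightarrow> f (x \<odot>\<^bsub>S\<^esub> y) = f x \<odot>\<^bsub>T\<^esub> f y"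
  and f_star: "x \<in> carrier S \<Longrightarrow> f (x\<^sup>\<star>\<^bsub>S\<^esub>) = (f x)\<^sup>\<star>\<^bsub>T\<^esub>"
  and f_proper: "q \<in> projs T \<Longrightarrow> \<exists>e \<in> projs S. nle T q (f e)"
  using mor by (auto simp: pbr_mor_def PiE_def Pi_def)

lemma f_proj [simp, intro]: "e \<in> projs S \<Longrightarrow> f e \<in> projs T"
  by (metis S.proj_star S.projs_closed T.star_in_projs f_closed f_star)

lemma f_jn: "\<lbrakk>e \<in> projs S; g \<in> projs S\<rbrakk> \<Longrightarrow> f (jn S e g) = jn T (f e) (f g)"
  and f_zero: "f (zero_of S) = zero_of T"
  using mor by (auto simp: pbr_mor_def gba_hom_pposet_iff [OF S.preBoolean_axioms T.preBoolean_axioms])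

lemma f_mono: "\<lbrakk>nle S s t; s \<in> carrier S; t \<in> carrier S\<rbrakk> \<Longrightarrow> nle T (f s) (f t)"
  unfolding nle_def by (metis f_mult f_star S.star_closed')

text \<open>By definition a morphism preserves joins of projections. Now \<open>f j\<close> bounds
  \<open>f s\<close> and \<open>f t\<close>, and its star is the join of their stars; this makes it
  the join, by \<open>is_join_of_star\<close>.\<close>

lemma f_join:
  assumes "is_join S {s, t} j" shows "is_join T {f s, f t} (f j)"
proof -
  note j = is_joinD [OF assms]
  show ?thesis
  proof (rule T.is_join_of_star)
    show "(f j)\<^sup>\<star>\<^bsub>T\<^esub> = jn T ((f s)\<^sup>\<star>\<^bsub>T\<^esub>) ((f t)\<^sup>\<star>\<^bsub>T\<^esub>)"
      using S.star_is_join [OF assms] j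
      by (metis S.star_in_projs f_jn f_star insert_subset)
  qed (use j in \<open>auto intro: f_mono\<close>)
qed

lemma f_fin_join:
  assumes "finite X" "is_join S X j"
  shows "is_join T (f ` X) (f j)"
  using assms
proof (induction rule: S.fin_join_induct)
  case (insert x X k j)
  then have "x \<in> carrier S" by (simp_all add: is_join_iff)
  then show ?case using T.is_join_insert [OF insert(5)] f_join [OF insert(3)] by simp
qed (simp add: f_zero)

end

lemma pbr_morI:
  assumes "preBoolean S" "preBoolean T" "f \<in> carrier S \<rightarrow>\<^sub>E carrier T"
    "\<And>x y. \<lbrakk>x \<in> carrier S; y \<in> carrier S\<rbrakk> \<Longrightarrow> f (x \<odot>\<^bsub>S\<^esub> y) = f x \<odot>\<^bsub>T\<^esub> f y"
    "\<And>x. x \<in> carrier S \<Longrightarrow> f (x\<^sup>\<star>\<^bsub>S\<^esub>) = (f x)\<^sup>\<star>\<^bsub>T\<^esub>"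
    "\<And>e g. \<lbrakk>e \<in> projs S; g \<in> projs S\<rbrakk> \<Longrightarrow> f (jn S e g) = jn T (f e) (f g)"
    "f (zero_of S) = zero_of T"
    "\<And>q. q \<in> projs T \<Longrightarrow> \<exists>e \<in> projs S. nle T q (f e)"
  shows "pbr_mor S T f"
proof -
  interpret S: preBoolean S by fact
  interpret T: preBoolean T by fact
  have "f e \<in> projs T" if "e \<in> projs S" for e
    using assms(3,5) that
    by (metis PiE_mem S.proj_star S.projs_closed T.star_in_projs)
  then show ?thesis
    using assms unfolding pbr_mor_def by (auto simp: gba_hom_pposet_iff)
qed

text \<open>The lengths \<open>n \<ge> 1\<close> and upper bounds of the definition are immaterial: replace
  \<open>ts k\<close> by \<open>ts k \<odot> t\<^sup>\<star>\<close>, and add \<open>0\<close> to an empty family.\<close>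

lemma proper_mor_iff:
  assumes "pbr_morphism S T f"
  shows "proper_mor S T f \<longleftrightarrow> (\<forall>t \<in> carrier T. \<exists>X. finite X \<and> is_join T X t
     \<and> (\<forall>x \<in> X. \<exists>s \<in> carrier S. nle T x (f s)))" (is "?l \<longleftrightarrow> ?r")
proof -
  interpret pbr_morphism S T f by fact
  show ?thesis
  proof
    assume ?l
    show ?r
    proof
      fix t assume t: "t \<in> carrier T"
      then have "\<exists>n \<ge> (1::nat). \<exists>ts ss j. (\<forall>k \<in> {1..n}. ts k \<in> carrier T \<and> ss k \<in> carrier S
          \<and> nle T (ts k) (f (ss k))) \<and> is_join T (ts ` {1..n}) j \<and> nle T t j"
        using \<open>?l\<close> unfolding proper_mor_def by (rule bspec [rotated])
      then obtain n :: nat and ts ss j where *: "\<And>k. k \<in> {1..n} \<Longrightarrow> ts k \<in> carrier T \<and> ss k \<in> carrier S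
          \<and> nle T (ts k) (f (ss k))" and j: "is_join T (ts ` {1..n}) j" "nle T t j"
        by blast
      let ?X = "(\<lambda>x. x \<odot>\<^bsub>T\<^esub> t\<^sup>\<star>\<^bsub>T\<^esub>) ` ts ` {1..n}"
      have "is_join T ?X (j \<odot>\<^bsub>T\<^esub> t\<^sup>\<star>\<^bsub>T\<^esub>)"
        by (rule T.fin_join_mult) (use j t in auto)
      then have "is_join T ?X t" using j by (simp add: nle_eqD)
      moreover have "\<exists>s \<in> carrier S. nle T x (f s)" if "x \<in> ?X" for x
      proof -
        obtain k where k: "k \<in> {1..n}" "x = ts k \<odot>\<^bsub>T\<^esub> t\<^sup>\<star>\<^bsub>T\<^esub>" using \<open>x \<in> ?X\<close> by auto
        have "nle T x (ts k)" using k * [OF k(1)] t by (auto intro: T.nleI)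
        then have "nle T x (f (ss k))" using * [OF k(1)] k(2) t T.nle_trans by blast
        then show ?thesis using * [OF k(1)] by blast
      qed
      moreover have "finite ?X" by simp
      ultimately show "\<exists>X. finite X \<and> is_join T X t \<and> (\<forall>x \<in> X. \<exists>s \<in> carrier S. nle T x (f s))"
        by blast
    qed
  next
    assume ?r
    show ?l
      unfolding proper_mor_def
    proof
      fix t assume t: "t \<in> carrier T"
      then obtain X where X: "finite X" "is_join T X t" "\<And>x. x \<in> X \<Longrightarrow> \<exists>s \<in> carrier S. nle T x (f s)"
        using \<open>?r\<close> by meson
      define Y where "Y = insert (zero_of T) X"
      have Xc: "X \<subseteq> carrier T" using X(2) by (simp_all add: is_join_iff)
      have Y: "is_join T Y t"
        using T.is_join_insert [OF X(2)] T.is_join_absorb t by (auto simp: Y_def)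
      have "\<exists>s \<in> carrier S. nle T y (f s)" if "y \<in> Y" for y
      proof (cases "y \<in> X")
        case False
        then have "nle T y (f (zero_of S))" using that by (auto simp: Y_def)
        then show ?thesis by blast
      qed (rule X(3))
      then obtain s where s: "\<And>y. y \<in> Y \<Longrightarrow> s y \<in> carrier S \<and> nle T y (f (s y))" by metis
      obtain ts where ts: "bij_betw ts {1..card Y} Y"
        using ex_bij_betw_nat_finite_1 [of Y] X(1) by (auto simp: Y_def)
      then have im: "ts ` {1..card Y} = Y" by (simp add: bij_betw_def)
      have "card Y \<ge> 1" using X(1) by (simp add: Y_def card_gt_0_iff Suc_le_eq)
      moreover have "\<forall>k \<in> {1..card Y}. ts k \<in> carrier T \<and> (s \<circ> ts) k \<in> carrier S
          \<and> nle T (ts k) (f ((s \<circ> ts) k))"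
        using im s is_joinD(1) [OF Y] by (auto simp del: One_nat_def)
      moreover have "is_join T (ts ` {1..card Y}) t" "nle T t t" using im Y t by auto
      ultimately show "\<exists>n \<ge> (1::nat). \<exists>ts ss j. (\<forall>k \<in> {1..n}. ts k \<in> carrier T \<and> ss k \<in> carrier S
          \<and> nle T (ts k) (f (ss k))) \<and> is_join T (ts ` {1..n}) j \<and> nle T t j"
        by blast
    qed
  qed
qed

lemma proper_morI:
  assumes "pbr_morphism S T f"
    and "\<And>t. t \<in> carrier T \<Longrightarrow> \<exists>X. finite X \<and> is_join T X t
     \<and> (\<forall>x \<in> X. \<exists>s \<in> carrier S. nle T x (f s))"
  shows "proper_mor S T f"
  using assms proper_mor_iff by blast

text \<open>\<open>u\<close> is a join of pieces \<open>y\<close> below elements \<open>g t\<close>,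
  and each such \<open>t\<close> is a join of pieces \<open>x\<close> below elements
  \<open>f s\<close>. Cutting the elements \<open>g x\<close> down to the star of \<open>y\<close>
  decomposes \<open>y\<close> into pieces below elements \<open>g (f s)\<close>.\<close>

lemma proper_mor_comp:
  assumes "pbr_morphism S T f" "pbr_morphism T U g" "pbr_morphism S U h"
    and h: "\<And>s. s \<in> carrier S \<Longrightarrow> h s = g (f s)"
    and "proper_mor S T f" "proper_mor T U g"
  shows "proper_mor S U h"
proof (rule proper_morI [OF assms(3)])
  interpret f: pbr_morphism S T f by fact
  interpret g: pbr_morphism T U g by fact
  fix u assume u: "u \<in> carrier U"
  obtain Y where Y: "finite Y" "is_join U Y u" "\<And>y. y \<in> Y \<Longrightarrow> \<exists>t \<in> carrier T. nle U y (g t)"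
    using assms(6) u proper_mor_iff [OF assms(2)] by meson
  have Yc: "Y \<subseteq> carrier U" using Y(2) by (simp_all add: is_join_iff)
  have "\<exists>Z. finite Z \<and> is_join U Z y \<and> (\<forall>z \<in> Z. \<exists>s \<in> carrier S. nle U z (h s))" if y: "y \<in> Y" for y
  proof -
    obtain t where t: "t \<in> carrier T" "nle U y (g t)" using Y(3) y by blast
    obtain X where X: "finite X" "is_join T X t" "\<And>x. x \<in> X \<Longrightarrow> \<exists>s \<in> carrier S. nle T x (f s)"
      using assms(5) t proper_mor_iff [OF assms(1)] by meson
    have Xc: "X \<subseteq> carrier T" using X(2) by (simp_all add: is_join_iff)
    have yc: "y \<in> carrier U" using y Yc by blast
    let ?Z = "(\<lambda>x. x \<odot>\<^bsub>U\<^esub> y\<^sup>\<star>\<^bsub>U\<^esub>) ` g ` X"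
    have "is_join U ?Z (g t \<odot>\<^bsub>U\<^esub> y\<^sup>\<star>\<^bsub>U\<^esub>)"
      by (rule g.T.fin_join_mult [OF _ g.f_fin_join]) (use X yc in auto)
    then have "is_join U ?Z y" using t by (simp add: nle_eqD)
    moreover have "\<exists>s \<in> carrier S. nle U z (h s)" if z: "z \<in> ?Z" for z
    proof -
      obtain x where x: "x \<in> X" "z = g x \<odot>\<^bsub>U\<^esub> y\<^sup>\<star>\<^bsub>U\<^esub>" using z by blast
      obtain s where s: "s \<in> carrier S" "nle T x (f s)" using X(3) x by blast
      have xc: "x \<in> carrier T" using x Xc by blast
      have "nle U (g x) (h s)" using s xc by (auto simp: h intro: g.f_mono)
      moreover have "nle U z (g x)" unfolding x(2) using xc yc by (auto intro: g.T.nleI)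
      ultimately show ?thesis
        using s xc yc x(2) h by (metis f.f_closed g.T.mult_closed' g.T.nle_trans g.T.star_closed' g.f_closed)
    qed
    ultimately show ?thesis using X(1) by (intro exI [of _ ?Z]) auto
  qed
  then obtain Z where Z: "\<And>y. y \<in> Y \<Longrightarrow> finite (Z y) \<and> is_join U (Z y) y
      \<and> (\<forall>z \<in> Z y. \<exists>s \<in> carrier S. nle U z (h s))" by metis
  show "\<exists>X. finite X \<and> is_join U X u \<and> (\<forall>x \<in> X. \<exists>s \<in> carrier S. nle U x (h s))"
    using g.T.is_join_Union [OF Y(2), of Z] Z Y(1) by (intro exI [of _ "\<Union>y \<in> Y. Z y"]) auto
qed

lemma pbr_hom_morphism:
  assumes "preBoolean S" "preBoolean T" "f \<in> pbr_hom i S T"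
  shows "pbr_morphism S T f"
  using assms by (simp add: pbr_morphism_def pbr_morphism_axioms_def pbr_hom_def)

lemma pbr_mor_comp:
  assumes "pbr_morphism S T f" "pbr_morphism T U g"
  shows "pbr_mor S U (pbr_comp S g f)"
proof -
  interpret f: pbr_morphism S T f by fact
  interpret g: pbr_morphism T U g by fact
  show ?thesis
  proof (rule pbr_morI)
    fix q assume q: "q \<in> projs U"
    then obtain p where p: "p \<in> projs T" "nle U q (g p)" using g.f_proper by blast
    then obtain e where e: "e \<in> projs S" "nle T p (f e)" using f.f_proper by blast
    then have "nle U (g p) (g (f e))" using p by (auto intro: g.f_mono)
    then have "nle U q (g (f e))" using p e q by (meson f.f_proj g.T.nle_trans g.T.projs_closed g.f_proj)
    then show "\<exists>e \<in> projs S. nle U q (pbr_comp S g f e)"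
      using e by (auto simp: compose_def intro!: bexI [of _ e])
  next
    show "pbr_comp S g f \<in> carrier S \<rightarrow>\<^sub>E carrier U"
      by (auto simp: compose_def)
  qed (auto simp: compose_def f.f_mult g.f_mult f.f_star g.f_star f.f_jn g.f_jn f.f_zero g.f_zero
      f.S.preBoolean_axioms g.T.preBoolean_axioms)
qed

lemma pbr_comp_hom:
  assumes "preBoolean S" "preBoolean T" "preBoolean U" "f \<in> pbr_hom i S T" "g \<in> pbr_hom i T U"
  shows "pbr_comp S g f \<in> pbr_hom i S U"
proof -
  interpret f: pbr_morphism S T f using assms pbr_hom_morphism by blast
  interpret g: pbr_morphism T U g using assms pbr_hom_morphism by blast
  have mor: "pbr_mor S U (pbr_comp S g f)"
    by (rule pbr_mor_comp) unfold_locales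
  interpret h: pbr_morphism S U "pbr_comp S g f" by unfold_locales (rule mor)
  have h: "pbr_comp S g f s = g (f s)" if "s \<in> carrier S" for s
    using that by (simp add: compose_def)
  have "weakly_meet_preserving S U (pbr_comp S g f)"
    if wf: "weakly_meet_preserving S T f" and wg: "weakly_meet_preserving T U g"
    unfolding weakly_meet_preserving_def
  proof (intro ballI impI)
    fix s t u assume c: "s \<in> carrier S" "t \<in> carrier S" "u \<in> carrier U"
      and "nle U u (pbr_comp S g f s) \<and> nle U u (pbr_comp S g f t)"
    then have "nle U u (g (f s))" "nle U u (g (f t))" by (simp_all add: h)
    then obtain v where v: "v \<in> carrier T" "nle T v (f s)" "nle T v (f t)" "nle U u (g v)"
      using wg c unfolding weakly_meet_preserving_def by blast
    then obtain w where w: "w \<in> carrier S" "nle S w s" "nle S w t" "nle T v (f w)"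
      using wf c v(1) unfolding weakly_meet_preserving_def by blast
    have "nle U (g v) (g (f w))" using v w by (auto intro: g.f_mono)
    then have "nle U u (g (f w))" using v w c by (meson f.f_closed g.T.nle_trans g.f_closed)
    then show "\<exists>v \<in> carrier S. nle S v s \<and> nle S v t \<and> nle U u (pbr_comp S g f v)"
      using w h by auto
  qed
  moreover have "proper_mor S U (pbr_comp S g f)" if "proper_mor S T f" "proper_mor T U g"
    by (rule proper_mor_comp [OF f.pbr_morphism_axioms g.pbr_morphism_axioms h.pbr_morphism_axioms h that])
  ultimately show ?thesis using assms mor by (auto simp: pbr_hom_def)
qed

lemma pbr_id_hom:
  assumes "preBoolean S"
  shows "pbr_id S \<in> pbr_hom i S S"
proof -
  interpret preBoolean S by fact
  have mor: "pbr_mor S S (pbr_id S)"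
    by (rule pbr_morI) (auto simp: pbr_id_def assms)
  interpret h: pbr_morphism S S "pbr_id S" by unfold_locales (rule mor)
  have "proper_mor S S (pbr_id S)"
  proof (rule proper_morI)
    fix t assume "t \<in> carrier S"
    then have "finite {t} \<and> is_join S {t} t \<and> (\<forall>x \<in> {t}. \<exists>s \<in> carrier S. x \<preceq> pbr_id S s)"
      by (auto simp: pbr_id_def)
    then show "\<exists>X. finite X \<and> is_join S X t \<and> (\<forall>x \<in> X. \<exists>s \<in> carrier S. x \<preceq> pbr_id S s)"
      by blast
  qed unfold_locales
  then show ?thesis
    using mor by (auto simp: pbr_hom_def weakly_meet_preserving_def pbr_id_def)
qed

lemma pbr_category_laws_holds:
  assumes "preBoolean S" "preBoolean T" "preBoolean U" "preBoolean V"
  shows "pbr_category_laws i S T U V"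
  unfolding pbr_category_laws_def
proof (intro conjI ballI)
  show "pbr_id S \<in> pbr_hom i S S" by (rule pbr_id_hom) fact
  fix f assume f: "f \<in> pbr_hom i S T"
  interpret f: pbr_morphism S T f using assms f pbr_hom_morphism by blast
  show "pbr_comp S f (pbr_id S) = f" "pbr_comp S (pbr_id T) f = f"
    by (rule extensionalityI [OF _ f.f_ext]; auto simp: compose_def pbr_id_def)+
  fix g assume g: "g \<in> pbr_hom i T U"
  show "pbr_comp S g f \<in> pbr_hom i S U" using pbr_comp_hom assms f g by blast
  fix h assume h: "h \<in> pbr_hom i U V"
  show "pbr_comp S h (pbr_comp S g f) = pbr_comp S (pbr_comp T h g) f"
    by (auto simp: compose_def fun_eq_iff)
qed

section \<open>Prime characters\<close>

text \<open>The hypothesis is the refinement condition under which a subbasis is a basis.\<close>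

lemma openin_generated_basis:
  assumes "\<And>A B x. \<lbrakk>A \<in> \<B>; B \<in> \<B>; x \<in> A; x \<in> B\<rbrakk> \<Longrightarrow> \<exists>D \<in> \<B>. x \<in> D \<and> D \<subseteq> A \<inter> B"
  shows "openin (topology_generated_by \<B>) U \<longleftrightarrow> (\<forall>x \<in> U. \<exists>D \<in> \<B>. x \<in> D \<and> D \<subseteq> U)"
proof
  assume "openin (topology_generated_by \<B>) U"
  then have "generate_topology_on \<B> U" by (simp add: openin_topology_generated_by_iff)
  then show "\<forall>x \<in> U. \<exists>D \<in> \<B>. x \<in> D \<and> D \<subseteq> U"
  proof induction
    case (Int a b)
    show ?case
    proof
      fix x assume "x \<in> a \<inter> b"
      then obtain A B where "A \<in> \<B>" "x \<in> A" "A \<subseteq> a" "B \<in> \<B>" "x \<in> B" "B \<subseteq> b" using Int.IH by blast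
      moreover then obtain D where "D \<in> \<B>" "x \<in> D" "D \<subseteq> A \<inter> B" using assms by meson
      ultimately show "\<exists>D \<in> \<B>. x \<in> D \<and> D \<subseteq> a \<inter> b" by blast
    qed
  next
    case (UN K)
    then show ?case by (meson Union_iff Union_upper subset_trans)
  qed auto
next
  assume "\<forall>x \<in> U. \<exists>D \<in> \<B>. x \<in> D \<and> D \<subseteq> U"
  then show "openin (topology_generated_by \<B>) U"
    by (subst openin_subopen) (metis topology_generated_by_Basis)
qed

section \<open>The two-element Boolean algebra\<close>

lemma bool_lattice_simps [simp]:
  "carrier bool_lattice = UNIV" "le bool_lattice = (\<le>)" "eq bool_lattice = (=)"
  by (simp_all add: bool_lattice_def)

lemma partial_order_bool: "partial_order bool_lattice"
  by unfold_locales auto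

lemma least_bool: "least bool_lattice (a \<or> b) (Upper bool_lattice {a, b})"
  by (auto simp: least_def Upper_def)

lemma greatest_bool: "greatest bool_lattice (a \<and> b) (Lower bool_lattice {a, b})"
  by (auto simp: greatest_def Lower_def)

lemma lattice_bool: "Lattice.lattice bool_lattice"
  by (intro lattice.intro upper_semilattice.intro lower_semilattice.intro partial_order_bool
      upper_semilattice_axioms.intro lower_semilattice_axioms.intro exI)
    (rule least_bool greatest_bool)+

lemma join_bool: "a \<squnion>\<^bsub>bool_lattice\<^esub> b = (a \<or> b)"
  unfolding join_def sup_def
  using least_bool [of a b] partial_order.least_unique [OF partial_order_bool _ least_bool]
  by (rule some_equality)

lemma meet_bool: "a \<sqinter>\<^bsub>bool_lattice\<^esub> b = (a \<and> b)"
  unfolding meet_def inf_def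
  using greatest_bool [of a b] partial_order.greatest_unique [OF partial_order_bool _ greatest_bool]
  by (rule some_equality)

lemma bottom_bool: "\<bottom>\<^bsub>bool_lattice\<^esub> = False"
  unfolding bottom_def by (rule some_equality) (auto simp: least_def)

section \<open>The Stone space of the generalized Boolean algebra of projections\<close>

context preBoolean
begin

lemma prime_chars_iff:
  "\<phi> \<in> prime_chars S \<longleftrightarrow> \<phi> \<in> extensional (projs S)
    \<and> (\<forall>e \<in> projs S. \<forall>g \<in> projs S. \<phi> (e \<odot> g) = (\<phi> e \<and> \<phi> g))
    \<and> (\<forall>e \<in> projs S. \<forall>g \<in> projs S. \<phi> (jn S e g) = (\<phi> e \<or> \<phi> g))
    \<and> \<not> \<phi> (zero_of S) \<and> (\<exists>e \<in> projs S. \<phi> e)"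
  using lattice_pposet lattice_bool
  by (auto simp: prime_chars_def gba_hom_def join_pres_def meet_pres_def jn_def zero_of_def
      meet_pposet join_bool meet_bool bottom_bool)

lemma
  assumes "\<phi> \<in> prime_chars S"
  shows char_ext: "\<phi> \<in> extensional (projs S)"
    and char_mult: "\<lbrakk>e \<in> projs S; g \<in> projs S\<rbrakk> \<Longrightarrow> \<phi> (e \<odot> g) \<longleftrightarrow> \<phi> e \<and> \<phi> g"
    and char_jn: "\<lbrakk>e \<in> projs S; g \<in> projs S\<rbrakk> \<Longrightarrow> \<phi> (jn S e g) \<longleftrightarrow> \<phi> e \<or> \<phi> g"
    and char_zero: "\<not> \<phi> (zero_of S)"
    and char_nonzero: "\<exists>e \<in> projs S. \<phi> e"
  using assms by (simp_all add: prime_chars_iff)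

lemma char_mono:
  "\<lbrakk>\<phi> \<in> prime_chars S; e \<preceq> g; e \<in> projs S; g \<in> projs S; \<phi> e\<rbrakk> \<Longrightarrow> \<phi> g"
  by (metis char_mult proj_nle_iff)

lemma char_le_star:
  "\<lbrakk>\<phi> \<in> prime_chars S; s \<preceq> t; s \<in> carrier S; t \<in> carrier S; \<phi> (s\<^sup>\<star>)\<rbrakk> \<Longrightarrow> \<phi> (t\<^sup>\<star>)"
  using char_mono star_mono by blast

lemma char_fin_join:
  assumes "finite X" "is_join S X j" "\<phi> \<in> prime_chars S"
  shows "\<phi> (j\<^sup>\<star>) \<longleftrightarrow> (\<exists>x \<in> X. \<phi> (x\<^sup>\<star>))"
  using assms(1,2)
proof (induction rule: fin_join_induct)
  case empty
  then show ?case using char_zero assms(3) by simp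
next
  case (insert x X k j)
  have c: "x \<in> carrier S" "k \<in> carrier S" using is_joinD(1) [OF insert(3)] by auto
  then have "\<phi> (j\<^sup>\<star>) \<longleftrightarrow> \<phi> (x\<^sup>\<star>) \<or> \<phi> (k\<^sup>\<star>)"
    using star_is_join [OF insert(3)] char_jn [OF assms(3)] by simp
  then show ?case using insert(5) by auto
qed

text \<open>Supports of prime characters are maximal, so an inclusion between them is an equality.
  If \<open>\<psi>\<close> is 1 at \<open>e\<close> and \<open>\<phi>\<close> is not, take
  \<open>g\<close> in the support of \<open>\<phi>\<close>: the difference \<open>h\<close> of
  \<open>g\<close> and \<open>e\<close> then lies in the support of \<open>\<phi>\<close>, hence of
  \<open>\<psi>\<close>, although \<open>h \<odot> e\<close> is zero.\<close>

lemma char_eqI: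
  assumes "\<phi> \<in> prime_chars S" "\<psi> \<in> prime_chars S" "\<And>e. e \<in> projs S \<Longrightarrow> \<phi> e \<Longrightarrow> \<psi> e"
  shows "\<phi> = \<psi>"
proof (rule extensionalityI [OF char_ext char_ext])
  fix e assume e: "e \<in> projs S"
  show "\<phi> e = \<psi> e"
  proof (rule ccontr)
    assume "\<phi> e \<noteq> \<psi> e"
    then have *: "\<not> \<phi> e" "\<psi> e" using assms(3) e by auto
    obtain g where g: "g \<in> projs S" "\<phi> g" using char_nonzero [OF assms(1)] by blast
    obtain h where h: "h \<in> projs S" "h \<odot> e = zero_of S" "jn S (g \<odot> e) h = g"
      using relative_complement [OF g(1) e] by blast
    have "\<phi> h" using h g e * char_jn [OF assms(1), of "g \<odot> e" h] char_mult [OF assms(1), of g e] by auto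
    then have "\<psi> (h \<odot> e)" using assms(3) h(1) * e char_mult [OF assms(2), of h e] by auto
    then show False using h(2) char_zero [OF assms(2)] by simp
  qed
qed fact+

lemma char_basic_iff [simp]: "\<phi> \<in> char_basic S e \<longleftrightarrow> \<phi> \<in> prime_chars S \<and> \<phi> e"
  by (simp add: char_basic_def)

abbreviation "CT \<equiv> topology_generated_by (char_basic S ` projs S)"

lemma topspace_CT [simp]: "topspace CT = prime_chars S"
  using char_nonzero by auto

lemma openin_char_basic [simp, intro]: "e \<in> projs S \<Longrightarrow> openin CT (char_basic S e)"
  by (rule topology_generated_by_Basis) simp

lemma openin_CT_iff:
  "openin CT U \<longleftrightarrow> (\<forall>\<phi> \<in> U. \<exists>e \<in> projs S. \<phi> \<in> char_basic S e \<and> char_basic S e \<subseteq> U)"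
proof (subst openin_generated_basis)
  fix A B \<phi> assume "A \<in> char_basic S ` projs S" "B \<in> char_basic S ` projs S" "\<phi> \<in> A" "\<phi> \<in> B"
  then obtain e g where *: "e \<in> projs S" "g \<in> projs S" "A = char_basic S e" "B = char_basic S g" "\<phi> \<in> A" "\<phi> \<in> B"
    by blast
  then have "\<phi> \<in> char_basic S (e \<odot> g)" "char_basic S (e \<odot> g) \<subseteq> A \<inter> B"
    by (auto simp: char_mult)
  then show "\<exists>D \<in> char_basic S ` projs S. \<phi> \<in> D \<and> D \<subseteq> A \<inter> B"
    using *(1,2) by (intro bexI [of _ "char_basic S (e \<odot> g)"] conjI imageI) auto
qed auto

text \<open>By \<open>char_eqI\<close> some \<open>e\<close> lies in the support of \<phi> and not
  of \<psi>. With \<open>g\<close> in the support of \<psi>, the basic sets of \<open>e\<close> and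
  of the difference of \<open>g\<close> and \<open>e\<close> separate the two characters.\<close>

lemma Hausdorff_CT: "Hausdorff_space CT"
proof -
  have sep: "\<exists>U V. openin CT U \<and> openin CT V \<and> \<phi> \<in> U \<and> \<psi> \<in> V \<and> disjnt U V"
    if \<phi>: "\<phi> \<in> prime_chars S" and \<psi>: "\<psi> \<in> prime_chars S" and ne: "\<phi> \<noteq> \<psi>" for \<phi> \<psi>
  proof -
    obtain e where e: "e \<in> projs S" "\<phi> e" "\<not> \<psi> e"
      using char_eqI [OF \<phi> \<psi>] ne by blast
    obtain g where g: "g \<in> projs S" "\<psi> g" using char_nonzero [OF \<psi>] by blast
    obtain h where h: "h \<in> projs S" "h \<odot> e = zero_of S" "jn S (g \<odot> e) h = g"
      using relative_complement [OF g(1) e(1)] by blast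
    have "\<psi> h" using h g e char_jn [OF \<psi>, of "g \<odot> e" h] char_mult [OF \<psi>, of g e] by auto
    moreover have "disjnt (char_basic S e) (char_basic S h)"
    proof -
      have False if "\<theta> \<in> prime_chars S" "\<theta> e" "\<theta> h" for \<theta>
        using char_mult [OF that(1) h(1) e(1)] h(2) that char_zero [OF that(1)] by simp
      then show ?thesis by (auto simp: disjnt_def)
    qed
    ultimately show ?thesis
      using \<phi> \<psi> e h by (intro exI [of _ "char_basic S e"] exI [of _ "char_basic S h"]) auto
  qed
  then show ?thesis unfolding Hausdorff_space_def topspace_CT by blast
qed

text \<open>The characters that do not vanish at \<open>e\<close> form a closed subset of the product of copies of
  the two-point space over \<open>projs S\<close>, and the product topology is finer on this subset.\<close>

lemma compactin_char_basic [simp, intro]: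
  assumes e: "e \<in> projs S"
  shows "compactin CT (char_basic S e)"
proof -
  let ?P = "product_topology (\<lambda>_. discrete_topology (UNIV :: bool set)) (projs S)"
  have top: "topspace ?P = extensional (projs S)" by (simp add: PiE_def)
  have coord: "openin ?P {\<phi> \<in> extensional (projs S). \<phi> a = b}" if "a \<in> projs S" for a b
  proof -
    have "openin ?P {\<phi> \<in> topspace ?P. \<phi> a \<in> {b}}"
      by (rule openin_continuous_map_preimage [OF continuous_map_product_projection [OF that]]) simp
    then show ?thesis by (simp add: PiE_def)
  qed
  \<comment> \<open>Every axiom of a prime character relates at most three coordinates: the values
    at two projections and at their product or join. A condition on three truth values defines a
    finite union of cylinders.\<close>
  have coord': "openin ?P {\<phi> \<in> extensional (projs S). Q (\<phi> a) (\<phi> b) (\<phi> c)}"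
    if "a \<in> projs S" "b \<in> projs S" "c \<in> projs S" for a b c and Q :: "bool \<Rightarrow> bool \<Rightarrow> bool \<Rightarrow> bool"
  proof -
    have "{\<phi> \<in> extensional (projs S). Q (\<phi> a) (\<phi> b) (\<phi> c)}
      = (\<Union>(x, y, z) \<in> {(x, y, z). Q x y z}. {\<phi> \<in> extensional (projs S). \<phi> a = x}
          \<inter> {\<phi> \<in> extensional (projs S). \<phi> b = y} \<inter> {\<phi> \<in> extensional (projs S). \<phi> c = z})"
      by auto
    also have "openin ?P \<dots>"
      by (intro openin_Union ballI) (auto intro!: openin_Int coord that)
    finally show ?thesis .
  qed
  have closed: "closedin ?P {\<phi> \<in> extensional (projs S). Q (\<phi> a) (\<phi> b) (\<phi> c)}"
    if "a \<in> projs S" "b \<in> projs S" "c \<in> projs S" for a b c and Q :: "bool \<Rightarrow> bool \<Rightarrow> bool \<Rightarrow> bool"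
  proof -
    have "openin ?P {\<phi> \<in> extensional (projs S). \<not> Q (\<phi> a) (\<phi> b) (\<phi> c)}"
      using coord' [OF that, of "\<lambda>x y z. \<not> Q x y z"] .
    moreover have "topspace ?P - {\<phi> \<in> extensional (projs S). Q (\<phi> a) (\<phi> b) (\<phi> c)}
      = {\<phi> \<in> extensional (projs S). \<not> Q (\<phi> a) (\<phi> b) (\<phi> c)}" by (auto simp: PiE_def)
    ultimately show ?thesis unfolding closedin_def top by auto
  qed
  let ?M = "\<lambda>(a, b). {\<phi> \<in> extensional (projs S). \<phi> (a \<odot> b) = (\<phi> a \<and> \<phi> b)}"
  let ?J = "\<lambda>(a, b). {\<phi> \<in> extensional (projs S). \<phi> (jn S a b) = (\<phi> a \<or> \<phi> b)}"
  let ?E = "{\<phi> \<in> extensional (projs S). \<phi> e}" and ?Z = "{\<phi> \<in> extensional (projs S). \<not> \<phi> (zero_of S)}"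
  have "char_basic S e = ?E \<inter> (?Z \<inter> ((\<Inter>p \<in> projs S \<times> projs S. ?M p) \<inter> (\<Inter>p \<in> projs S \<times> projs S. ?J p)))"
    using e by (auto simp: prime_chars_iff)
  also have "closedin ?P \<dots>"
  proof (intro closedin_Int closedin_INT)
    show "closedin ?P ?E" using closed [OF e e e, of "\<lambda>x y z. x"] .
    show "closedin ?P ?Z"
      using closed [OF zero_proj zero_proj zero_proj, of "\<lambda>x y z. \<not> x"] .
    show "projs S \<times> projs S \<noteq> {}" "projs S \<times> projs S \<noteq> {}" using e by auto
    show "closedin ?P (?M p)" if "p \<in> projs S \<times> projs S" for p
      using closed [of "fst p \<odot> snd p" "fst p" "snd p" "\<lambda>x y z. x = (y \<and> z)"] that by auto
    show "closedin ?P (?J p)" if "p \<in> projs S \<times> projs S" for p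
      using closed [of "jn S (fst p) (snd p)" "fst p" "snd p" "\<lambda>x y z. x = (y \<or> z)"] that by auto
  qed
  finally have cl: "closedin ?P (char_basic S e)" .
  have "compact_space ?P" by (simp add: compact_space_product_topology compact_space_discrete_topology)
  then have comp: "compactin ?P (char_basic S e)" using cl closedin_compact_space by blast
  have "continuous_map (subtopology ?P (char_basic S e)) CT (\<lambda>\<phi>. \<phi>)"
    unfolding continuous_map_def topspace_CT
  proof (intro conjI allI impI)
    show "(\<lambda>\<phi>. \<phi>) \<in> topspace (subtopology ?P (char_basic S e)) \<rightarrow> prime_chars S" by auto
    fix U assume "openin CT U"
    then have U: "\<forall>\<phi> \<in> U. \<exists>a \<in> projs S. \<phi> \<in> char_basic S a \<and> char_basic S a \<subseteq> U"
      by (simp only: openin_CT_iff)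
    let ?A = "{a \<in> projs S. char_basic S a \<subseteq> U}"
    have "U \<inter> char_basic S e = (\<Union>a \<in> ?A. {\<phi> \<in> extensional (projs S). \<phi> a = True}) \<inter> char_basic S e"
      using U char_ext by fastforce
    moreover have "openin ?P (\<Union>a \<in> ?A. {\<phi> \<in> extensional (projs S). \<phi> a = True})"
      using coord by (intro openin_Union) blast
    moreover have "{x \<in> topspace (subtopology ?P (char_basic S e)). x \<in> U} = U \<inter> char_basic S e"
      using closedin_subset [OF cl] by auto
    ultimately show "openin (subtopology ?P (char_basic S e))
        {x \<in> topspace (subtopology ?P (char_basic S e)). x \<in> U}"
      by (simp add: openin_subtopology) blast
  qed
  then have "compactin CT ((\<lambda>\<phi>. \<phi>) ` char_basic S e)"
    using comp image_compactin compactin_subtopology by (metis subset_refl)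
  then show ?thesis by simp
qed

text \<open>A maximal filter is prime; equivalently, a maximal multiplicatively closed set avoiding \<open>0\<close>
  is the support of a prime character.\<close>

lemma char_exists:
  assumes a: "a \<in> projs S" "a \<noteq> zero_of S"
  shows "\<exists>\<phi> \<in> prime_chars S. \<phi> a"
proof -
  define \<F> where "\<F> = {M. M \<subseteq> projs S \<and> a \<in> M \<and> zero_of S \<notin> M \<and> (\<forall>x \<in> M. \<forall>y \<in> M. x \<odot> y \<in> M)}"
  have "\<exists>M \<in> \<F>. \<forall>X \<in> \<F>. M \<subseteq> X \<longrightarrow> X = M"
  proof (rule subset_Zorn_nonempty)
    have "{a} \<in> \<F>" using a by (auto simp: \<F>_def)
    then show "\<F> \<noteq> {}" by blast
    fix \<C> assume \<C>: "\<C> \<noteq> {}" "subset.chain \<F> \<C>"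
    then have sub: "\<C> \<subseteq> \<F>" and ch: "\<And>X Y. X \<in> \<C> \<Longrightarrow> Y \<in> \<C> \<Longrightarrow> X \<subseteq> Y \<or> Y \<subseteq> X"
      by (auto simp: subset.chain_def)
    have "x \<odot> y \<in> \<Union>\<C>" if xy: "x \<in> \<Union>\<C>" "y \<in> \<Union>\<C>" for x y
    proof -
      obtain X Y where "X \<in> \<C>" "Y \<in> \<C>" "x \<in> X" "y \<in> Y" using xy by blast
      then obtain Z where "Z \<in> \<C>" "x \<in> Z" "y \<in> Z" using ch [of X Y] by blast
      then show ?thesis using sub unfolding \<F>_def by blast
    qed
    then show "\<Union>\<C> \<in> \<F>" using \<C>(1) sub unfolding \<F>_def by blast
  qed
  then obtain M where M: "M \<in> \<F>" and max: "\<And>X. X \<in> \<F> \<Longrightarrow> M \<subseteq> X \<Longrightarrow> X = M" by blast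
  have MP: "M \<subseteq> projs S" and aM: "a \<in> M" and M0: "zero_of S \<notin> M"
    and Mm: "\<And>x y. x \<in> M \<Longrightarrow> y \<in> M \<Longrightarrow> x \<odot> y \<in> M" using M by (auto simp: \<F>_def)
  \<comment> \<open>Here maximality of \<open>M\<close> is used: if no element of \<open>M\<close>
    is disjoint from \<open>e\<close>, then adding \<open>e\<close> and the products of
    \<open>e\<close> with elements of \<open>M\<close> gives again a multiplicatively closed set
    that avoids zero.\<close>
  have mem: "e \<in> M \<longleftrightarrow> (\<forall>m \<in> M. m \<odot> e \<noteq> zero_of S)" if e: "e \<in> projs S" for e
  proof
    assume "e \<in> M" then show "\<forall>m \<in> M. m \<odot> e \<noteq> zero_of S" using Mm M0 by metis
  next
    assume *: "\<forall>m \<in> M. m \<odot> e \<noteq> zero_of S"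
    let ?X = "M \<union> {e} \<union> (\<lambda>m. m \<odot> e) ` M"
    have e0: "e \<noteq> zero_of S" using * aM a by auto
    have 1: "m \<odot> n \<odot> e \<in> ?X" if "m \<in> M" "n \<in> M" for m n using Mm that by auto
    have swap: "(m \<odot> e) \<odot> n = m \<odot> n \<odot> e" if "m \<in> M" "n \<in> M" for m n
      using that MP e by (metis mult_assoc proj_commute projs_closed subsetD)
    have swap': "e \<odot> n = n \<odot> e" if "n \<in> M" for n
      using that MP e by (metis proj_commute subsetD)
    have swap'': "(m \<odot> e) \<odot> (n \<odot> e) = m \<odot> n \<odot> e" if "m \<in> M" "n \<in> M" for m n
    proof -
      have mn: "m \<in> carrier S" "n \<in> carrier S" "e \<in> carrier S" using that MP e by auto
      have "(m \<odot> e) \<odot> (n \<odot> e) = m \<odot> ((e \<odot> n) \<odot> e)" using mn by (simp add: mult_assoc)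
      also have "\<dots> = m \<odot> n \<odot> e" using mn e by (simp add: swap' that mult_assoc)
      finally show ?thesis .
    qed
    have "m \<odot> e \<odot> e = m \<odot> e" if "m \<in> M" for m
      using that MP e by (metis mult_assoc proj_idem projs_closed subsetD)
    moreover have "e \<odot> (m \<odot> e) = m \<odot> e" if "m \<in> M" for m
      using that MP e by (metis mult_assoc proj_idem projs_closed subsetD swap')
    moreover have "m \<odot> (n \<odot> e) = m \<odot> n \<odot> e" if "m \<in> M" "n \<in> M" for m n
      using that MP e by (metis mult_assoc projs_closed subsetD)
    ultimately have "\<forall>x \<in> ?X. \<forall>y \<in> ?X. x \<odot> y \<in> ?X"
      using Mm e swap swap' swap'' by (auto simp: proj_idem)
    moreover have "?X \<subseteq> projs S" using MP e by auto
    ultimately have "?X \<in> \<F>" using * e0 M0 aM by (auto simp: \<F>_def)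
    then show "e \<in> M" using max [of ?X] by blast
  qed
  have up: "g \<in> M" if eM: "e \<in> M" and eg: "e \<preceq> g" and g: "g \<in> projs S" for e g
  proof -
    have "m \<odot> g \<noteq> zero_of S" if m: "m \<in> M" for m
    proof
      assume 0: "m \<odot> g = zero_of S"
      have "m \<odot> e = (m \<odot> g) \<odot> e"
        using eg g eM m MP by (metis mult_assoc proj_nle_iff projs_closed subsetD)
      then have "m \<odot> e = zero_of S" using 0 eM m MP by (auto simp: subset_iff)
      then show False using Mm [OF m eM] M0 by simp
    qed
    then show ?thesis using mem g by blast
  qed
  \<comment> \<open>If neither projection belonged to \<open>M\<close>, some \<open>m\<close> and
    \<open>n\<close> in \<open>M\<close> would annihilate \<open>e\<close> and \<open>g\<close>. By
    distributivity \<open>m \<odot> n\<close> annihilates the join, so zero would be a product of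
    two elements of \<open>M\<close>.\<close>
  have join: "e \<in> M \<or> g \<in> M" if j: "jn S e g \<in> M" and eg: "e \<in> projs S" "g \<in> projs S" for e g
  proof (rule ccontr)
    assume "\<not> (e \<in> M \<or> g \<in> M)"
    then obtain m n where m: "m \<in> M" "m \<odot> e = zero_of S" "n \<in> M" "n \<odot> g = zero_of S"
      using mem eg by blast
    have mp: "m \<in> projs S" "n \<in> projs S" using m MP by auto
    let ?k = "m \<odot> n"
    have "e \<odot> ?k = zero_of S"
      using m(2) mp eg by (metis mult_assoc proj_commute projs_closed zero_left)
    moreover have "g \<odot> ?k = zero_of S"
      using m(4) mp eg by (metis mult_assoc proj_commute projs_closed zero_left)
    ultimately have "jn S e g \<odot> ?k = jn S (zero_of S) (zero_of S)"
      using jn_mult_distrib eg mp by simp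
    also have "\<dots> = zero_of S" using is_join_projs [of "zero_of S" "zero_of S" "zero_of S"] by simp
    finally show False using Mm [OF j Mm [OF m(1,3)]] M0 by simp
  qed
  define \<phi> where "\<phi> = (\<lambda>e \<in> projs S. e \<in> M)"
  have "\<phi> \<in> prime_chars S"
    unfolding prime_chars_iff
  proof (intro conjI ballI)
    fix e g assume eg: "e \<in> projs S" "g \<in> projs S"
    have "e \<odot> g \<in> M \<longleftrightarrow> e \<in> M \<and> g \<in> M"
      using up [of "e \<odot> g" e] up [of "e \<odot> g" g] Mm eg nleI [of e g] proj_mult_le [of e g] by auto
    then show "\<phi> (e \<odot> g) = (\<phi> e \<and> \<phi> g)" using eg by (simp add: \<phi>_def)
    have "jn S e g \<in> M \<longleftrightarrow> e \<in> M \<or> g \<in> M"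
      using up [of e "jn S e g"] up [of g "jn S e g"] join eg jn_least_projs by auto
    then show "\<phi> (jn S e g) = (\<phi> e \<or> \<phi> g)" using eg by (simp add: \<phi>_def)
  qed (use a aM M0 in \<open>auto simp: \<phi>_def\<close>)
  then show ?thesis using a aM by (intro bexI [of _ \<phi>]) (auto simp: \<phi>_def)
qed

end

section \<open>Local homeomorphisms\<close>

text \<open>On an open set where it is injective, a continuous open map is an open bijection onto an
  open image.\<close>

lemma local_homeomorphismI:
  assumes "continuous_map X Y f" "open_map X Y f"
    and "\<And>x. x \<in> topspace X \<Longrightarrow> \<exists>U. openin X U \<and> x \<in> U \<and> inj_on f U"
  shows "local_homeomorphism X Y f"
  unfolding local_homeomorphism_def
proof
  fix x assume "x \<in> topspace X"
  then obtain U where U: "openin X U" "x \<in> U" "inj_on f U" using assms(3) by blast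
  then have sub: "U \<subseteq> topspace X" by (simp add: openin_subset)
  have fU: "openin Y (f ` U)" using U assms(2) by (simp add: open_map_def)
  have "homeomorphic_map (subtopology X U) (subtopology Y (f ` U)) f"
  proof (rule bijective_open_imp_homeomorphic_map)
    show "continuous_map (subtopology X U) (subtopology Y (f ` U)) f"
      using assms(1) by (auto simp: continuous_map_in_subtopology continuous_map_from_subtopology)
    show "open_map (subtopology X U) (subtopology Y (f ` U)) f"
      using assms(2) U(1) fU
      by (auto simp: open_map_def openin_open_subtopology)
    show "f ` topspace (subtopology X U) = topspace (subtopology Y (f ` U))"
      using sub openin_subset [OF fU] by auto
    show "inj_on f (topspace (subtopology X U))" using U(3) by (simp add: inj_on_Int)
  qed
  with U fU show "\<exists>U. openin X U \<and> x \<in> U \<and> openin Y (f ` U)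
     \<and> homeomorphic_map (subtopology X U) (subtopology Y (f ` U)) f" by blast
qed

lemma local_homeomorphism_open_map:
  assumes "local_homeomorphism X Y f"
  shows "open_map X Y f"
  unfolding open_map_def
proof (intro allI impI)
  fix V assume V: "openin X V"
  show "openin Y (f ` V)"
  proof (subst openin_subopen, intro ballI)
    fix y assume "y \<in> f ` V"
    then obtain x where x: "x \<in> V" "y = f x" by blast
    then have "x \<in> topspace X" using V openin_subset by blast
    then obtain U where U: "openin X U" "x \<in> U" "openin Y (f ` U)"
        "homeomorphic_map (subtopology X U) (subtopology Y (f ` U)) f"
      using assms unfolding local_homeomorphism_def by blast
    have "openin (subtopology X U) (U \<inter> V)" using V U by (simp add: openin_open_subtopology openin_Int)
    then have "openin (subtopology Y (f ` U)) (f ` (U \<inter> V))"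
      using homeomorphic_imp_open_map [OF U(4)] by (simp add: open_map_def)
    then have "openin Y (f ` (U \<inter> V))" using U(3) by (simp add: openin_open_subtopology)
    then show "\<exists>T. openin Y T \<and> y \<in> T \<and> T \<subseteq> f ` V" using x U(2) by blast
  qed
qed

lemma local_homeomorphism_inj:
  assumes "local_homeomorphism X Y f" "x \<in> topspace X"
  obtains U where "openin X U" "x \<in> U" "inj_on f U"
proof -
  obtain U where U: "openin X U" "x \<in> U" "homeomorphic_map (subtopology X U) (subtopology Y (f ` U)) f"
    using assms unfolding local_homeomorphism_def by blast
  then have "inj_on f U"
    using homeomorphic_imp_injective_map [OF U(3)] openin_subset [OF U(1)] by (simp add: Int_absorb1)
  with U that show ?thesis by blast
qed

lemma is_basis_iff:
  "is_basis X \<B> \<longleftrightarrow> (\<forall>A \<in> \<B>. openin X A)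
    \<and> (\<forall>U x. openin X U \<and> x \<in> U \<longrightarrow> (\<exists>A \<in> \<B>. x \<in> A \<and> A \<subseteq> U))"
  unfolding is_basis_def openin_topology_base_unique Ball_def Bex_def by (rule refl)

text \<open>Operations defined by representatives are evaluated with this rule: one representative
  gives \<open>v\<close>, and every other one gives the same value.\<close>

lemma the_elem_eqI: "\<lbrakk>v \<in> X; \<And>y. y \<in> X \<Longrightarrow> y = v\<rbrakk> \<Longrightarrow> the_elem X = v"
proof -
  assume *: "v \<in> X" "\<And>y. y \<in> X \<Longrightarrow> y = v"
  have "X = {v}" using * by blast
  then show ?thesis by simp
qed

section \<open>Germs\<close>

context preBoolean
begin

abbreviation "GS \<equiv> germ_cat S"

lemma pre_germs_iff: "(s, \<phi>) \<in> pre_germs S \<longleftrightarrow> s \<in> carrier S \<and> \<phi> \<in> prime_chars S \<and> \<phi> (s\<^sup>\<star>)"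
  by (simp add: pre_germs_def)

text \<open>A common lower bound \<open>u\<close> is the restriction of both \<open>s\<close> and
  \<open>t\<close> by the star of \<open>u\<close>; conversely the common value
  \<open>s \<odot> e = t \<odot> e\<close> is a lower bound. In this form germs are handled by
  equations between products with projections.\<close>

lemma germ_rel_iff:
  "((s, \<phi>), (t, \<psi>)) \<in> germ_rel S \<longleftrightarrow> (s, \<phi>) \<in> pre_germs S \<and> (t, \<psi>) \<in> pre_germs S \<and> \<phi> = \<psi>
     \<and> (\<exists>e \<in> projs S. \<phi> e \<and> s \<odot> e = t \<odot> e)"
proof -
  have "(\<exists>u \<in> carrier S. u \<preceq> s \<and> u \<preceq> t \<and> \<phi> (u\<^sup>\<star>)) \<longleftrightarrow> (\<exists>e \<in> projs S. \<phi> e \<and> s \<odot> e = t \<odot> e)"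
    if st: "(s, \<phi>) \<in> pre_germs S" "(t, \<phi>) \<in> pre_germs S"
  proof
    assume "\<exists>u \<in> carrier S. u \<preceq> s \<and> u \<preceq> t \<and> \<phi> (u\<^sup>\<star>)"
    then show "\<exists>e \<in> projs S. \<phi> e \<and> s \<odot> e = t \<odot> e" by (metis nle_eqD star_in_projs)
  next
    assume "\<exists>e \<in> projs S. \<phi> e \<and> s \<odot> e = t \<odot> e"
    then obtain e where e: "e \<in> projs S" "\<phi> e" "s \<odot> e = t \<odot> e" by blast
    have "s \<odot> e \<preceq> s" "s \<odot> e \<preceq> t" using st e nleI [of s e] nleI [of t e] by (auto simp: pre_germs_iff)
    moreover have "\<phi> ((s \<odot> e)\<^sup>\<star>)"
      using st e by (simp add: pre_germs_iff star_mult_proj char_mult)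
    ultimately show "\<exists>u \<in> carrier S. u \<preceq> s \<and> u \<preceq> t \<and> \<phi> (u\<^sup>\<star>)"
      using st e by (auto simp: pre_germs_iff intro!: bexI [of _ "s \<odot> e"])
  qed
  then show ?thesis unfolding germ_rel_def by auto
qed

lemma equiv_germ_rel: "equiv (pre_germs S) (germ_rel S)"
proof (rule equivI)
  show "germ_rel S \<subseteq> pre_germs S \<times> pre_germs S" by (auto simp: germ_rel_iff)
  show "refl_on (pre_germs S) (germ_rel S)"
    by (rule refl_onI) (use star_in_projs in \<open>fastforce simp: germ_rel_iff pre_germs_iff\<close>)
  show "sym (germ_rel S)" by (rule symI) (auto simp: germ_rel_iff, metis)
  show "trans (germ_rel S)"
  proof (rule transI)
    fix p q r assume *: "(p, q) \<in> germ_rel S" "(q, r) \<in> germ_rel S"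
    obtain s \<phi> t \<phi>' w \<phi>'' where "p = (s, \<phi>)" "q = (t, \<phi>')" "r = (w, \<phi>'')"
      by (metis surj_pair)
    with * have pqr: "p = (s, \<phi>)" "q = (t, \<phi>)" "r = (w, \<phi>)" by (simp_all add: germ_rel_iff)
    obtain e where e: "e \<in> projs S" "\<phi> e" "s \<odot> e = t \<odot> e" using * pqr by (auto simp: germ_rel_iff)
    obtain g where g: "g \<in> projs S" "\<phi> g" "t \<odot> g = w \<odot> g" using * pqr by (auto simp: germ_rel_iff)
    have c: "s \<in> carrier S" "t \<in> carrier S" "w \<in> carrier S" "\<phi> \<in> prime_chars S"
      using * pqr by (auto simp: germ_rel_iff pre_germs_iff)
    \<comment> \<open>All three elements agree on the product of the two projections. Commuting the
      projections brings the one that is needed next to the element it restricts.\<close>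
    have "s \<odot> (e \<odot> g) = t \<odot> (e \<odot> g)" using c e g by (metis mult_assoc projs_closed)
    also have "\<dots> = t \<odot> (g \<odot> e)" using e g proj_commute by simp
    also have "\<dots> = w \<odot> (g \<odot> e)" using c e g by (metis mult_assoc projs_closed)
    also have "\<dots> = w \<odot> (e \<odot> g)" using e g proj_commute by simp
    finally show "(p, r) \<in> germ_rel S"
      using * pqr e g c by (auto simp: germ_rel_iff char_mult intro!: bexI [of _ "e \<odot> g"])
  qed
qed

lemma mem_germ: "(t, \<psi>) \<in> germ S s \<phi> \<longleftrightarrow> ((s, \<phi>), (t, \<psi>)) \<in> germ_rel S"
  by (simp add: germ_def)

lemma germ_self: "(s, \<phi>) \<in> pre_germs S \<Longrightarrow> (s, \<phi>) \<in> germ S s \<phi>"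
  by (auto simp: mem_germ germ_rel_iff pre_germs_iff)

lemma germ_eq_iff:
  assumes "(s, \<phi>) \<in> pre_germs S" "(t, \<psi>) \<in> pre_germs S"
  shows "germ S s \<phi> = germ S t \<psi> \<longleftrightarrow> \<phi> = \<psi> \<and> (\<exists>e \<in> projs S. \<phi> e \<and> s \<odot> e = t \<odot> e)"
proof -
  have "germ S s \<phi> = germ S t \<psi> \<longleftrightarrow> ((s, \<phi>), (t, \<psi>)) \<in> germ_rel S"
    unfolding germ_def using eq_equiv_class_iff [OF equiv_germ_rel] assms by blast
  then show ?thesis using assms by (simp add: germ_rel_iff)
qed

lemma mem_germ_eq:
  assumes "(s, \<phi>) \<in> pre_germs S"
  shows "(t, \<psi>) \<in> germ S s \<phi> \<longleftrightarrow> \<psi> = \<phi> \<and> (t, \<phi>) \<in> pre_germs S \<and> germ S t \<phi> = germ S s \<phi>"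
proof (cases "\<psi> = \<phi> \<and> (t, \<phi>) \<in> pre_germs S")
  case True
  then have "(t, \<psi>) \<in> germ S s \<phi> \<longleftrightarrow> (\<exists>e \<in> projs S. \<phi> e \<and> s \<odot> e = t \<odot> e)"
    using assms by (simp add: mem_germ germ_rel_iff)
  also have "\<dots> \<longleftrightarrow> germ S s \<phi> = germ S t \<phi>" using germ_eq_iff [OF assms] True by blast
  finally show ?thesis using True by auto
qed (auto simp: mem_germ germ_rel_iff)

lemma pre_germs_restrict:
  assumes "(s, \<phi>) \<in> pre_germs S" "e \<in> projs S" "\<phi> e"
  shows "(s \<odot> e, \<phi>) \<in> pre_germs S" and "germ S (s \<odot> e) \<phi> = germ S s \<phi>"
proof -
  show *: "(s \<odot> e, \<phi>) \<in> pre_germs S"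
    using assms by (simp add: pre_germs_iff star_mult_proj char_mult)
  show "germ S (s \<odot> e) \<phi> = germ S s \<phi>"
    using assms by (subst germ_eq_iff [OF *]) (auto simp: mult_assoc pre_germs_iff intro!: bexI [of _ e])
qed

lemma pre_germs_le:
  assumes "u \<preceq> s" "(u, \<phi>) \<in> pre_germs S" "s \<in> carrier S"
  shows "(s, \<phi>) \<in> pre_germs S" "germ S s \<phi> = germ S u \<phi>"
proof -
  show *: "(s, \<phi>) \<in> pre_germs S"
    using assms char_le_star by (auto simp: pre_germs_iff)
  show "germ S s \<phi> = germ S u \<phi>"
    using pre_germs_restrict(2) [OF *, of "u\<^sup>\<star>"] assms by (simp add: pre_germs_iff nle_eqD)
qed

lemma Theta_iff: "g \<in> Theta S s \<longleftrightarrow> (\<exists>\<phi>. (s, \<phi>) \<in> pre_germs S \<and> g = germ S s \<phi>)"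
  by (auto simp: Theta_def)

lemma germ_in_Theta:
  assumes "(s, \<phi>) \<in> pre_germs S"
  shows "germ S s \<phi> \<in> Theta S t \<longleftrightarrow> (t, \<phi>) \<in> pre_germs S \<and> germ S s \<phi> = germ S t \<phi>"
  using assms germ_eq_iff [OF assms] unfolding Theta_iff by metis

lemma Theta_mono: "\<lbrakk>u \<preceq> s; s \<in> carrier S\<rbrakk> \<Longrightarrow> Theta S u \<subseteq> Theta S s"
  using pre_germs_le by (fastforce simp: Theta_iff)

lemma Theta_zero: "Theta S (zero_of S) = {}"
  by (auto simp: Theta_iff pre_germs_iff char_zero)

lemma Theta_fin_join:
  assumes "finite X" "is_join S X j"
  shows "Theta S j = (\<Union>x \<in> X. Theta S x)"
proof
  note j = is_joinD [OF assms(2)]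
  show "(\<Union>x \<in> X. Theta S x) \<subseteq> Theta S j" using Theta_mono j by blast
  show "Theta S j \<subseteq> (\<Union>x \<in> X. Theta S x)"
  proof
    fix g assume "g \<in> Theta S j"
    then obtain \<phi> where \<phi>: "(j, \<phi>) \<in> pre_germs S" "g = germ S j \<phi>" by (auto simp: Theta_iff)
    then obtain x where x: "x \<in> X" "\<phi> (x\<^sup>\<star>)"
      using char_fin_join [OF assms] by (auto simp: pre_germs_iff)
    then have "(x, \<phi>) \<in> pre_germs S" using \<phi> j(1) by (auto simp: pre_germs_iff)
    moreover have "germ S j \<phi> = germ S x \<phi>" by (rule pre_germs_le) (use calculation x j in auto)
    ultimately show "g \<in> (\<Union>x \<in> X. Theta S x)" using x \<phi> by (auto simp: Theta_iff)
  qed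
qed

lemma germ_cat_sel:
  "obj GS = CT"
  "arr GS = topology_generated_by (Theta S ` carrier S)"
  by (simp_all add: germ_cat_def)

lemma objs_germ_cat [simp]: "objs GS = prime_chars S"
  unfolding germ_cat_sel by (rule topspace_CT)

lemma arrs_germ_iff: "g \<in> arrs GS \<longleftrightarrow> (\<exists>s \<phi>. (s, \<phi>) \<in> pre_germs S \<and> g = germ S s \<phi>)"
  by (auto simp: germ_cat_sel Theta_iff pre_germs_iff)

lemma germ_arr [simp, intro]: "(s, \<phi>) \<in> pre_germs S \<Longrightarrow> germ S s \<phi> \<in> arrs GS"
  by (auto simp: arrs_germ_iff)

lemma src_germ [simp]: "(s, \<phi>) \<in> pre_germs S \<Longrightarrow> src GS (germ S s \<phi>) = \<phi>"
  by (auto simp: germ_cat_def mem_germ_eq intro!: the_elem_eqI)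

lemma char_act_apply: "e \<in> projs S \<Longrightarrow> char_act S s \<phi> e = \<phi> ((e \<odot> s)\<^sup>\<star>)"
  by (simp add: char_act_def)

lemma char_act_ext: "char_act S s \<phi> \<in> extensional (projs S)"
  by (simp add: char_act_def)

text \<open>\<open>(g \<odot> s \<odot> e)\<^sup>\<star>\<close> is
  \<open>(g \<odot> s)\<^sup>\<star> \<odot> e\<close>, and \<phi> is 1 at \<open>e\<close>.\<close>

lemma char_act_restrict:
  assumes "s \<in> carrier S" "\<phi> \<in> prime_chars S" "e \<in> projs S" "\<phi> e"
  shows "char_act S (s \<odot> e) \<phi> = char_act S s \<phi>"
proof -
  have "\<phi> ((g \<odot> (s \<odot> e))\<^sup>\<star>) = \<phi> ((g \<odot> s)\<^sup>\<star>)" if "g \<in> projs S" for g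
  proof -
    have "(g \<odot> (s \<odot> e))\<^sup>\<star> = (g \<odot> s)\<^sup>\<star> \<odot> e"
      using assms that by (metis mult_assoc mult_closed' projs_closed star_mult_proj)
    then show ?thesis using assms that by (simp add: char_mult)
  qed
  then show ?thesis by (intro extensionalityI [OF char_act_ext char_act_ext]) (simp add: char_act_apply)
qed

text \<open>This is the identity \<open>(xy)* = (x* y)*\<close> with \<open>x = es\<close> and
  \<open>y = t\<close>.\<close>

lemma char_act_mult:
  assumes "s \<in> carrier S" "t \<in> carrier S"
  shows "char_act S (s \<odot> t) \<phi> = char_act S s (char_act S t \<phi>)"
proof -
  have "\<phi> ((e \<odot> (s \<odot> t))\<^sup>\<star>) = char_act S t \<phi> ((e \<odot> s)\<^sup>\<star>)" if "e \<in> projs S" for e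
    using assms that by (simp add: char_act_apply flip: mult_assoc star_mult)
  then show ?thesis by (intro extensionalityI [OF char_act_ext char_act_ext]) (simp add: char_act_apply)
qed

lemma char_act_cong:
  assumes "(s, \<phi>) \<in> pre_germs S" "(t, \<phi>) \<in> pre_germs S" "germ S s \<phi> = germ S t \<phi>"
  shows "char_act S s \<phi> = char_act S t \<phi>"
proof -
  obtain e where e: "e \<in> projs S" "\<phi> e" "s \<odot> e = t \<odot> e"
    using assms germ_eq_iff [OF assms(1,2)] by blast
  then show ?thesis
    using assms char_act_restrict [of s \<phi> e] char_act_restrict [of t \<phi> e]
    by (simp add: pre_germs_iff)
qed

lemma tgt_germ [simp]: "(s, \<phi>) \<in> pre_germs S \<Longrightarrow> tgt GS (germ S s \<phi>) = char_act S s \<phi>"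
proof -
  assume s: "(s, \<phi>) \<in> pre_germs S"
  have "the_elem {char_act S t \<psi> |t \<psi>. (t, \<psi>) \<in> germ S s \<phi>} = char_act S s \<phi>"
  proof (rule the_elem_eqI)
    show "char_act S s \<phi> \<in> {char_act S t \<psi> |t \<psi>. (t, \<psi>) \<in> germ S s \<phi>}" using germ_self [OF s] by blast
    fix y assume "y \<in> {char_act S t \<psi> |t \<psi>. (t, \<psi>) \<in> germ S s \<phi>}"
    then obtain t \<psi> where t: "y = char_act S t \<psi>" "(t, \<psi>) \<in> germ S s \<phi>" by blast
    then have "\<psi> = \<phi>" "(t, \<phi>) \<in> pre_germs S" "germ S t \<phi> = germ S s \<phi>"
      by (simp_all add: mem_germ_eq [OF s])
    then show "y = char_act S s \<phi>" using t char_act_cong [of t \<phi> s] s by simp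
  qed
  then show ?thesis by (simp add: germ_cat_def)
qed

lemma char_act_proj: "\<lbrakk>e \<in> projs S; \<phi> \<in> prime_chars S; \<phi> e\<rbrakk> \<Longrightarrow> char_act S e \<phi> = \<phi>"
  by (rule extensionalityI [of _ "projs S"]) (auto simp: char_act_def char_mult char_ext)

lemma pre_germs_proj: "e \<in> projs S \<Longrightarrow> (e, \<phi>) \<in> pre_germs S \<longleftrightarrow> \<phi> \<in> prime_chars S \<and> \<phi> e"
  by (auto simp: pre_germs_iff)

text \<open>Any two projections in the support of \<phi> coincide on their product, so the identity
  does not depend on the one chosen.\<close>

lemma idt_germ:
  assumes "e \<in> projs S" "\<phi> \<in> prime_chars S" "\<phi> e"
  shows "idt GS \<phi> = germ S e \<phi>"
proof -
  have "germ S g \<phi> = germ S e \<phi>" if "g \<in> projs S" "\<phi> g" for g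
    using assms that
    by (subst germ_eq_iff)
      (auto simp: pre_germs_proj char_mult mult_assoc intro!: bexI [of _ "g \<odot> e"],
        metis mult_assoc proj_commute proj_idem projs_closed)
  then have "the_elem {germ S g \<phi> |g. g \<in> projs S \<and> \<phi> g} = germ S e \<phi>"
    using assms by (intro the_elem_eqI) blast+
  then show ?thesis by (simp add: germ_cat_def)
qed

lemma pre_germs_mult:
  assumes "(s, char_act S t \<psi>) \<in> pre_germs S" "(t, \<psi>) \<in> pre_germs S"
  shows "(s \<odot> t, \<psi>) \<in> pre_germs S"
proof -
  have c: "s \<in> carrier S" "t \<in> carrier S" "\<psi> \<in> prime_chars S" "char_act S t \<psi> (s\<^sup>\<star>)"
    using assms by (auto simp: pre_germs_iff)
  then have "\<psi> ((s\<^sup>\<star> \<odot> t)\<^sup>\<star>)" by (simp add: char_act_apply)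
  then show ?thesis using c star_mult [of s t] by (simp add: pre_germs_iff)
qed

text \<open>The projection \<open>e\<close> on which \<open>s\<close> and \<open>s'\<close> agree
  stands between the factors. The ample law moves it past \<open>t\<close>, where it becomes
  \<open>h = (e \<odot> t)\<^sup>\<star>\<close>; that \<psi> is 1 at \<open>h\<close> says that
  \<open>e\<close> lies in the support of \<open>char_act S t \<psi>\<close>. On
  \<open>g \<odot> h\<close> the two products agree.\<close>

lemma germ_mult_cong:
  assumes s: "(s, char_act S t \<psi>) \<in> pre_germs S" and t: "(t, \<psi>) \<in> pre_germs S"
    and s': "(s', char_act S t \<psi>) \<in> pre_germs S" and t': "(t', \<psi>) \<in> pre_germs S"
    and eq: "germ S s (char_act S t \<psi>) = germ S s' (char_act S t \<psi>)" "germ S t \<psi> = germ S t' \<psi>"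
  shows "germ S (s \<odot> t) \<psi> = germ S (s' \<odot> t') \<psi>"
proof -
  obtain e where e: "e \<in> projs S" "char_act S t \<psi> e" "s \<odot> e = s' \<odot> e"
    using eq(1) germ_eq_iff [OF s s'] by blast
  obtain g where g: "g \<in> projs S" "\<psi> g" "t \<odot> g = t' \<odot> g"
    using eq(2) germ_eq_iff [OF t t'] by blast
  have c: "s \<in> carrier S" "t \<in> carrier S" "s' \<in> carrier S" "t' \<in> carrier S" "\<psi> \<in> prime_chars S"
    "e \<in> carrier S" "g \<in> carrier S"
    using assms e g by (auto simp: pre_germs_iff)
  define h where "h = (e \<odot> t)\<^sup>\<star>"
  have h: "h \<in> projs S" "h \<in> carrier S" "\<psi> h" using e c by (auto simp: char_act_apply h_def)
  have et: "t \<odot> h = e \<odot> t" using proj_move [of e t] e c by (simp add: h_def)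
  have gh: "g \<odot> h = h \<odot> g" using g h proj_commute by simp
  have "(s \<odot> t) \<odot> (g \<odot> h) = s \<odot> (t \<odot> h) \<odot> g"
    unfolding gh using c h by (simp add: mult_assoc)
  also have "\<dots> = (s \<odot> e) \<odot> (t \<odot> g)" unfolding et using c by (simp add: mult_assoc)
  also have "\<dots> = s' \<odot> (e \<odot> t) \<odot> g" unfolding e(3) using c by (simp add: mult_assoc)
  also have "\<dots> = s' \<odot> (t \<odot> (g \<odot> h))" unfolding et [symmetric] gh using c h by (simp add: mult_assoc)
  also have "\<dots> = s' \<odot> ((t \<odot> g) \<odot> h)" using c h by (simp add: mult_assoc)
  also have "\<dots> = (s' \<odot> t') \<odot> (g \<odot> h)" unfolding g(3) using c h by (simp add: mult_assoc)
  finally have main: "(s \<odot> t) \<odot> (g \<odot> h) = (s' \<odot> t') \<odot> (g \<odot> h)" .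
  have "(s', char_act S t' \<psi>) \<in> pre_germs S"
    using char_act_cong [OF t t' eq(2)] s' by simp
  then have "(s' \<odot> t', \<psi>) \<in> pre_germs S" using t' by (rule pre_germs_mult)
  then show ?thesis
    using main g h c by (subst germ_eq_iff [OF pre_germs_mult [OF s t]])
      (auto simp: char_mult intro!: bexI [of _ "g \<odot> h"])
qed

lemma cmp_germ:
  assumes s: "(s, char_act S t \<psi>) \<in> pre_germs S" and t: "(t, \<psi>) \<in> pre_germs S"
  shows "cmp GS (germ S s (char_act S t \<psi>), germ S t \<psi>) = germ S (s \<odot> t) \<psi>"
proof -
  have "germ S (s' \<odot> t') \<psi>' = germ S (s \<odot> t) \<psi>"
    if "(s', char_act S t' \<psi>') \<in> germ S s (char_act S t \<psi>)" "(t', \<psi>') \<in> germ S t \<psi>" for s' t' \<psi>'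
    using that germ_mult_cong [OF s t, of s' t'] by (auto simp: mem_germ_eq s t)
  then have "the_elem {germ S (s' \<odot> t') \<psi>' |s' t' \<psi>'. (s', char_act S t' \<psi>') \<in> germ S s (char_act S t \<psi>)
      \<and> (t', \<psi>') \<in> germ S t \<psi>} = germ S (s \<odot> t) \<psi>"
    using germ_self [OF s] germ_self [OF t] by (intro the_elem_eqI) blast+
  then show ?thesis by (simp add: germ_cat_def)
qed

lemma cmp_pairs_germ:
  assumes "(g, h) \<in> cmp_pairs GS"
  obtains s t \<psi> where "(s, char_act S t \<psi>) \<in> pre_germs S" "(t, \<psi>) \<in> pre_germs S"
    "g = germ S s (char_act S t \<psi>)" "h = germ S t \<psi>"
  using assms by (auto simp: cmp_pairs_def arrs_germ_iff)

text \<open>The sets \<open>Theta\<close> form a basis: a germ common to \<open>Theta S s\<close>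
  and \<open>Theta S t\<close> lies in \<open>Theta S (s \<odot> e)\<close> for a projection
  \<open>e\<close> on which \<open>s\<close> and \<open>t\<close> agree.\<close>

lemma openin_arr_germ_iff:
  "openin (arr GS) U \<longleftrightarrow> (\<forall>g \<in> U. \<exists>s \<in> carrier S. g \<in> Theta S s \<and> Theta S s \<subseteq> U)"
  unfolding germ_cat_sel
proof (subst openin_generated_basis)
  fix A B g assume "A \<in> Theta S ` carrier S" "B \<in> Theta S ` carrier S" "g \<in> A" "g \<in> B"
  then obtain s t where st: "s \<in> carrier S" "t \<in> carrier S" "A = Theta S s" "B = Theta S t"
    "g \<in> Theta S s" "g \<in> Theta S t" by blast
  then obtain \<phi> where \<phi>s: "(s, \<phi>) \<in> pre_germs S" "g = germ S s \<phi>" unfolding Theta_iff by blast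
  with st have \<phi>: "(s, \<phi>) \<in> pre_germs S" "(t, \<phi>) \<in> pre_germs S" "g = germ S s \<phi>" "g = germ S t \<phi>"
    using germ_in_Theta [OF \<phi>s(1), of t] by auto
  then obtain e where e: "e \<in> projs S" "\<phi> e" "s \<odot> e = t \<odot> e" using germ_eq_iff by metis
  have "Theta S (s \<odot> e) \<subseteq> A"
    unfolding st(3) by (rule Theta_mono [OF nleI]) (use st e in auto)
  moreover have "Theta S (s \<odot> e) \<subseteq> B"
    unfolding e(3) st(4) using st e by (intro Theta_mono [OF nleI])
  moreover have "g \<in> Theta S (s \<odot> e)"
    using pre_germs_restrict [OF \<phi>(1) e(1,2)] \<phi> by (auto simp: Theta_iff)
  ultimately show "\<exists>D \<in> Theta S ` carrier S. g \<in> D \<and> D \<subseteq> A \<inter> B"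
    using st e by (intro bexI [of _ "Theta S (s \<odot> e)"] conjI imageI) auto
qed auto

lemma openin_Theta [simp, intro]: "s \<in> carrier S \<Longrightarrow> openin (arr GS) (Theta S s)"
  by (auto simp: openin_arr_germ_iff)

lemma src_Theta: "s \<in> carrier S \<Longrightarrow> src GS ` Theta S s = char_basic S (s\<^sup>\<star>)"
  by (force simp: Theta_iff pre_germs_iff image_iff)

lemma inj_src_Theta: "inj_on (src GS) (Theta S s)"
  by (auto simp: inj_on_def Theta_iff)

text \<open>This map is the section of the source map with image \<open>Theta S s\<close>.
  Compactness of \<open>Theta S s\<close> is transported along it from
  \<open>char_basic S (s\<^sup>\<star>)\<close>.\<close>

lemma continuous_germ:
  assumes s: "s \<in> carrier S"
  shows "continuous_map (subtopology CT (char_basic S (s\<^sup>\<star>))) (arr GS) (germ S s)"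
  unfolding germ_cat_sel(2)
proof (rule continuous_on_generated_topo)
  fix U assume "U \<in> Theta S ` carrier S"
  then obtain t where t: "t \<in> carrier S" "U = Theta S t" by blast
  let ?X = "subtopology CT (char_basic S (s\<^sup>\<star>))"
  show "openin ?X (germ S s -` U \<inter> topspace ?X)"
  proof (subst openin_subopen, intro ballI)
    fix \<phi> assume "\<phi> \<in> germ S s -` U \<inter> topspace ?X"
    then have \<phi>: "germ S s \<phi> \<in> Theta S t" "(s, \<phi>) \<in> pre_germs S"
      using t s by (auto simp: pre_germs_iff)
    then have \<phi>t: "(t, \<phi>) \<in> pre_germs S" "germ S s \<phi> = germ S t \<phi>" by (auto simp: germ_in_Theta)
    then obtain e where e: "e \<in> projs S" "\<phi> e" "s \<odot> e = t \<odot> e" using germ_eq_iff [OF \<phi>(2)] by blast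
    \<comment> \<open>On this set \<open>s\<close> and \<open>t\<close> both have germs, and these
      agree because \<open>s\<close> and \<open>t\<close> agree after restriction by
      \<open>e\<close>.\<close>
    let ?T = "char_basic S (s\<^sup>\<star>) \<inter> char_basic S (e \<odot> t\<^sup>\<star>)"
    have "?T \<subseteq> germ S s -` U \<inter> topspace ?X"
    proof
      fix \<psi> assume "\<psi> \<in> ?T"
      then have \<psi>: "(s, \<psi>) \<in> pre_germs S" "(t, \<psi>) \<in> pre_germs S" "\<psi> e"
        using s t e by (auto simp: pre_germs_iff char_mult)
      then show "\<psi> \<in> germ S s -` U \<inter> topspace ?X"
        using s e t germ_eq_iff [OF \<psi>(1,2)] \<psi> by (auto simp: germ_in_Theta pre_germs_iff)
    qed
    moreover have "openin ?X ?T"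
      using t e by (intro openin_subtopology_Int2 openin_char_basic) auto
    moreover have "\<phi> \<in> ?T"
      using \<phi> \<phi>t e by (auto simp: pre_germs_iff char_mult)
    ultimately show "\<exists>T. openin ?X T \<and> \<phi> \<in> T \<and> T \<subseteq> germ S s -` U \<inter> topspace ?X" by blast
  qed
next
  show "germ S s ` topspace (subtopology CT (char_basic S (s\<^sup>\<star>))) \<subseteq> \<Union> (Theta S ` carrier S)"
  proof (intro image_subsetI)
    fix \<phi> assume "\<phi> \<in> topspace (subtopology CT (char_basic S (s\<^sup>\<star>)))"
    then have "germ S s \<phi> \<in> Theta S s" using s by (auto simp: Theta_iff pre_germs_iff)
    then show "germ S s \<phi> \<in> \<Union> (Theta S ` carrier S)" using s by blast
  qed
qed

lemma compactin_Theta [simp, intro]: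
  assumes "s \<in> carrier S" shows "compactin (arr GS) (Theta S s)"
proof -
  have "compactin (subtopology CT (char_basic S (s\<^sup>\<star>))) (char_basic S (s\<^sup>\<star>))"
    using assms by (auto simp: compactin_subtopology)
  then have "compactin (arr GS) (germ S s ` char_basic S (s\<^sup>\<star>))"
    using image_compactin continuous_germ [OF assms] by blast
  moreover have "germ S s ` char_basic S (s\<^sup>\<star>) = Theta S s"
    using assms by (auto simp: Theta_iff pre_germs_iff)
  ultimately show ?thesis by simp
qed

lemma Theta_compact_slice: "s \<in> carrier S \<Longrightarrow> Theta S s \<in> compact_slices GS"
  by (simp add: compact_slices_def slice_def inj_src_Theta)

end

section \<open>The category of germs is ample\<close>

context preBoolean_lu
begin

text \<open>Multiplicativity comes from moving both projections past \<open>s\<close> with the ample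
  law, preservation of joins from \<open>BR3\<close> together with \<open>star_is_join\<close>. A
  local unit of \<open>s\<close> shows that the character is not zero.\<close>

lemma char_act_closed:
  assumes "(s, \<phi>) \<in> pre_germs S"
  shows "char_act S s \<phi> \<in> prime_chars S"
  unfolding prime_chars_iff
proof (intro conjI ballI)
  have s: "s \<in> carrier S" "\<phi> \<in> prime_chars S" "\<phi> (s\<^sup>\<star>)" using assms by (auto simp: pre_germs_iff)
  show "char_act S s \<phi> \<in> extensional (projs S)" by (simp add: char_act_def)
  show "\<not> char_act S s \<phi> (zero_of S)" using s by (simp add: char_act_apply char_zero)
  obtain e where "e \<in> projs S" "e \<odot> s = s" using local_units s by blast
  then show "\<exists>e \<in> projs S. char_act S s \<phi> e" using s by (intro bexI [of _ e]) (auto simp: char_act_apply)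
  fix e g assume eg: "e \<in> projs S" "g \<in> projs S"
  have "(e \<odot> g) \<odot> s = s \<odot> ((g \<odot> s)\<^sup>\<star> \<odot> (e \<odot> s)\<^sup>\<star>)"
  proof -
    have "(e \<odot> g) \<odot> s = e \<odot> (s \<odot> (g \<odot> s)\<^sup>\<star>)"
      using eg s(1) proj_move [of g s] by (simp add: mult_assoc)
    also have "\<dots> = (s \<odot> (e \<odot> s)\<^sup>\<star>) \<odot> (g \<odot> s)\<^sup>\<star>"
      using eg s(1) proj_move [of e s] by (simp flip: mult_assoc)
    also have "\<dots> = s \<odot> ((g \<odot> s)\<^sup>\<star> \<odot> (e \<odot> s)\<^sup>\<star>)"
      using eg s(1) proj_commute [of "(e \<odot> s)\<^sup>\<star>" "(g \<odot> s)\<^sup>\<star>"] by (simp add: mult_assoc)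
    finally show ?thesis .
  qed
  then have "((e \<odot> g) \<odot> s)\<^sup>\<star> = s\<^sup>\<star> \<odot> ((g \<odot> s)\<^sup>\<star> \<odot> (e \<odot> s)\<^sup>\<star>)"
    using eg s(1) star_mult_proj by simp
  then show "char_act S s \<phi> (e \<odot> g) = (char_act S s \<phi> e \<and> char_act S s \<phi> g)"
    using eg s by (auto simp: char_act_apply char_mult)
  have "is_join S {e \<odot> s, g \<odot> s} (jn S e g \<odot> s)"
    using BR3 [OF _ _ _ is_join_jn] eg s by auto
  then show "char_act S s \<phi> (jn S e g) = (char_act S s \<phi> e \<or> char_act S s \<phi> g)"
    using eg s star_is_join by (simp add: char_act_apply char_jn)
qed

lemma cmp_pairs_germI:
  assumes "(s, char_act S t \<psi>) \<in> pre_germs S" "(t, \<psi>) \<in> pre_germs S"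
  shows "(germ S s (char_act S t \<psi>), germ S t \<psi>) \<in> cmp_pairs GS"
  using assms by (auto simp: cmp_pairs_def)

text \<open>A germ of \<open>s \<odot> t\<close> at \<psi> splits into a product:
  \<open>(st)* = (s* t)*\<close> lies below \<open>t*\<close>, so \<open>t\<close> has a germ at
  \<psi>, and the same identity says that \<open>s\<close> has a germ at the range of that
  one.\<close>

lemma Theta_mult:
  assumes "s \<in> carrier S" "t \<in> carrier S"
  shows "cmp GS ` (Theta S s \<times> Theta S t \<inter> cmp_pairs GS) = Theta S (s \<odot> t)"
proof (intro equalityI subsetI)
  fix g assume "g \<in> cmp GS ` (Theta S s \<times> Theta S t \<inter> cmp_pairs GS)"
  then obtain \<phi> \<psi> where *: "(s, \<phi>) \<in> pre_germs S" "(t, \<psi>) \<in> pre_germs S"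
    "(germ S s \<phi>, germ S t \<psi>) \<in> cmp_pairs GS" "g = cmp GS (germ S s \<phi>, germ S t \<psi>)"
    by (auto simp: Theta_iff)
  then have "\<phi> = char_act S t \<psi>" by (simp add: cmp_pairs_def)
  then show "g \<in> Theta S (s \<odot> t)"
    using * cmp_germ [of s t \<psi>] pre_germs_mult [of s t \<psi>] by (auto simp: Theta_iff)
next
  fix g assume "g \<in> Theta S (s \<odot> t)"
  then obtain \<psi> where \<psi>: "(s \<odot> t, \<psi>) \<in> pre_germs S" "g = germ S (s \<odot> t) \<psi>" by (auto simp: Theta_iff)
  have "(s \<odot> t)\<^sup>\<star> \<preceq> t\<^sup>\<star>"
    using assms star_mono [OF proj_mult_le, of "s\<^sup>\<star>" t] star_mult [of s t] by simp
  then have t: "(t, \<psi>) \<in> pre_germs S"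
    using \<psi>(1) assms char_mono [of \<psi> "(s \<odot> t)\<^sup>\<star>" "t\<^sup>\<star>"] by (simp add: pre_germs_iff)
  then have s: "(s, char_act S t \<psi>) \<in> pre_germs S"
    using \<psi>(1) assms char_act_closed [OF t] star_mult [of s t]
    by (simp add: pre_germs_iff char_act_apply)
  have "g = cmp GS (germ S s (char_act S t \<psi>), germ S t \<psi>)"
    using cmp_germ [OF s t] \<psi> by simp
  then show "g \<in> cmp GS ` (Theta S s \<times> Theta S t \<inter> cmp_pairs GS)"
    using cmp_pairs_germI [OF s t] s t by (intro image_eqI) (auto simp: Theta_iff)
qed

lemma Theta_star:
  assumes "s \<in> carrier S"
  shows "idt GS ` src GS ` Theta S s = Theta S (s\<^sup>\<star>)"
proof -
  have "idt GS ` char_basic S (s\<^sup>\<star>) = germ S (s\<^sup>\<star>) ` char_basic S (s\<^sup>\<star>)"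
    using assms idt_germ [of "s\<^sup>\<star>"] by (intro image_cong) auto
  also have "\<dots> = Theta S (s\<^sup>\<star>)" using assms by (auto simp: Theta_iff pre_germs_proj)
  finally show ?thesis by (simp add: src_Theta assms)
qed

lemma src_germ_preimage:
  assumes "e \<in> projs S"
  shows "openin (arr GS) (src GS -` char_basic S e \<inter> arrs GS)"
  unfolding openin_arr_germ_iff
proof
  fix g assume "g \<in> src GS -` char_basic S e \<inter> arrs GS"
  then obtain s \<phi> where s: "(s, \<phi>) \<in> pre_germs S" "g = germ S s \<phi>" "\<phi> e"
    by (auto simp: arrs_germ_iff)
  then have "g \<in> Theta S (s \<odot> e)" using pre_germs_restrict [OF s(1) assms] by (auto simp: Theta_iff)
  moreover have "Theta S (s \<odot> e) \<subseteq> src GS -` char_basic S e \<inter> arrs GS"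
    using s assms by (auto simp: Theta_iff pre_germs_iff star_mult_proj char_mult)
  ultimately show "\<exists>s \<in> carrier S. g \<in> Theta S s
      \<and> Theta S s \<subseteq> src GS -` char_basic S e \<inter> arrs GS"
    using s assms by (intro bexI [of _ "s \<odot> e"]) (auto simp: pre_germs_iff)
qed

text \<open>Left multiplication by \<open>e\<close> cuts \<open>Theta S s\<close> down to germs with
  range in \<open>char_basic S e\<close>, as right multiplication does for sources.\<close>

lemma tgt_germ_preimage:
  assumes "e \<in> projs S"
  shows "openin (arr GS) (tgt GS -` char_basic S e \<inter> arrs GS)"
  unfolding openin_arr_germ_iff
proof
  fix g assume "g \<in> tgt GS -` char_basic S e \<inter> arrs GS"
  then obtain s \<phi> where s: "(s, \<phi>) \<in> pre_germs S" "g = germ S s \<phi>" "\<phi> ((e \<odot> s)\<^sup>\<star>)"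
    using assms by (auto simp: arrs_germ_iff char_act_apply)
  have sc: "s \<in> carrier S" using s by (simp add: pre_germs_iff)
  have "(e \<odot> s, \<phi>) \<in> pre_germs S" using s assms by (simp add: pre_germs_iff)
  then have "g \<in> Theta S (e \<odot> s)"
    using pre_germs_le(2) [OF proj_mult_le [OF assms sc] _ sc] s by (auto simp: Theta_iff)
  moreover have "Theta S (e \<odot> s) \<subseteq> tgt GS -` char_basic S e \<inter> arrs GS"
  proof
    fix h assume "h \<in> Theta S (e \<odot> s)"
    then obtain \<psi> where \<psi>: "(e \<odot> s, \<psi>) \<in> pre_germs S" "h = germ S (e \<odot> s) \<psi>" by (auto simp: Theta_iff)
    have "(e \<odot> (e \<odot> s))\<^sup>\<star> = (e \<odot> s)\<^sup>\<star>" using assms sc by (simp flip: mult_assoc)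
    then show "h \<in> tgt GS -` char_basic S e \<inter> arrs GS"
      using \<psi> assms char_act_closed [OF \<psi>(1)] by (auto simp: char_act_apply pre_germs_iff)
  qed
  ultimately show "\<exists>s \<in> carrier S. g \<in> Theta S s
      \<and> Theta S s \<subseteq> tgt GS -` char_basic S e \<inter> arrs GS"
    using sc assms by (intro bexI [of _ "e \<odot> s"]) auto
qed

lemma src_cont_germ: "continuous_map (arr GS) (obj GS) (src GS)"
  unfolding germ_cat_sel(1)
  by (rule continuous_on_generated_topo)
    (use src_germ_preimage char_nonzero in \<open>auto simp: arrs_germ_iff pre_germs_iff image_iff\<close>)

lemma tgt_cont_germ: "continuous_map (arr GS) (obj GS) (tgt GS)"
  unfolding germ_cat_sel(1)
proof (rule continuous_on_generated_topo)
  have "tgt GS ` arrs GS \<subseteq> topspace CT"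
    unfolding topspace_CT using char_act_closed by (auto simp: arrs_germ_iff)
  then show "tgt GS ` arrs GS \<subseteq> \<Union> (char_basic S ` projs S)" by simp
qed (use tgt_germ_preimage in auto)

lemma idt_cont_germ: "continuous_map (obj GS) (arr GS) (idt GS)"
  unfolding continuous_map_def
proof (intro conjI allI impI)
  have "idt GS \<phi> \<in> arrs GS" if \<phi>: "\<phi> \<in> prime_chars S" for \<phi>
  proof -
    obtain e where "e \<in> projs S" "\<phi> e" using char_nonzero \<phi> by blast
    then show ?thesis using idt_germ \<phi> by (simp add: pre_germs_proj)
  qed
  then show "idt GS \<in> objs GS \<rightarrow> arrs GS" by auto
  fix U assume U: "openin (arr GS) U"
  show "openin (obj GS) {\<phi> \<in> objs GS. idt GS \<phi> \<in> U}"
  proof (subst openin_subopen, intro ballI)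
    fix \<phi> assume "\<phi> \<in> {\<phi> \<in> objs GS. idt GS \<phi> \<in> U}"
    then have \<phi>: "\<phi> \<in> prime_chars S" "idt GS \<phi> \<in> U" by auto
    obtain e where e: "e \<in> projs S" "\<phi> e" using char_nonzero \<phi> by blast
    let ?T = "{\<psi> \<in> topspace (subtopology CT (char_basic S (e\<^sup>\<star>))). germ S e \<psi> \<in> U}"
    have "openin (subtopology CT (char_basic S (e\<^sup>\<star>))) ?T"
      using continuous_germ [of e] e U by (auto simp: continuous_map_def)
    then have "openin CT ?T" using e by (simp add: openin_open_subtopology)
    moreover have "\<phi> \<in> ?T" using \<phi> e idt_germ [OF e(1) \<phi>(1) e(2)] by auto
    moreover have "?T \<subseteq> {\<phi> \<in> objs GS. idt GS \<phi> \<in> U}"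
      using e idt_germ [OF e(1)] by auto
    ultimately show "\<exists>T. openin (obj GS) T \<and> \<phi> \<in> T
        \<and> T \<subseteq> {\<phi> \<in> objs GS. idt GS \<phi> \<in> U}"
      unfolding germ_cat_sel by blast
  qed
qed

lemma cmp_cont_germ:
  "continuous_map (subtopology (prod_topology (arr GS) (arr GS))
     (cmp_pairs GS)) (arr GS) (cmp GS)"
  (is "continuous_map ?X ?A ?m")
  unfolding continuous_map_def
proof (intro conjI allI impI)
  have top: "topspace ?X = cmp_pairs GS" by (auto simp: cmp_pairs_def)
  show "?m \<in> topspace ?X \<rightarrow> topspace ?A"
  proof
    fix p assume p: "p \<in> topspace ?X"
    obtain g h where gh: "p = (g, h)" "(g, h) \<in> cmp_pairs GS" using p top by (cases p) auto
    then show "?m p \<in> topspace ?A"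
      using pre_germs_mult by (auto elim!: cmp_pairs_germ simp: cmp_germ)
  qed
  fix U assume U: "openin ?A U"
  show "openin ?X {p \<in> topspace ?X. ?m p \<in> U}"
  proof (subst openin_subopen, intro ballI)
    fix p assume "p \<in> {p \<in> topspace ?X. ?m p \<in> U}"
    then obtain g h where gh: "p = (g, h)" "(g, h) \<in> cmp_pairs GS" "?m (g, h) \<in> U"
      using top by (cases p) auto
    obtain s t \<psi> where st: "(s, char_act S t \<psi>) \<in> pre_germs S" "(t, \<psi>) \<in> pre_germs S"
      "g = germ S s (char_act S t \<psi>)" "h = germ S t \<psi>"
      using cmp_pairs_germ [OF gh(2)] by blast
    then have "germ S (s \<odot> t) \<psi> \<in> U" using gh(3) cmp_germ by simp
    then obtain w where w: "w \<in> carrier S" "germ S (s \<odot> t) \<psi> \<in> Theta S w" "Theta S w \<subseteq> U"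
      using U openin_arr_germ_iff by blast
    note p1 = pre_germs_mult [OF st(1,2)]
    have w': "(w, \<psi>) \<in> pre_germs S" "germ S (s \<odot> t) \<psi> = germ S w \<psi>"
      using w(2) by (simp_all add: germ_in_Theta p1)
    obtain e where e: "e \<in> projs S" "\<psi> e" "(s \<odot> t) \<odot> e = w \<odot> e"
      using w'(2) unfolding germ_eq_iff [OF p1 w'(1)] by blast
    have c: "s \<in> carrier S" "t \<in> carrier S" using st by (auto simp: pre_germs_iff)
    have le: "s \<odot> (t \<odot> e) \<preceq> w" using nleI' [of "s \<odot> (t \<odot> e)" w e] e w c by (simp add: mult_assoc)
    \<comment> \<open>It suffices to shrink the second factor: products of these germs lie in
      \<open>Theta S (s \<odot> (t \<odot> e))\<close>, and \<open>s \<odot> (t \<odot> e)\<close>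
      is below \<open>w\<close>.\<close>
    let ?T = "cmp_pairs GS \<inter> Theta S s \<times> Theta S (t \<odot> e)"
    have "openin ?X ?T"
      using c e by (intro openin_subtopology_Int2) (auto simp: openin_prod_Times_iff)
    moreover have "p \<in> ?T"
      using gh st pre_germs_restrict [OF st(2) e(1,2)] by (auto simp: Theta_iff)
    moreover have "?T \<subseteq> {p \<in> topspace ?X. ?m p \<in> U}"
    proof
      fix q assume q: "q \<in> ?T"
      then have "?m q \<in> Theta S (s \<odot> (t \<odot> e))" using Theta_mult [of s "t \<odot> e"] c e by auto
      then have "?m q \<in> U" using Theta_mono [OF le w(1)] w(3) by blast
      then show "q \<in> {p \<in> topspace ?X. ?m p \<in> U}" using q top by auto
    qed
    ultimately show "\<exists>T. openin ?X T \<and> p \<in> T \<and> T \<subseteq> {p \<in> topspace ?X. ?m p \<in> U}" by blast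
  qed
qed

lemma topological_category_germ: "topological_category GS"
proof
  fix \<phi> assume "\<phi> \<in> objs GS"
  then obtain e where e: "e \<in> projs S" "\<phi> e" "\<phi> \<in> prime_chars S" using char_nonzero by auto
  then show "src GS (idt GS \<phi>) = \<phi>" "tgt GS (idt GS \<phi>) = \<phi>"
    by (simp_all add: idt_germ pre_germs_proj char_act_proj)
next
  fix g h assume gh: "(g, h) \<in> cmp_pairs GS"
  then show "src GS (cmp GS (g, h)) = src GS h"
    by (auto elim!: cmp_pairs_germ simp: cmp_germ pre_germs_mult)
  show "tgt GS (cmp GS (g, h)) = tgt GS g"
    using gh
  proof (rule cmp_pairs_germ)
    fix s t \<psi> assume st: "(s, char_act S t \<psi>) \<in> pre_germs S" "(t, \<psi>) \<in> pre_germs S"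
      "g = germ S s (char_act S t \<psi>)" "h = germ S t \<psi>"
    then have "s \<in> carrier S" "t \<in> carrier S" by (auto simp: pre_germs_iff)
    then show ?thesis using st pre_germs_mult [OF st(1,2)] by (simp add: cmp_germ char_act_mult)
  qed
next
  fix g assume "g \<in> arrs GS"
  then obtain s \<phi> where s: "(s, \<phi>) \<in> pre_germs S" "g = germ S s \<phi>" by (auto simp: arrs_germ_iff)
  then have c: "s \<in> carrier S" "\<phi> \<in> prime_chars S" "\<phi> (s\<^sup>\<star>)" by (auto simp: pre_germs_iff)
  have 1: "idt GS \<phi> = germ S (s\<^sup>\<star>) \<phi>" using c by (intro idt_germ) auto
  have 2: "char_act S (s\<^sup>\<star>) \<phi> = \<phi>" using c by (intro char_act_proj) auto
  show "cmp GS (g, idt GS (src GS g)) = g"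
    using cmp_germ [of s "s\<^sup>\<star>" \<phi>] s c by (simp add: 1 2 pre_germs_proj mult_star)
  \<comment> \<open>A local unit \<open>e\<close> of \<open>s\<close> represents the identity at the
    range of the germ: since \<open>e \<odot> s = s\<close>, the range character takes at
    \<open>e\<close> the value of \<phi> at the star of \<open>s\<close>, which is 1.\<close>
  obtain e where e: "e \<in> projs S" "e \<odot> s = s" using local_units c by blast
  then have 3: "char_act S s \<phi> e" using c by (simp add: char_act_apply)
  have "idt GS (char_act S s \<phi>) = germ S e (char_act S s \<phi>)"
    using e 3 char_act_closed [OF s(1)] by (intro idt_germ)
  then show "cmp GS (idt GS (tgt GS g), g) = g"
    using cmp_germ [of e s \<phi>] s e 3 char_act_closed [OF s(1)] by (simp add: pre_germs_proj)
next
  fix g h k assume gh: "(g, h) \<in> cmp_pairs GS" and hk: "(h, k) \<in> cmp_pairs GS"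
  obtain t w \<psi> where hk': "(t, char_act S w \<psi>) \<in> pre_germs S" "(w, \<psi>) \<in> pre_germs S"
    "h = germ S t (char_act S w \<psi>)" "k = germ S w \<psi>" using cmp_pairs_germ [OF hk] by blast
  obtain s \<phi> where s: "(s, \<phi>) \<in> pre_germs S" "g = germ S s \<phi>" "\<phi> = char_act S t (char_act S w \<psi>)"
  proof -
    have "g \<in> arrs GS" "src GS g = tgt GS h"
      using gh by (auto simp: cmp_pairs_def)
    then show ?thesis using that hk' unfolding arrs_germ_iff by auto
  qed
  have c: "s \<in> carrier S" "t \<in> carrier S" "w \<in> carrier S" using s hk' by (auto simp: pre_germs_iff)
  have tw: "char_act S (t \<odot> w) \<psi> = \<phi>" using s c char_act_mult by simp
  have "cmp GS (cmp GS (g, h), k) = germ S ((s \<odot> t) \<odot> w) \<psi>"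
    using cmp_germ [of s t "char_act S w \<psi>"] cmp_germ [of "s \<odot> t" w \<psi>] s hk'
      pre_germs_mult [of s t "char_act S w \<psi>"] by simp
  also have "\<dots> = germ S (s \<odot> (t \<odot> w)) \<psi>" using c mult_assoc by simp
  also have "\<dots> = cmp GS (g, cmp GS (h, k))"
    using cmp_germ [of t w \<psi>] cmp_germ [of s "t \<odot> w" \<psi>] s hk' pre_germs_mult [of t w \<psi>] tw by simp
  finally show "cmp GS (cmp GS (g, h), k) = cmp GS (g, cmp GS (h, k))" .
qed (rule idt_cont_germ src_cont_germ tgt_cont_germ cmp_cont_germ)+

lemma ample_germ: "ample_category GS"
proof (intro ample_category.intro etale_category.intro topological_category_germ
    etale_category_axioms.intro ample_category_axioms.intro)
  show "Hausdorff_space (obj GS)" unfolding germ_cat_sel by (rule Hausdorff_CT)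
  show "locally_compact_space (obj GS)"
    unfolding germ_cat_sel locally_compact_space_def
  proof
    fix \<phi> assume "\<phi> \<in> topspace CT"
    then obtain e where "e \<in> projs S" "\<phi> \<in> char_basic S e" using char_nonzero by auto
    then show "\<exists>U K. openin CT U \<and> compactin CT K \<and> \<phi> \<in> U \<and> U \<subseteq> K"
      by (intro exI [of _ "char_basic S e"]) auto
  qed
  have "open_map (arr GS) (obj GS) (src GS)"
    unfolding open_map_def
  proof (intro allI impI)
    fix U assume U: "openin (arr GS) U"
    show "openin (obj GS) (src GS ` U)"
    proof (subst openin_subopen, intro ballI)
      fix \<phi> assume "\<phi> \<in> src GS ` U"
      then obtain s where s: "s \<in> carrier S" "\<phi> \<in> src GS ` Theta S s" "Theta S s \<subseteq> U"
        using U unfolding openin_arr_germ_iff by blast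
      then show "\<exists>T. openin (obj GS) T \<and> \<phi> \<in> T \<and> T \<subseteq> src GS ` U"
        unfolding germ_cat_sel(1)
        by (intro exI [of _ "src GS ` Theta S s"] conjI image_mono)
          (simp_all add: src_Theta)
    qed
  qed
  then show "local_homeomorphism (arr GS) (obj GS) (src GS)"
  proof (rule local_homeomorphismI [OF src_cont_germ])
    fix g assume "g \<in> arrs GS"
    then obtain s where "s \<in> carrier S" "g \<in> Theta S s" by (auto simp: arrs_germ_iff Theta_iff pre_germs_iff)
    then show "\<exists>U. openin (arr GS) U \<and> g \<in> U \<and> inj_on (src GS) U"
      using inj_src_Theta by blast
  qed
  show "is_basis (arr GS) (compact_slices GS)"
    unfolding is_basis_iff
  proof (intro conjI ballI allI impI)
    show "openin (arr GS) A" if "A \<in> compact_slices GS" for A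
      using that by (simp add: compact_slices_def slice_def)
    fix U g assume "openin (arr GS) U \<and> g \<in> U"
    then show "\<exists>A \<in> compact_slices GS. g \<in> A \<and> A \<subseteq> U"
      unfolding openin_arr_germ_iff using Theta_compact_slice by blast
  qed
qed

end

section \<open>The semigroup of compact slices\<close>

lemma slice_sg_simps [simp]:
  "carrier (slice_sg C) = compact_slices C"
  "A \<odot>\<^bsub>slice_sg C\<^esub> B = cmp C ` (A \<times> B \<inter> cmp_pairs C)"
  "A\<^sup>\<star>\<^bsub>slice_sg C\<^esub> = idt C ` src C ` A"
  by (simp_all add: slice_sg_def)

section \<open>Products of sets of arrows\<close>

context topological_category
begin

lemma src_closed [simp, intro]: "a \<in> arrs C \<Longrightarrow> src C a \<in> objs C"
  using src_continuous by (auto simp: continuous_map_def)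

lemma tgt_closed [simp, intro]: "a \<in> arrs C \<Longrightarrow> tgt C a \<in> objs C"
  using tgt_continuous by (auto simp: continuous_map_def)

lemma idt_closed [simp, intro]: "x \<in> objs C \<Longrightarrow> idt C x \<in> arrs C"
  using idt_continuous by (auto simp: continuous_map_def)

lemma cmp_pairs_iff: "(a, b) \<in> cmp_pairs C \<longleftrightarrow> a \<in> arrs C \<and> b \<in> arrs C \<and> src C a = tgt C b"
  by (auto simp: cmp_pairs_def)

lemma cmp_closed [intro]: "(a, b) \<in> cmp_pairs C \<Longrightarrow> cmp C (a, b) \<in> arrs C"
  using cmp_continuous by (auto simp: continuous_map_def cmp_pairs_def)

lemma inj_on_idt: "inj_on (idt C) (objs C)"
  by (metis inj_onI src_idt)

lemma src_idt_image: "U \<subseteq> objs C \<Longrightarrow> src C ` idt C ` U = U"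
  by (auto simp: image_image src_idt subset_iff intro!: image_eqI)

lemma tgt_idt_image: "U \<subseteq> objs C \<Longrightarrow> tgt C ` idt C ` U = U"
  by (auto simp: image_image tgt_idt subset_iff intro!: image_eqI)

text \<open>The product of \<open>slice_sg C\<close> as a constant of its own, so that the
  simplifier does not unfold it. Its laws are proved for arbitrary sets of arrows, before openness
  and compactness enter.\<close>

definition sm :: "'a set \<Rightarrow> 'a set \<Rightarrow> 'a set" where
  "sm A B = cmp C ` (A \<times> B \<inter> cmp_pairs C)"

lemma mem_sm:
  assumes "A \<subseteq> arrs C" "B \<subseteq> arrs C"
  shows "c \<in> sm A B \<longleftrightarrow> (\<exists>a \<in> A. \<exists>b \<in> B. src C a = tgt C b \<and> c = cmp C (a, b))"
proof
  assume "c \<in> sm A B"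
  then show "\<exists>a \<in> A. \<exists>b \<in> B. src C a = tgt C b \<and> c = cmp C (a, b)"
  proof -
    obtain p where "p \<in> A \<times> B \<inter> cmp_pairs C" "c = cmp C p"
      using \<open>c \<in> sm A B\<close> unfolding sm_def by blast
    then show ?thesis by (cases p) (auto simp: cmp_pairs_iff)
  qed
next
  assume "\<exists>a \<in> A. \<exists>b \<in> B. src C a = tgt C b \<and> c = cmp C (a, b)"
  then obtain a b where ab: "a \<in> A" "b \<in> B" "src C a = tgt C b" "c = cmp C (a, b)" by blast
  then have "(a, b) \<in> A \<times> B \<inter> cmp_pairs C" using assms by (auto simp: cmp_pairs_iff)
  then show "c \<in> sm A B" unfolding sm_def ab(4) by (rule imageI)
qed

text \<open>Multiplying by identities restricts a set of arrows. Apart from associativity, the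
  axioms for \<open>slice_sg C\<close> reduce to this fact, its mirror image and the description of
  the sources of a product.\<close>

lemma sm_idt_right:
  assumes "A \<subseteq> arrs C" "U \<subseteq> objs C"
  shows "sm A (idt C ` U) = {a \<in> A. src C a \<in> U}"
proof -
  have U: "idt C ` U \<subseteq> arrs C" using assms by auto
  have *: "cmp C (a, idt C (src C a)) = a" if "a \<in> A" for a using assms that cmp_idt_right by blast
  show ?thesis
    unfolding set_eq_iff mem_sm [OF assms(1) U]
    using assms * by (auto simp: tgt_idt subset_iff)
qed

lemma sm_idt_left:
  assumes "A \<subseteq> arrs C" "U \<subseteq> objs C"
  shows "sm (idt C ` U) A = {a \<in> A. tgt C a \<in> U}"
proof -
  have U: "idt C ` U \<subseteq> arrs C" using assms by auto
  have *: "cmp C (idt C (tgt C a), a) = a" if "a \<in> A" for a using assms that cmp_idt_left by blast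
  show ?thesis
    unfolding set_eq_iff mem_sm [OF U assms(1)]
    using assms * by (auto simp: src_idt subset_iff) (metis src_idt)+
qed

lemma src_sm:
  assumes "A \<subseteq> arrs C" "B \<subseteq> arrs C"
  shows "src C ` sm A B = src C ` {b \<in> B. tgt C b \<in> src C ` A}"
proof -
  have "x \<in> src C ` sm A B \<longleftrightarrow> (\<exists>a \<in> A. \<exists>b \<in> B. src C a = tgt C b \<and> x = src C b)" for x
  proof -
    have "src C (cmp C (a, b)) = src C b" if "a \<in> A" "b \<in> B" "src C a = tgt C b" for a b
      using that assms src_cmp by (auto simp: cmp_pairs_iff)
    then show ?thesis unfolding image_iff Bex_def mem_sm [OF assms] by metis
  qed
  moreover have "x \<in> src C ` {b \<in> B. tgt C b \<in> src C ` A}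
      \<longleftrightarrow> (\<exists>a \<in> A. \<exists>b \<in> B. src C a = tgt C b \<and> x = src C b)" for x
    unfolding image_iff Bex_def mem_Collect_eq by metis
  ultimately show ?thesis unfolding set_eq_iff by simp
qed

lemma tgt_sm:
  assumes "A \<subseteq> arrs C" "B \<subseteq> arrs C"
  shows "tgt C ` sm A B = tgt C ` {a \<in> A. src C a \<in> tgt C ` B}"
proof -
  have "x \<in> tgt C ` sm A B \<longleftrightarrow> (\<exists>a \<in> A. \<exists>b \<in> B. src C a = tgt C b \<and> x = tgt C a)" for x
  proof -
    have "tgt C (cmp C (a, b)) = tgt C a" if "a \<in> A" "b \<in> B" "src C a = tgt C b" for a b
      using that assms tgt_cmp by (auto simp: cmp_pairs_iff)
    then show ?thesis unfolding image_iff Bex_def mem_sm [OF assms] by metis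
  qed
  moreover have "x \<in> tgt C ` {a \<in> A. src C a \<in> tgt C ` B}
      \<longleftrightarrow> (\<exists>a \<in> A. \<exists>b \<in> B. src C a = tgt C b \<and> x = tgt C a)" for x
    unfolding image_iff Bex_def mem_Collect_eq by metis
  ultimately show ?thesis unfolding set_eq_iff by simp
qed

lemma sm_subset: "\<lbrakk>A \<subseteq> arrs C; B \<subseteq> arrs C\<rbrakk> \<Longrightarrow> sm A B \<subseteq> arrs C"
  unfolding sm_def using cmp_closed by auto

lemma sm_assoc:
  assumes A: "A \<subseteq> arrs C" and B: "B \<subseteq> arrs C" and D: "D \<subseteq> arrs C"
  shows "sm (sm A B) D = sm A (sm B D)"
proof -
  have 1: "x \<in> sm (sm A B) D \<longleftrightarrow> (\<exists>a \<in> A. \<exists>b \<in> B. \<exists>c \<in> D. src C a = tgt C b \<and> src C b = tgt C c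
      \<and> x = cmp C (cmp C (a, b), c))" for x
  proof -
    have "src C (cmp C (a, b)) = src C b" if "a \<in> A" "b \<in> B" "src C a = tgt C b" for a b
      using that A B src_cmp by (auto simp: cmp_pairs_iff)
    then show ?thesis unfolding mem_sm [OF sm_subset [OF A B] D] Bex_def mem_sm [OF A B] by metis
  qed
  have 2: "x \<in> sm A (sm B D) \<longleftrightarrow> (\<exists>a \<in> A. \<exists>b \<in> B. \<exists>c \<in> D. src C a = tgt C b \<and> src C b = tgt C c
      \<and> x = cmp C (a, cmp C (b, c)))" for x
  proof -
    have "tgt C (cmp C (b, c)) = tgt C b" if "b \<in> B" "c \<in> D" "src C b = tgt C c" for b c
      using that B D tgt_cmp by (auto simp: cmp_pairs_iff)
    then show ?thesis unfolding mem_sm [OF A sm_subset [OF B D]] Bex_def mem_sm [OF B D] by metis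
  qed
  have "cmp C (cmp C (a, b), c) = cmp C (a, cmp C (b, c))"
    if "a \<in> A" "b \<in> B" "c \<in> D" "src C a = tgt C b" "src C b = tgt C c" for a b c
    using that A B D by (intro cmp_assoc) (auto simp: cmp_pairs_iff)
  then show ?thesis unfolding set_eq_iff 1 2 by metis
qed

end

section \<open>Compact slices form a preBoolean restriction semigroup\<close>

context etale_category
begin

abbreviation "KC \<equiv> slice_sg C"

lemma src_open: "open_map (arr C) (obj C) (src C)"
  by (rule local_homeomorphism_open_map) (rule src_local_homeo)

text \<open>A continuous section over an open set has open image, because it is locally inverse to
  the local homeomorphism \<open>src\<close>.\<close>

lemma section_image_open:
  assumes U: "openin (obj C) U" and \<sigma>: "continuous_map (subtopology (obj C) U) (arr C) \<sigma>"
    and sec: "\<And>x. x \<in> U \<Longrightarrow> src C (\<sigma> x) = x"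
  shows "openin (arr C) (\<sigma> ` U)"
proof (subst openin_subopen, intro ballI)
  fix a assume "a \<in> \<sigma> ` U"
  then obtain x where x: "x \<in> U" "a = \<sigma> x" by blast
  have UT: "topspace (subtopology (obj C) U) = U" using openin_subset [OF U] by auto
  have "a \<in> arrs C" using x \<sigma> UT by (auto simp: continuous_map_def)
  then obtain W where W: "openin (arr C) W" "a \<in> W" "inj_on (src C) W"
    by (rule local_homeomorphism_inj [OF src_local_homeo])
  \<comment> \<open>Over this set the section stays in \<open>W\<close>, where \<open>src C\<close>
    is injective. An arrow of \<open>W\<close> over a point of it must therefore be the value of the
    section at that point.\<close>
  let ?N = "{y \<in> U. \<sigma> y \<in> W}"
  have "openin (subtopology (obj C) U) ?N"
    using openin_continuous_map_preimage [OF \<sigma> W(1)] unfolding UT .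
  then have N: "openin (obj C) ?N" using U by (simp add: openin_open_subtopology)
  let ?T = "W \<inter> {b \<in> arrs C. src C b \<in> ?N}"
  have "openin (arr C) ?T"
    using openin_Int [OF W(1) openin_continuous_map_preimage [OF src_continuous N]] .
  moreover have "a \<in> ?T" using x W sec \<open>a \<in> arrs C\<close> by auto
  moreover have "?T \<subseteq> \<sigma> ` U"
  proof
    fix b assume b: "b \<in> ?T"
    then have "src C (\<sigma> (src C b)) = src C b" using sec by blast
    then have "\<sigma> (src C b) = b" using b W(3) by (auto simp: inj_on_def)
    moreover have "src C b \<in> U" using b by blast
    ultimately show "b \<in> \<sigma> ` U" by (metis image_eqI)
  qed
  ultimately show "\<exists>T. openin (arr C) T \<and> a \<in> T \<and> T \<subseteq> \<sigma> ` U" by blast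
qed

lemma slice_at_eq: "\<lbrakk>inj_on (src C) A; a \<in> A\<rbrakk> \<Longrightarrow> slice_at C A (src C a) = a"
  unfolding slice_at_def by (rule the_equality) (auto dest: inj_onD)

lemma slice_at_mem:
  assumes "inj_on (src C) A" "x \<in> src C ` A"
  shows "slice_at C A x \<in> A" "src C (slice_at C A x) = x"
  using assms slice_at_eq by auto

text \<open>The preimage of an open set \<open>V\<close> is the set of sources of the arrows in
  \<open>A \<inter> V\<close>, which is open because \<open>src C\<close> is an open map.\<close>

lemma slice_at_continuous:
  assumes "slice C A"
  shows "continuous_map (subtopology (obj C) (src C ` A)) (arr C) (slice_at C A)"
  unfolding continuous_map_def
proof (intro conjI allI impI)
  have A: "openin (arr C) A" "inj_on (src C) A" using assms by (auto simp: slice_def)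
  then have sub: "A \<subseteq> arrs C" by (simp add: openin_subset)
  have sA: "openin (obj C) (src C ` A)" using A src_open by (simp add: open_map_def)
  have top: "topspace (subtopology (obj C) (src C ` A)) = src C ` A"
    using openin_subset [OF sA] by auto
  show "slice_at C A \<in> topspace (subtopology (obj C) (src C ` A)) \<rightarrow> arrs C"
    unfolding top using slice_at_mem [OF A(2)] sub by blast
  fix V assume V: "openin (arr C) V"
  have "{x \<in> src C ` A. slice_at C A x \<in> V} = src C ` (A \<inter> V)"
    using slice_at_eq [OF A(2)] by auto
  moreover have "openin (obj C) (src C ` (A \<inter> V))"
    using A V src_open by (simp add: open_map_def openin_Int)
  ultimately show "openin (subtopology (obj C) (src C ` A))
      {x \<in> topspace (subtopology (obj C) (src C ` A)). slice_at C A x \<in> V}"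
    unfolding top using sA by (auto simp: openin_open_subtopology)
qed

text \<open>Compact open sets of objects correspond to the projections of \<open>slice_sg C\<close>.
  In a Hausdorff space they are also closed, hence stable under differences; the relative
  complements of projections come from this.\<close>

definition co :: "'b set \<Rightarrow> bool" where
  "co U \<longleftrightarrow> compactin (obj C) U \<and> openin (obj C) U"

lemma coD: "co U \<Longrightarrow> compactin (obj C) U" "co U \<Longrightarrow> openin (obj C) U" "co U \<Longrightarrow> U \<subseteq> objs C"
  "co U \<Longrightarrow> closedin (obj C) U"
  using obj_Hausdorff compactin_imp_closedin by (auto simp: co_def openin_subset)

lemma co_empty [simp]: "co {}" by (simp add: co_def)

lemma co_Un: "co U \<Longrightarrow> co V \<Longrightarrow> co (U \<union> V)" by (auto simp: co_def compactin_Un)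

lemma co_Int: "co U \<Longrightarrow> co V \<Longrightarrow> co (U \<inter> V)"
  using coD by (metis co_def compact_Int_closedin openin_Int)

lemma co_Diff: "co U \<Longrightarrow> co V \<Longrightarrow> co (U - V)"
proof -
  assume U: "co U" and V: "co V"
  have "closedin (obj C) (objs C - V)" using coD(2) [OF V] by blast
  then have "compactin (obj C) (U \<inter> (objs C - V))" using coD(1) [OF U] by (simp add: compact_Int_closedin)
  moreover have "U \<inter> (objs C - V) = U - V" using coD(3) [OF U] by blast
  moreover have "openin (obj C) (U - V)" using coD(2) [OF U] coD(4) [OF V] by (rule openin_diff)
  ultimately show ?thesis by (simp add: co_def)
qed

lemma compact_sliceD:
  assumes "A \<in> compact_slices C"
  shows "openin (arr C) A" "inj_on (src C) A" "compactin (arr C) A" "A \<subseteq> arrs C" "slice C A"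
  using assms by (auto simp: compact_slices_def slice_def openin_subset)

lemma compact_sliceI:
  "\<lbrakk>openin (arr C) A; inj_on (src C) A; compactin (arr C) A\<rbrakk> \<Longrightarrow> A \<in> compact_slices C"
  by (simp add: compact_slices_def slice_def)

lemma co_src: "A \<in> compact_slices C \<Longrightarrow> co (src C ` A)"
  using compact_sliceD src_open image_compactin [OF _ src_continuous]
  by (auto simp: co_def open_map_def)

text \<open>\<open>idt C\<close> is a continuous section of the local homeomorphism
  \<open>src C\<close>, so its image over an open set is open.\<close>

lemma idt_compact_slice:
  assumes "co U" shows "idt C ` U \<in> compact_slices C"
proof (rule compact_sliceI)
  show "openin (arr C) (idt C ` U)"
    using coD [OF assms] idt_continuous
    by (intro section_image_open) (auto simp: continuous_map_from_subtopology src_idt)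
  show "inj_on (src C) (idt C ` U)" using coD(3) [OF assms] by (auto simp: inj_on_def src_idt subset_iff)
  show "compactin (arr C) (idt C ` U)" using image_compactin idt_continuous coD(1) [OF assms] by blast
qed

lemma projs_slice_sg: "projs KC = {idt C ` U | U. co U}"
proof (intro equalityI subsetI)
  fix E assume "E \<in> projs KC"
  then show "E \<in> {idt C ` U | U. co U}" using co_src by (auto simp: projs_def)
next
  fix E assume "E \<in> {idt C ` U | U. co U}"
  then obtain U where U: "co U" "E = idt C ` U" by blast
  then have "E = (idt C ` U)\<^sup>\<star>\<^bsub>KC\<^esub>" by (simp add: src_idt_image coD)
  then show "E \<in> projs KC"
    using idt_compact_slice [OF U(1)] unfolding projs_def by auto
qed

lemma compact_slice_Union:
  assumes "finite X" "X \<subseteq> compact_slices C" "\<Union>X \<subseteq> W" "inj_on (src C) W"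
  shows "\<Union>X \<in> compact_slices C"
proof (rule compact_sliceI)
  show "openin (arr C) (\<Union>X)"
    by (intro openin_Union compact_sliceD(1)) (use assms in auto)
  show "inj_on (src C) (\<Union>X)" using assms(4,3) by (rule inj_on_subset)
  show "compactin (arr C) (\<Union>X)" using assms compact_sliceD by (intro compactin_Union) auto
qed

text \<open>The product is the image of a continuous section \<open>?\<sigma>\<close>: the object
  \<open>x\<close> is sent to the arrow of \<open>B\<close> over \<open>x\<close>, composed with the
  arrow of \<open>A\<close> over its range. The section is defined over \<open>?D\<close>, the
  sources of those arrows of \<open>B\<close> whose range is a source of \<open>A\<close>; this set
  is compact open, because the sources of \<open>A\<close> form an open and closed set.\<close>

lemma sm_compact_slice:
  assumes A: "A \<in> compact_slices C" and B: "B \<in> compact_slices C"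
  shows "sm A B \<in> compact_slices C"
proof -
  note a = compact_sliceD [OF A] and b = compact_sliceD [OF B]
  let ?B = "{b \<in> B. tgt C b \<in> src C ` A}"
  let ?D = "src C ` ?B"
  let ?\<sigma> = "\<lambda>x. cmp C (slice_at C A (tgt C (slice_at C B x)), slice_at C B x)"
  have eq: "?B = B \<inter> {b \<in> arrs C. tgt C b \<in> src C ` A}" using b(4) by auto
  have Bo: "openin (arr C) ?B"
    unfolding eq using b(1) openin_continuous_map_preimage [OF tgt_continuous coD(2) [OF co_src [OF A]]]
    by (rule openin_Int)
  have Bc: "compactin (arr C) ?B"
    unfolding eq using b(3) closedin_continuous_map_preimage [OF tgt_continuous coD(4) [OF co_src [OF A]]]
    by (rule compact_Int_closedin)
  have D: "co ?D"
    using Bo Bc src_open image_compactin [OF Bc src_continuous] by (simp add: co_def open_map_def)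
  have Dsub: "?D \<subseteq> src C ` B" by blast
  have topD: "topspace (subtopology (obj C) ?D) = ?D" using coD(3) [OF D] by auto
  have at: "slice_at C B x \<in> ?B" "src C (slice_at C B x) = x" if "x \<in> ?D" for x
    using that slice_at_eq [OF b(2)] by auto
  have 1: "continuous_map (subtopology (obj C) ?D) (arr C) (slice_at C B)"
    using continuous_map_from_subtopology_mono [OF slice_at_continuous [OF b(5)] Dsub] .
  have 2: "continuous_map (subtopology (obj C) ?D) (subtopology (obj C) (src C ` A))
      (\<lambda>x. tgt C (slice_at C B x))"
    using continuous_map_compose [OF 1 tgt_continuous] at topD
    by (auto simp: continuous_map_in_subtopology o_def)
  have 3: "continuous_map (subtopology (obj C) ?D) (arr C) (\<lambda>x. slice_at C A (tgt C (slice_at C B x)))"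
    using continuous_map_compose [OF 2 slice_at_continuous [OF a(5)]] by (simp add: o_def)
  have pair: "(slice_at C A (tgt C (slice_at C B x)), slice_at C B x) \<in> cmp_pairs C" if "x \<in> ?D" for x
    using at [OF that] slice_at_mem [OF a(2)] a(4) b(4) by (auto simp: cmp_pairs_iff)
  have 4: "continuous_map (subtopology (obj C) ?D) (subtopology (prod_topology (arr C) (arr C)) (cmp_pairs C))
      (\<lambda>x. (slice_at C A (tgt C (slice_at C B x)), slice_at C B x))"
    using 1 3 pair topD by (auto simp: continuous_map_in_subtopology continuous_map_pairwise o_def)
  have 5: "continuous_map (subtopology (obj C) ?D) (arr C) ?\<sigma>"
    using continuous_map_compose [OF 4 cmp_continuous] by (simp add: o_def)
  have src: "src C (?\<sigma> x) = x" if "x \<in> ?D" for x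
    using src_cmp [OF pair [OF that]] at [OF that] by simp
  have img: "?\<sigma> ` ?D = sm A B"
  proof (intro equalityI subsetI)
    fix c assume "c \<in> ?\<sigma> ` ?D"
    then obtain x where x: "x \<in> ?D" "c = ?\<sigma> x" by (rule imageE) blast
    then show "c \<in> sm A B"
      unfolding mem_sm [OF a(4) b(4)] using at [OF x(1)] slice_at_mem [OF a(2)]
      by (intro bexI [of _ "slice_at C A (tgt C (slice_at C B x))"] bexI [of _ "slice_at C B x"]) auto
  next
    fix c assume "c \<in> sm A B"
    then obtain p q where pq: "p \<in> A" "q \<in> B" "src C p = tgt C q" "c = cmp C (p, q)"
      unfolding mem_sm [OF a(4) b(4)] by blast
    then have "q \<in> ?B" by (metis (mono_tags, lifting) imageI mem_Collect_eq)
    moreover have "c = ?\<sigma> (src C q)"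
      using pq slice_at_eq [OF b(2) pq(2)] slice_at_eq [OF a(2) pq(1)] by simp
    ultimately have "q \<in> ?B" "c = ?\<sigma> (src C q)" .
    then show "c \<in> ?\<sigma> ` ?D" by blast
  qed
  show ?thesis
  proof (rule compact_sliceI)
    show "openin (arr C) (sm A B)"
      using section_image_open [OF coD(2) [OF D] 5 src] img by simp
    show "inj_on (src C) (sm A B)"
      unfolding img [symmetric] using src by (intro inj_onI) (metis (no_types, lifting) imageE)
    have "compactin (subtopology (obj C) ?D) ?D" using coD(1) [OF D] by (simp add: compactin_subtopology)
    then show "compactin (arr C) (sm A B)" using image_compactin [OF _ 5] unfolding img [symmetric] by blast
  qed
qed

lemma smult_sm [simp]: "A \<odot>\<^bsub>KC\<^esub> B = sm A B"
  by (simp add: sm_def)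

declare slice_sg_simps(2) [simp del]

lemma restriction_semigroup_slice: "restriction_semigroup KC"
proof
  fix A B D assume "A \<in> carrier KC" "B \<in> carrier KC" "D \<in> carrier KC"
  then show "A \<odot>\<^bsub>KC\<^esub> B \<odot>\<^bsub>KC\<^esub> D = A \<odot>\<^bsub>KC\<^esub> (B \<odot>\<^bsub>KC\<^esub> D)"
    using compact_sliceD(4) by (simp add: sm_assoc)
next
  fix A assume A: "A \<in> carrier KC"
  then show "A\<^sup>\<star>\<^bsub>KC\<^esub> \<in> carrier KC" using co_src idt_compact_slice by simp
  have "A \<subseteq> arrs C" using A compact_sliceD by simp
  then show "A \<odot>\<^bsub>KC\<^esub> A\<^sup>\<star>\<^bsub>KC\<^esub> = A" using A coD(3) [OF co_src] by (auto simp: sm_idt_right)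
next
  fix A B assume "A \<in> carrier KC" "B \<in> carrier KC"
  then have AB: "A \<in> compact_slices C" "B \<in> compact_slices C" by auto
  note a = compact_sliceD [OF AB(1)] and b = compact_sliceD [OF AB(2)]
  note sA = co_src [OF AB(1)] and sB = co_src [OF AB(2)]
  show "A \<odot>\<^bsub>KC\<^esub> B \<in> carrier KC" using AB sm_compact_slice by simp
  have prod: "sm (idt C ` U) (idt C ` V) = idt C ` (U \<inter> V)" if "U \<subseteq> objs C" "V \<subseteq> objs C" for U V
    using that by (subst sm_idt_right) (auto simp: src_idt subset_iff)
  note pr = prod [OF coD(3) [OF sA] coD(3) [OF sB]] prod [OF coD(3) [OF sB] coD(3) [OF sA]]
  show "A\<^sup>\<star>\<^bsub>KC\<^esub> \<odot>\<^bsub>KC\<^esub> B\<^sup>\<star>\<^bsub>KC\<^esub> = B\<^sup>\<star>\<^bsub>KC\<^esub> \<odot>\<^bsub>KC\<^esub> A\<^sup>\<star>\<^bsub>KC\<^esub>"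
    by (simp add: pr Int_commute)
  show "A\<^sup>\<star>\<^bsub>KC\<^esub> \<odot>\<^bsub>KC\<^esub> B\<^sup>\<star>\<^bsub>KC\<^esub> = (A\<^sup>\<star>\<^bsub>KC\<^esub> \<odot>\<^bsub>KC\<^esub> B\<^sup>\<star>\<^bsub>KC\<^esub>)\<^sup>\<star>\<^bsub>KC\<^esub>"
    using coD(3) [OF co_Int [OF sA sB]] by (simp add: pr src_idt_image)
  have left: "sm (idt C ` src C ` A) B = {b \<in> B. tgt C b \<in> src C ` A}"
    using b(4) coD(3) [OF sA] by (rule sm_idt_left)
  show "(A \<odot>\<^bsub>KC\<^esub> B)\<^sup>\<star>\<^bsub>KC\<^esub> = (A\<^sup>\<star>\<^bsub>KC\<^esub> \<odot>\<^bsub>KC\<^esub> B)\<^sup>\<star>\<^bsub>KC\<^esub>"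
    using a(4) b(4) by (simp add: left src_sm)
  have "src C ` sm A B \<subseteq> objs C" using sm_subset [OF a(4) b(4)] by blast
  then have "sm B (idt C ` src C ` sm A B) = {b \<in> B. src C b \<in> src C ` sm A B}"
    by (rule sm_idt_right [OF b(4)])
  \<comment> \<open>Since \<open>src C\<close> is injective on \<open>B\<close>, an arrow of
    \<open>B\<close> whose source is also the source of a product is itself one that can be composed
    with an arrow of \<open>A\<close>.\<close>
  also have "\<dots> = {b \<in> B. tgt C b \<in> src C ` A}"
    unfolding src_sm [OF a(4) b(4)] using b(2) by (auto dest: inj_onD)
  finally show "A\<^sup>\<star>\<^bsub>KC\<^esub> \<odot>\<^bsub>KC\<^esub> B = B \<odot>\<^bsub>KC\<^esub> (A \<odot>\<^bsub>KC\<^esub> B)\<^sup>\<star>\<^bsub>KC\<^esub>"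
    by (simp add: left)
qed

sublocale SG: restriction_semigroup KC
  by (rule restriction_semigroup_slice)

text \<open>Restricting \<open>B\<close> to the sources of \<open>A\<close> gives \<open>A\<close>
  precisely when \<open>A\<close> is contained in \<open>B\<close>, as \<open>B\<close> has at most
  one arrow over each object.\<close>

lemma nle_slice_iff:
  assumes "A \<in> compact_slices C" "B \<in> compact_slices C"
  shows "nle KC A B \<longleftrightarrow> A \<subseteq> B"
proof -
  note a = compact_sliceD [OF assms(1)] and b = compact_sliceD [OF assms(2)]
  have "nle KC A B \<longleftrightarrow> A = {b \<in> B. src C b \<in> src C ` A}"
    using coD(3) [OF co_src [OF assms(1)]] b(4) by (simp add: nle_def sm_idt_right)
  also have "\<dots> \<longleftrightarrow> A \<subseteq> B" using b(2) by (auto dest: inj_onD)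
  finally show ?thesis .
qed

text \<open>A union of slices need not be a slice. Here it is contained in the slice
  \<open>J\<close>, hence is one; then it bounds \<open>X\<close>, so \<open>J\<close> is contained
  in it.\<close>

lemma is_join_slice_iff:
  assumes "finite X" "X \<subseteq> compact_slices C" "J \<in> compact_slices C"
  shows "is_join KC X J \<longleftrightarrow> J = \<Union>X"
proof
  assume j: "is_join KC X J"
  have "B \<subseteq> J" if "B \<in> X" for B
    using is_joinD(3) [OF j that] nle_slice_iff [of B J] that assms by auto
  then have sub: "\<Union>X \<subseteq> J" by blast
  then have "\<Union>X \<in> compact_slices C"
    using compact_slice_Union [OF assms(1,2) sub compact_sliceD(2) [OF assms(3)]] by blast
  then have "J \<subseteq> \<Union>X"
    using is_joinD(4) [OF j, of "\<Union>X"] nle_slice_iff [OF _ \<open>\<Union>X \<in> compact_slices C\<close>] assms(2,3)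
    by (auto simp: subset_iff)
  with sub show "J = \<Union>X" by blast
next
  assume "J = \<Union>X"
  then show "is_join KC X J"
    using assms by (intro is_joinI) (auto simp: nle_slice_iff subset_iff)
qed

lemma is_joinD_slice:
  assumes "finite X" "is_join KC X J"
  shows "J = \<Union>X"
  using is_join_slice_iff [OF assms(1)] is_joinD(1,2) [OF assms(2)] assms(2) by simp

text \<open>As \<open>idt C\<close> is injective on objects, the projections form a ring of sets
  isomorphic to the ring of compact open sets of objects.\<close>

lemma gen_boolean_algebra_slice: "gen_boolean_algebra (pposet KC)"
proof -
  let ?P = "pposet KC"
  interpret P: partial_order ?P by (rule SG.partial_order_pposet)
  have cs: "E \<in> compact_slices C" if "E \<in> projs KC" for E
    using that SG.projs_closed by simp
  have le: "nle KC E F \<longleftrightarrow> E \<subseteq> F" if "E \<in> projs KC" "F \<in> projs KC" for E F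
    using that cs nle_slice_iff by blast
  have un: "E \<union> F \<in> projs KC" if EF: "E \<in> projs KC" "F \<in> projs KC" for E F
  proof -
    obtain U V where "co U" "E = idt C ` U" "co V" "F = idt C ` V"
      using EF unfolding projs_slice_sg by blast
    then have "E \<union> F = idt C ` (U \<union> V)" "co (U \<union> V)" using co_Un by auto
    then show ?thesis unfolding projs_slice_sg by blast
  qed
  have int: "E \<inter> F \<in> projs KC" if EF: "E \<in> projs KC" "F \<in> projs KC" for E F
  proof -
    obtain U V where UV: "co U" "E = idt C ` U" "co V" "F = idt C ` V"
      using EF unfolding projs_slice_sg by blast
    then have "E \<inter> F = idt C ` (U \<inter> V)"
      using inj_on_image_Int [OF inj_on_idt coD(3) coD(3)] by simp
    then show ?thesis using co_Int [OF UV(1,3)] unfolding projs_slice_sg by blast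
  qed
  have diff: "E - F \<in> projs KC" if EF: "E \<in> projs KC" "F \<in> projs KC" for E F
  proof -
    obtain U V where UV: "co U" "E = idt C ` U" "co V" "F = idt C ` V"
      using EF unfolding projs_slice_sg by blast
    then have "E - F = idt C ` (U - V)"
      using inj_on_image_set_diff [OF inj_on_idt, of U V] coD(3) by auto
    then show ?thesis using co_Diff [OF UV(1,3)] unfolding projs_slice_sg by blast
  qed
  have lub: "least ?P (E \<union> F) (Upper ?P {E, F})"
    if E: "E \<in> projs KC" and F: "F \<in> projs KC" for E F
  proof -
    note u = un [OF E F]
    show ?thesis
    proof (rule least_UpperI)
      show "x \<sqsubseteq>\<^bsub>?P\<^esub> E \<union> F" if "x \<in> {E, F}" for x
        using that le [OF E u] le [OF F u] by auto
      fix y assume "y \<in> Upper ?P {E, F}"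
      then have y: "y \<in> projs KC" "nle KC E y" "nle KC F y"
        using E F unfolding Upper_def by auto
      then show "E \<union> F \<sqsubseteq>\<^bsub>?P\<^esub> y"
        using le [OF E y(1)] le [OF F y(1)] le [OF u y(1)] by simp
    qed (use E F u in simp_all)
  qed
  have glb: "greatest ?P (E \<inter> F) (Lower ?P {E, F})"
    if E: "E \<in> projs KC" and F: "F \<in> projs KC" for E F
  proof -
    note u = int [OF E F]
    show ?thesis
    proof (rule greatest_LowerI)
      show "E \<inter> F \<sqsubseteq>\<^bsub>?P\<^esub> x" if "x \<in> {E, F}" for x
        using that le [OF u E] le [OF u F] by auto
      fix y assume "y \<in> Lower ?P {E, F}"
      then have y: "y \<in> projs KC" "nle KC y E" "nle KC y F"
        using E F unfolding Lower_def by auto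
      then show "y \<sqsubseteq>\<^bsub>?P\<^esub> E \<inter> F"
        using le [OF y(1) E] le [OF y(1) F] le [OF y(1) u] by simp
    qed (use E F u in simp_all)
  qed
  have lattice: "Lattice.lattice ?P"
    by unfold_locales (metis lub glb pposet_simps(1))+
  have join: "E \<squnion>\<^bsub>?P\<^esub> F = E \<union> F" if "E \<in> projs KC" "F \<in> projs KC" for E F
    unfolding join_def sup_def using lub [OF that] P.least_unique by (intro some_equality) blast+
  have meet: "E \<sqinter>\<^bsub>?P\<^esub> F = E \<inter> F" if "E \<in> projs KC" "F \<in> projs KC" for E F
    unfolding meet_def inf_def using glb [OF that] P.greatest_unique by (intro some_equality) blast+
  show ?thesis
  proof (intro gen_boolean_algebra.intro lattice gen_boolean_algebra_axioms.intro)
    show "E \<sqinter>\<^bsub>?P\<^esub> (F \<squnion>\<^bsub>?P\<^esub> G) = (E \<sqinter>\<^bsub>?P\<^esub> F) \<squnion>\<^bsub>?P\<^esub> (E \<sqinter>\<^bsub>?P\<^esub> G)"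
      if "E \<in> carrier ?P" "F \<in> carrier ?P" "G \<in> carrier ?P" for E F G
      using that un int by (simp add: join meet Int_Un_distrib)
    have "{} \<in> projs KC" unfolding projs_slice_sg by (auto intro!: exI [of _ "{}"])
    then show "\<exists>z. least ?P z (carrier ?P)" by (intro exI [of _ "{}"]) (auto simp: least_def le)
    fix a b x assume "a \<in> carrier ?P" "b \<in> carrier ?P" "x \<in> carrier ?P"
      "a \<sqsubseteq>\<^bsub>?P\<^esub> x" "x \<sqsubseteq>\<^bsub>?P\<^esub> b"
    then have *: "a \<in> projs KC" "b \<in> projs KC" "x \<in> projs KC" "a \<subseteq> x" "x \<subseteq> b"
      by (auto simp: le)
    \<comment> \<open>This is the complement of \<open>x\<close> in the interval from
      \<open>a\<close> to \<open>b\<close>.\<close>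
    then have y: "a \<union> (b - x) \<in> projs KC" using un diff by blast
    then show "\<exists>y \<in> carrier ?P. x \<sqinter>\<^bsub>?P\<^esub> y = a \<and> x \<squnion>\<^bsub>?P\<^esub> y = b"
      using * by (intro bexI [of _ "a \<union> (b - x)"]) (auto simp: join meet)
  qed
qed

lemma empty_proj: "{} \<in> projs KC"
  unfolding projs_slice_sg by (auto intro!: exI [of _ "{}"])

lemma empty_slice [simp]: "{} \<in> compact_slices C"
  by (rule compact_sliceI) auto

lemma preBoolean_slice: "preBoolean KC"
proof (intro preBoolean.intro restriction_semigroup_slice preBoolean_axioms.intro gen_boolean_algebra_slice)
  show "\<exists>Z \<in> projs KC. \<forall>A \<in> carrier KC. Z \<odot>\<^bsub>KC\<^esub> A = Z"
    using empty_proj by (intro bexI [of _ "{}"]) (auto simp: sm_def)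
  show "\<exists>J. is_join KC {A, B} J"
    if "A \<in> carrier KC" "B \<in> carrier KC" "W \<in> carrier KC"
      "nle KC A W" "nle KC B W" for A B W
  proof -
    have "A \<subseteq> W" "B \<subseteq> W" "A \<in> compact_slices C" "B \<in> compact_slices C" "W \<in> compact_slices C"
      using that by (auto simp: nle_slice_iff)
    then have "\<Union>{A, B} \<in> compact_slices C"
      using compact_slice_Union [of "{A, B}" W] compact_sliceD(2) by auto
    then show ?thesis using is_join_slice_iff [of "{A, B}" "\<Union>{A, B}"] that by auto
  qed
  show "is_join KC {A \<odot>\<^bsub>KC\<^esub> D, B \<odot>\<^bsub>KC\<^esub> D} (J \<odot>\<^bsub>KC\<^esub> D)"
    if "A \<in> carrier KC" "B \<in> carrier KC" "D \<in> carrier KC"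
      "is_join KC {A, B} J" for A B D J
  proof -
    have J: "J = A \<union> B" "J \<in> compact_slices C"
      using is_joinD_slice [OF _ that(4)] is_joinD(2) [OF that(4)] by auto
    have "sm J D = sm A D \<union> sm B D" unfolding J(1) sm_def by blast
    then show ?thesis
      using that(1-3) sm_compact_slice [of J D] J(2) is_join_slice_iff [of "{sm A D, sm B D}" "sm J D"]
        sm_compact_slice [of A D] sm_compact_slice [of B D] by simp
  qed
qed

sublocale SG: preBoolean KC
  by (rule preBoolean_slice)

end

section \<open>Compact open sets of objects and local units in an ample category\<close>

context ample_category
begin

lemma slice_through:
  assumes "openin (arr C) V" "a \<in> V"
  obtains A where "A \<in> compact_slices C" "a \<in> A" "A \<subseteq> V"
  using compact_slices_basis assms unfolding is_basis_iff by blast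

text \<open>The basis of compact slices descends to objects: take a compact slice through the
  identity at \<open>x\<close> whose sources lie in the given open set; its set of sources is
  compact open.\<close>

lemma co_basis:
  assumes "openin (obj C) O'" "x \<in> O'"
  obtains U where "co U" "x \<in> U" "U \<subseteq> O'"
proof -
  have x: "x \<in> objs C" using assms openin_subset by blast
  have "openin (arr C) {a \<in> arrs C. src C a \<in> O'}"
    using assms(1) src_continuous openin_continuous_map_preimage by blast
  moreover have "idt C x \<in> {a \<in> arrs C. src C a \<in> O'}" using x assms by (simp add: src_idt)
  ultimately obtain A where A: "A \<in> compact_slices C" "idt C x \<in> A" "A \<subseteq> {a \<in> arrs C. src C a \<in> O'}"
    by (rule slice_through)
  then have "co (src C ` A)" "x \<in> src C ` A" "src C ` A \<subseteq> O'"
    using co_src x by (auto simp: image_iff src_idt intro!: bexI [of _ "idt C x"])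
  then show ?thesis using that by blast
qed

text \<open>Applied to ranges of slices it yields local units, applied to images under anchor maps
  it yields properness of \<open>slice_map\<close> on projections.\<close>

lemma co_cover:
  assumes "compactin (obj C) K"
  obtains U where "co U" "K \<subseteq> U"
proof -
  have K: "K \<subseteq> objs C" using assms compactin_subset_topspace by blast
  have "\<exists>\<F>. finite \<F> \<and> \<F> \<subseteq> Collect co \<and> K \<subseteq> \<Union>\<F>"
  proof (rule compactinD [OF assms])
    show "openin (obj C) U" if "U \<in> Collect co" for U using that coD by blast
    show "K \<subseteq> \<Union>(Collect co)"
    proof
      fix x assume "x \<in> K"
      then obtain U where "co U" "x \<in> U" using K co_basis [OF openin_topspace] by blast
      then show "x \<in> \<Union>(Collect co)" by blast
    qed
  qed
  then obtain \<F> where \<F>: "finite \<F>" "\<F> \<subseteq> Collect co" "K \<subseteq> \<Union>\<F>" by blast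
  from \<F>(1,2) have "co (\<Union>\<F>)" by induction (auto intro: co_Un)
  with \<F>(3) that show ?thesis by blast
qed

lemma compact_tgt: "A \<in> compact_slices C \<Longrightarrow> compactin (obj C) (tgt C ` A)"
  using compact_sliceD(3) image_compactin tgt_continuous by blast

text \<open>The range of a compact slice is compact but in general not open. So the local unit
  consists of the identities over a compact open set that covers the range.\<close>

lemma preBoolean_lu_slice: "preBoolean_lu KC"
proof (intro preBoolean_lu.intro preBoolean_slice preBoolean_lu_axioms.intro)
  fix A assume "A \<in> carrier KC"
  then have A: "A \<in> compact_slices C" by simp
  obtain U where U: "co U" "tgt C ` A \<subseteq> U" using co_cover [OF compact_tgt [OF A]] by blast
  have "sm (idt C ` U) A = A"
    using sm_idt_left [OF compact_sliceD(4) [OF A] coD(3) [OF U(1)]] U(2) by auto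
  then show "\<exists>E \<in> projs KC. E \<odot>\<^bsub>KC\<^esub> A = A"
    using U(1) unfolding projs_slice_sg by auto
qed

sublocale SG: preBoolean_lu KC
  by (rule preBoolean_lu_slice)

end

section \<open>Cofunctors\<close>

lemma act_dom_iff: "(s, x) \<in> act_dom C X f \<longleftrightarrow> s \<in> arrs C \<and> x \<in> topspace X \<and> src C s = f x"
  by (simp add: act_dom_def)

lemma act_dom_cong: "(\<And>x. x \<in> topspace X \<Longrightarrow> f x = g x) \<Longrightarrow> act_dom C X f = act_dom C X g"
  by (auto simp: act_dom_def)

lemma act_dom_restrict: "act_dom C X (restrict f (topspace X)) = act_dom C X f"
  by (rule act_dom_cong) simp

lemma topspace_act_top [simp]: "topspace (act_top C X f) = act_dom C X f"
  by (auto simp: act_top_def act_dom_def)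

lemma act_dom_induct:
  assumes "p \<in> act_dom C X f" "\<And>s x. (s, x) \<in> act_dom C X f \<Longrightarrow> P (s, x)"
  shows "P p"
  using assms by (cases p) simp

lemma continuous_map_into_act_top:
  assumes "continuous_map Z (arr C) g" "continuous_map Z X h"
    "\<And>z. z \<in> topspace Z \<Longrightarrow> src C (g z) = f (h z)"
  shows "continuous_map Z (act_top C X f) (\<lambda>z. (g z, h z))"
proof -
  have "continuous_map Z (prod_topology (arr C) X) (\<lambda>z. (g z, h z))"
    using assms by (simp add: continuous_map_pairwise o_def)
  moreover have "(\<lambda>z. (g z, h z)) \<in> topspace Z \<rightarrow> act_dom C X f"
    using assms by (auto simp: act_dom_def continuous_map_def Pi_iff)
  ultimately show ?thesis
    unfolding act_top_def by (auto simp: continuous_map_in_subtopology Pi_iff)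
qed

lemma continuous_map_fst_act: "continuous_map (act_top C X f) (arr C) fst"
  and continuous_map_snd_act: "continuous_map (act_top C X f) X snd"
  unfolding act_top_def
  by (rule continuous_map_from_subtopology, rule continuous_map_fst continuous_map_snd)+

lemma transf_cat_simps [simp]:
  "arr (transf_cat C X \<mu> f) = act_top C X f" "obj (transf_cat C X \<mu> f) = X"
  "idt (transf_cat C X \<mu> f) x = (idt C (f x), x)" "src (transf_cat C X \<mu> f) p = snd p"
  "tgt (transf_cat C X \<mu> f) p = \<mu> p"
  "cmp (transf_cat C X \<mu> f) ((s, y), (t, x)) = (cmp C (s, t), x)"
  by (simp_all add: transf_cat_def)

text \<open>The action of a cofunctor is determined by its functor part: \<open>s \<cdot> x\<close> is the range of
  \<open>\<rho>\<^sub>1(s, x)\<close>.\<close>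

lemma cofunctorI:
  assumes "topological_category C" "topological_category D"
    and anc: "continuous_map (obj D) (obj C) (anc F)"
    and rho: "continuous_map (act_top C (obj D) (anc F)) (arr D) (rho1 F)"
    and act: "act F = restrict (\<lambda>p. tgt D (rho1 F p)) (cof_dom C D F)"
    and src: "\<And>s x. (s, x) \<in> cof_dom C D F \<Longrightarrow> src D (rho1 F (s, x)) = x"
    and tgt: "\<And>s x. (s, x) \<in> cof_dom C D F \<Longrightarrow> anc F (tgt D (rho1 F (s, x))) = tgt C s"
    and idt: "\<And>x. x \<in> objs D \<Longrightarrow> rho1 F (idt C (anc F x), x) = idt D x"
    and cmp: "\<And>s t x. \<lbrakk>(s, t) \<in> cmp_pairs C; (t, x) \<in> cof_dom C D F\<rbrakk>
      \<Longrightarrow> rho1 F (cmp C (s, t), x) = cmp D (rho1 F (s, tgt D (rho1 F (t, x))), rho1 F (t, x))"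
    and proper: "\<And>K. compactin (obj C) K \<Longrightarrow> compactin (obj D) {x \<in> objs D. anc F x \<in> K}"
    and image: "\<And>A. A \<in> compact_slices C
      \<Longrightarrow> compactin (arr D) (cof_image C D F A) \<and> openin (arr D) (cof_image C D F A)"
    and ext: "anc F \<in> extensional (objs D)" "rho1 F \<in> extensional (cof_dom C D F)"
    and rho0: "rho0 F = restrict (\<lambda>x. x) (objs D)"
  shows "cofunctor C D F"
proof -
  interpret C: topological_category C by fact
  interpret D: topological_category D by fact
  have rc: "rho1 F p \<in> arrs D" if "p \<in> cof_dom C D F" for p
    using rho that by (auto simp: continuous_map_def)
  have ac: "act F p = tgt D (rho1 F p)" if "p \<in> cof_dom C D F" for p
    using that by (simp add: act)
  have dom_t: "(s, tgt D (rho1 F (t, x))) \<in> cof_dom C D F"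
    if "(s, t) \<in> cmp_pairs C" "(t, x) \<in> cof_dom C D F" for s t x
    using that rc [OF that(2)] tgt [OF that(2)] by (auto simp: act_dom_iff C.cmp_pairs_iff)
  have dom_st: "(cmp C (s, t), x) \<in> cof_dom C D F"
    if "(s, t) \<in> cmp_pairs C" "(t, x) \<in> cof_dom C D F" for s t x
    using that C.src_cmp [OF that(1)] C.cmp_closed [OF that(1)] by (auto simp: act_dom_iff)
  have dom_i: "(idt C (anc F x), x) \<in> cof_dom C D F" if "x \<in> objs D" for x
    using that anc by (auto simp: act_dom_iff C.src_idt continuous_map_def Pi_iff)
  have act_cont: "continuous_map (act_top C (obj D) (anc F)) (obj D) (act F)"
    by (rule continuous_map_eq [OF continuous_map_compose [OF rho D.tgt_continuous]])
      (simp add: ac o_def)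
  have act_mult: "act F (s, act F (t, x)) = act F (cmp C (s, t), x)"
    if st: "(s, t) \<in> cmp_pairs C" "(t, x) \<in> cof_dom C D F" for s t x
  proof -
    note 1 = dom_t [OF st]
    have "(rho1 F (s, tgt D (rho1 F (t, x))), rho1 F (t, x)) \<in> cmp_pairs D"
      using rc [OF 1] rc [OF st(2)] src [OF 1] by (simp add: D.cmp_pairs_iff)
    then show ?thesis
      by (simp add: ac st 1 dom_st cmp D.tgt_cmp)
  qed
  show ?thesis
  proof
    show "is_action C (obj D) (act F) (anc F)"
      unfolding is_action_def using anc act_cont act_mult
      by (auto simp: ac tgt dom_i idt D.tgt_idt)
    show "continuous_functor (transf_cat C (obj D) (act F) (anc F)) D (rho1 F) (rho0 F)"
      unfolding continuous_functor_def
    proof (intro conjI ballI)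
      show "continuous_map (obj (transf_cat C (obj D) (act F) (anc F))) (obj D) (rho0 F)"
        by (rule continuous_map_eq [of _ _ "\<lambda>x. x"]) (simp_all add: rho0)
      fix p assume p: "p \<in> arrs (transf_cat C (obj D) (act F) (anc F))"
      then obtain s x where sx: "p = (s, x)" "(s, x) \<in> cof_dom C D F" by (cases p) auto
      show "src D (rho1 F p) = rho0 F (src (transf_cat C (obj D) (act F) (anc F)) p)"
        using sx src by (simp add: rho0 act_dom_iff)
      show "tgt D (rho1 F p) = rho0 F (tgt (transf_cat C (obj D) (act F) (anc F)) p)"
        using sx ac rc by (simp add: rho0)
    next
      fix pq assume pq: "pq \<in> cmp_pairs (transf_cat C (obj D) (act F) (anc F))"
      obtain s y t x where e: "pq = ((s, y), (t, x))" by (metis surj_pair)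
      have *: "(s, y) \<in> cof_dom C D F" "(t, x) \<in> cof_dom C D F" "y = act F (t, x)"
        using pq by (auto simp: e cmp_pairs_def)
      then have st: "(s, t) \<in> cmp_pairs C"
        using tgt [OF *(2)] by (simp add: act_dom_iff C.cmp_pairs_iff ac)
      show "case pq of (p, q) \<Rightarrow> rho1 F (cmp (transf_cat C (obj D) (act F) (anc F)) (p, q))
          = cmp D (rho1 F p, rho1 F q)"
        using * st by (simp add: e cmp ac)
    qed (use rho in \<open>simp_all add: idt rho0\<close>)
  qed (use act rho0 ext proper image in \<open>simp_all\<close>)
qed

section \<open>Images of compact slices under a cofunctor\<close>

locale ample_cofunctor = C: ample_category C + D: ample_category D + cofunctor C D F
  for C :: "('a, 'o) topcat" and D :: "('b, 'p) topcat" and F :: "('a, 'o, 'b, 'p) cof"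
begin

lemma anc_continuous: "continuous_map (obj D) (obj C) (anc F)"
  and act_continuous: "continuous_map (act_top C (obj D) (anc F)) (obj D) (act F)"
  using action by (simp_all add: is_action_def)

lemma rho_continuous: "continuous_map (act_top C (obj D) (anc F)) (arr D) (rho1 F)"
  using rho_functor by (simp add: continuous_functor_def)

lemma anc_closed [simp, intro]: "x \<in> objs D \<Longrightarrow> anc F x \<in> objs C"
  using anc_continuous by (auto simp: continuous_map_def)

lemma rho_closed: "p \<in> cof_dom C D F \<Longrightarrow> rho1 F p \<in> arrs D"
  using rho_continuous by (auto simp: continuous_map_def)

lemma act_closed: "p \<in> cof_dom C D F \<Longrightarrow> act F p \<in> objs D"
  using act_continuous by (auto simp: continuous_map_def)

lemma anc_act: "(s, x) \<in> cof_dom C D F \<Longrightarrow> anc F (act F (s, x)) = tgt C s"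
  using action by (auto simp: is_action_def)

lemma src_rho: "(s, x) \<in> cof_dom C D F \<Longrightarrow> src D (rho1 F (s, x)) = x"
  using rho_functor rho0_identity by (auto simp: continuous_functor_def act_dom_iff)

lemma tgt_rho: "p \<in> cof_dom C D F \<Longrightarrow> tgt D (rho1 F p) = act F p"
  using rho_functor rho0_identity act_closed by (auto simp: continuous_functor_def)

lemma idt_dom: "x \<in> objs D \<Longrightarrow> (idt C (anc F x), x) \<in> cof_dom C D F"
  by (simp add: act_dom_iff C.src_idt)

lemma rho_idt: "x \<in> objs D \<Longrightarrow> rho1 F (idt C (anc F x), x) = idt D x"
  using rho_functor rho0_identity by (auto simp: continuous_functor_def)

lemma cmp_dom: "\<lbrakk>(s, t) \<in> cmp_pairs C; (t, x) \<in> cof_dom C D F\<rbrakk>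
  \<Longrightarrow> (s, act F (t, x)) \<in> cof_dom C D F \<and> (cmp C (s, t), x) \<in> cof_dom C D F"
  using anc_act [of t x] act_closed [of "(t, x)"] C.src_cmp [of s t] C.cmp_closed [of s t]
  by (simp add: act_dom_iff C.cmp_pairs_iff)

lemma rho_cmp:
  assumes "(s, t) \<in> cmp_pairs C" "(t, x) \<in> cof_dom C D F"
  shows "rho1 F (cmp C (s, t), x) = cmp D (rho1 F (s, act F (t, x)), rho1 F (t, x))"
proof -
  have "((s, act F (t, x)), (t, x)) \<in> cmp_pairs (transf_cat C (obj D) (act F) (anc F))"
    using assms cmp_dom [OF assms] by (simp add: cmp_pairs_def)
  then have "case ((s, act F (t, x)), (t, x)) of (p, q) \<Rightarrow>
      rho1 F (cmp (transf_cat C (obj D) (act F) (anc F)) (p, q)) = cmp D (rho1 F p, rho1 F q)"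
    using rho_functor unfolding continuous_functor_def by blast
  then show ?thesis by simp
qed

lemma mem_cof_image: "t \<in> cof_image C D F A \<longleftrightarrow>
    (\<exists>s x. s \<in> A \<and> (s, x) \<in> cof_dom C D F \<and> t = rho1 F (s, x))"
  by (auto simp: cof_image_def)

lemma cof_image_Union: "cof_image C D F (\<Union>X) = (\<Union>A \<in> X. cof_image C D F A)"
  by (auto simp: cof_image_def)

text \<open>The arrow \<open>rho1 F (s, x)\<close> has source \<open>x\<close>, and \<open>x\<close>
  determines the source \<open>anc F x\<close> of \<open>s\<close>, hence \<open>s\<close> itself
  within the slice \<open>A\<close>.\<close>

lemma cof_image_slice:
  assumes "A \<in> compact_slices C"
  shows "cof_image C D F A \<in> compact_slices D"
proof (rule D.compact_sliceI)
  show "inj_on (src D) (cof_image C D F A)"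
  proof (rule inj_onI)
    fix p q assume "p \<in> cof_image C D F A" "q \<in> cof_image C D F A" and eq: "src D p = src D q"
    then obtain s x t y where *: "s \<in> A" "(s, x) \<in> cof_dom C D F" "p = rho1 F (s, x)"
      "t \<in> A" "(t, y) \<in> cof_dom C D F" "q = rho1 F (t, y)" unfolding mem_cof_image by blast
    then have "x = y" using eq src_rho by simp
    then have "src C s = src C t" using * by (simp add: act_dom_iff)
    then have "s = t" using inj_onD [OF C.compact_sliceD(2) [OF assms]] * by blast
    with \<open>x = y\<close> * show "p = q" by simp
  qed
qed (use image_compact_open [OF assms] in auto)

text \<open>On projections the image map is the preimage under the anchor: an identity that acts on
  \<open>x\<close> must be the identity at \<open>anc F x\<close>, and \<open>rho1 F\<close>
  preserves identities.\<close>

lemma cof_image_idt: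
  assumes "U \<subseteq> objs C"
  shows "cof_image C D F (idt C ` U) = idt D ` {x \<in> objs D. anc F x \<in> U}"
proof (intro equalityI subsetI)
  fix t assume "t \<in> cof_image C D F (idt C ` U)"
  then obtain y x where "y \<in> U" "(idt C y, x) \<in> cof_dom C D F" "t = rho1 F (idt C y, x)"
    unfolding mem_cof_image by blast
  moreover then have "y = anc F x" "x \<in> objs D" using assms by (auto simp: act_dom_iff C.src_idt subset_iff)
  ultimately show "t \<in> idt D ` {x \<in> objs D. anc F x \<in> U}" using rho_idt by auto
next
  fix t assume "t \<in> idt D ` {x \<in> objs D. anc F x \<in> U}"
  then obtain x where "x \<in> objs D" "anc F x \<in> U" "t = idt D x" by blast
  then show "t \<in> cof_image C D F (idt C ` U)"
    unfolding mem_cof_image using idt_dom [of x] rho_idt [of x]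
    by (intro exI [of _ "idt C (anc F x)"] exI [of _ x]) auto
qed

text \<open>If \<open>rho1 F (a, y)\<close> and \<open>rho1 F (b, x)\<close> are composable, then
  \<open>y\<close> is the result of \<open>b\<close> acting on \<open>x\<close>. Comparing anchors
  shows that \<open>a\<close> and \<open>b\<close> are composable, and functoriality does the
  rest.\<close>

lemma cof_image_mult:
  assumes "A \<subseteq> arrs C" "B \<subseteq> arrs C" "cof_image C D F A \<subseteq> arrs D" "cof_image C D F B \<subseteq> arrs D"
  shows "cof_image C D F (C.sm A B) = D.sm (cof_image C D F A) (cof_image C D F B)"
proof (intro equalityI subsetI)
  fix c assume "c \<in> cof_image C D F (C.sm A B)"
  then obtain p x where p: "p \<in> C.sm A B" "(p, x) \<in> cof_dom C D F" "c = rho1 F (p, x)"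
    unfolding mem_cof_image by blast
  then obtain a b where ab: "a \<in> A" "b \<in> B" "src C a = tgt C b" "p = cmp C (a, b)"
    unfolding C.mem_sm [OF assms(1,2)] by blast
  have pr: "(a, b) \<in> cmp_pairs C" using ab assms by (auto simp: C.cmp_pairs_iff)
  have b: "(b, x) \<in> cof_dom C D F"
    using p(2) C.src_cmp [OF pr] ab assms by (auto simp: act_dom_iff)
  note d = cmp_dom [OF pr b]
  have "c = cmp D (rho1 F (a, act F (b, x)), rho1 F (b, x))" using rho_cmp [OF pr b] p ab by simp
  moreover have "src D (rho1 F (a, act F (b, x))) = tgt D (rho1 F (b, x))"
    using src_rho d tgt_rho b by simp
  ultimately show "c \<in> D.sm (cof_image C D F A) (cof_image C D F B)"
    unfolding D.mem_sm [OF assms(3,4)] mem_cof_image Bex_def using ab b d by metis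
next
  fix c assume "c \<in> D.sm (cof_image C D F A) (cof_image C D F B)"
  then obtain p q where pq: "p \<in> cof_image C D F A" "q \<in> cof_image C D F B" "src D p = tgt D q" "c = cmp D (p, q)"
    unfolding D.mem_sm [OF assms(3,4)] by blast
  then obtain a y b x where ab: "a \<in> A" "(a, y) \<in> cof_dom C D F" "p = rho1 F (a, y)"
    "b \<in> B" "(b, x) \<in> cof_dom C D F" "q = rho1 F (b, x)" unfolding mem_cof_image by blast
  have y: "y = act F (b, x)" using pq(3) ab src_rho tgt_rho by simp
  then have eq: "src C a = tgt C b" using ab anc_act [OF ab(5)] by (simp add: act_dom_iff)
  then have pr: "(a, b) \<in> cmp_pairs C" using ab assms by (auto simp: C.cmp_pairs_iff)
  have "c = rho1 F (cmp C (a, b), x)" using rho_cmp [OF pr ab(5)] pq ab y by simp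
  moreover have "cmp C (a, b) \<in> C.sm A B" using ab eq unfolding C.mem_sm [OF assms(1,2)] by blast
  ultimately show "c \<in> cof_image C D F (C.sm A B)"
    unfolding mem_cof_image using cmp_dom [OF pr ab(5)] by blast
qed

lemma src_cof_image:
  assumes "A \<subseteq> arrs C"
  shows "src D ` cof_image C D F A = {x \<in> objs D. anc F x \<in> src C ` A}"
proof (intro equalityI subsetI)
  fix x assume "x \<in> src D ` cof_image C D F A"
  then obtain s y where "s \<in> A" "(s, y) \<in> cof_dom C D F" "x = src D (rho1 F (s, y))"
    unfolding image_iff mem_cof_image Bex_def by blast
  moreover then have "x = y" using src_rho by simp
  ultimately show "x \<in> {x \<in> objs D. anc F x \<in> src C ` A}" by (auto simp: act_dom_iff image_iff) metis
next
  fix x assume "x \<in> {x \<in> objs D. anc F x \<in> src C ` A}"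
  then obtain s where s: "s \<in> A" "(s, x) \<in> cof_dom C D F" using assms by (auto simp: act_dom_iff)
  then have "rho1 F (s, x) \<in> cof_image C D F A" "x = src D (rho1 F (s, x))"
    using src_rho by (auto simp: mem_cof_image)
  then show "x \<in> src D ` cof_image C D F A" by (rule rev_image_eqI)
qed

lemma slice_map_apply: "A \<in> compact_slices C \<Longrightarrow> slice_map C D F A = cof_image C D F A"
  by (simp add: slice_map_def)

end

context etale_category
begin

lemma jn_slice: "\<lbrakk>E \<in> projs KC; G \<in> projs KC\<rbrakk> \<Longrightarrow> jn KC E G = E \<union> G"
  using is_joinD_slice [OF _ SG.is_join_jn, of E G] by simp

lemma zero_slice: "zero_of KC = {}"
  by (rule SG.zero_unique [OF empty_proj]) (simp add: sm_def)

end

section \<open>The morphism of semigroups induced by a cofunctor\<close>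

context ample_cofunctor
begin

lemma slice_map_mor: "pbr_mor (slice_sg C) (slice_sg D) (slice_map C D F)"
proof (rule pbr_morI)
  show "slice_map C D F \<in> carrier (slice_sg C) \<rightarrow>\<^sub>E carrier (slice_sg D)"
    using cof_image_slice by (auto simp: slice_map_def)
  fix A B assume "A \<in> carrier (slice_sg C)" "B \<in> carrier (slice_sg C)"
  then have AB: "A \<in> compact_slices C" "B \<in> compact_slices C" by auto
  then show "slice_map C D F (A \<odot>\<^bsub>slice_sg C\<^esub> B) = slice_map C D F A \<odot>\<^bsub>slice_sg D\<^esub> slice_map C D F B"
    using cof_image_mult [of A B] C.compact_sliceD(4) D.compact_sliceD(4) cof_image_slice C.sm_compact_slice
    by (simp add: slice_map_apply)
next
  fix A assume "A \<in> carrier (slice_sg C)"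
  then have A: "A \<in> compact_slices C" by auto
  have "cof_image C D F (idt C ` src C ` A) = idt D ` src D ` cof_image C D F A"
    using cof_image_idt [OF C.coD(3) [OF C.co_src [OF A]]] src_cof_image [OF C.compact_sliceD(4) [OF A]] by simp
  then show "slice_map C D F (A\<^sup>\<star>\<^bsub>slice_sg C\<^esub>) = (slice_map C D F A)\<^sup>\<star>\<^bsub>slice_sg D\<^esub>"
    using A C.idt_compact_slice [OF C.co_src [OF A]] by (simp add: slice_map_apply)
next
  fix E G assume EG: "E \<in> projs (slice_sg C)" "G \<in> projs (slice_sg C)"
  then have cs: "E \<in> compact_slices C" "G \<in> compact_slices C"
    using C.SG.projs_closed by auto
  \<comment> \<open>\<open>jn_slice\<close> identifies joins with unions for projections, so the
    images of projections must first be recognised as projections.\<close>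
  have im: "slice_map C D F P \<in> projs (slice_sg D)" if P: "P \<in> projs (slice_sg C)" for P
  proof -
    obtain U where U: "C.co U" "P = idt C ` U" using P unfolding C.projs_slice_sg by blast
    have P': "P \<in> compact_slices C" using U C.idt_compact_slice by simp
    have "cof_image C D F P = idt D ` {x \<in> objs D. anc F x \<in> U}"
      using cof_image_idt U C.coD(3) by simp
    moreover have "{x \<in> objs D. anc F x \<in> U} = src D ` cof_image C D F P"
      using calculation by (simp add: D.src_idt_image)
    moreover have "D.co (src D ` cof_image C D F P)" using D.co_src cof_image_slice P' by blast
    ultimately show ?thesis unfolding D.projs_slice_sg using P' by (auto simp: slice_map_apply)
  qed
  have "E \<union> G \<in> compact_slices C"
    using C.SG.jn_closed [OF EG] C.jn_slice [OF EG] C.SG.projs_closed by simp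
  moreover have "cof_image C D F (E \<union> G) = cof_image C D F E \<union> cof_image C D F G"
    using cof_image_Union [of "{E, G}"] by simp
  ultimately show "slice_map C D F (jn (slice_sg C) E G)
      = jn (slice_sg D) (slice_map C D F E) (slice_map C D F G)"
    using im [OF EG(1)] im [OF EG(2)] EG cs by (simp add: C.jn_slice D.jn_slice slice_map_apply)
next
  show "slice_map C D F (zero_of (slice_sg C)) = zero_of (slice_sg D)"
    by (auto simp: C.zero_slice D.zero_slice slice_map_apply cof_image_def)
  fix Q assume "Q \<in> projs (slice_sg D)"
  then obtain V where V: "D.co V" "Q = idt D ` V" unfolding D.projs_slice_sg by blast
  \<comment> \<open>The anchor map sends the compact set \<open>V\<close> into a compact open set
    \<open>U\<close>. So \<open>V\<close> lies in the preimage of \<open>U\<close>, over which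
    \<open>slice_map\<close> places the image of the projection of \<open>U\<close>.\<close>
  have "compactin (obj C) (anc F ` V)" using image_compactin anc_continuous D.coD(1) [OF V(1)] by blast
  then obtain U where U: "C.co U" "anc F ` V \<subseteq> U" using C.co_cover by blast
  have E: "idt C ` U \<in> projs (slice_sg C)" unfolding C.projs_slice_sg using U by blast
  have cs: "idt C ` U \<in> compact_slices C" using C.idt_compact_slice U by blast
  have "Q \<subseteq> cof_image C D F (idt C ` U)"
    unfolding V(2) cof_image_idt [OF C.coD(3) [OF U(1)]]
    by (rule image_mono) (use D.coD(3) [OF V(1)] U(2) in auto)
  then have "nle (slice_sg D) Q (slice_map C D F (idt C ` U))"
    using D.nle_slice_iff [OF _ cof_image_slice [OF cs]] D.idt_compact_slice [OF V(1)] V(2) cs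
    by (simp add: slice_map_apply)
  then show "\<exists>E \<in> projs (slice_sg C). nle (slice_sg D) Q (slice_map C D F E)" using E by blast
qed (rule C.preBoolean_slice D.preBoolean_slice)+

lemma slice_map_morphism: "pbr_morphism (slice_sg C) (slice_sg D) (slice_map C D F)"
  by unfold_locales (rule slice_map_mor)

text \<open>An arrow of \<open>U\<close> comes from an arrow of \<open>A\<close> and from one of
  \<open>B\<close>; by injectivity these are the same. The open set \<open>A \<inter> B\<close> need
  not be compact, because the space of arrows need not be Hausdorff. Hence \<open>U\<close> is
  covered by images of finitely many compact slices inside it, and their union is a slice as it lies
  in \<open>A\<close>.\<close>

lemma slice_map_weakly_meet_preserving:
  assumes inj: "injective_on_arrows C D F"
  shows "weakly_meet_preserving (slice_sg C) (slice_sg D) (slice_map C D F)"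
  unfolding weakly_meet_preserving_def
proof (intro ballI impI)
  fix A B U assume "A \<in> carrier (slice_sg C)" "B \<in> carrier (slice_sg C)" "U \<in> carrier (slice_sg D)"
    and le: "nle (slice_sg D) U (slice_map C D F A) \<and> nle (slice_sg D) U (slice_map C D F B)"
  then have cs: "A \<in> compact_slices C" "B \<in> compact_slices C" "U \<in> compact_slices D" by auto
  have sub: "U \<subseteq> cof_image C D F A" "U \<subseteq> cof_image C D F B"
    using le cs D.nle_slice_iff cof_image_slice by (simp_all add: slice_map_apply)
  define \<W> where "\<W> = {W \<in> compact_slices C. W \<subseteq> A \<inter> B}"
  have "\<exists>\<F>. finite \<F> \<and> \<F> \<subseteq> cof_image C D F ` \<W> \<and> U \<subseteq> \<Union>\<F>"
  proof (rule compactinD [OF D.compact_sliceD(3) [OF cs(3)]])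
    show "openin (arr D) V" if "V \<in> cof_image C D F ` \<W>" for V
      using that D.compact_sliceD(1) cof_image_slice by (auto simp: \<W>_def)
    show "U \<subseteq> \<Union>(cof_image C D F ` \<W>)"
    proof
      fix t assume t: "t \<in> U"
      obtain s x where s: "s \<in> A" "(s, x) \<in> cof_dom C D F" "t = rho1 F (s, x)"
        using sub(1) t unfolding subset_iff mem_cof_image by blast
      obtain s' x' where s': "s' \<in> B" "(s', x') \<in> cof_dom C D F" "t = rho1 F (s', x')"
        using sub(2) t unfolding subset_iff mem_cof_image by blast
      have "x = x'" using s s' src_rho by metis
      then have "s = s'" using inj s s' unfolding injective_on_arrows_def by metis
      then have "s \<in> A \<inter> B" using s s' by blast
      moreover have "openin (arr C) (A \<inter> B)" using cs C.compact_sliceD(1) by blast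
      ultimately obtain W where W: "W \<in> compact_slices C" "s \<in> W" "W \<subseteq> A \<inter> B"
        using C.slice_through by metis
      then have "t \<in> cof_image C D F W" using s unfolding mem_cof_image by blast
      then show "t \<in> \<Union>(cof_image C D F ` \<W>)" using W by (auto simp: \<W>_def)
    qed
  qed
  then obtain \<G> where \<G>: "finite \<G>" "\<G> \<subseteq> \<W>" "U \<subseteq> \<Union>(cof_image C D F ` \<G>)"
    by (metis finite_subset_image)
  have V: "\<Union>\<G> \<in> compact_slices C" "\<Union>\<G> \<subseteq> A" "\<Union>\<G> \<subseteq> B"
    using \<G> C.compact_slice_Union [of \<G> A] C.compact_sliceD(2) [OF cs(1)] by (auto simp: \<W>_def)
  have "U \<subseteq> cof_image C D F (\<Union>\<G>)" using \<G> by (simp add: cof_image_Union)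
  then show "\<exists>V \<in> carrier (slice_sg C). nle (slice_sg C) V A \<and> nle (slice_sg C) V B
      \<and> nle (slice_sg D) U (slice_map C D F V)"
    using V cs by (intro bexI [of _ "\<Union>\<G>"])
      (simp_all add: C.nle_slice_iff D.nle_slice_iff slice_map_apply cof_image_slice)
qed

text \<open>By surjectivity every arrow of \<open>A\<close> lies in the image of some compact slice
  of \<open>C\<close>. Compact slices inside \<open>A\<close> and inside one such image cover
  \<open>A\<close>, and finitely many of them have \<open>A\<close> as their join.\<close>

lemma slice_map_proper:
  assumes surj: "surjective_on_arrows C D F"
  shows "proper_mor (slice_sg C) (slice_sg D) (slice_map C D F)"
proof (rule proper_morI [OF slice_map_morphism])
  fix A assume "A \<in> carrier (slice_sg D)"
  then have A: "A \<in> compact_slices D" by simp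
  define \<W> where "\<W> = {W \<in> compact_slices D. W \<subseteq> A \<and> (\<exists>B \<in> compact_slices C. W \<subseteq> cof_image C D F B)}"
  have "\<exists>\<F>. finite \<F> \<and> \<F> \<subseteq> \<W> \<and> A \<subseteq> \<Union>\<F>"
  proof (rule compactinD [OF D.compact_sliceD(3) [OF A]])
    show "openin (arr D) V" if "V \<in> \<W>" for V
      using that D.compact_sliceD(1) by (auto simp: \<W>_def)
    show "A \<subseteq> \<Union>\<W>"
    proof
      fix t assume t: "t \<in> A"
      then have "t \<in> arrs D" using D.compact_sliceD(4) [OF A] by blast
      then obtain s where s: "(s, src D t) \<in> cof_dom C D F" "rho1 F (s, src D t) = t"
        using surj unfolding surjective_on_arrows_def by blast
      then have "s \<in> arrs C" by (simp add: act_dom_iff)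
      then obtain B where B: "B \<in> compact_slices C" "s \<in> B"
        using C.slice_through [OF openin_topspace] by metis
      have "t \<in> cof_image C D F B" using s B unfolding mem_cof_image by metis
      moreover have "openin (arr D) (A \<inter> cof_image C D F B)"
        using A B D.compact_sliceD(1) cof_image_slice by blast
      ultimately obtain W where "W \<in> compact_slices D" "t \<in> W" "W \<subseteq> A \<inter> cof_image C D F B"
        using D.slice_through t by (metis IntI)
      then show "t \<in> \<Union>\<W>" using B by (auto simp: \<W>_def)
    qed
  qed
  then obtain \<F> where \<F>: "finite \<F>" "\<F> \<subseteq> \<W>" "A \<subseteq> \<Union>\<F>" by blast
  then have "A = \<Union>\<F>" by (auto simp: \<W>_def)
  moreover have "\<F> \<subseteq> compact_slices D" using \<F> by (auto simp: \<W>_def)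
  ultimately have "is_join (slice_sg D) \<F> A" using \<F> A by (simp add: D.is_join_slice_iff)
  moreover have "\<exists>B \<in> carrier (slice_sg C). nle (slice_sg D) W (slice_map C D F B)" if "W \<in> \<F>" for W
  proof -
    have "W \<in> \<W>" using \<open>W \<in> \<F>\<close> \<F>(2) by blast
    then obtain B where "W \<in> compact_slices D" "B \<in> compact_slices C" "W \<subseteq> cof_image C D F B"
      by (auto simp: \<W>_def)
    then show ?thesis
      by (intro bexI [of _ B]) (simp_all add: D.nle_slice_iff slice_map_apply cof_image_slice)
  qed
  ultimately show "\<exists>X. finite X \<and> is_join (slice_sg D) X A
      \<and> (\<forall>x \<in> X. \<exists>s \<in> carrier (slice_sg C). nle (slice_sg D) x (slice_map C D F s))"
    using \<F>(1) by blast
qed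

end

section \<open>Identities, composites and equality of cofunctors\<close>

lemma cof_hom_ample:
  assumes "ample_category C" "ample_category D" "F \<in> cof_hom i C D"
  shows "ample_cofunctor C D F"
  using assms by (simp add: ample_cofunctor_def cof_hom_def)

lemma slice_map_hom:
  assumes "ample_category C" "ample_category D" "F \<in> cof_hom i C D"
  shows "slice_map C D F \<in> pbr_hom i (slice_sg C) (slice_sg D)"
proof -
  interpret ample_cofunctor C D F using cof_hom_ample [OF assms] .
  show ?thesis
    using assms(3) slice_map_mor slice_map_weakly_meet_preserving slice_map_proper
    by (auto simp: pbr_hom_def cof_hom_def)
qed

text \<open>\<open>act\<close> is \<open>tgt D\<close> after \<open>rho1\<close>,
  \<open>rho0\<close> is the identity, and extensionality settles the values off the
  domains.\<close>

lemma cofunctor_eqI: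
  assumes "ample_cofunctor C D F" "ample_cofunctor C D G"
    and anc: "\<And>x. x \<in> objs D \<Longrightarrow> anc F x = anc G x"
    and rho: "\<And>s x. (s, x) \<in> cof_dom C D F \<Longrightarrow> rho1 F (s, x) = rho1 G (s, x)"
  shows "F = G"
proof -
  interpret F: ample_cofunctor C D F by fact
  interpret G: ample_cofunctor C D G by fact
  have dom: "cof_dom C D F = cof_dom C D G" by (rule act_dom_cong) (rule anc)
  have 1: "anc F = anc G" by (rule extensionalityI [OF F.anc_extensional G.anc_extensional anc])
  have 2: "rho1 F = rho1 G"
    by (rule extensionalityI [OF F.rho1_extensional]) (use G.rho1_extensional dom rho in auto)
  have 3: "act F = act G"
    by (rule extensionalityI [OF F.act_extensional])
      (use G.act_extensional dom 2 F.tgt_rho G.tgt_rho in auto)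
  have 4: "rho0 F = rho0 G"
    by (rule extensionalityI [OF F.rho0_extensional G.rho0_extensional])
      (simp add: F.rho0_identity G.rho0_identity)
  show ?thesis by (rule cof.equality) (simp_all add: 1 2 3 4)
qed

text \<open>The definition describes the domain by the identity function, whereas
  \<open>cof_dom\<close> reads it off from the restricted anchor map. Both agree on objects, and the
  second form fits the general facts on cofunctors.\<close>

lemma cof_id_sel:
  "anc (cof_id C) = restrict (\<lambda>x. x) (objs C)" "rho0 (cof_id C) = restrict (\<lambda>x. x) (objs C)"
  "rho1 (cof_id C) = restrict fst (cof_dom C C (cof_id C))"
  "act (cof_id C) = restrict (\<lambda>p. tgt C (fst p)) (cof_dom C C (cof_id C))"
proof -
  have dom: "act_dom C (obj C) (\<lambda>x. x) = cof_dom C C (cof_id C)"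
    by (rule act_dom_cong) (simp add: cof_id_def)
  show "rho1 (cof_id C) = restrict fst (cof_dom C C (cof_id C))"
    "act (cof_id C) = restrict (\<lambda>p. tgt C (fst p)) (cof_dom C C (cof_id C))"
    unfolding dom [symmetric] by (auto simp: cof_id_def restrict_def)
qed (simp_all add: cof_id_def)

lemma cof_dom_id: "(s, x) \<in> cof_dom C C (cof_id C) \<longleftrightarrow> s \<in> arrs C \<and> x \<in> objs C \<and> src C s = x"
  by (auto simp: act_dom_iff cof_id_sel)

lemma cof_image_id:
  assumes "topological_category C" "A \<subseteq> arrs C"
  shows "cof_image C C (cof_id C) A = A"
proof -
  interpret topological_category C by fact
  have "(a, src C a) \<in> cof_dom C C (cof_id C)" if "a \<in> A" for a
    using that assms by (auto simp: cof_dom_id)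
  then show ?thesis by (force simp: cof_image_def cof_id_sel(3))
qed

lemma cof_id_cofunctor:
  assumes "ample_category C"
  shows "cofunctor C C (cof_id C)"
proof -
  interpret ample_category C by fact
  have dom: "s \<in> arrs C" "x = src C s" "rho1 (cof_id C) (s, x) = s" if "(s, x) \<in> cof_dom C C (cof_id C)" for s x
    using that by (simp_all add: cof_dom_id cof_id_sel(3))
  have mem: "(s, src C s) \<in> cof_dom C C (cof_id C)" if "s \<in> arrs C" for s
    using that by (simp add: cof_dom_id)
  have val: "rho1 (cof_id C) (s, src C s) = s" if "s \<in> arrs C" for s
    using mem [OF that] dom(3) by blast
  show ?thesis
  proof (rule cofunctorI)
    show "continuous_map (obj C) (obj C) (anc (cof_id C))"
      by (rule continuous_map_eq [of _ _ "\<lambda>x. x"]) (simp_all add: cof_id_sel)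
    show "continuous_map (act_top C (obj C) (anc (cof_id C))) (arr C) (rho1 (cof_id C))"
      by (rule continuous_map_eq [OF continuous_map_fst_act]) (simp add: cof_id_sel(3))
    show "act (cof_id C) = restrict (\<lambda>p. tgt C (rho1 (cof_id C) p)) (cof_dom C C (cof_id C))"
      by (auto simp: cof_id_sel(3,4) restrict_def)
    show "src C (rho1 (cof_id C) (s, x)) = x" if "(s, x) \<in> cof_dom C C (cof_id C)" for s x
      using dom [OF that] by simp
    show "anc (cof_id C) (tgt C (rho1 (cof_id C) (s, x))) = tgt C s"
      if "(s, x) \<in> cof_dom C C (cof_id C)" for s x
      using dom [OF that] by (simp add: cof_id_sel(1))
    show "rho1 (cof_id C) (idt C (anc (cof_id C) x), x) = idt C x" if "x \<in> objs C" for x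
      using val [of "idt C x"] that by (simp add: cof_id_sel(1) src_idt)
    show "rho1 (cof_id C) (cmp C (s, t), x)
        = cmp C (rho1 (cof_id C) (s, tgt C (rho1 (cof_id C) (t, x))), rho1 (cof_id C) (t, x))"
      if st: "(s, t) \<in> cmp_pairs C" and tx: "(t, x) \<in> cof_dom C C (cof_id C)" for s t x
    proof -
      have "x = src C t" "s \<in> arrs C" "t \<in> arrs C" "tgt C t = src C s"
        using st dom [OF tx] by (auto simp: cmp_pairs_iff)
      then show ?thesis
        using val [of t] val [of s] val [of "cmp C (s, t)"] src_cmp [OF st] cmp_closed [OF st] by simp
    qed
    show "compactin (obj C) {x \<in> objs C. anc (cof_id C) x \<in> K}" if "compactin (obj C) K" for K
    proof -
      have "{x \<in> objs C. anc (cof_id C) x \<in> K} = K"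
        using compactin_subset_topspace [OF that] by (auto simp: cof_id_sel)
      with that show ?thesis by simp
    qed
    show "compactin (arr C) (cof_image C C (cof_id C) A) \<and> openin (arr C) (cof_image C C (cof_id C) A)"
      if "A \<in> compact_slices C" for A
      using compact_sliceD [OF that] cof_image_id [OF topological_category_axioms, of A] by simp
    show "rho1 (cof_id C) \<in> extensional (cof_dom C C (cof_id C))" by (simp add: cof_id_sel(3))
  qed (simp_all add: cof_id_sel topological_category_axioms)
qed

lemma cof_id_hom:
  assumes "ample_category C"
  shows "cof_id C \<in> cof_hom i C C"
proof -
  interpret ample_category C by fact
  have "rho1 (cof_id C) (s, src C s) = s \<and> (s, src C s) \<in> cof_dom C C (cof_id C)" if "s \<in> arrs C" for s
  proof -
    have "(s, src C s) \<in> cof_dom C C (cof_id C)" using that by (simp add: cof_dom_id)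
    then show ?thesis by (simp add: cof_id_sel(3))
  qed
  then have "surjective_on_arrows C C (cof_id C)" unfolding surjective_on_arrows_def by blast
  moreover have "injective_on_arrows C C (cof_id C)"
    unfolding injective_on_arrows_def
  proof (intro allI impI, elim conjE)
    fix s t x assume "(s, x) \<in> cof_dom C C (cof_id C)" "(t, x) \<in> cof_dom C C (cof_id C)"
      "rho1 (cof_id C) (s, x) = rho1 (cof_id C) (t, x)"
    then show "s = t" by (simp add: cof_id_sel(3))
  qed
  ultimately show ?thesis using cof_id_cofunctor [OF assms] by (simp add: cof_hom_def)
qed

locale cofunctor_pair = F: ample_cofunctor C D F + G: ample_cofunctor D E G
  for C :: "('a, 'o) topcat" and D :: "('b, 'p) topcat" and E :: "('c, 'q) topcat" and F G
begin

abbreviation "GF \<equiv> cof_comp C E G F"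

lemma comp_sel:
  "anc GF = restrict (\<lambda>x. anc F (anc G x)) (objs E)" "rho0 GF = restrict (\<lambda>x. x) (objs E)"
  "rho1 GF = restrict (\<lambda>(s, x). rho1 G (rho1 F (s, anc G x), x)) (cof_dom C E GF)"
  "act GF = restrict (\<lambda>(s, x). act G (rho1 F (s, anc G x), x)) (cof_dom C E GF)"
  by (simp_all add: cof_comp_def Let_def act_dom_restrict)

lemma dom_comp: "(s, x) \<in> cof_dom C E GF \<longleftrightarrow> x \<in> objs E \<and> (s, anc G x) \<in> cof_dom C D F"
  by (auto simp: act_dom_iff comp_sel(1))

lemma dom_comp':
  assumes "(s, x) \<in> cof_dom C E GF"
  shows "(s, anc G x) \<in> cof_dom C D F" "(rho1 F (s, anc G x), x) \<in> cof_dom D E G" "x \<in> objs E"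
  using assms F.rho_closed F.src_rho by (auto simp: dom_comp) (simp add: act_dom_iff)

lemma rho_comp: "(s, x) \<in> cof_dom C E GF \<Longrightarrow> rho1 GF (s, x) = rho1 G (rho1 F (s, anc G x), x)"
  by (simp add: comp_sel(3))

lemma act_comp: "(s, x) \<in> cof_dom C E GF \<Longrightarrow> act GF (s, x) = act G (rho1 F (s, anc G x), x)"
  by (simp add: comp_sel(4))

text \<open>Functoriality of \<open>slice_map\<close> rests on this, and so does compact openness
  for the composite, where the inner image is again a compact slice.\<close>

lemma cof_image_comp: "cof_image C E GF A = cof_image D E G (cof_image C D F A)"
proof (intro equalityI subsetI)
  fix t assume "t \<in> cof_image C E GF A"
  then obtain s x where s: "s \<in> A" "(s, x) \<in> cof_dom C E GF" "t = rho1 GF (s, x)"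
    by (auto simp: cof_image_def)
  then have "rho1 F (s, anc G x) \<in> cof_image C D F A" "t = rho1 G (rho1 F (s, anc G x), x)"
    using dom_comp' [OF s(2)] rho_comp F.mem_cof_image by auto
  then show "t \<in> cof_image D E G (cof_image C D F A)"
    unfolding G.mem_cof_image using dom_comp'(2) [OF s(2)] by blast
next
  fix t assume "t \<in> cof_image D E G (cof_image C D F A)"
  then obtain p x where p: "p \<in> cof_image C D F A" "(p, x) \<in> cof_dom D E G" "t = rho1 G (p, x)"
    unfolding G.mem_cof_image by blast
  then obtain s y where s: "s \<in> A" "(s, y) \<in> cof_dom C D F" "p = rho1 F (s, y)"
    unfolding F.mem_cof_image by blast
  have "y = anc G x" using p(2) s F.src_rho by (simp add: act_dom_iff)
  then have "(s, x) \<in> cof_dom C E GF" "t = rho1 G (rho1 F (s, anc G x), x)"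
    using p s by (simp_all add: dom_comp) (simp add: act_dom_iff)
  then show "t \<in> cof_image C E GF A"
    using s(1) rho_comp [of s x] unfolding cof_image_def
    by (intro CollectI exI [of _ s] exI [of _ x]) simp
qed

lemma comp_cofunctor: "cofunctor C E GF"
proof (rule cofunctorI)
  show "continuous_map (obj E) (obj C) (anc GF)"
    by (rule continuous_map_eq [OF continuous_map_compose [OF G.anc_continuous F.anc_continuous]])
      (simp add: comp_sel)
  let ?X = "act_top C (obj E) (anc GF)"
  have "continuous_map ?X (obj D) (\<lambda>p. anc G (snd p))"
    using continuous_map_compose [OF continuous_map_snd_act G.anc_continuous] by (simp add: o_def)
  then have 1: "continuous_map ?X (act_top C (obj D) (anc F)) (\<lambda>p. (fst p, anc G (snd p)))"
    by (rule continuous_map_into_act_top [OF continuous_map_fst_act])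
      (auto simp: act_dom_iff comp_sel(1))
  have 2: "continuous_map ?X (arr D) (\<lambda>p. rho1 F (fst p, anc G (snd p)))"
    using continuous_map_compose [OF 1 F.rho_continuous] by (simp add: o_def)
  have 3: "continuous_map ?X (act_top D (obj E) (anc G)) (\<lambda>p. (rho1 F (fst p, anc G (snd p)), snd p))"
    by (rule continuous_map_into_act_top [OF 2 continuous_map_snd_act])
      (use dom_comp' F.src_rho in auto)
  have 4: "continuous_map ?X (arr E) (\<lambda>p. rho1 G (rho1 F (fst p, anc G (snd p)), snd p))"
    using continuous_map_compose [OF 3 G.rho_continuous] by (simp add: o_def)
  show "continuous_map ?X (arr E) (rho1 GF)"
    by (rule continuous_map_eq [OF 4]) (auto simp: rho_comp)
  show "act GF = restrict (\<lambda>p. tgt E (rho1 GF p)) (cof_dom C E GF)"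
  proof (rule extensionalityI [of _ "cof_dom C E GF"])
    show "act GF p = restrict (\<lambda>p. tgt E (rho1 GF p)) (cof_dom C E GF) p" if "p \<in> cof_dom C E GF" for p
      using that
    proof (rule act_dom_induct)
      fix s x assume "(s, x) \<in> cof_dom C E GF"
      then show "act GF (s, x) = restrict (\<lambda>p. tgt E (rho1 GF p)) (cof_dom C E GF) (s, x)"
        using dom_comp' by (simp add: act_comp rho_comp G.tgt_rho)
    qed
  qed (simp_all add: comp_sel(4))
  show "src E (rho1 GF (s, x)) = x" if "(s, x) \<in> cof_dom C E GF" for s x
    using that dom_comp' by (simp add: rho_comp G.src_rho)
  show "anc GF (tgt E (rho1 GF (s, x))) = tgt C s" if sx: "(s, x) \<in> cof_dom C E GF" for s x
  proof -
    note d = dom_comp' [OF sx]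
    have "anc GF (tgt E (rho1 GF (s, x))) = anc F (anc G (act G (rho1 F (s, anc G x), x)))"
      using d sx G.act_closed by (simp add: rho_comp G.tgt_rho comp_sel(1))
    also have "\<dots> = anc F (tgt D (rho1 F (s, anc G x)))" using d G.anc_act by simp
    also have "\<dots> = tgt C s" using d F.tgt_rho F.anc_act by simp
    finally show ?thesis .
  qed
  show "rho1 GF (idt C (anc GF x), x) = idt E x" if "x \<in> objs E" for x
  proof -
    have "(idt C (anc GF x), x) \<in> cof_dom C E GF"
      using that F.idt_dom [of "anc G x"] unfolding dom_comp by (simp add: comp_sel(1))
    then show ?thesis
      using that F.rho_idt [of "anc G x"] G.rho_idt [of x] by (simp add: rho_comp) (simp add: comp_sel(1))
  qed
  show "rho1 GF (cmp C (s, t), x) = cmp E (rho1 GF (s, tgt E (rho1 GF (t, x))), rho1 GF (t, x))"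
    if st: "(s, t) \<in> cmp_pairs C" and tx: "(t, x) \<in> cof_dom C E GF" for s t x
  proof -
    note d = dom_comp' [OF tx]
    let ?r = "rho1 F (t, anc G x)" and ?q = "rho1 F (s, act F (t, anc G x))"
    note c = F.cmp_dom [OF st d(1)]
    have pr: "(?q, ?r) \<in> cmp_pairs D"
      using F.rho_closed c d F.src_rho F.tgt_rho by (simp add: F.D.cmp_pairs_iff)
    have y: "tgt E (rho1 GF (t, x)) = act G (?r, x)" using tx d by (simp add: rho_comp G.tgt_rho)
    \<comment> \<open>The anchor of the moved point is the anchor moved by \<open>F\<close>.
      Therefore \<open>s\<close> acts on the moved point through \<open>?q\<close>, and the functor
      laws of \<open>F\<close> and \<open>G\<close> can be applied in turn.\<close>
    have gy: "anc G (act G (?r, x)) = act F (t, anc G x)"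
      using G.anc_act [OF d(2)] F.tgt_rho [OF d(1)] by simp
    have "(s, act G (?r, x)) \<in> cof_dom C E GF" using c gy G.act_closed [OF d(2)] by (simp add: dom_comp)
    then have 1: "rho1 GF (s, act G (?r, x)) = rho1 G (?q, act G (?r, x))" by (simp add: rho_comp gy)
    have "(cmp C (s, t), x) \<in> cof_dom C E GF" using c d by (simp add: dom_comp)
    then have "rho1 GF (cmp C (s, t), x) = rho1 G (cmp D (?q, ?r), x)"
      using F.rho_cmp [OF st d(1)] by (simp add: rho_comp)
    also have "\<dots> = cmp E (rho1 G (?q, act G (?r, x)), rho1 G (?r, x))" using G.rho_cmp [OF pr d(2)] .
    finally show ?thesis using 1 y tx by (simp add: rho_comp)
  qed
  show "compactin (obj E) {x \<in> objs E. anc GF x \<in> K}" if "compactin (obj C) K" for K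
  proof -
    have "{x \<in> objs E. anc GF x \<in> K} = {x \<in> objs E. anc G x \<in> {y \<in> objs D. anc F y \<in> K}}"
      by (auto simp: comp_sel(1))
    then show ?thesis using G.anc_proper [OF F.anc_proper [OF that]] by simp
  qed
  show "compactin (arr E) (cof_image C E GF A) \<and> openin (arr E) (cof_image C E GF A)"
    if "A \<in> compact_slices C" for A
    unfolding cof_image_comp by (rule G.image_compact_open [OF F.cof_image_slice [OF that]])
  show "rho1 GF \<in> extensional (cof_dom C E GF)" by (simp add: comp_sel(3))
qed (simp_all add: comp_sel F.C.topological_category_axioms G.D.topological_category_axioms)

lemma comp_ample_cofunctor: "ample_cofunctor C E GF"
  using comp_cofunctor by (simp add: ample_cofunctor_def F.C.ample_category_axioms G.D.ample_category_axioms)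

lemma comp_injective:
  assumes "injective_on_arrows C D F" "injective_on_arrows D E G"
  shows "injective_on_arrows C E GF"
  unfolding injective_on_arrows_def
proof (intro allI impI, elim conjE)
  fix s t x assume s: "(s, x) \<in> cof_dom C E GF" and t: "(t, x) \<in> cof_dom C E GF"
    and eq: "rho1 GF (s, x) = rho1 GF (t, x)"
  then have "rho1 F (s, anc G x) = rho1 F (t, anc G x)"
    using assms(2) dom_comp' [OF s] dom_comp' [OF t] rho_comp [OF s] rho_comp [OF t]
    unfolding injective_on_arrows_def by metis
  then show "s = t" using assms(1) dom_comp' [OF s] dom_comp' [OF t]
    unfolding injective_on_arrows_def by blast
qed

lemma comp_surjective:
  assumes "surjective_on_arrows C D F" "surjective_on_arrows D E G"
  shows "surjective_on_arrows C E GF"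
  unfolding surjective_on_arrows_def
proof
  fix t assume t: "t \<in> arrs E"
  then obtain r where r: "(r, src E t) \<in> cof_dom D E G" "rho1 G (r, src E t) = t"
    using assms(2) unfolding surjective_on_arrows_def by blast
  then have sr: "r \<in> arrs D" "src D r = anc G (src E t)" by (auto simp: act_dom_iff)
  then obtain s where s: "(s, src D r) \<in> cof_dom C D F" "rho1 F (s, src D r) = r"
    using assms(1) unfolding surjective_on_arrows_def by blast
  then have "(s, src E t) \<in> cof_dom C E GF" using t sr by (simp add: dom_comp)
  then show "\<exists>s. (s, src E t) \<in> cof_dom C E GF \<and> rho1 GF (s, src E t) = t"
    using r s sr by (intro exI [of _ s]) (simp add: rho_comp)
qed

end

lemma cofunctor_pairI:
  assumes "ample_category C" "ample_category D" "ample_category E" "F \<in> cof_hom i C D" "G \<in> cof_hom i D E"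
  shows "cofunctor_pair C D E F G"
  by (intro cofunctor_pair.intro cof_hom_ample) (use assms in auto)

lemma cof_comp_hom:
  assumes "ample_category C" "ample_category D" "ample_category E" "F \<in> cof_hom i C D" "G \<in> cof_hom i D E"
  shows "cof_comp C E G F \<in> cof_hom i C E"
proof -
  interpret cofunctor_pair C D E F G using cofunctor_pairI [OF assms] .
  show ?thesis
    using comp_cofunctor comp_injective comp_surjective assms(4,5) by (auto simp: cof_hom_def)
qed

lemma ac_category_laws_holds:
  assumes "ample_category C" "ample_category D" "ample_category E" "ample_category B"
  shows "ac_category_laws i C D E B"
  unfolding ac_category_laws_def
proof (intro conjI ballI)
  show "cof_id C \<in> cof_hom i C C" by (rule cof_id_hom) fact
  fix F assume F: "F \<in> cof_hom i C D"
  interpret F: ample_cofunctor C D F using cof_hom_ample assms F by blast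
  interpret FI: cofunctor_pair C C D "cof_id C" F
    using cofunctor_pairI [OF assms(1,1,2) cof_id_hom [OF assms(1)] F] .
  interpret IF: cofunctor_pair C D D F "cof_id D"
    using cofunctor_pairI [OF assms(1,2,2) F cof_id_hom [OF assms(2)]] .
  show "cof_comp C D F (cof_id C) = F"
  proof (rule cofunctor_eqI [OF FI.comp_ample_cofunctor F.ample_cofunctor_axioms])
    show "anc (cof_comp C D F (cof_id C)) x = anc F x" if "x \<in> objs D" for x
      using that by (simp add: FI.comp_sel cof_id_sel)
    show "rho1 (cof_comp C D F (cof_id C)) (s, x) = rho1 F (s, x)"
      if "(s, x) \<in> cof_dom C D (cof_comp C D F (cof_id C))" for s x
      using FI.dom_comp' [OF that] FI.rho_comp [OF that] by (simp add: cof_id_sel(3))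
  qed
  show "cof_comp C D (cof_id D) F = F"
  proof (rule cofunctor_eqI [OF IF.comp_ample_cofunctor F.ample_cofunctor_axioms])
    show "anc (cof_comp C D (cof_id D) F) x = anc F x" if "x \<in> objs D" for x
      using that by (simp add: IF.comp_sel cof_id_sel)
    show "rho1 (cof_comp C D (cof_id D) F) (s, x) = rho1 F (s, x)"
      if "(s, x) \<in> cof_dom C D (cof_comp C D (cof_id D) F)" for s x
      using IF.dom_comp' [OF that] IF.rho_comp [OF that] by (simp add: cof_id_sel(1,3))
  qed
  fix G assume G: "G \<in> cof_hom i D E"
  show "cof_comp C E G F \<in> cof_hom i C E" using cof_comp_hom assms F G by blast
  fix H assume H: "H \<in> cof_hom i E B"
  interpret FG: cofunctor_pair C D E F G using cofunctor_pairI [OF assms(1-3) F G] .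
  interpret GH: cofunctor_pair D E B G H using cofunctor_pairI [OF assms(2-4) G H] .
  interpret FG_H: cofunctor_pair C E B "cof_comp C E G F" H
    using FG.comp_ample_cofunctor GH.G.ample_cofunctor_axioms by (rule cofunctor_pair.intro)
  interpret F_GH: cofunctor_pair C D B F "cof_comp D B H G"
    using F.ample_cofunctor_axioms GH.comp_ample_cofunctor by (rule cofunctor_pair.intro)
  show "cof_comp C B H (cof_comp C E G F) = cof_comp C B (cof_comp D B H G) F"
  proof (rule cofunctor_eqI [OF FG_H.comp_ample_cofunctor F_GH.comp_ample_cofunctor])
    show anc: "anc (cof_comp C B H (cof_comp C E G F)) x = anc (cof_comp C B (cof_comp D B H G) F) x"
      if "x \<in> objs B" for x
      using that by (simp add: FG_H.comp_sel(1) F_GH.comp_sel(1) FG.comp_sel(1) GH.comp_sel(1))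
    show "rho1 (cof_comp C B H (cof_comp C E G F)) (s, x) = rho1 (cof_comp C B (cof_comp D B H G) F) (s, x)"
      if sx: "(s, x) \<in> cof_dom C B (cof_comp C B H (cof_comp C E G F))" for s x
    proof -
      note d = FG_H.dom_comp' [OF sx]
      have sx': "(s, x) \<in> cof_dom C B (cof_comp C B (cof_comp D B H G) F)"
        using sx anc by (simp add: act_dom_iff)
      note d' = F_GH.dom_comp' [OF sx']
      have gx: "anc (cof_comp D B H G) x = anc G (anc H x)" using d by (simp add: GH.comp_sel(1))
      show ?thesis
        unfolding FG_H.rho_comp [OF sx] F_GH.rho_comp [OF sx'] FG.rho_comp [OF d(1)] GH.rho_comp [OF d'(2)]
        by (simp add: gx)
    qed
  qed
qed

lemma slice_functor_laws_holds:
  assumes "ample_category C" "ample_category D" "ample_category E"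
  shows "slice_functor_laws i C D E"
  unfolding slice_functor_laws_def
proof (intro conjI ballI)
  interpret C: ample_category C by fact
  show "slice_map C C (cof_id C) = pbr_id (slice_sg C)"
    using cof_image_id [OF C.topological_category_axioms C.compact_sliceD(4)]
    unfolding slice_map_def pbr_id_def slice_sg_simps by (intro restrict_ext) simp
  fix F assume F: "F \<in> cof_hom i C D"
  show "slice_map C D F \<in> pbr_hom i (slice_sg C) (slice_sg D)" using slice_map_hom assms F by blast
  fix G assume G: "G \<in> cof_hom i D E"
  interpret cofunctor_pair C D E F G using cofunctor_pairI [OF assms F G] .
  show "slice_map C E (cof_comp C E G F) = pbr_comp (slice_sg C) (slice_map D E G) (slice_map C D F)"
    using F.cof_image_slice unfolding slice_map_def compose_def slice_sg_simps
    by (intro restrict_ext) (simp add: cof_image_comp)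
qed

section \<open>The cofunctor of a morphism\<close>

context preBoolean
begin

lemma compact_open_germ:
  assumes "compactin (arr GS) A" "openin (arr GS) A"
  obtains X where "finite X" "X \<subseteq> carrier S" "A = (\<Union>s \<in> X. Theta S s)"
proof -
  have "\<exists>\<F>. finite \<F> \<and> \<F> \<subseteq> Theta S ` {s \<in> carrier S. Theta S s \<subseteq> A} \<and> A \<subseteq> \<Union>\<F>"
  proof (rule compactinD [OF assms(1)])
    show "A \<subseteq> \<Union> (Theta S ` {s \<in> carrier S. Theta S s \<subseteq> A})"
      using assms(2) unfolding openin_arr_germ_iff by blast
  qed auto
  then obtain \<F> where \<F>: "finite \<F>" "\<F> \<subseteq> Theta S ` {s \<in> carrier S. Theta S s \<subseteq> A}" "A \<subseteq> \<Union>\<F>"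
    by auto
  obtain X where "finite X" "X \<subseteq> {s \<in> carrier S. Theta S s \<subseteq> A}" "\<F> = Theta S ` X"
    using finite_subset_image [OF \<F>(1,2)] by (elim exE conjE)
  with \<F>(3) show ?thesis by (intro that [of X]) auto
qed

text \<open>Finitely many basic sets have the basic set of the join of their projections as their
  union, so a compact set of characters fits into a single one.\<close>

lemma compact_cover_chars:
  assumes "compactin CT K"
  obtains e where "e \<in> projs S" "K \<subseteq> char_basic S e"
proof -
  have K: "K \<subseteq> prime_chars S" using compactin_subset_topspace [OF assms] unfolding topspace_CT .
  have "\<exists>\<F>. finite \<F> \<and> \<F> \<subseteq> char_basic S ` projs S \<and> K \<subseteq> \<Union>\<F>"
    by (rule compactinD [OF assms]) (use K char_nonzero in auto)
  then obtain X where X: "finite X" "X \<subseteq> projs S" "K \<subseteq> \<Union>(char_basic S ` X)"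
    by (metis finite_subset_image)
  have "\<exists>e \<in> projs S. \<Union>(char_basic S ` X) \<subseteq> char_basic S e"
    using X(1,2)
  proof induction
    case (insert a X)
    then obtain e where e: "e \<in> projs S" "\<Union>(char_basic S ` X) \<subseteq> char_basic S e" by auto
    have "char_basic S a \<union> char_basic S e = char_basic S (jn S a e)"
      using e insert.prems by (auto simp: char_jn)
    then show ?case using e insert.prems by (intro bexI [of _ "jn S a e"]) auto
  qed auto
  then obtain e where "e \<in> projs S" "\<Union>(char_basic S ` X) \<subseteq> char_basic S e" by blast
  with X(3) have "e \<in> projs S" "K \<subseteq> char_basic S e" by auto
  then show ?thesis by (rule that)
qed

end

locale germ_morphism = S: preBoolean_lu S + T: preBoolean_lu T + pbr_morphism S T f
  for S :: "'s rsg" and T :: "'t rsg" and f :: "'s \<Rightarrow> 't"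
begin

text \<open>The function bound locally inside \<open>germ_cof\<close>: the anchor map before its
  restriction to the prime characters of \<open>T\<close>.\<close>

definition pull :: "('t \<Rightarrow> bool) \<Rightarrow> 's \<Rightarrow> bool" where
  "pull \<psi> = (\<lambda>e \<in> projs S. \<psi> (f e))"

lemma pull_apply: "e \<in> projs S \<Longrightarrow> pull \<psi> e = \<psi> (f e)"
  by (simp add: pull_def)

text \<open>That the pulled back character is non-zero is the role of properness on projections: a
  \<open>q\<close> with \<open>\<psi> q\<close> lies below some \<open>f e\<close>.\<close>

lemma pull_closed:
  assumes "\<psi> \<in> prime_chars T" shows "pull \<psi> \<in> prime_chars S"
  unfolding S.prime_chars_iff
proof (intro conjI ballI)
  obtain q where q: "q \<in> projs T" "\<psi> q" using T.char_nonzero assms by blast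
  then obtain e where "e \<in> projs S" "nle T q (f e)" using f_proper by blast
  then show "\<exists>e \<in> projs S. pull \<psi> e"
    using q T.char_mono [OF assms, of q "f e"] by (intro bexI [of _ e]) (auto simp: pull_apply)
qed (use assms in \<open>auto simp: pull_apply f_mult f_jn f_zero T.char_mult T.char_jn T.char_zero\<close>,
    simp add: pull_def)

lemma pull_star: "s \<in> carrier S \<Longrightarrow> pull \<psi> (s\<^sup>\<star>\<^bsub>S\<^esub>) = \<psi> ((f s)\<^sup>\<star>\<^bsub>T\<^esub>)"
  by (simp add: pull_apply f_star)

lemma pre_germs_pull:
  assumes "\<psi> \<in> prime_chars T"
  shows "(s, pull \<psi>) \<in> pre_germs S \<longleftrightarrow> s \<in> carrier S \<and> (f s, \<psi>) \<in> pre_germs T"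
  using assms pull_closed [OF assms] pull_star by (auto simp: S.pre_germs_iff T.pre_germs_iff)

lemma germ_pull_cong:
  assumes "\<psi> \<in> prime_chars T" "(s, pull \<psi>) \<in> pre_germs S" "(t, pull \<psi>) \<in> pre_germs S"
    "germ S s (pull \<psi>) = germ S t (pull \<psi>)"
  shows "germ T (f s) \<psi> = germ T (f t) \<psi>"
proof -
  obtain e where e: "e \<in> projs S" "pull \<psi> e" "s \<odot>\<^bsub>S\<^esub> e = t \<odot>\<^bsub>S\<^esub> e"
    using S.germ_eq_iff [OF assms(2,3)] assms(4) by blast
  have "f s \<odot>\<^bsub>T\<^esub> f e = f t \<odot>\<^bsub>T\<^esub> f e"
    using e assms by (metis S.pre_germs_iff S.projs_closed f_mult)
  moreover have "(f s, \<psi>) \<in> pre_germs T" "(f t, \<psi>) \<in> pre_germs T"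
    using assms pre_germs_pull by auto
  ultimately show ?thesis
    using e T.germ_eq_iff [of "f s" \<psi> "f t" \<psi>] by (auto simp: pull_apply)
qed

text \<open>Equivariance of the anchor map. It holds because \<open>f\<close> commutes with products
  and stars, hence with the formation of \<open>(e \<odot> t)\<^sup>\<star>\<close>.\<close>

lemma char_act_pull:
  assumes "t \<in> carrier S"
  shows "pull (char_act T (f t) \<psi>) = char_act S t (pull \<psi>)"
proof (rule extensionalityI [OF _ S.char_act_ext])
  fix e assume "e \<in> projs S"
  then show "pull (char_act T (f t) \<psi>) e = char_act S t (pull \<psi>) e"
    using assms by (simp add: pull_apply T.char_act_apply S.char_act_apply f_star flip: f_mult)
qed (simp add: pull_def)

abbreviation "GF \<equiv> germ_cof S T f"
abbreviation "gdom \<equiv> cof_dom (germ_cat S) (germ_cat T) GF"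

lemma anc_germ_cof: "anc GF = restrict pull (prime_chars T)"
  and rho0_germ_cof: "rho0 GF = restrict (\<lambda>\<psi>. \<psi>) (prime_chars T)"
  by (simp_all add: germ_cof_def Let_def pull_def [abs_def])

lemma dom_eq: "gdom = act_dom (germ_cat S) (obj (germ_cat T)) pull"
  by (rule act_dom_cong) (simp add: anc_germ_cof)

lemma dom_germ_iff: "(g, \<psi>) \<in> gdom \<longleftrightarrow>
    \<psi> \<in> prime_chars T \<and> (\<exists>s. (s, pull \<psi>) \<in> pre_germs S \<and> g = germ S s (pull \<psi>))"
  by (auto simp: dom_eq act_dom_iff S.arrs_germ_iff)

lemma dom_germI:
  "\<lbrakk>\<psi> \<in> prime_chars T; (s, pull \<psi>) \<in> pre_germs S\<rbrakk> \<Longrightarrow> (germ S s (pull \<psi>), \<psi>) \<in> gdom"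
  by (auto simp: dom_germ_iff)

lemma rho_germ:
  assumes "\<psi> \<in> prime_chars T" "(s, pull \<psi>) \<in> pre_germs S"
  shows "rho1 GF (germ S s (pull \<psi>), \<psi>) = germ T (f s) \<psi>"
proof -
  have "the_elem {germ T (f t) \<psi> |t. (t, pull \<psi>) \<in> germ S s (pull \<psi>)} = germ T (f s) \<psi>"
  proof (rule the_elem_eqI)
    show "germ T (f s) \<psi> \<in> {germ T (f t) \<psi> |t. (t, pull \<psi>) \<in> germ S s (pull \<psi>)}"
      using S.germ_self [OF assms(2)] by blast
    fix y assume "y \<in> {germ T (f t) \<psi> |t. (t, pull \<psi>) \<in> germ S s (pull \<psi>)}"
    then obtain t where t: "y = germ T (f t) \<psi>" "(t, pull \<psi>) \<in> germ S s (pull \<psi>)" by blast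
    then show "y = germ T (f s) \<psi>"
      using germ_pull_cong [OF assms(1), of t s] assms(2) by (simp add: S.mem_germ_eq)
  qed
  then show ?thesis
    using dom_germI [OF assms] unfolding dom_eq by (simp add: germ_cof_def Let_def pull_def [abs_def])
qed

lemma act_germ:
  assumes "\<psi> \<in> prime_chars T" "(s, pull \<psi>) \<in> pre_germs S"
  shows "act GF (germ S s (pull \<psi>), \<psi>) = char_act T (f s) \<psi>"
proof -
  have "the_elem {char_act T (f t) \<psi> |t. (t, pull \<psi>) \<in> germ S s (pull \<psi>)} = char_act T (f s) \<psi>"
  proof (rule the_elem_eqI)
    show "char_act T (f s) \<psi> \<in> {char_act T (f t) \<psi> |t. (t, pull \<psi>) \<in> germ S s (pull \<psi>)}"
      using S.germ_self [OF assms(2)] by blast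
    fix y assume "y \<in> {char_act T (f t) \<psi> |t. (t, pull \<psi>) \<in> germ S s (pull \<psi>)}"
    then obtain t where t: "y = char_act T (f t) \<psi>" "(t, pull \<psi>) \<in> germ S s (pull \<psi>)" by blast
    then have t': "(t, pull \<psi>) \<in> pre_germs S" "germ S t (pull \<psi>) = germ S s (pull \<psi>)"
      using assms(2) by (simp_all add: S.mem_germ_eq)
    show "y = char_act T (f s) \<psi>"
      unfolding t(1)
      using T.char_act_cong [of "f t" \<psi> "f s"] germ_pull_cong [OF assms(1) t'(1) assms(2) t'(2)]
        t'(1) assms pre_germs_pull [OF assms(1)] by simp
  qed
  then show ?thesis
    using dom_germI [OF assms] unfolding dom_eq by (simp add: germ_cof_def Let_def pull_def [abs_def])
qed

text \<open>This identity yields both that images of compact slices are compact open and that the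
  unit is natural.\<close>

lemma cof_image_Theta:
  assumes "s \<in> carrier S"
  shows "cof_image (germ_cat S) (germ_cat T) GF (Theta S s) = Theta T (f s)"
proof (intro equalityI subsetI)
  fix h assume "h \<in> cof_image (germ_cat S) (germ_cat T) GF (Theta S s)"
  then obtain g \<psi> where g: "h = rho1 GF (g, \<psi>)" "g \<in> Theta S s" "(g, \<psi>) \<in> gdom"
    by (auto simp: cof_image_def)
  then have \<psi>: "\<psi> \<in> prime_chars T" by (simp add: dom_germ_iff)
  obtain t where t: "(t, pull \<psi>) \<in> pre_germs S" "g = germ S t (pull \<psi>)"
    using g(3) by (auto simp: dom_germ_iff)
  then have s: "(s, pull \<psi>) \<in> pre_germs S" "g = germ S s (pull \<psi>)" using g(2) S.germ_in_Theta by auto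
  then show "h \<in> Theta T (f s)"
    using g(1) rho_germ [OF \<psi> s(1)] pre_germs_pull [OF \<psi>] by (auto simp: T.Theta_iff)
next
  fix h assume "h \<in> Theta T (f s)"
  then obtain \<psi> where \<psi>: "(f s, \<psi>) \<in> pre_germs T" "h = germ T (f s) \<psi>" by (auto simp: T.Theta_iff)
  then have p: "\<psi> \<in> prime_chars T" by (simp add: T.pre_germs_iff)
  then have s: "(s, pull \<psi>) \<in> pre_germs S" using pre_germs_pull assms \<psi> by blast
  show "h \<in> cof_image (germ_cat S) (germ_cat T) GF (Theta S s)"
    unfolding cof_image_def using rho_germ [OF p s] dom_germI [OF p s] s \<psi>
    by (intro CollectI exI [of _ "germ S s (pull \<psi>)"] exI [of _ \<psi>]) (auto simp: S.Theta_iff)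
qed

lemma germ_cof_cofunctor: "cofunctor (germ_cat S) (germ_cat T) GF"
proof (rule cofunctorI)
  show anc: "continuous_map (obj (germ_cat T)) (obj (germ_cat S)) (anc GF)"
    unfolding S.germ_cat_sel
  proof (rule continuous_on_generated_topo)
    fix U assume "U \<in> char_basic S ` projs S"
    then obtain e where e: "e \<in> projs S" "U = char_basic S e" by blast
    then have "anc GF -` U \<inter> objs (germ_cat T) = char_basic T (f e)"
      using pull_closed by (auto simp: anc_germ_cof pull_apply)
    then show "openin (obj (germ_cat T)) (anc GF -` U \<inter> objs (germ_cat T))"
      using e by (simp add: T.germ_cat_sel)
  next
    have "anc GF ` objs (germ_cat T) \<subseteq> topspace (topology_generated_by (char_basic S ` projs S))"
      unfolding S.topspace_CT using pull_closed by (auto simp: anc_germ_cof)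
    then show "anc GF ` objs (germ_cat T) \<subseteq> \<Union> (char_basic S ` projs S)" by simp
  qed
  let ?X = "act_top (germ_cat S) (obj (germ_cat T)) (anc GF)"
  show "continuous_map ?X (arr (germ_cat T)) (rho1 GF)"
    unfolding T.germ_cat_sel(2)
  proof (rule continuous_on_generated_topo)
    show "rho1 GF ` topspace ?X \<subseteq> \<Union> (Theta T ` carrier T)"
    proof (rule image_subsetI)
      fix p assume "p \<in> topspace ?X"
      then obtain g \<psi> where p: "p = (g, \<psi>)" "(g, \<psi>) \<in> gdom" by (cases p) auto
      then obtain s where s: "\<psi> \<in> prime_chars T" "(s, pull \<psi>) \<in> pre_germs S" "g = germ S s (pull \<psi>)"
        by (auto simp: dom_germ_iff)
      then have "rho1 GF p \<in> Theta T (f s)" "f s \<in> carrier T"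
        using rho_germ pre_germs_pull p by (auto simp: T.Theta_iff S.pre_germs_iff)
      then show "rho1 GF p \<in> \<Union> (Theta T ` carrier T)" by blast
    qed
    fix U assume "U \<in> Theta T ` carrier T"
    then obtain t where t: "t \<in> carrier T" "U = Theta T t" by blast
    show "openin ?X (rho1 GF -` U \<inter> topspace ?X)"
    proof (subst openin_subopen, intro ballI)
      fix p assume p: "p \<in> rho1 GF -` U \<inter> topspace ?X"
      then obtain g \<psi> where g: "p = (g, \<psi>)" "(g, \<psi>) \<in> gdom" by (cases p) auto
      then obtain s where s: "\<psi> \<in> prime_chars T" "(s, pull \<psi>) \<in> pre_germs S" "g = germ S s (pull \<psi>)"
        by (auto simp: dom_germ_iff)
      have sc: "s \<in> carrier S" using s by (simp add: S.pre_germs_iff)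
      have fs: "(f s, \<psi>) \<in> pre_germs T" using pre_germs_pull s by blast
      have "germ T (f s) \<psi> \<in> Theta T t" using p g s t rho_germ by auto
      then have tg: "(t, \<psi>) \<in> pre_germs T" "germ T (f s) \<psi> = germ T t \<psi>" using T.germ_in_Theta [OF fs] by auto
      then obtain e where e: "e \<in> projs T" "\<psi> e" "f s \<odot>\<^bsub>T\<^esub> e = t \<odot>\<^bsub>T\<^esub> e"
        using T.germ_eq_iff [OF fs tg(1)] by blast
      \<comment> \<open>For pairs in this neighbourhood the germ is represented by \<open>s\<close>,
        and \<open>f s\<close> agrees with \<open>t\<close> on \<open>e\<close>; so the value stays
        in \<open>Theta T t\<close>.\<close>
      let ?N = "gdom \<inter> Theta S s \<times> char_basic T (e \<odot>\<^bsub>T\<^esub> t\<^sup>\<star>\<^bsub>T\<^esub>)"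
      have "openin ?X ?N"
        unfolding act_top_def using sc e t
        by (intro openin_subtopology_Int2)
          (auto simp: openin_prod_Times_iff T.germ_cat_sel(1))
      moreover have "p \<in> ?N"
        using g s e tg by (auto simp: S.Theta_iff T.pre_germs_iff T.char_mult)
      moreover have "?N \<subseteq> rho1 GF -` U \<inter> topspace ?X"
      proof
        fix q assume q: "q \<in> ?N"
        obtain h \<theta> where h: "q = (h, \<theta>)" by (cases q)
        then have \<theta>: "(h, \<theta>) \<in> gdom" "h \<in> Theta S s" "\<theta> \<in> prime_chars T" "\<theta> e" "\<theta> (t\<^sup>\<star>\<^bsub>T\<^esub>)"
          using q e t by (auto simp: T.char_mult)
        then obtain s' where s': "(s', pull \<theta>) \<in> pre_germs S" "h = germ S s' (pull \<theta>)"
          by (auto simp: dom_germ_iff)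
        then have sh: "(s, pull \<theta>) \<in> pre_germs S" "h = germ S s (pull \<theta>)"
          using \<theta>(2) S.germ_in_Theta by auto
        have f1: "(f s, \<theta>) \<in> pre_germs T" "(t, \<theta>) \<in> pre_germs T"
          using pre_germs_pull [OF \<theta>(3)] sh t \<theta> by (auto simp: T.pre_germs_iff)
        then have "germ T (f s) \<theta> = germ T t \<theta>" using T.germ_eq_iff [OF f1] e \<theta> by blast
        then have "rho1 GF (h, \<theta>) \<in> Theta T t"
          using rho_germ [OF \<theta>(3) sh(1)] sh f1 by (auto simp: T.Theta_iff)
        then show "q \<in> rho1 GF -` U \<inter> topspace ?X" using h q t by auto
      qed
      ultimately show "\<exists>N. openin ?X N \<and> p \<in> N \<and> N \<subseteq> rho1 GF -` U \<inter> topspace ?X" by blast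
    qed
  qed
  have sc: "s \<in> carrier S" if "(s, \<phi>) \<in> pre_germs S" for s \<phi>
    using that by (simp add: S.pre_germs_iff)
  have val: "rho1 GF (germ S s (pull \<psi>), \<psi>) = germ T (f s) \<psi>" "(f s, \<psi>) \<in> pre_germs T"
      "act GF (germ S s (pull \<psi>), \<psi>) = char_act T (f s) \<psi>"
    if "\<psi> \<in> prime_chars T" "(s, pull \<psi>) \<in> pre_germs S" for s \<psi>
    using that rho_germ act_germ pre_germs_pull by auto
  show "act GF = restrict (\<lambda>p. tgt (germ_cat T) (rho1 GF p)) gdom"
  proof (rule extensionalityI [of _ gdom])
    show "act GF \<in> extensional gdom"
      unfolding dom_eq by (simp add: germ_cof_def Let_def pull_def [abs_def])
    show "act GF p = restrict (\<lambda>p. tgt (germ_cat T) (rho1 GF p)) gdom p" if "p \<in> gdom" for p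
      using that
    proof (rule act_dom_induct)
      fix g \<psi> assume d: "(g, \<psi>) \<in> gdom"
      then obtain s where s: "\<psi> \<in> prime_chars T" "(s, pull \<psi>) \<in> pre_germs S" "g = germ S s (pull \<psi>)"
        by (auto simp: dom_germ_iff)
      show "act GF (g, \<psi>) = restrict (\<lambda>p. tgt (germ_cat T) (rho1 GF p)) gdom (g, \<psi>)"
        using d val [OF s(1,2)] s(3) by simp
    qed
  qed simp
  show "src (germ_cat T) (rho1 GF (g, \<psi>)) = \<psi>" if "(g, \<psi>) \<in> gdom" for g \<psi>
    using that val by (auto simp: dom_germ_iff)
  show "anc GF (tgt (germ_cat T) (rho1 GF (g, \<psi>))) = tgt (germ_cat S) g" if d: "(g, \<psi>) \<in> gdom" for g \<psi>
  proof -
    obtain s where s: "\<psi> \<in> prime_chars T" "(s, pull \<psi>) \<in> pre_germs S" "g = germ S s (pull \<psi>)"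
      using d by (auto simp: dom_germ_iff)
    then show ?thesis
      using val [OF s(1,2)] T.char_act_closed sc by (simp add: anc_germ_cof char_act_pull)
  qed
  show "rho1 GF (idt (germ_cat S) (anc GF \<psi>), \<psi>) = idt (germ_cat T) \<psi>"
    if "\<psi> \<in> objs (germ_cat T)" for \<psi>
  proof -
    have \<psi>: "\<psi> \<in> prime_chars T" using that by simp
    obtain e where e: "e \<in> projs S" "pull \<psi> e" using S.char_nonzero pull_closed [OF \<psi>] by blast
    have "idt (germ_cat S) (pull \<psi>) = germ S e (pull \<psi>)" using e pull_closed [OF \<psi>] by (intro S.idt_germ)
    moreover have "idt (germ_cat T) \<psi> = germ T (f e) \<psi>" using e \<psi> by (intro T.idt_germ) (auto simp: pull_apply)
    moreover have "(e, pull \<psi>) \<in> pre_germs S" using e pull_closed [OF \<psi>] by (simp add: S.pre_germs_proj)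
    ultimately show ?thesis using val \<psi> by (simp add: anc_germ_cof)
  qed
  show "rho1 GF (cmp (germ_cat S) (g, h), \<psi>)
      = cmp (germ_cat T) (rho1 GF (g, tgt (germ_cat T) (rho1 GF (h, \<psi>))), rho1 GF (h, \<psi>))"
    if gh: "(g, h) \<in> cmp_pairs (germ_cat S)" and d: "(h, \<psi>) \<in> gdom" for g h \<psi>
  proof -
    obtain t where t: "\<psi> \<in> prime_chars T" "(t, pull \<psi>) \<in> pre_germs S" "h = germ S t (pull \<psi>)"
      using d by (auto simp: dom_germ_iff)
    obtain s where s: "(s, char_act S t (pull \<psi>)) \<in> pre_germs S" "g = germ S s (char_act S t (pull \<psi>))"
    proof -
      have "g \<in> arrs (germ_cat S)" "src (germ_cat S) g = tgt (germ_cat S) h"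
        using gh by (auto simp: cmp_pairs_def)
      then show ?thesis using that t(2,3) unfolding S.arrs_germ_iff by auto
    qed
    let ?\<theta> = "char_act T (f t) \<psi>"
    have \<theta>: "?\<theta> \<in> prime_chars T" "pull ?\<theta> = char_act S t (pull \<psi>)"
      using val(2) [OF t(1,2)] T.char_act_closed char_act_pull sc t by auto
    have s': "(s, pull ?\<theta>) \<in> pre_germs S" using s \<theta> by simp
    have "rho1 GF (g, ?\<theta>) = germ T (f s) ?\<theta>" using val(1) [OF \<theta>(1) s'] s \<theta> by simp
    moreover have "cmp (germ_cat S) (g, h) = germ S (s \<odot>\<^bsub>S\<^esub> t) (pull \<psi>)"
      using S.cmp_germ [OF s(1) t(2)] s t by simp
    moreover have "rho1 GF (germ S (s \<odot>\<^bsub>S\<^esub> t) (pull \<psi>), \<psi>) = germ T (f s \<odot>\<^bsub>T\<^esub> f t) \<psi>"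
      using val(1) [OF t(1) S.pre_germs_mult [OF s(1) t(2)]] sc s t f_mult by simp
    moreover have "cmp (germ_cat T) (germ T (f s) ?\<theta>, germ T (f t) \<psi>) = germ T (f s \<odot>\<^bsub>T\<^esub> f t) \<psi>"
      using val(2) [OF \<theta>(1) s'] val(2) [OF t(1,2)] by (intro T.cmp_germ)
    ultimately show ?thesis using t val(1) [OF t(1,2)] val(2) [OF t(1,2)] by simp
  qed
  show "compactin (obj (germ_cat T)) {\<psi> \<in> objs (germ_cat T). anc GF \<psi> \<in> K}"
    if K: "compactin (obj (germ_cat S)) K" for K
  proof -
    \<comment> \<open>The preimage of \<open>K\<close> is closed by continuity and contained in the
      compact set \<open>char_basic T (f e)\<close>, hence compact.\<close>
    obtain e where e: "e \<in> projs S" "K \<subseteq> char_basic S e"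
      using S.compact_cover_chars K unfolding S.germ_cat_sel by blast
    have "closedin (obj (germ_cat S)) K"
      using K compactin_imp_closedin S.Hausdorff_CT unfolding S.germ_cat_sel by blast
    then have cl: "closedin (obj (germ_cat T)) {\<psi> \<in> objs (germ_cat T). anc GF \<psi> \<in> K}"
      using anc closedin_continuous_map_preimage by blast
    have "{\<psi> \<in> objs (germ_cat T). anc GF \<psi> \<in> K} \<subseteq> char_basic T (f e)"
      using e by (auto simp: anc_germ_cof pull_apply subset_iff)
    moreover have "compactin (obj (germ_cat T)) (char_basic T (f e))" using e by (simp add: T.germ_cat_sel)
    ultimately show ?thesis using cl closed_compactin by blast
  qed
  show "compactin (arr (germ_cat T)) (cof_image (germ_cat S) (germ_cat T) GF A)
      \<and> openin (arr (germ_cat T)) (cof_image (germ_cat S) (germ_cat T) GF A)"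
    if "A \<in> compact_slices (germ_cat S)" for A
  proof -
    obtain X where X: "finite X" "X \<subseteq> carrier S" "A = (\<Union>s \<in> X. Theta S s)"
    proof (rule S.compact_open_germ)
      show "compactin (arr (germ_cat S)) A" "openin (arr (germ_cat S)) A"
        using \<open>A \<in> compact_slices (germ_cat S)\<close> by (simp_all add: compact_slices_def slice_def)
    qed
    have "cof_image (germ_cat S) (germ_cat T) GF A
        = (\<Union>s \<in> X. cof_image (germ_cat S) (germ_cat T) GF (Theta S s))"
      unfolding X(3) cof_image_def by blast
    also have "\<dots> = (\<Union>s \<in> X. Theta T (f s))" using X(2) cof_image_Theta by (intro SUP_cong) auto
    finally have eq: "cof_image (germ_cat S) (germ_cat T) GF A = (\<Union>s \<in> X. Theta T (f s))" .
    have "compactin (arr (germ_cat T)) (\<Union>s \<in> X. Theta T (f s))"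
      using X by (intro compactin_Union) auto
    moreover have "openin (arr (germ_cat T)) (\<Union>s \<in> X. Theta T (f s))"
      using X by (intro openin_Union) auto
    ultimately show ?thesis unfolding eq by blast
  qed
  show "rho1 GF \<in> extensional gdom"
    unfolding dom_eq by (simp add: germ_cof_def Let_def pull_def [abs_def])
qed (simp_all add: anc_germ_cof rho0_germ_cof S.topological_category_germ T.topological_category_germ)

lemma germ_cof_ample: "ample_cofunctor (germ_cat S) (germ_cat T) GF"
  using germ_cof_cofunctor S.ample_germ T.ample_germ by (simp add: ample_cofunctor_def)

text \<open>If \<open>f s\<close> and \<open>f t\<close> have the same germ at \<psi>, they have a
  common lower bound \<open>u\<close> whose star lies in the support of \<psi>. Weak meet
  preservation gives \<open>v\<close> below \<open>s\<close> and \<open>t\<close> with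
  \<open>f v\<close> above \<open>u\<close>, and the germ of \<open>v\<close> is that of
  \<open>s\<close> and of \<open>t\<close>.\<close>

lemma germ_cof_injective:
  assumes "weakly_meet_preserving S T f"
  shows "injective_on_arrows (germ_cat S) (germ_cat T) GF"
  unfolding injective_on_arrows_def
proof (intro allI impI, elim conjE)
  fix g h \<psi> assume "(g, \<psi>) \<in> gdom" "(h, \<psi>) \<in> gdom" and eq: "rho1 GF (g, \<psi>) = rho1 GF (h, \<psi>)"
  then obtain s t where *: "\<psi> \<in> prime_chars T" "(s, pull \<psi>) \<in> pre_germs S" "g = germ S s (pull \<psi>)"
    "(t, pull \<psi>) \<in> pre_germs S" "h = germ S t (pull \<psi>)" by (auto simp: dom_germ_iff)
  then have fs: "(f s, \<psi>) \<in> pre_germs T" "(f t, \<psi>) \<in> pre_germs T" using pre_germs_pull by auto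
  have "germ T (f s) \<psi> = germ T (f t) \<psi>" using eq * rho_germ by simp
  then have "((f s, \<psi>), (f t, \<psi>)) \<in> germ_rel T"
    using T.germ_eq_iff [OF fs] fs by (simp add: T.germ_rel_iff)
  then obtain u where u: "u \<in> carrier T" "nle T u (f s)" "nle T u (f t)" "\<psi> (u\<^sup>\<star>\<^bsub>T\<^esub>)"
    by (auto simp: germ_rel_def)
  have c: "s \<in> carrier S" "t \<in> carrier S" using * by (auto simp: S.pre_germs_iff)
  obtain v where v: "v \<in> carrier S" "nle S v s" "nle S v t" "nle T u (f v)"
    using assms u c unfolding weakly_meet_preserving_def by blast
  have "\<psi> ((f v)\<^sup>\<star>\<^bsub>T\<^esub>)" using T.char_le_star [OF *(1) v(4)] u v by simp
  then have "(v, pull \<psi>) \<in> pre_germs S" using v * pull_closed pull_star by (simp add: S.pre_germs_iff)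
  then show "g = h"
    using S.pre_germs_le(2) [OF v(2) _ c(1)] S.pre_germs_le(2) [OF v(3) _ c(2)] * by simp
qed

text \<open>A germ of \<open>t\<close> is a germ of one of the finitely many pieces that have
  \<open>t\<close> as their join. This piece lies below some \<open>f s\<close>, so the germ is one
  of \<open>f s\<close>.\<close>

lemma germ_cof_surjective:
  assumes "proper_mor S T f"
  shows "surjective_on_arrows (germ_cat S) (germ_cat T) GF"
  unfolding surjective_on_arrows_def
proof
  fix h assume "h \<in> arrs (germ_cat T)"
  then obtain t \<psi> where t: "(t, \<psi>) \<in> pre_germs T" "h = germ T t \<psi>" by (auto simp: T.arrs_germ_iff)
  then have tc: "t \<in> carrier T" and \<psi>: "\<psi> \<in> prime_chars T" by (auto simp: T.pre_germs_iff)
  obtain X where X: "finite X" "is_join T X t" "\<And>x. x \<in> X \<Longrightarrow> \<exists>s \<in> carrier S. nle T x (f s)"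
    using assms tc proper_mor_iff [OF pbr_morphism_axioms] by meson
  have "\<exists>x \<in> X. germ T t \<psi> \<in> Theta T x"
  proof -
    have "germ T t \<psi> \<in> Theta T t" using t(1) by (auto simp: T.Theta_iff)
    then show ?thesis unfolding T.Theta_fin_join [OF X(1,2)] by blast
  qed
  then obtain x where x: "x \<in> X" "(x, \<psi>) \<in> pre_germs T" "h = germ T x \<psi>"
    using T.germ_in_Theta [OF t(1)] t by auto
  obtain s where s: "s \<in> carrier S" "nle T x (f s)" using X(3) x by blast
  have fs: "(f s, \<psi>) \<in> pre_germs T" "germ T (f s) \<psi> = h"
    using T.pre_germs_le [OF s(2) x(2)] s x by auto
  then have sp: "(s, pull \<psi>) \<in> pre_germs S" using pre_germs_pull [OF \<psi>] s by blast
  have "src (germ_cat T) h = \<psi>" using t by simp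
  then show "\<exists>g. (g, src (germ_cat T) h) \<in> gdom \<and> rho1 GF (g, src (germ_cat T) h) = h"
    using dom_germI [OF \<psi> sp] rho_germ [OF \<psi> sp] fs by auto
qed

end

lemma germ_morphismI:
  assumes "preBoolean_lu S" "preBoolean_lu T" "f \<in> pbr_hom i S T"
  shows "germ_morphism S T f"
proof -
  interpret S: preBoolean_lu S by fact
  interpret T: preBoolean_lu T by fact
  show ?thesis
    using pbr_hom_morphism [OF S.preBoolean_axioms T.preBoolean_axioms assms(3)] assms(1,2)
    by (simp add: germ_morphism_def)
qed

lemma germ_cof_hom:
  assumes "preBoolean_lu S" "preBoolean_lu T" "f \<in> pbr_hom i S T"
  shows "germ_cof S T f \<in> cof_hom i (germ_cat S) (germ_cat T)"
proof -
  interpret germ_morphism S T f using germ_morphismI [OF assms] .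
  show ?thesis
    using assms(3) germ_cof_cofunctor germ_cof_injective germ_cof_surjective
    by (auto simp: cof_hom_def pbr_hom_def)
qed

lemma pbr_id_apply: "s \<in> carrier S \<Longrightarrow> pbr_id S s = s"
  by (simp add: pbr_id_def)

lemma germ_functor_laws_holds:
  assumes "preBoolean_lu S" "preBoolean_lu T" "preBoolean_lu U"
  shows "germ_functor_laws i S T U"
  unfolding germ_functor_laws_def
proof (intro conjI ballI)
  interpret S: preBoolean_lu S by fact
  interpret T: preBoolean_lu T by fact
  interpret U: preBoolean_lu U by fact
  have id: "pbr_id S \<in> pbr_hom i S S" by (rule pbr_id_hom) (rule S.preBoolean_axioms)
  interpret I: germ_morphism S S "pbr_id S" using germ_morphismI [OF assms(1,1) id] .
  have Ip: "I.pull \<psi> = \<psi>" if "\<psi> \<in> prime_chars S" for \<psi>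
    unfolding I.pull_def
    by (rule extensionalityI [OF _ S.char_ext [OF that]]) (auto simp: pbr_id_def)
  show "germ_cof S S (pbr_id S) = cof_id (germ_cat S)"
  proof (rule cofunctor_eqI [OF I.germ_cof_ample])
    show "ample_cofunctor (germ_cat S) (germ_cat S) (cof_id (germ_cat S))"
      using cof_id_cofunctor [OF S.ample_germ] S.ample_germ by (simp add: ample_cofunctor_def)
    show "anc (germ_cof S S (pbr_id S)) \<psi> = anc (cof_id (germ_cat S)) \<psi>" if "\<psi> \<in> objs (germ_cat S)" for \<psi>
      using that by (simp add: I.anc_germ_cof cof_id_sel Ip)
    fix g \<psi> assume d: "(g, \<psi>) \<in> I.gdom"
    then obtain s where s: "\<psi> \<in> prime_chars S" "(s, \<psi>) \<in> pre_germs S" "g = germ S s \<psi>"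
      by (auto simp: I.dom_germ_iff Ip)
    then have "rho1 (germ_cof S S (pbr_id S)) (g, \<psi>) = g"
      using I.rho_germ [of \<psi> s] Ip [OF s(1)] by (simp add: pbr_id_apply S.pre_germs_iff)
    moreover have "rho1 (cof_id (germ_cat S)) (g, \<psi>) = g"
      using s by (simp add: cof_id_sel(3) cof_dom_id)
    ultimately show "rho1 (germ_cof S S (pbr_id S)) (g, \<psi>) = rho1 (cof_id (germ_cat S)) (g, \<psi>)" by simp
  qed
  fix f assume f: "f \<in> pbr_hom i S T"
  show "germ_cof S T f \<in> cof_hom i (germ_cat S) (germ_cat T)" using germ_cof_hom assms f by blast
  fix g assume g: "g \<in> pbr_hom i T U"
  have h: "pbr_comp S g f \<in> pbr_hom i S U"
    using pbr_comp_hom [OF S.preBoolean_axioms T.preBoolean_axioms U.preBoolean_axioms f g] .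
  interpret f: germ_morphism S T f using germ_morphismI assms f by blast
  interpret g: germ_morphism T U g using germ_morphismI assms g by blast
  interpret h: germ_morphism S U "pbr_comp S g f" using germ_morphismI assms h by blast
  interpret P: cofunctor_pair "germ_cat S" "germ_cat T" "germ_cat U" "germ_cof S T f" "germ_cof T U g"
    by (intro cofunctor_pair.intro f.germ_cof_ample g.germ_cof_ample)
  have pull: "h.pull \<psi> = f.pull (g.pull \<psi>)" for \<psi>
    unfolding h.pull_def f.pull_def
    by (intro restrict_ext) (simp add: g.pull_def compose_def)
  show "germ_cof S U (pbr_comp S g f)
      = cof_comp (germ_cat S) (germ_cat U) (germ_cof T U g) (germ_cof S T f)"
  proof (rule cofunctor_eqI [OF h.germ_cof_ample P.comp_ample_cofunctor])
    show "anc (germ_cof S U (pbr_comp S g f)) \<psi> = anc P.GF \<psi>" if "\<psi> \<in> objs (germ_cat U)" for \<psi>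
      using that g.pull_closed
      by (simp add: h.anc_germ_cof P.comp_sel f.anc_germ_cof g.anc_germ_cof pull)
    fix k \<psi> assume "(k, \<psi>) \<in> h.gdom"
    then obtain s where s: "\<psi> \<in> prime_chars U" "(s, h.pull \<psi>) \<in> pre_germs S" "k = germ S s (h.pull \<psi>)"
      by (auto simp: h.dom_germ_iff)
    have gp: "g.pull \<psi> \<in> prime_chars T" using g.pull_closed s by blast
    have s1: "(s, f.pull (g.pull \<psi>)) \<in> pre_germs S" using s pull by simp
    have s2: "(f s, g.pull \<psi>) \<in> pre_germs T" using f.pre_germs_pull [OF gp] s1 by blast
    have ag: "anc (germ_cof T U g) \<psi> = g.pull \<psi>" using s by (simp add: g.anc_germ_cof)
    have dk: "(k, \<psi>) \<in> cof_dom (germ_cat S) (germ_cat U) P.GF"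
      unfolding P.dom_comp ag using f.dom_germI [OF gp s1] s pull by simp
    have "rho1 P.GF (k, \<psi>) = germ U (g (f s)) \<psi>"
      unfolding P.rho_comp [OF dk] ag
      using f.rho_germ [OF gp s1] g.rho_germ [OF s(1) s2] s pull by simp
    moreover have "rho1 (germ_cof S U (pbr_comp S g f)) (k, \<psi>) = germ U (g (f s)) \<psi>"
      using h.rho_germ [OF s(1,2)] s by (simp add: compose_def S.pre_germs_iff)
    ultimately show "rho1 (germ_cof S U (pbr_comp S g f)) (k, \<psi>) = rho1 P.GF (k, \<psi>)" by simp
  qed
qed

section \<open>Unit and counit\<close>

context preBoolean_lu
begin

lemma unit_apply: "s \<in> carrier S \<Longrightarrow> unit S s = Theta S s"
  by (simp add: unit_def)

lemma unit_mor: "pbr_mor S (slice_sg GS) (unit S)"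
proof -
  interpret G: ample_category GS by (rule ample_germ)
  have proj: "Theta S e \<in> projs (slice_sg GS)" if "e \<in> projs S" for e
  proof -
    have "Theta S e = (Theta S e)\<^sup>\<star>\<^bsub>slice_sg GS\<^esub>"
      using that Theta_star [of e] by simp
    then show ?thesis using that Theta_compact_slice [of e] unfolding projs_def by auto
  qed
  show ?thesis
  proof (rule pbr_morI)
    show "unit S \<in> carrier S \<rightarrow>\<^sub>E carrier (slice_sg GS)"
      using Theta_compact_slice by (auto simp: unit_def)
    show "unit S (x \<odot> y) = unit S x \<odot>\<^bsub>slice_sg GS\<^esub> unit S y"
      if "x \<in> carrier S" "y \<in> carrier S" for x y
      using that Theta_mult [of x y] by (simp add: unit_apply G.sm_def)
    show "unit S (x\<^sup>\<star>) = (unit S x)\<^sup>\<star>\<^bsub>slice_sg GS\<^esub>" if "x \<in> carrier S" for x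
      using that Theta_star [of x] by (simp add: unit_apply)
    show "unit S (jn S e g) = jn (slice_sg GS) (unit S e) (unit S g)"
      if "e \<in> projs S" "g \<in> projs S" for e g
      using that Theta_fin_join [OF _ is_join_jn [OF that]] proj by (simp add: unit_apply G.jn_slice)
    show "unit S (zero_of S) = zero_of (slice_sg GS)"
      by (simp add: unit_apply Theta_zero G.zero_slice)
    fix Q assume Q: "Q \<in> projs (slice_sg GS)"
    then obtain U where U: "G.co U" "Q = idt GS ` U" unfolding G.projs_slice_sg by blast
    \<comment> \<open>Properness on projections: the compact set \<open>U\<close> of characters is
      contained in one basic set, which puts \<open>Q\<close> inside
      \<open>Theta S e\<close>.\<close>
    obtain e where e: "e \<in> projs S" "U \<subseteq> char_basic S e"
      using compact_cover_chars [of U] G.coD(1) [OF U(1)] unfolding germ_cat_sel by blast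
    have "Q \<subseteq> Theta S e"
    proof
      fix g assume "g \<in> Q"
      then obtain \<phi> where "\<phi> \<in> U" "g = idt GS \<phi>" using U by blast
      then show "g \<in> Theta S e"
        using e idt_germ [of e \<phi>] by (auto simp: Theta_iff pre_germs_proj subset_iff)
    qed
    then show "\<exists>e \<in> projs S. nle (slice_sg GS) Q (unit S e)"
      using e Q G.nle_slice_iff [of Q "Theta S e"] Theta_compact_slice [of e] G.SG.projs_closed [OF Q]
      by (intro bexI [of _ e]) (auto simp: unit_apply)
  qed (rule preBoolean_axioms G.preBoolean_slice)+
qed

text \<open>\<open>A\<close> is covered by sets \<open>Theta S u\<close> with \<open>u\<close> below
  \<open>s\<close> and \<open>t\<close>, by the definition of a germ. Finitely many suffice; their
  elements have a join because \<open>s\<close> bounds them, and the join still lies below both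
  \<open>s\<close> and \<open>t\<close>.\<close>

lemma unit_weakly_meet_preserving: "weakly_meet_preserving S (slice_sg GS) (unit S)"
  unfolding weakly_meet_preserving_def
proof (intro ballI impI)
  interpret G: ample_category GS by (rule ample_germ)
  fix s t A assume st: "s \<in> carrier S" "t \<in> carrier S" and "A \<in> carrier (slice_sg GS)"
    and le: "nle (slice_sg GS) A (unit S s) \<and> nle (slice_sg GS) A (unit S t)"
  then have A: "A \<in> compact_slices GS" by simp
  note a = G.compact_sliceD [OF A]
  have sub: "A \<subseteq> Theta S s" "A \<subseteq> Theta S t"
    using le A st Theta_compact_slice by (auto simp: unit_apply G.nle_slice_iff)
  let ?W = "{u \<in> carrier S. u \<preceq> s \<and> u \<preceq> t}"
  have "\<exists>\<F>. finite \<F> \<and> \<F> \<subseteq> Theta S ` ?W \<and> A \<subseteq> \<Union>\<F>"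
  proof (rule compactinD [OF a(3)])
    show "A \<subseteq> \<Union>(Theta S ` ?W)"
    proof
      fix g assume g: "g \<in> A"
      then obtain \<phi> where \<phi>: "(s, \<phi>) \<in> pre_germs S" "g = germ S s \<phi>" using sub(1) unfolding Theta_iff subset_iff by blast
      then have "(t, \<phi>) \<in> pre_germs S" "germ S s \<phi> = germ S t \<phi>"
        using g sub(2) germ_in_Theta [OF \<phi>(1), of t] by auto
      then have "((s, \<phi>), (t, \<phi>)) \<in> germ_rel S"
        using germ_eq_iff [OF \<phi>(1)] \<phi>(1) by (simp add: germ_rel_iff)
      then obtain u where u: "u \<in> carrier S" "u \<preceq> s" "u \<preceq> t" "\<phi> (u\<^sup>\<star>)" by (auto simp: germ_rel_def)
      then have p: "(u, \<phi>) \<in> pre_germs S" using \<phi> by (simp add: pre_germs_iff)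
      then have "g \<in> Theta S u" using pre_germs_le(2) [OF u(2) p st(1)] \<phi> by (auto simp: Theta_iff)
      then show "g \<in> \<Union>(Theta S ` ?W)" using u by blast
    qed
  qed auto
  then obtain \<F> where \<F>: "finite \<F>" "\<F> \<subseteq> Theta S ` ?W" "A \<subseteq> \<Union>\<F>" by blast
  obtain X where X: "X \<subseteq> ?W" "finite X" "\<F> = Theta S ` X"
    using finite_subset_image [OF \<F>(1,2)] by (elim exE conjE)
  obtain v where v: "is_join S X v" using fin_join_exists [OF X(2), of s] X(1) st by auto
  have "v \<preceq> s" "v \<preceq> t" using is_joinD(4) [OF v] X(1) st by auto
  moreover have "A \<subseteq> Theta S v" using \<F>(3) X(3) Theta_fin_join [OF X(2) v] by simp
  ultimately show "\<exists>v \<in> carrier S. v \<preceq> s \<and> v \<preceq> t \<and> nle (slice_sg GS) A (unit S v)"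
    using is_joinD(2) [OF v] A Theta_compact_slice
    by (intro bexI [of _ v]) (auto simp: unit_apply G.nle_slice_iff)
qed

lemma unit_proper: "proper_mor S (slice_sg GS) (unit S)"
proof (rule proper_morI)
  interpret G: ample_category GS by (rule ample_germ)
  show "pbr_morphism S (slice_sg GS) (unit S)" by unfold_locales (rule unit_mor)
  fix A assume "A \<in> carrier (slice_sg GS)"
  then have A: "A \<in> compact_slices GS" by simp
  obtain X where X: "finite X" "X \<subseteq> carrier S" "A = (\<Union>s \<in> X. Theta S s)"
    using G.compact_sliceD(3) [OF A] G.compact_sliceD(1) [OF A] by (rule compact_open_germ)
  have sub: "Theta S ` X \<subseteq> compact_slices GS" using X(2) Theta_compact_slice by auto
  have "is_join (slice_sg GS) (Theta S ` X) A"
    using G.is_join_slice_iff [OF _ sub A] X by simp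
  moreover have "\<exists>s \<in> carrier S. nle (slice_sg GS) B (unit S s)" if "B \<in> Theta S ` X" for B
  proof -
    obtain s where "s \<in> carrier S" "B = Theta S s" using \<open>B \<in> Theta S ` X\<close> X(2) by blast
    then show ?thesis using Theta_compact_slice
      by (intro bexI [of _ s]) (simp_all add: unit_apply G.nle_slice_iff)
  qed
  ultimately show "\<exists>Y. finite Y \<and> is_join (slice_sg GS) Y A
     \<and> (\<forall>B \<in> Y. \<exists>s \<in> carrier S. nle (slice_sg GS) B (unit S s))"
    using X(1) by (intro exI [of _ "Theta S ` X"]) auto
qed

lemma unit_hom: "unit S \<in> pbr_hom i S (slice_sg GS)"
  using unit_mor unit_weakly_meet_preserving unit_proper by (simp add: pbr_hom_def)

end

lemma unit_laws_holds:
  assumes "preBoolean_lu S" "preBoolean_lu T"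
  shows "unit_laws i S T"
  unfolding unit_laws_def
proof (intro conjI ballI)
  interpret S: preBoolean_lu S by fact
  interpret T: preBoolean_lu T by fact
  show "unit S \<in> pbr_hom i S (slice_sg (germ_cat S))" by (rule S.unit_hom)
  fix f assume "f \<in> pbr_hom i S T"
  then interpret f: germ_morphism S T f using germ_morphismI assms by blast
  show "pbr_comp S (unit T) f
      = pbr_comp S (slice_map (germ_cat S) (germ_cat T) (germ_cof S T f)) (unit S)"
    unfolding compose_def
    by (intro restrict_ext)
      (simp add: S.unit_apply T.unit_apply slice_map_def S.Theta_compact_slice f.cof_image_Theta)
qed

section \<open>The counit of the adjunction\<close>

context ample_category
begin

abbreviation "pc \<equiv> point_char C"
abbreviation "GC \<equiv> germ_cat KC"

text \<open>As \<open>idt C\<close> is injective on objects, the set \<open>U\<close> in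
  \<open>point_char\<close> is determined by \<open>E\<close>. So the character tests whether the
  identity at \<open>x\<close> belongs to \<open>E\<close>.\<close>

lemma pc_apply:
  assumes "x \<in> objs C" "E \<in> projs KC"
  shows "pc x E \<longleftrightarrow> idt C x \<in> E"
proof -
  have "pc x E \<longleftrightarrow> (\<exists>U. co U \<and> E = idt C ` U \<and> x \<in> U)"
    using assms(2) by (simp add: point_char_def co_def conj_assoc)
  also have "\<dots> \<longleftrightarrow> idt C x \<in> E"
  proof
    assume x: "idt C x \<in> E"
    obtain U where U: "co U" "E = idt C ` U" using assms(2) unfolding projs_slice_sg by blast
    then have "x \<in> U" using x inj_on_image_mem_iff [OF inj_on_idt assms(1) coD(3)] by blast
    with U show "\<exists>U. co U \<and> E = idt C ` U \<and> x \<in> U" by blast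
  qed blast
  finally show ?thesis .
qed

lemma pc_idt:
  assumes "x \<in> objs C" "co U" shows "pc x (idt C ` U) \<longleftrightarrow> x \<in> U"
proof -
  have "idt C ` U \<in> projs KC" using assms unfolding projs_slice_sg by blast
  then show ?thesis
    using pc_apply [OF assms(1)] inj_on_image_mem_iff [OF inj_on_idt assms(1) coD(3) [OF assms(2)]] by blast
qed

lemma pc_star: "\<lbrakk>x \<in> objs C; A \<in> compact_slices C\<rbrakk> \<Longrightarrow> pc x (idt C ` src C ` A) \<longleftrightarrow> x \<in> src C ` A"
  by (rule pc_idt [OF _ co_src])

lemma pc_prime:
  assumes x: "x \<in> objs C" shows "pc x \<in> prime_chars KC"
  unfolding SG.prime_chars_iff
proof (intro conjI ballI)
  show "pc x \<in> extensional (projs KC)" by (simp add: point_char_def)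
  have "{} \<in> projs KC" by (rule empty_proj)
  then show "\<not> pc x (zero_of KC)" using pc_apply [OF x] by (simp add: zero_slice)
  obtain U where U: "co U" "x \<in> U" "U \<subseteq> objs C" using openin_topspace x by (rule co_basis)
  then have "idt C ` U \<in> projs KC" "pc x (idt C ` U)"
    using pc_idt [OF x] unfolding projs_slice_sg by auto
  then show "\<exists>E \<in> projs KC. pc x E" by blast
  fix E F assume EF: "E \<in> projs KC" "F \<in> projs KC"
  obtain V where V: "co V" "F = idt C ` V" using EF(2) unfolding projs_slice_sg by blast
  have "E \<subseteq> arrs C" using compact_sliceD(4) SG.projs_closed [OF EF(1)] by simp
  then have "sm E F = {a \<in> E. src C a \<in> V}" using sm_idt_right coD(3) V by blast
  moreover have "idt C x \<in> F \<longleftrightarrow> x \<in> V" using pc_idt [OF x V(1)] pc_apply [OF x EF(2)] V(2) by simp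
  ultimately have "idt C x \<in> sm E F \<longleftrightarrow> idt C x \<in> E \<and> idt C x \<in> F" using x by (simp add: src_idt)
  then show "pc x (E \<odot>\<^bsub>KC\<^esub> F) = (pc x E \<and> pc x F)"
    using pc_apply [OF x] EF SG.proj_mult [OF EF] by simp
  show "pc x (jn KC E F) = (pc x E \<or> pc x F)"
    using pc_apply [OF x] EF SG.jn_closed [OF EF] by (simp add: jn_slice)
qed

lemma pc_inj: "inj_on pc (objs C)"
proof (rule inj_onI, rule ccontr)
  fix x y assume xy: "x \<in> objs C" "y \<in> objs C" and eq: "pc x = pc y" and "x \<noteq> y"
  then obtain U V where "openin (obj C) U" "openin (obj C) V" "x \<in> U" "y \<in> V" "disjnt U V"
    using obj_Hausdorff unfolding Hausdorff_space_def by metis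
  then obtain W where "co W" "x \<in> W" "y \<notin> W" using co_basis unfolding disjnt_def by (metis disjoint_iff subsetD)
  then show False using pc_idt xy eq by metis
qed

text \<open>The point of a prime character is found in the intersection of the compact open sets on
  which the character takes the value 1.\<close>

lemma pc_surj:
  assumes \<phi>: "\<phi> \<in> prime_chars KC"
  obtains x where "x \<in> objs C" "\<phi> = pc x"
proof -
  have pr: "idt C ` U \<in> projs KC" if "co U" for U using that unfolding projs_slice_sg by blast
  obtain E where "E \<in> projs KC" "\<phi> E" using SG.char_nonzero [OF \<phi>] by blast
  then obtain U0 where U0: "co U0" "\<phi> (idt C ` U0)" unfolding projs_slice_sg by blast
  let ?\<U> = "{U. co U \<and> \<phi> (idt C ` U)}"
  \<comment> \<open>The compact open sets whose projections are sent to 1 are stable under finite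
    intersections, because \<phi> is multiplicative. They are non-empty because \<phi> vanishes at
    zero, which gives the finite intersection property.\<close>
  have fin: "\<exists>V. V \<in> ?\<U> \<and> V \<subseteq> U0 \<inter> \<Inter>\<F>" if "finite \<F>" "\<F> \<subseteq> ?\<U>" for \<F>
    using that
  proof induction
    case empty
    then show ?case using U0 by blast
  next
    case (insert U \<F>)
    then obtain V where V: "co V" "\<phi> (idt C ` V)" "V \<subseteq> U0 \<inter> \<Inter>\<F>" by auto
    have U: "co U" "\<phi> (idt C ` U)" using insert.prems by auto
    have "sm (idt C ` U) (idt C ` V) = idt C ` (U \<inter> V)"
      using coD(3) [OF U(1)] coD(3) [OF V(1)] by (subst sm_idt_right) (auto simp: src_idt subset_iff)
    then have "\<phi> (idt C ` (U \<inter> V))"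
      using SG.char_mult [OF \<phi> pr [OF U(1)] pr [OF V(1)]] U V by simp
    then have "U \<inter> V \<in> ?\<U>" using co_Int [OF U(1) V(1)] by blast
    moreover have "U \<inter> V \<subseteq> U0 \<inter> \<Inter>(insert U \<F>)" using V(3) by auto
    ultimately show ?case by blast
  qed
  have "U0 \<inter> \<Inter>?\<U> \<noteq> {}"
  proof -
    have all: "\<forall>\<U>. (\<forall>D \<in> \<U>. closedin (obj C) D) \<and> (\<forall>\<F>. finite \<F> \<and> \<F> \<subseteq> \<U> \<longrightarrow> U0 \<inter> \<Inter>\<F> \<noteq> {})
        \<longrightarrow> U0 \<inter> \<Inter>\<U> \<noteq> {}"
      using coD(1) [OF U0(1)] unfolding compactin_fip by (rule conjunct2)
    have cl: "\<forall>D \<in> ?\<U>. closedin (obj C) D" using coD(4) by auto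
    have fip: "\<forall>\<F>. finite \<F> \<and> \<F> \<subseteq> ?\<U> \<longrightarrow> U0 \<inter> \<Inter>\<F> \<noteq> {}"
    proof (intro allI impI, elim conjE)
      fix \<F> assume \<F>: "finite \<F>" "\<F> \<subseteq> ?\<U>"
      obtain V where V: "V \<in> ?\<U>" "V \<subseteq> U0 \<inter> \<Inter>\<F>" using fin [OF \<F>] by (elim exE conjE)
      have "V \<noteq> {}" using V(1) SG.char_zero [OF \<phi>] by (auto simp: zero_slice)
      then show "U0 \<inter> \<Inter>\<F> \<noteq> {}" using V(2) by blast
    qed
    show ?thesis by (rule mp [OF spec [OF all, of ?\<U>] conjI [OF cl fip]])
  qed
  then obtain x where x: "x \<in> U0" "\<And>U. co U \<Longrightarrow> \<phi> (idt C ` U) \<Longrightarrow> x \<in> U" by blast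
  have xo: "x \<in> objs C" using x(1) coD(3) [OF U0(1)] by blast
  \<comment> \<open>For prime characters inclusion of the supports suffices, and it holds by the
    choice of \<open>x\<close>.\<close>
  have "\<phi> = pc x"
  proof (rule SG.char_eqI [OF \<phi> pc_prime [OF xo]])
    fix E assume "E \<in> projs KC" "\<phi> E"
    then obtain U where "co U" "E = idt C ` U" "\<phi> (idt C ` U)" unfolding projs_slice_sg by blast
    then show "pc x E" using x(2) pc_idt [OF xo] by simp
  qed
  with xo that show ?thesis by blast
qed

text \<open>Both spaces have a basis indexed by the compact open sets of objects, and the bijection
  \<open>pc\<close> carries \<open>U\<close> to the basic set of its projection.\<close>

lemma pc_homeomorphic: "homeomorphic_map (obj C) (obj GC) pc"
proof (rule bijective_open_imp_homeomorphic_map)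
  show "continuous_map (obj C) (obj GC) pc"
    unfolding SG.germ_cat_sel
  proof (rule continuous_on_generated_topo)
    fix D assume "D \<in> char_basic KC ` projs KC"
    then obtain U where U: "co U" "D = char_basic KC (idt C ` U)"
      unfolding projs_slice_sg by blast
    have "pc -` D \<inter> objs C = U"
      using U(2) pc_idt [OF _ U(1)] pc_prime coD(3) [OF U(1)] by auto
    then show "openin (obj C) (pc -` D \<inter> objs C)" using coD(2) [OF U(1)] by simp
  next
    have "pc ` objs C \<subseteq> topspace (topology_generated_by (char_basic KC ` projs KC))"
      unfolding SG.topspace_CT using pc_prime by blast
    then show "pc ` objs C \<subseteq> \<Union> (char_basic KC ` projs KC)" by simp
  qed
  show "open_map (obj C) (obj GC) pc"
    unfolding open_map_def SG.germ_cat_sel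
  proof (intro allI impI)
    fix O' assume O': "openin (obj C) O'"
    show "openin SG.CT (pc ` O')"
      unfolding SG.openin_CT_iff
    proof
      fix \<phi> assume "\<phi> \<in> pc ` O'"
      then obtain x where x: "x \<in> O'" "\<phi> = pc x" by blast
      then have xo: "x \<in> objs C" using openin_subset [OF O'] by blast
      obtain U where U: "co U" "x \<in> U" "U \<subseteq> O'" using co_basis [OF O' x(1)] by blast
      have "char_basic KC (idt C ` U) \<subseteq> pc ` O'"
      proof
        fix \<psi> assume \<psi>: "\<psi> \<in> char_basic KC (idt C ` U)"
        then obtain y where "y \<in> objs C" "\<psi> = pc y" using pc_surj [of \<psi>] by auto
        then show "\<psi> \<in> pc ` O'" using \<psi> pc_idt [OF _ U(1)] U(3) by auto
      qed
      moreover have "\<phi> \<in> char_basic KC (idt C ` U)"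
        using x xo U pc_prime pc_idt by simp
      moreover have "idt C ` U \<in> projs KC" using U(1) unfolding projs_slice_sg by blast
      ultimately show "\<exists>e \<in> projs KC. \<phi> \<in> char_basic KC e
          \<and> char_basic KC e \<subseteq> pc ` O'" by blast
    qed
  qed
  show "pc ` objs C = objs GC"
    using pc_surj pc_prime unfolding SG.objs_germ_cat by blast
  show "inj_on pc (objs C)" by (rule pc_inj)
qed

lemma pre_germs_pc:
  "x \<in> objs C \<Longrightarrow> (A, pc x) \<in> pre_germs KC \<longleftrightarrow> A \<in> compact_slices C \<and> x \<in> src C ` A"
  using pc_prime pc_star by (auto simp: SG.pre_germs_iff)

lemma germ_pc_eq_iff:
  assumes x: "x \<in> objs C" and A: "A \<in> compact_slices C" "x \<in> src C ` A"
    and B: "B \<in> compact_slices C" "x \<in> src C ` B"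
  shows "germ KC A (pc x) = germ KC B (pc x) \<longleftrightarrow> slice_at C A x = slice_at C B x"
proof
  note a = compact_sliceD [OF A(1)] and b = compact_sliceD [OF B(1)]
  have pA: "(A, pc x) \<in> pre_germs KC" and pB: "(B, pc x) \<in> pre_germs KC"
    using x A B by (simp_all add: pre_germs_pc)
  {
    assume "germ KC A (pc x) = germ KC B (pc x)"
    then obtain E where E: "E \<in> projs KC" "pc x E" "sm A E = sm B E"
      using SG.germ_eq_iff [OF pA pB] by auto
    then obtain U where U: "co U" "E = idt C ` U" unfolding projs_slice_sg by blast
    then have "x \<in> U" using E pc_idt [OF x] by simp
    \<comment> \<open>Equality after multiplication by a projection means that the two slices
      coincide over the corresponding set of objects, in particular over \<open>x\<close>.\<close>
    have "{a \<in> A. src C a \<in> U} = {b \<in> B. src C b \<in> U}"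
      using E(3) sm_idt_right [OF a(4) coD(3) [OF U(1)]] sm_idt_right [OF b(4) coD(3) [OF U(1)]] U(2) by simp
    moreover have "slice_at C A x \<in> {a \<in> A. src C a \<in> U}"
      using slice_at_mem [OF a(2) A(2)] \<open>x \<in> U\<close> by simp
    ultimately have "slice_at C A x \<in> B" by simp
    then show "slice_at C A x = slice_at C B x"
      using slice_at_eq [OF b(2)] slice_at_mem(2) [OF a(2) A(2)] by metis
  }
  assume eq: "slice_at C A x = slice_at C B x"
  let ?a = "slice_at C A x"
  have "?a \<in> A \<inter> B" "src C ?a = x"
    using slice_at_mem [OF a(2) A(2)] slice_at_mem [OF b(2) B(2)] eq by auto
  moreover have "openin (arr C) (A \<inter> B)" using a b by blast
  \<comment> \<open>A compact slice through the common arrow and inside \<open>A \<inter> B\<close>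
    is the common lower bound that identifies the germs.\<close>
  ultimately obtain W where W: "W \<in> compact_slices C" "?a \<in> W" "W \<subseteq> A \<inter> B"
    using slice_through by metis
  then have "x \<in> src C ` W" using \<open>src C ?a = x\<close> by (metis imageI)
  then have pW: "(W, pc x) \<in> pre_germs KC" using x W by (simp add: pre_germs_pc)
  have "germ KC A (pc x) = germ KC W (pc x)"
    by (rule SG.pre_germs_le(2) [OF _ pW]) (use W A in \<open>auto simp: nle_slice_iff\<close>)
  moreover have "germ KC B (pc x) = germ KC W (pc x)"
    by (rule SG.pre_germs_le(2) [OF _ pW]) (use W B in \<open>auto simp: nle_slice_iff\<close>)
  ultimately show "germ KC A (pc x) = germ KC B (pc x)" by simp
qed

text \<open>For the projection of \<open>U\<close>, the product with \<open>B\<close> consists of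
  the arrows of \<open>B\<close> with range in \<open>U\<close>. As \<open>B\<close> has one arrow
  over the source of \<open>b\<close>, the left side tests whether the range of \<open>b\<close>
  lies in \<open>U\<close>.\<close>

lemma char_act_pc:
  assumes B: "B \<in> compact_slices C" and b: "b \<in> B"
  shows "char_act KC B (pc (src C b)) = pc (tgt C b)"
proof (rule extensionalityI [OF SG.char_act_ext])
  note bb = compact_sliceD [OF B]
  have bo: "b \<in> arrs C" using b bb(4) by blast
  show "pc (tgt C b) \<in> extensional (projs KC)" by (simp add: point_char_def)
  fix E assume E: "E \<in> projs KC"
  then obtain U where U: "co U" "E = idt C ` U" unfolding projs_slice_sg by blast
  have sm: "sm E B \<in> compact_slices C" using sm_compact_slice [OF _ B] idt_compact_slice U by blast
  have "char_act KC B (pc (src C b)) E = pc (src C b) (idt C ` src C ` sm E B)"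
    using SG.char_act_apply [OF E] by simp
  also have "\<dots> \<longleftrightarrow> src C b \<in> src C ` sm E B" using bo pc_star sm by blast
  also have "\<dots> \<longleftrightarrow> src C b \<in> src C ` {b \<in> B. tgt C b \<in> U}"
    using sm_idt_left [OF bb(4) coD(3) [OF U(1)]] U(2) by simp
  also have "\<dots> \<longleftrightarrow> tgt C b \<in> U" using b bb(2) by (auto dest: inj_onD)
  also have "\<dots> \<longleftrightarrow> pc (tgt C b) E" using bo pc_idt [OF _ U(1)] U(2) by simp
  finally show "char_act KC B (pc (src C b)) E = pc (tgt C b) E" .
qed

abbreviation "CU \<equiv> counit C"
abbreviation "cdom \<equiv> cof_dom GC C CU"

lemma anc_counit: "anc CU = restrict pc (objs C)"
  and rho0_counit: "rho0 CU = restrict (\<lambda>x. x) (objs C)"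
  by (simp_all add: counit_def Let_def)

lemma cdom_eq: "cdom = act_dom GC (obj C) pc"
  by (rule act_dom_cong) (simp add: anc_counit)

lemma cdom_iff: "(g, x) \<in> cdom \<longleftrightarrow> x \<in> objs C
    \<and> (\<exists>A \<in> compact_slices C. x \<in> src C ` A \<and> g = germ KC A (pc x))"
proof -
  have "(g, x) \<in> cdom \<longleftrightarrow> x \<in> objs C \<and> (\<exists>A. (A, pc x) \<in> pre_germs KC \<and> g = germ KC A (pc x))"
    unfolding cdom_eq act_dom_iff SG.arrs_germ_iff by auto
  then show ?thesis
    using pre_germs_pc [of x] by (cases "x \<in> objs C") (simp_all add: Bex_def conj_assoc)
qed

lemma counit_values:
  assumes x: "x \<in> objs C" and A: "A \<in> compact_slices C" "x \<in> src C ` A"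
  shows "rho1 CU (germ KC A (pc x), x) = slice_at C A x"
    and "act CU (germ KC A (pc x), x) = tgt C (slice_at C A x)"
proof -
  have pA: "(A, pc x) \<in> pre_germs KC" using assms by (simp add: pre_germs_pc)
  have d: "(germ KC A (pc x), x) \<in> act_dom GC (obj C) pc"
    using assms cdom_iff cdom_eq by blast
  have *: "slice_at C B x = slice_at C A x" if "(B, pc x) \<in> germ KC A (pc x)" for B
  proof -
    have "(B, pc x) \<in> pre_germs KC" "germ KC B (pc x) = germ KC A (pc x)"
      using that SG.mem_germ_eq [OF pA] by auto
    then show ?thesis using germ_pc_eq_iff [OF x _ _ A, of B] pre_germs_pc [OF x] by blast
  qed
  have "the_elem {slice_at C B x | B. (B, pc x) \<in> germ KC A (pc x)} = slice_at C A x"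
    by (rule the_elem_eqI) (use * SG.germ_self [OF pA] in blast)+
  then show "rho1 CU (germ KC A (pc x), x) = slice_at C A x"
    using d by (simp add: counit_def Let_def)
  have "the_elem {tgt C (slice_at C B x) | B. (B, pc x) \<in> germ KC A (pc x)} = tgt C (slice_at C A x)"
  proof (rule the_elem_eqI)
    fix y assume "y \<in> {tgt C (slice_at C B x) | B. (B, pc x) \<in> germ KC A (pc x)}"
    then obtain B where "y = tgt C (slice_at C B x)" "(B, pc x) \<in> germ KC A (pc x)" by blast
    then show "y = tgt C (slice_at C A x)" using * by simp
  qed (use SG.germ_self [OF pA] in blast)
  then show "act CU (germ KC A (pc x), x) = tgt C (slice_at C A x)"
    using d by (simp add: counit_def Let_def)
qed

text \<open>Coordinates on the domain of the counit: a pair is given by an arrow \<open>a\<close>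
  and a compact slice containing it, and its value is \<open>a\<close>.\<close>

lemma cdomE:
  assumes "(g, x) \<in> cdom"
  obtains A a where "A \<in> compact_slices C" "a \<in> A" "x = src C a" "x \<in> objs C" "a \<in> arrs C"
    "g = germ KC A (pc x)" "rho1 CU (g, x) = a" "(A, pc x) \<in> pre_germs KC"
proof -
  obtain A where A: "x \<in> objs C" "A \<in> compact_slices C" "x \<in> src C ` A" "g = germ KC A (pc x)"
    using assms cdom_iff by blast
  note a = slice_at_mem [OF compact_sliceD(2) [OF A(2)] A(3)]
  show ?thesis
    using that [of A "slice_at C A x"] A a counit_values(1) [OF A(1-3)] compact_sliceD(4) [OF A(2)]
      pre_germs_pc [OF A(1)] by auto
qed

lemma counit_at:
  assumes "A \<in> compact_slices C" "a \<in> A"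
  shows "(germ KC A (pc (src C a)), src C a) \<in> cdom"
    and "rho1 CU (germ KC A (pc (src C a)), src C a) = a"
    and "(A, pc (src C a)) \<in> pre_germs KC"
proof -
  have x: "src C a \<in> objs C" using assms compact_sliceD(4) by blast
  show "(germ KC A (pc (src C a)), src C a) \<in> cdom" using x assms cdom_iff by blast
  show "rho1 CU (germ KC A (pc (src C a)), src C a) = a"
    using counit_values(1) [OF x assms(1)] assms slice_at_eq compact_sliceD(2) by simp
  show "(A, pc (src C a)) \<in> pre_germs KC" using x assms by (simp add: pre_germs_pc)
qed

text \<open>The preimage of a compact slice is described by the basic set \<open>Theta KC B\<close>.
  Continuity of \<open>rho1\<close>, the image of a set \<open>Theta\<close> and the openness of
  \<open>rho1\<close> are derived from this.\<close>

lemma counit_rho_mem: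
  assumes gx: "(g, x) \<in> cdom" and B: "B \<in> compact_slices C"
  shows "rho1 CU (g, x) \<in> B \<longleftrightarrow> g \<in> Theta KC B"
  using gx
proof (rule cdomE)
  fix A a assume A: "A \<in> compact_slices C" "a \<in> A" "x = src C a" "x \<in> objs C" "a \<in> arrs C"
    "g = germ KC A (pc x)" "rho1 CU (g, x) = a" "(A, pc x) \<in> pre_germs KC"
  have sA: "slice_at C A x = a" using A slice_at_eq compact_sliceD(2) by blast
  have "g \<in> Theta KC B \<longleftrightarrow> (B, pc x) \<in> pre_germs KC
      \<and> germ KC A (pc x) = germ KC B (pc x)"
    using SG.germ_in_Theta [OF A(8), of B] A(6) by simp
  also have "\<dots> \<longleftrightarrow> x \<in> src C ` B \<and> a = slice_at C B x"
  proof (cases "x \<in> src C ` B")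
    case True
    have "x \<in> src C ` A" using A(2,3) by simp
    then show ?thesis using germ_pc_eq_iff [OF A(4,1) _ B True] pre_germs_pc [OF A(4)] B sA True by simp
  qed (simp add: pre_germs_pc [OF A(4)])
  also have "\<dots> \<longleftrightarrow> a \<in> B"
    using slice_at_mem(1) [OF compact_sliceD(2) [OF B]] slice_at_eq [OF compact_sliceD(2) [OF B]] A(3) by auto
  finally show ?thesis using A(7) by simp
qed

lemma cof_image_counit_Theta:
  assumes "A \<in> compact_slices C"
  shows "cof_image GC C CU (Theta KC A) = A"
proof (intro equalityI subsetI)
  fix a assume "a \<in> cof_image GC C CU (Theta KC A)"
  then obtain g x where "g \<in> Theta KC A" "(g, x) \<in> cdom" "a = rho1 CU (g, x)"
    by (auto simp: cof_image_def)
  then show "a \<in> A" using counit_rho_mem assms by blast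
next
  fix a assume "a \<in> A"
  note c = counit_at [OF assms this]
  have "germ KC A (pc (src C a)) \<in> Theta KC A"
    using c(3) unfolding SG.Theta_iff by blast
  then show "a \<in> cof_image GC C CU (Theta KC A)"
    unfolding cof_image_def using c by (metis (mono_tags, lifting) mem_Collect_eq)
qed

lemma counit_rho_continuous: "continuous_map (act_top GC (obj C) (anc CU)) (arr C) (rho1 CU)"
  unfolding continuous_map_def
proof (intro conjI allI impI)
  let ?X = "act_top GC (obj C) (anc CU)"
  show "rho1 CU \<in> topspace ?X \<rightarrow> arrs C"
  proof
    fix p assume "p \<in> topspace ?X"
    then obtain g x where "p = (g, x)" "(g, x) \<in> cdom" by (cases p) auto
    then show "rho1 CU p \<in> arrs C" using cdomE by metis
  qed
  fix V assume V: "openin (arr C) V"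
  show "openin ?X {p \<in> topspace ?X. rho1 CU p \<in> V}"
  proof (subst openin_subopen, intro ballI)
    fix p assume "p \<in> {p \<in> topspace ?X. rho1 CU p \<in> V}"
    then obtain g x where p: "p = (g, x)" "(g, x) \<in> cdom" "rho1 CU (g, x) \<in> V" by (cases p) auto
    obtain B where B: "B \<in> compact_slices C" "rho1 CU (g, x) \<in> B" "B \<subseteq> V"
      using slice_through [OF V p(3)] by blast
    let ?N = "cdom \<inter> Theta KC B \<times> objs C"
    have "openin ?X ?N"
      unfolding act_top_def using B(1)
      by (intro openin_subtopology_Int2) (simp add: openin_prod_Times_iff)
    moreover have "p \<in> ?N" using p B counit_rho_mem by (auto simp: act_dom_iff)
    moreover have "?N \<subseteq> {p \<in> topspace ?X. rho1 CU p \<in> V}" using counit_rho_mem B by auto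
    ultimately show "\<exists>N. openin ?X N \<and> p \<in> N \<and> N \<subseteq> {p \<in> topspace ?X. rho1 CU p \<in> V}" by blast
  qed
qed

lemma counit_cofunctor: "cofunctor GC C CU"
proof (rule cofunctorI)
  interpret G: ample_category GC by (rule SG.ample_germ)
  show "topological_category GC" "topological_category C" by unfold_locales
  have pc_cont: "continuous_map (obj C) (obj GC) pc" using pc_homeomorphic homeomorphic_imp_continuous_map by blast
  then show anc: "continuous_map (obj C) (obj GC) (anc CU)"
    by (rule continuous_map_eq) (simp add: anc_counit)
  show "continuous_map (act_top GC (obj C) (anc CU)) (arr C) (rho1 CU)" by (rule counit_rho_continuous)
  show "act CU = restrict (\<lambda>p. tgt C (rho1 CU p)) cdom"
  proof (rule extensionalityI [of _ cdom])
    show "act CU \<in> extensional cdom" unfolding cdom_eq by (simp add: counit_def Let_def)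
    show "act CU p = restrict (\<lambda>p. tgt C (rho1 CU p)) cdom p" if "p \<in> cdom" for p
      using that
    proof (rule act_dom_induct)
      fix g x assume gx: "(g, x) \<in> cdom"
      then obtain A where "x \<in> objs C" "A \<in> compact_slices C" "x \<in> src C ` A" "g = germ KC A (pc x)"
        using cdom_iff by blast
      then show "act CU (g, x) = restrict (\<lambda>p. tgt C (rho1 CU p)) cdom (g, x)"
        using gx counit_values by simp
    qed
  qed simp
  show "src C (rho1 CU (g, x)) = x" if "(g, x) \<in> cdom" for g x
    using that by (rule cdomE) simp
  show "anc CU (tgt C (rho1 CU (g, x))) = tgt GC g" if "(g, x) \<in> cdom" for g x
    using that
  proof (rule cdomE)
    fix A a assume A: "A \<in> compact_slices C" "a \<in> A" "x = src C a" "x \<in> objs C" "a \<in> arrs C"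
      "g = germ KC A (pc x)" "rho1 CU (g, x) = a" "(A, pc x) \<in> pre_germs KC"
    then show ?thesis using SG.tgt_germ [OF A(8)] char_act_pc [OF A(1,2)] by (simp add: anc_counit)
  qed
  show "rho1 CU (idt GC (anc CU x), x) = idt C x" if x: "x \<in> objs C" for x
  proof -
    obtain U where U: "co U" "x \<in> U" "U \<subseteq> objs C" using openin_topspace x by (rule co_basis)
    let ?E = "idt C ` U"
    have E: "?E \<in> projs KC" using U unfolding projs_slice_sg by blast
    have "idt GC (pc x) = germ KC ?E (pc x)"
      using pc_idt [OF x U(1)] U(2) E pc_prime [OF x] by (intro SG.idt_germ) auto
    then show ?thesis
      using counit_at(2) [OF idt_compact_slice [OF U(1)], of "idt C x"] U(2) x
      by (simp add: anc_counit src_idt)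
  qed
  show "rho1 CU (cmp GC (g, h), x) = cmp C (rho1 CU (g, tgt C (rho1 CU (h, x))), rho1 CU (h, x))"
    if gh: "(g, h) \<in> cmp_pairs GC" and hx: "(h, x) \<in> cdom" for g h x
    using hx
  proof (rule cdomE)
    fix B b assume B: "B \<in> compact_slices C" "b \<in> B" "x = src C b" "x \<in> objs C" "b \<in> arrs C"
      "h = germ KC B (pc x)" "rho1 CU (h, x) = b" "(B, pc x) \<in> pre_germs KC"
    let ?y = "tgt C b"
    have act: "char_act KC B (pc x) = pc ?y" using char_act_pc [OF B(1,2)] B(3) by simp
    then have "src GC g = pc ?y" "g \<in> arrs GC"
      using gh SG.tgt_germ [OF B(8)] B(6) by (auto simp: cmp_pairs_def)
    then have "(g, ?y) \<in> cdom" using B(5) by (simp add: cdom_eq act_dom_iff)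
    then show ?thesis
    proof (rule cdomE)
      fix A a assume A: "A \<in> compact_slices C" "a \<in> A" "?y = src C a" "?y \<in> objs C" "a \<in> arrs C"
        "g = germ KC A (pc ?y)" "rho1 CU (g, ?y) = a" "(A, pc ?y) \<in> pre_germs KC"
      have "cmp GC (g, h) = germ KC (sm A B) (pc x)"
        using SG.cmp_germ [of A B "pc x"] A(6,8) B(6,8) act by simp
      moreover have "cmp C (a, b) \<in> sm A B"
        using mem_sm [OF compact_sliceD(4) [OF A(1)] compact_sliceD(4) [OF B(1)]] A(2,3) B(2) by metis
      moreover have "src C (cmp C (a, b)) = x"
        using src_cmp [of a b] A B by (simp add: cmp_pairs_iff)
      ultimately show ?thesis
        using counit_at(2) [OF sm_compact_slice [OF A(1) B(1)]] A(7) B(7) by metis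
    qed
  qed
  show "compactin (obj C) {x \<in> objs C. anc CU x \<in> K}" if K: "compactin (obj GC) K" for K
  proof -
    have "compactin (obj GC) (pc ` {x \<in> objs C. pc x \<in> K})"
    proof -
      have "K \<subseteq> pc ` objs C"
        using compactin_subset_topspace [OF K] homeomorphic_imp_surjective_map [OF pc_homeomorphic] by simp
      then have "pc ` {x \<in> objs C. pc x \<in> K} = K" by blast
      with K show ?thesis by simp
    qed
    then have "compactin (obj C) {x \<in> objs C. pc x \<in> K}"
      using homeomorphic_map_compactness [OF pc_homeomorphic, of "{x \<in> objs C. pc x \<in> K}"] by auto
    moreover have "{x \<in> objs C. anc CU x \<in> K} = {x \<in> objs C. pc x \<in> K}" by (auto simp: anc_counit)
    ultimately show ?thesis by simp
  qed
  show "compactin (arr C) (cof_image GC C CU A) \<and> openin (arr C) (cof_image GC C CU A)"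
    if A: "A \<in> compact_slices GC" for A
  proof -
    obtain X where X: "finite X" "X \<subseteq> carrier KC" "A = (\<Union>B \<in> X. Theta KC B)"
      using G.compact_sliceD(3) [OF A] G.compact_sliceD(1) [OF A] by (rule SG.compact_open_germ)
    have "cof_image GC C CU A = (\<Union>B \<in> X. cof_image GC C CU (Theta KC B))"
      unfolding X(3) cof_image_def by blast
    also have "\<dots> = \<Union>X" using X(2) cof_image_counit_Theta by auto
    finally have eq: "cof_image GC C CU A = \<Union>X" .
    have cs: "B \<in> compact_slices C" if "B \<in> X" for B using X(2) that by auto
    have "compactin (arr C) (\<Union>X)" using X(1) compact_sliceD(3) [OF cs] by (intro compactin_Union)
    moreover have "openin (arr C) (\<Union>X)" using compact_sliceD(1) [OF cs] by (intro openin_Union)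
    ultimately show ?thesis unfolding eq by blast
  qed
  show "anc CU \<in> extensional (objs C)" by (simp add: anc_counit)
  show "rho1 CU \<in> extensional cdom" unfolding cdom_eq by (simp add: counit_def Let_def)
  show "rho0 CU = restrict (\<lambda>x. x) (objs C)" by (rule rho0_counit)
qed

lemma counit_ample: "ample_cofunctor GC C CU"
  using counit_cofunctor SG.ample_germ ample_category_axioms by (simp add: ample_cofunctor_def)

lemma counit_injective: "injective_on_arrows GC C CU"
  unfolding injective_on_arrows_def
proof (intro allI impI, elim conjE)
  fix g h x assume gx: "(g, x) \<in> cdom" and hx: "(h, x) \<in> cdom" and eq: "rho1 CU (g, x) = rho1 CU (h, x)"
  obtain A where A: "x \<in> objs C" "A \<in> compact_slices C" "x \<in> src C ` A" "g = germ KC A (pc x)"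
    using gx cdom_iff by blast
  obtain B where B: "B \<in> compact_slices C" "x \<in> src C ` B" "h = germ KC B (pc x)"
    using hx cdom_iff by blast
  show "g = h"
    using eq counit_values(1) [OF A(1-3)] counit_values(1) [OF A(1) B(1,2)]
      germ_pc_eq_iff [OF A(1-3) B(1,2)] A(4) B(3) by simp
qed

lemma counit_surjective: "surjective_on_arrows GC C CU"
  unfolding surjective_on_arrows_def
proof
  fix a assume "a \<in> arrs C"
  then obtain A where A: "A \<in> compact_slices C" "a \<in> A" using slice_through [OF openin_topspace] by metis
  then show "\<exists>g. (g, src C a) \<in> cdom \<and> rho1 CU (g, src C a) = a" using counit_at by blast
qed

lemma counit_hom: "counit C \<in> cof_hom i GC C"
  using counit_cofunctor counit_injective counit_surjective by (simp add: cof_hom_def)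

lemma counit_iso: "cof_iso GC C CU"
  unfolding cof_iso_def
proof (intro conjI)
  interpret K: ample_cofunctor GC C CU by (rule counit_ample)
  show "cofunctor GC C CU" by (rule counit_cofunctor)
  show h: "homeomorphic_map (obj C) (obj GC) (anc CU)"
    by (rule homeomorphic_map_eq [OF pc_homeomorphic]) (simp add: anc_counit)
  show "natural_action_equiv GC (obj C) (act CU) (anc CU) (anc CU)"
    unfolding natural_action_equiv_def
  proof (intro conjI ballI)
    fix p assume p: "p \<in> cdom"
    obtain g x where gx: "p = (g, x)" by (cases p)
    then have gd: "(g, x) \<in> cdom" using p by simp
    then have "g \<in> arrs GC" "x \<in> objs C" "src GC g = anc CU x" by (auto simp: act_dom_iff)
    moreover then have "anc CU x \<in> objs GC" using K.anc_closed by blast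
    ultimately have "(g, anc CU x) \<in> cof_dom GC GC (cof_id GC)" by (simp only: cof_dom_id)
    then show "case p of (s, x) \<Rightarrow> anc CU (act CU (s, x)) = act (cof_id GC) (s, anc CU x)"
      using K.anc_act [OF gd] gx by (simp add: cof_id_sel(4))
  qed simp
  have rho: "homeomorphic_map (act_top GC (obj C) (anc CU)) (arr C) (rho1 CU)"
  proof (rule bijective_open_imp_homeomorphic_map)
    let ?X = "act_top GC (obj C) (anc CU)"
    show "continuous_map ?X (arr C) (rho1 CU)" by (rule counit_rho_continuous)
    show "rho1 CU ` topspace ?X = arrs C"
    proof (intro equalityI subsetI)
      fix a assume "a \<in> rho1 CU ` topspace ?X"
      then show "a \<in> arrs C" using K.rho_closed by auto
    next
      fix a assume "a \<in> arrs C"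
      then obtain g where "(g, src C a) \<in> cdom" "rho1 CU (g, src C a) = a"
        using counit_surjective unfolding surjective_on_arrows_def by blast
      then show "a \<in> rho1 CU ` topspace ?X" by (metis image_eqI topspace_act_top)
    qed
    show "inj_on (rho1 CU) (topspace ?X)"
    proof (rule inj_onI)
      fix p q assume "p \<in> topspace ?X" "q \<in> topspace ?X" and eq: "rho1 CU p = rho1 CU q"
      then obtain g x h y where *: "p = (g, x)" "(g, x) \<in> cdom" "q = (h, y)" "(h, y) \<in> cdom"
        by (cases p, cases q) auto
      then have "x = y" using K.src_rho eq by metis
      then show "p = q" using * eq counit_injective unfolding injective_on_arrows_def by metis
    qed
    show "open_map ?X (arr C) (rho1 CU)"
      unfolding open_map_def
    proof (intro allI impI)
      fix N assume N: "openin ?X N"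
      show "openin (arr C) (rho1 CU ` N)"
      proof (subst openin_subopen, intro ballI)
        fix a assume "a \<in> rho1 CU ` N"
        then obtain p where p: "p \<in> N" "a = rho1 CU p" by blast
        then have "p \<in> cdom" using openin_subset [OF N] by auto
        obtain W where W: "openin (prod_topology (arr GC) (obj C)) W" "N = W \<inter> cdom"
          using N unfolding act_top_def openin_subtopology by blast
        obtain g x where gx: "p = (g, x)" by (cases p)
        obtain P Q where PQ: "openin (arr GC) P" "openin (obj C) Q" "g \<in> P" "x \<in> Q" "P \<times> Q \<subseteq> W"
        proof -
          have "(g, x) \<in> W" using W p gx by simp
          then have "\<exists>P Q. openin (arr GC) P \<and> openin (obj C) Q \<and> g \<in> P \<and> x \<in> Q \<and> P \<times> Q \<subseteq> W"
            using W(1) by (simp add: openin_prod_topology_alt)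
          then show ?thesis using that by (elim exE conjE)
        qed
        obtain A where A: "A \<in> compact_slices C" "g \<in> Theta KC A" "Theta KC A \<subseteq> P"
          using PQ(1,3) unfolding SG.openin_arr_germ_iff by auto
        note a = compact_sliceD [OF A(1)]
        \<comment> \<open>Every arrow \<open>b\<close> of \<open>A\<close> is the value of
          \<open>rho1 CU\<close> at the germ of \<open>A\<close> over its source. Requiring that
          source to lie in \<open>Q\<close> keeps the pair inside the given neighbourhood.\<close>
        let ?T = "A \<inter> {b \<in> arrs C. src C b \<in> Q}"
        have "openin (arr C) ?T"
          using a(1) PQ(2) openin_continuous_map_preimage [OF src_continuous] by (intro openin_Int)
        moreover have "a \<in> ?T"
          using \<open>p \<in> cdom\<close> p gx counit_rho_mem [OF _ A(1)] A(2) a(4) K.src_rho [of g x] PQ(4) by auto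
        moreover have "?T \<subseteq> rho1 CU ` N"
        proof
          fix b assume b: "b \<in> ?T"
          then have bA: "b \<in> A" "src C b \<in> Q" by auto
          note c = counit_at [OF A(1) bA(1)]
          have "germ KC A (pc (src C b)) \<in> Theta KC A"
            using c(3) unfolding SG.Theta_iff by blast
          then have "(germ KC A (pc (src C b)), src C b) \<in> N"
            using A(3) PQ(5) bA(2) c(1) W(2) by blast
          then show "b \<in> rho1 CU ` N" using c(2) by (metis image_eqI)
        qed
        ultimately show "\<exists>T. openin (arr C) T \<and> a \<in> T \<and> T \<subseteq> rho1 CU ` N" by blast
      qed
    qed
  qed
  have "homeomorphic_map (obj C) (obj C) (rho0 CU)"
    by (rule homeomorphic_map_eq [of _ _ id]) (simp_all add: rho0_counit)
  then show "topcat_iso (transf_cat GC (obj C) (act CU) (anc CU)) C (rho1 CU) (rho0 CU)"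
    unfolding topcat_iso_def using K.rho_functor rho by simp
qed

end

section \<open>Naturality of the counit and the triangle identities\<close>

lemma counit_laws_holds:
  assumes "ample_category C" "ample_category D"
  shows "counit_laws i C D"
  unfolding counit_laws_def
proof (intro conjI ballI)
  interpret C: ample_category C by fact
  interpret D: ample_category D by fact
  show "counit C \<in> cof_hom i (germ_cat (slice_sg C)) C" by (rule C.counit_hom)
  fix F assume F: "F \<in> cof_hom i C D"
  interpret F: ample_cofunctor C D F using cof_hom_ample assms F by blast
  interpret f: germ_morphism "slice_sg C" "slice_sg D" "slice_map C D F"
    using germ_morphismI [OF C.preBoolean_lu_slice D.preBoolean_lu_slice slice_map_hom [OF assms F]] .
  interpret L: cofunctor_pair C.GC C D "counit C" F
    using C.counit_ample F.ample_cofunctor_axioms by (rule cofunctor_pair.intro)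
  interpret R: cofunctor_pair C.GC D.GC D f.GF "counit D"
    using f.germ_cof_ample D.counit_ample by (rule cofunctor_pair.intro)
  \<comment> \<open>The anchor maps of the two composites agree: \<open>slice_map\<close> sends the
    projection of \<open>U\<close> to that of its preimage under \<open>anc F\<close>, so evaluation
    at \<open>x\<close> pulls back to evaluation at \<open>anc F x\<close>.\<close>
  have pull: "f.pull (point_char D x) = point_char C (anc F x)" if x: "x \<in> objs D" for x
  proof (rule extensionalityI [of _ "projs (slice_sg C)"])
    show "f.pull (point_char D x) \<in> extensional (projs (slice_sg C))" by (simp add: f.pull_def)
    show "point_char C (anc F x) \<in> extensional (projs (slice_sg C))" by (simp add: point_char_def)
    fix E assume E: "E \<in> projs (slice_sg C)"
    then obtain U where U: "C.co U" "E = idt C ` U" unfolding C.projs_slice_sg by blast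
    have E': "E \<in> compact_slices C" using C.SG.projs_closed [OF E] by simp
    have im: "slice_map C D F E = idt D ` {y \<in> objs D. anc F y \<in> U}"
      using F.slice_map_apply [OF E'] F.cof_image_idt [OF C.coD(3) [OF U(1)]] U(2) by simp
    have "point_char D x (slice_map C D F E) \<longleftrightarrow> idt D x \<in> idt D ` {y \<in> objs D. anc F y \<in> U}"
      using D.pc_apply [OF x f.f_proj [OF E]] unfolding im .
    also have "\<dots> \<longleftrightarrow> anc F x \<in> U"
      using inj_on_image_mem_iff [OF D.inj_on_idt x, of "{y \<in> objs D. anc F y \<in> U}"] x by auto
    also have "\<dots> \<longleftrightarrow> point_char C (anc F x) E"
      using C.pc_idt [OF F.anc_closed [OF x] U(1)] U(2) by simp
    finally show "f.pull (point_char D x) E = point_char C (anc F x) E"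
      using f.pull_apply [OF E] by simp
  qed
  show "cof_comp C.GC D F (counit C)
      = cof_comp C.GC D (counit D) (germ_cof (slice_sg C) (slice_sg D) (slice_map C D F))"
  proof (rule cofunctor_eqI [OF L.comp_ample_cofunctor R.comp_ample_cofunctor])
    show ea: "anc L.GF x = anc R.GF x" if x: "x \<in> objs D" for x
      using x pull [OF x] D.pc_prime [OF x] F.anc_closed [OF x]
      by (simp add: L.comp_sel R.comp_sel C.anc_counit D.anc_counit f.anc_germ_cof)
    fix g x assume gx: "(g, x) \<in> cof_dom C.GC D L.GF"
    then have gx': "(g, x) \<in> cof_dom C.GC D R.GF" using ea by (simp add: act_dom_iff)
    note d = L.dom_comp' [OF gx] and d' = R.dom_comp' [OF gx']
    \<comment> \<open>Both composites have the value \<open>rho1 F (a, x)\<close>. On one side the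
      germ \<open>g\<close> is first evaluated to \<open>a\<close>; on the other the slice
      \<open>A\<close> is sent to its image, whose arrow over \<open>x\<close> is this
      value.\<close>
    obtain A a where A: "A \<in> compact_slices C" "a \<in> A" "anc F x = src C a"
      "g = germ (slice_sg C) A (point_char C (anc F x))" "rho1 (counit C) (g, anc F x) = a"
      "(A, point_char C (anc F x)) \<in> pre_germs (slice_sg C)" "a \<in> arrs C"
      using C.cdomE [OF d(1)] by metis
    have adom: "(a, x) \<in> cof_dom C D F" using d(2) A(5) by simp
    let ?b = "rho1 F (a, x)"
    have b: "?b \<in> slice_map C D F A"
      using A(1,2) adom F.slice_map_apply F.mem_cof_image by blast
    have sA: "slice_map C D F A \<in> compact_slices D" using f.f_closed [of A] A(1) by simp
    have sb: "src D ?b = x" using F.src_rho [OF adom] .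
    have p: "point_char D x \<in> prime_chars (slice_sg D)" using D.pc_prime d(3) by blast
    have q: "(A, f.pull (point_char D x)) \<in> pre_germs (slice_sg C)" using A(6) pull d(3) by simp
    have "rho1 f.GF (g, point_char D x) = germ (slice_sg D) (slice_map C D F A) (point_char D x)"
      using f.rho_germ [OF p q] pull [OF d(3)] A(4) by simp
    moreover have "rho1 (counit D) (germ (slice_sg D) (slice_map C D F A) (point_char D x), x) = ?b"
      using D.counit_at(2) [OF sA b] sb by simp
    moreover have "anc (counit D) x = point_char D x" using d(3) by (simp add: D.anc_counit)
    ultimately show "rho1 L.GF (g, x) = rho1 R.GF (g, x)"
      unfolding L.rho_comp [OF gx] R.rho_comp [OF gx'] using A(5) by simp
  qed
qed

lemma triangle_laws_holds:
  assumes "preBoolean_lu S" "ample_category C"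
  shows "triangle_laws S C"
  unfolding triangle_laws_def
proof
  interpret S: preBoolean_lu S by fact
  interpret C: ample_category C by fact
  interpret G: ample_category "germ_cat S" by (rule S.ample_germ)
  interpret f: germ_morphism S "slice_sg (germ_cat S)" "unit S"
    using germ_morphismI [OF assms(1) G.preBoolean_lu_slice S.unit_hom] .
  interpret P: cofunctor_pair "germ_cat S" G.GC "germ_cat S" f.GF "counit (germ_cat S)"
    using f.germ_cof_ample G.counit_ample by (rule cofunctor_pair.intro)
  \<comment> \<open>Evaluating \<open>Theta S e\<close> at \<phi> asks whether the identity germ at
    \<phi> lies in it, and that germ is represented by any projection in the support of
    \<phi>.\<close>
  have pull: "f.pull (point_char (germ_cat S) \<phi>) = \<phi>" if \<phi>: "\<phi> \<in> prime_chars S" for \<phi>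
  proof (rule extensionalityI [OF _ S.char_ext [OF \<phi>]])
    show "f.pull (point_char (germ_cat S) \<phi>) \<in> extensional (projs S)" by (simp add: f.pull_def)
    fix e assume e: "e \<in> projs S"
    have "point_char (germ_cat S) \<phi> (unit S e) \<longleftrightarrow> idt (germ_cat S) \<phi> \<in> Theta S e"
      using G.pc_apply [OF _ f.f_proj [OF e], of \<phi>] \<phi> e by (simp add: S.unit_apply)
    also have "\<dots> \<longleftrightarrow> \<phi> e"
    proof -
      obtain g where g: "g \<in> projs S" "\<phi> g" using S.char_nonzero \<phi> by blast
      have p: "(g, \<phi>) \<in> pre_germs S" using g \<phi> by (simp add: S.pre_germs_proj)
      have i: "idt (germ_cat S) \<phi> = germ S g \<phi>" using g \<phi> by (intro S.idt_germ)
      show ?thesis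
      proof
        assume "\<phi> e"
        then show "idt (germ_cat S) \<phi> \<in> Theta S e"
          using S.idt_germ [OF e \<phi>] e \<phi> by (auto simp: S.Theta_iff S.pre_germs_proj)
      next
        assume "idt (germ_cat S) \<phi> \<in> Theta S e"
        then show "\<phi> e" using S.germ_in_Theta [OF p, of e] e i by (simp add: S.pre_germs_proj)
      qed
    qed
    finally show "f.pull (point_char (germ_cat S) \<phi>) e = \<phi> e" using f.pull_apply [OF e] by simp
  qed
  show "cof_comp (germ_cat S) (germ_cat S) (counit (germ_cat S)) (germ_cof S (slice_sg (germ_cat S)) (unit S))
      = cof_id (germ_cat S)"
  proof (rule cofunctor_eqI [OF P.comp_ample_cofunctor])
    show "ample_cofunctor (germ_cat S) (germ_cat S) (cof_id (germ_cat S))"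
      using cof_id_cofunctor [OF S.ample_germ] S.ample_germ by (simp add: ample_cofunctor_def)
    show "anc P.GF \<phi> = anc (cof_id (germ_cat S)) \<phi>" if "\<phi> \<in> objs (germ_cat S)" for \<phi>
      using that G.pc_prime [OF that] pull
      by (simp add: P.comp_sel cof_id_sel G.anc_counit f.anc_germ_cof)
    fix g \<phi> assume gd: "(g, \<phi>) \<in> cof_dom (germ_cat S) (germ_cat S) P.GF"
    note d = P.dom_comp' [OF gd]
    have \<phi>: "\<phi> \<in> prime_chars S" using d(3) by simp
    have pcp: "point_char (germ_cat S) \<phi> \<in> prime_chars (slice_sg (germ_cat S))" using G.pc_prime d(3) by blast
    have ag: "anc (counit (germ_cat S)) \<phi> = point_char (germ_cat S) \<phi>" using d(3) by (simp add: G.anc_counit)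
    obtain s where s: "(s, \<phi>) \<in> pre_germs S" "g = germ S s \<phi>"
      using d(1) unfolding ag f.dom_germ_iff pull [OF \<phi>] by blast
    have sc: "s \<in> carrier S" using s by (simp add: S.pre_germs_iff)
    have "rho1 f.GF (g, point_char (germ_cat S) \<phi>)
        = germ (slice_sg (germ_cat S)) (Theta S s) (point_char (germ_cat S) \<phi>)"
      using f.rho_germ [OF pcp, of s] s pull [OF \<phi>] sc by (simp add: S.unit_apply)
    moreover have "g \<in> Theta S s" "src (germ_cat S) g = \<phi>" using s by (auto simp: S.Theta_iff)
    ultimately have "rho1 P.GF (g, \<phi>) = g"
      unfolding P.rho_comp [OF gd] ag
      using G.counit_at(2) [OF S.Theta_compact_slice [OF sc], of g] by simp
    moreover have "rho1 (cof_id (germ_cat S)) (g, \<phi>) = g"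
      using s \<phi> by (simp add: cof_id_sel(3) cof_dom_id)
    ultimately show "rho1 P.GF (g, \<phi>) = rho1 (cof_id (germ_cat S)) (g, \<phi>)" by simp
  qed
  show "pbr_comp (slice_sg C) (slice_map (germ_cat (slice_sg C)) C (counit C)) (unit (slice_sg C))
      = pbr_id (slice_sg C)"
    unfolding compose_def pbr_id_def
    by (intro restrict_ext)
      (simp add: C.SG.unit_apply slice_map_def C.SG.Theta_compact_slice C.cof_image_counit_Theta)
qed

section \<open>Range semigroups\<close>

context preBoolean_range
begin

lemma plus_proj [simp, intro]: "x \<in> carrier S \<Longrightarrow> p x \<in> projs S"
  by (metis plus_closed plus_star star_in_projs)

lemma proj_plus [simp]: "e \<in> projs S \<Longrightarrow> p e = e"
  by (metis proj_star projs_closed star_plus)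

text \<open>The projection \<open>p s\<close> is itself a local unit of \<open>s\<close>.\<close>

lemma preBoolean_lu: "preBoolean_lu S"
proof (intro preBoolean_lu.intro preBoolean_axioms preBoolean_lu_axioms.intro)
  fix s assume "s \<in> carrier S"
  then show "\<exists>e \<in> projs S. e \<odot> s = s" using plus_mult by (intro bexI [of _ "p s"]) auto
qed

sublocale lu: preBoolean_lu S
  by (rule preBoolean_lu)

lemma plus_proj_mult:
  assumes "e \<in> projs S" "s \<in> carrier S" shows "p (e \<odot> s) = e \<odot> p s"
proof -
  have "p (e \<odot> s) = p (e \<odot> p s)" using assms plus_of_mult by auto
  also have "\<dots> = e \<odot> p s" using assms by (intro proj_plus proj_mult) auto
  finally show ?thesis .
qed

text \<open>The image is compact, hence closed.  It is also dense: a basic open set \<open>D\<^sub>e\<close> missing it gives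
  \<open>D\<^bsub>(es)\<^sup>\<star>\<^esub> = \<emptyset>\<close>, so \<open>es = 0\<close> and \<open>es\<^sup>+ = 0\<close>.\<close>

lemma tgt_Theta:
  assumes s: "s \<in> carrier S"
  shows "tgt GS ` Theta S s = char_basic S (p s)"
proof (intro equalityI subsetI)
  fix \<psi> assume "\<psi> \<in> tgt GS ` Theta S s"
  then obtain \<phi> where \<phi>: "(s, \<phi>) \<in> pre_germs S" "\<psi> = char_act S s \<phi>" by (auto simp: Theta_iff)
  then have "\<psi> (p s)" using s plus_mult by (simp add: char_act_apply pre_germs_iff)
  then show "\<psi> \<in> char_basic S (p s)" using \<phi> lu.char_act_closed by simp
next
  fix \<psi> assume \<psi>: "\<psi> \<in> char_basic S (p s)"
  let ?R = "tgt GS ` Theta S s"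
  show "\<psi> \<in> ?R"
  proof (rule ccontr)
    assume "\<psi> \<notin> ?R"
    have "compactin CT ?R"
      using image_compactin [OF compactin_Theta [OF s] lu.tgt_cont_germ] by (simp add: germ_cat_sel)
    then have "closedin CT ?R" using Hausdorff_CT compactin_imp_closedin by blast
    then have "openin CT (topspace CT - ?R)" by blast
    moreover have "\<psi> \<in> topspace CT - ?R" using \<psi> \<open>\<psi> \<notin> ?R\<close> unfolding topspace_CT by simp
    ultimately obtain e where e: "e \<in> projs S" "\<psi> \<in> char_basic S e" "char_basic S e \<subseteq> topspace CT - ?R"
      unfolding openin_CT_iff by blast
    have "(e \<odot> s)\<^sup>\<star> = zero_of S"
    proof (rule ccontr)
      assume "(e \<odot> s)\<^sup>\<star> \<noteq> zero_of S"
      then obtain \<phi> where \<phi>: "\<phi> \<in> prime_chars S" "\<phi> ((e \<odot> s)\<^sup>\<star>)"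
        using char_exists [of "(e \<odot> s)\<^sup>\<star>"] e s by auto
      have "\<phi> (s\<^sup>\<star>)" using char_le_star [OF \<phi>(1) proj_mult_le [OF e(1) s]] \<phi>(2) e s by auto
      then have g: "(s, \<phi>) \<in> pre_germs S" using \<phi> s by (simp add: pre_germs_iff)
      then have "tgt GS (germ S s \<phi>) \<in> ?R" by (intro imageI) (auto simp: Theta_iff)
      then have "char_act S s \<phi> \<in> ?R" using g by simp
      moreover have "char_act S s \<phi> \<in> char_basic S e"
        using lu.char_act_closed [OF g] \<phi>(2) e(1) by (simp add: char_act_apply)
      ultimately show False using e(3) by blast
    qed
    then have "e \<odot> s = zero_of S" using zero_cong_star e s by auto
    then have "e \<odot> p s = zero_of S" using plus_proj_mult [OF e(1) s] by simp
    moreover have "\<psi> (e \<odot> p s)" using \<psi> e s char_mult [of \<psi> e "p s"] by auto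
    ultimately show False using \<psi> char_zero [of \<psi>] by auto
  qed
qed

lemma tgt_open_germ: "open_map (arr GS) (obj GS) (tgt GS)"
  unfolding open_map_def
proof (intro allI impI)
  fix U assume U: "openin (arr GS) U"
  show "openin (obj GS) (tgt GS ` U)"
  proof (subst openin_subopen, intro ballI)
    fix \<phi> assume "\<phi> \<in> tgt GS ` U"
    then obtain s where s: "s \<in> carrier S" "\<phi> \<in> tgt GS ` Theta S s" "Theta S s \<subseteq> U"
      using U unfolding openin_arr_germ_iff by blast
    then show "\<exists>T. openin (obj GS) T \<and> \<phi> \<in> T \<and> T \<subseteq> tgt GS ` U"
      unfolding germ_cat_sel(1)
      by (intro exI [of _ "tgt GS ` Theta S s"] conjI image_mono)
        (simp_all add: tgt_Theta)
  qed
qed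

lemma strongly_ample_germ: "strongly_ample_category GS"
  by (intro strongly_ample_category.intro lu.ample_germ strongly_ample_category_axioms.intro tgt_open_germ)

text \<open>The character at the source can be recovered from the one at the range: by
  \<open>s \<odot> e = p (s \<odot> e) \<odot> s\<close>, the value of \<phi> at \<open>e\<close>
  equals the value of \<open>char_act S s \<phi>\<close> at \<open>p (s \<odot> e)\<close>.\<close>

lemma inj_tgt_Theta:
  assumes "bideterministic S p s"
  shows "inj_on (tgt GS) (Theta S s)"
proof (rule inj_onI)
  have s: "s \<in> carrier S" and b: "\<And>e. e \<in> projs S \<Longrightarrow> s \<odot> e = p (s \<odot> e) \<odot> s"
    using assms by (auto simp: bideterministic_def)
  have *: "\<phi> e \<longleftrightarrow> char_act S s \<phi> (p (s \<odot> e))" if g: "(s, \<phi>) \<in> pre_germs S" and e: "e \<in> projs S" for \<phi> e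
  proof -
    have "\<phi> e \<longleftrightarrow> \<phi> ((s \<odot> e)\<^sup>\<star>)" using g e by (simp add: pre_germs_iff star_mult_proj char_mult)
    also have "(s \<odot> e)\<^sup>\<star> = (p (s \<odot> e) \<odot> s)\<^sup>\<star>" using b [OF e] by simp
    also have "\<phi> \<dots> \<longleftrightarrow> char_act S s \<phi> (p (s \<odot> e))" using s e by (simp add: char_act_apply)
    finally show ?thesis .
  qed
  fix g h assume "g \<in> Theta S s" "h \<in> Theta S s" and eq: "tgt GS g = tgt GS h"
  then obtain \<phi> \<psi> where g: "(s, \<phi>) \<in> pre_germs S" "g = germ S s \<phi>" and h: "(s, \<psi>) \<in> pre_germs S" "h = germ S s \<psi>"
    by (auto simp: Theta_iff)
  have "char_act S s \<phi> = char_act S s \<psi>" using eq g h by simp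
  then have "\<phi> = \<psi>"
    using * [OF g(1)] * [OF h(1)] g h
    by (intro extensionalityI [of _ "projs S"]) (auto simp: pre_germs_iff char_ext)
  then show "g = h" using g h by simp
qed

end

context etale_preBoolean_range
begin

lemma biample_germ: "biample_category GS"
proof (intro biample_category.intro bietale_category.intro bietale_category_axioms.intro
    biample_category_axioms.intro)
  interpret G: ample_category GS by (rule lu.ample_germ)
  show "etale_category GS" by (rule G.etale_category_axioms)
  \<comment> \<open>The finite decomposition of \<open>s\<close> splits \<open>Theta S s\<close>
    into the sets of its bideterministic members, and the given germ lies in one of these.\<close>
  have bis: "\<exists>b. bideterministic S p b \<and> g \<in> Theta S b \<and> Theta S b \<subseteq> Theta S s"
    if s: "s \<in> carrier S" and g: "g \<in> Theta S s" for g s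
  proof -
    obtain B where B: "finite B" "\<forall>b \<in> B. bideterministic S p b" "is_join S B s" using etale [OF s] by blast
    then obtain b where b: "b \<in> B" "g \<in> Theta S b" using g Theta_fin_join [OF B(1,3)] by blast
    then show ?thesis using B is_joinD(3) [OF B(3) b(1)] Theta_mono s by blast
  qed
  have slice: "Theta S b \<in> compact_bislices GS" if "bideterministic S p b" for b
    using that Theta_compact_slice [of b] inj_tgt_Theta
    by (simp add: compact_bislices_def compact_slices_def bislice_def bideterministic_def)
  show "local_homeomorphism (arr GS) (obj GS) (tgt GS)"
  proof (rule local_homeomorphismI [OF lu.tgt_cont_germ tgt_open_germ])
    fix g assume "g \<in> arrs GS"
    then obtain s where "s \<in> carrier S" "g \<in> Theta S s"
      by (auto simp: arrs_germ_iff Theta_iff pre_germs_iff)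
    then obtain b where "bideterministic S p b" "g \<in> Theta S b" using bis by blast
    moreover then have "b \<in> carrier S" by (simp add: bideterministic_def)
    ultimately show "\<exists>U. openin (arr GS) U \<and> g \<in> U \<and> inj_on (tgt GS) U"
      using inj_tgt_Theta openin_Theta by blast
  qed
  show "is_basis (arr GS) (compact_bislices GS)"
    unfolding is_basis_iff
  proof (intro conjI ballI allI impI)
    show "openin (arr GS) A" if "A \<in> compact_bislices GS" for A
      using that by (simp add: compact_bislices_def bislice_def slice_def)
    fix U g assume Ug: "openin (arr GS) U \<and> g \<in> U"
    then obtain s where s: "s \<in> carrier S" "g \<in> Theta S s" "Theta S s \<subseteq> U"
      unfolding openin_arr_germ_iff by blast
    obtain b where b: "bideterministic S p b" "g \<in> Theta S b" "Theta S b \<subseteq> Theta S s"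
      using bis [OF s(1,2)] by blast
    then show "\<exists>A \<in> compact_bislices GS. g \<in> A \<and> A \<subseteq> U" using s(3) slice [OF b(1)] by blast
  qed
qed

end

section \<open>Slices of strongly ample and of biample categories\<close>

context strongly_ample_category
begin

text \<open>Openness of the range map makes the range of a compact slice compact open, so that
  \<open>slice_plus C A\<close> is a projection.\<close>

lemma co_tgt: "A \<in> compact_slices C \<Longrightarrow> co (tgt C ` A)"
  using compact_tgt compact_sliceD(1) tgt_open by (simp add: co_def open_map_def)

lemma preBoolean_range_slice: "preBoolean_range KC (slice_plus C)"
proof (intro preBoolean_range.intro range_semigroup.intro SG.preBoolean_axioms
    restriction_semigroup_slice range_semigroup_axioms.intro)
  have prod: "sm (idt C ` U) (idt C ` V) = idt C ` (U \<inter> V)" if "co U" "co V" for U V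
    using coD(3) [OF that(1)] coD(3) [OF that(2)]
    by (subst sm_idt_right) (auto simp: src_idt subset_iff)
  fix A assume "A \<in> carrier KC"
  then have A: "A \<in> compact_slices C" by simp
  note a = compact_sliceD [OF A] and tA = co_tgt [OF A]
  show "slice_plus C A \<in> carrier KC" using idt_compact_slice tA by (simp add: slice_plus_def)
  show "slice_plus C A \<odot>\<^bsub>KC\<^esub> A = A"
    using sm_idt_left [OF a(4) coD(3) [OF tA]] by (auto simp: slice_plus_def)
  show "(slice_plus C A)\<^sup>\<star>\<^bsub>KC\<^esub> = slice_plus C A"
    using src_idt_image [OF coD(3) [OF tA]] by (simp add: slice_plus_def)
  show "slice_plus C (A\<^sup>\<star>\<^bsub>KC\<^esub>) = A\<^sup>\<star>\<^bsub>KC\<^esub>"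
    using tgt_idt_image [OF coD(3) [OF co_src [OF A]]] by (simp add: slice_plus_def)
  fix B assume "B \<in> carrier KC"
  then have B: "B \<in> compact_slices C" by simp
  note b = compact_sliceD [OF B] and tB = co_tgt [OF B]
  show "slice_plus C A \<odot>\<^bsub>KC\<^esub> slice_plus C B = slice_plus C B \<odot>\<^bsub>KC\<^esub> slice_plus C A"
    using prod tA tB by (simp add: slice_plus_def Int_commute)
  show "slice_plus C A \<odot>\<^bsub>KC\<^esub> slice_plus C B = slice_plus C (slice_plus C A \<odot>\<^bsub>KC\<^esub> slice_plus C B)"
    using prod [OF tA tB] tgt_idt_image [OF coD(3) [OF co_Int [OF tA tB]]] by (simp add: slice_plus_def)
  have "tgt C ` sm A (idt C ` tgt C ` B) = tgt C ` {a \<in> A. src C a \<in> tgt C ` B}"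
    using sm_idt_right [OF a(4) coD(3) [OF tB]] by simp
  then show "slice_plus C (A \<odot>\<^bsub>KC\<^esub> B) = slice_plus C (A \<odot>\<^bsub>KC\<^esub> slice_plus C B)"
    using tgt_sm [OF a(4) b(4)] by (simp add: slice_plus_def)
qed

text \<open>The first identity is the ample law. For the second, the right side consists of the
  arrows of \<open>A\<close> that share their range with an arrow of the product of \<open>A\<close>
  and \<open>E\<close>; injectivity of \<open>tgt C\<close> on \<open>A\<close> makes them arrows of
  that product.\<close>

lemma bideterministic_bislice:
  assumes A: "A \<in> compact_slices C" and inj: "inj_on (tgt C) A"
  shows "bideterministic KC (slice_plus C) A"
  unfolding bideterministic_def
proof (intro conjI ballI)
  note a = compact_sliceD [OF A]
  show "A \<in> carrier KC" using A by simp
  fix E assume E: "E \<in> projs KC"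
  show "E \<odot>\<^bsub>KC\<^esub> A = A \<odot>\<^bsub>KC\<^esub> (E \<odot>\<^bsub>KC\<^esub> A)\<^sup>\<star>\<^bsub>KC\<^esub>"
    by (rule SG.proj_move [OF E]) (simp add: A)
  have cs: "sm A E \<in> compact_slices C" using sm_compact_slice [OF A] SG.projs_closed [OF E] by simp
  obtain U where U: "co U" "E = idt C ` U" using E unfolding projs_slice_sg by blast
  have eq: "sm A E = {a \<in> A. src C a \<in> U}" using sm_idt_right [OF a(4) coD(3) [OF U(1)]] U(2) by simp
  have "sm (idt C ` tgt C ` sm A E) A = {a \<in> A. tgt C a \<in> tgt C ` sm A E}"
    using sm_idt_left [OF a(4) coD(3) [OF co_tgt [OF cs]]] .
  also have "\<dots> = sm A E" unfolding eq using inj by (auto dest: inj_onD)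
  finally show "A \<odot>\<^bsub>KC\<^esub> E = slice_plus C (A \<odot>\<^bsub>KC\<^esub> E) \<odot>\<^bsub>KC\<^esub> A"
    by (simp add: slice_plus_def)
qed

end

context biample_category
begin

lemma compact_bislice_slice: "A \<in> compact_bislices C \<Longrightarrow> A \<in> compact_slices C \<and> inj_on (tgt C) A"
  by (simp add: compact_bislices_def compact_slices_def bislice_def)

lemma strongly_ample: "strongly_ample_category C"
proof (intro strongly_ample_category.intro ample_category.intro etale_category_axioms
    ample_category_axioms.intro strongly_ample_category_axioms.intro)
  show "open_map (arr C) (obj C) (tgt C)" by (rule local_homeomorphism_open_map) (rule tgt_local_homeo)
  show "is_basis (arr C) (compact_slices C)"
    unfolding is_basis_iff
  proof (intro conjI ballI allI impI)
    show "openin (arr C) A" if "A \<in> compact_slices C" for A using compact_sliceD(1) that by blast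
    fix U a assume "openin (arr C) U \<and> a \<in> U"
    then obtain A where "A \<in> compact_bislices C" "a \<in> A" "A \<subseteq> U"
      using compact_bislices_basis unfolding is_basis_iff by blast
    then show "\<exists>A \<in> compact_slices C. a \<in> A \<and> A \<subseteq> U" using compact_bislice_slice by blast
  qed
qed

text \<open>A compact slice is covered by the compact bislices inside it. Finitely many cover it,
  their union is the join, and compact bislices are bideterministic.\<close>

lemma etale_slice: "etale_preBoolean_range KC (slice_plus C)"
proof -
  interpret strongly_ample_category C by (rule strongly_ample)
  show ?thesis
  proof (intro etale_preBoolean_range.intro preBoolean_range_slice etale_preBoolean_range_axioms.intro)
    fix A assume "A \<in> carrier KC"
    then have A: "A \<in> compact_slices C" by simp
    let ?\<B> = "{B \<in> compact_bislices C. B \<subseteq> A}"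
    have "\<exists>\<F>. finite \<F> \<and> \<F> \<subseteq> ?\<B> \<and> A \<subseteq> \<Union>\<F>"
    proof (rule compactinD [OF compact_sliceD(3) [OF A]])
      show "openin (arr C) B" if "B \<in> ?\<B>" for B
        using that compact_bislice_slice compact_sliceD(1) by blast
      show "A \<subseteq> \<Union>?\<B>"
      proof
        fix a assume "a \<in> A"
        then obtain B where "B \<in> compact_bislices C" "a \<in> B" "B \<subseteq> A"
          using compact_bislices_basis compact_sliceD(1) [OF A] unfolding is_basis_iff by blast
        then show "a \<in> \<Union>?\<B>" by blast
      qed
    qed
    then obtain \<F> where \<F>: "finite \<F>" "\<F> \<subseteq> ?\<B>" "A \<subseteq> \<Union>\<F>" by blast
    then have "A = \<Union>\<F>" by blast
    moreover have "\<F> \<subseteq> compact_slices C" using \<F>(2) compact_bislice_slice by blast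
    ultimately have "is_join KC \<F> A" using is_join_slice_iff [OF \<F>(1) _ A] by blast
    moreover have "\<forall>B \<in> \<F>. bideterministic KC (slice_plus C) B"
      using \<F>(2) compact_bislice_slice bideterministic_bislice by blast
    ultimately show "\<exists>B. finite B \<and> (\<forall>b \<in> B. bideterministic KC (slice_plus C) b)
        \<and> is_join KC B A" using \<F>(1) by blast
  qed
qed

end

section \<open>The adjunction\<close>

lemma adjunction_laws_holds:
  assumes "preBoolean_lu S" "preBoolean_lu T" "preBoolean_lu U" "preBoolean_lu V"
    and "ample_category C" "ample_category D" "ample_category E" "ample_category B"
  shows "adjunction_laws i S T U V C D E B"
  unfolding adjunction_laws_def
  using assms pbr_category_laws_holds [of S T U V i] ac_category_laws_holds [of C D E B i]
    germ_functor_laws_holds [of S T U i] slice_functor_laws_holds [of C D E i]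
    unit_laws_holds [of S T i] counit_laws_holds [of C D i] triangle_laws_holds [of S C]
  by (simp add: preBoolean_lu.axioms(1))

theorem theorem9p1:
  fixes i :: nat
    and S :: "'s rsg" and T :: "'t rsg" and U :: "'u rsg" and V :: "'v rsg"
    and pS :: "'s \<Rightarrow> 's" and pT :: "'t \<Rightarrow> 't" and pU :: "'u \<Rightarrow> 'u" and pV :: "'v \<Rightarrow> 'v"
    and C :: "('a, 'o) topcat" and D :: "('b, 'p) topcat"
    and E :: "('c, 'q) topcat" and B :: "('d, 'r) topcat"
  assumes "i \<in> {1, 2, 3, 4}"
  shows
    "( (preBoolean_lu S \<longrightarrow> ample_category (germ_cat S))
     \<and> (ample_category C \<longrightarrow> preBoolean_lu (slice_sg C))
     \<and> (preBoolean_lu S \<and> preBoolean_lu T \<and> preBoolean_lu U \<and> preBoolean_lu V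
          \<and> ample_category C \<and> ample_category D \<and> ample_category E \<and> ample_category B
          \<longrightarrow> adjunction_laws i S T U V C D E B)
     \<and> (ample_category C \<longrightarrow>
          (\<forall>x \<in> objs C. anc (counit C) x = point_char C x \<and> rho0 (counit C) x = x
             \<and> (\<forall>A \<in> compact_slices C. x \<in> src C ` A \<longrightarrow>
                  act (counit C) (germ (slice_sg C) A (point_char C x), x) = tgt C (slice_at C A x)
                  \<and> rho1 (counit C) (germ (slice_sg C) A (point_char C x), x) = slice_at C A x))
          \<and> cof_iso (germ_cat (slice_sg C)) C (counit C)) )
   \<and> ( (preBoolean_range S pS \<longrightarrow> preBoolean_lu S \<and> strongly_ample_category (germ_cat S))
     \<and> (strongly_ample_category C \<longrightarrow>
          ample_category C \<and> preBoolean_range (slice_sg C) (slice_plus C))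
     \<and> (preBoolean_range S pS \<and> preBoolean_range T pT \<and> preBoolean_range U pU \<and> preBoolean_range V pV
          \<and> strongly_ample_category C \<and> strongly_ample_category D
          \<and> strongly_ample_category E \<and> strongly_ample_category B
          \<longrightarrow> adjunction_laws i S T U V C D E B) )
   \<and> ( (etale_preBoolean_range S pS \<longrightarrow> preBoolean_range S pS \<and> biample_category (germ_cat S))
     \<and> (biample_category C \<longrightarrow>
          strongly_ample_category C \<and> etale_preBoolean_range (slice_sg C) (slice_plus C))
     \<and> (etale_preBoolean_range S pS \<and> etale_preBoolean_range T pT
          \<and> etale_preBoolean_range U pU \<and> etale_preBoolean_range V pV
          \<and> biample_category C \<and> biample_category D \<and> biample_category E \<and> biample_category B
          \<longrightarrow> adjunction_laws i S T U V C D E B) )"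
proof -
  have vals: "\<forall>x \<in> objs C. anc (counit C) x = point_char C x \<and> rho0 (counit C) x = x
             \<and> (\<forall>A \<in> compact_slices C. x \<in> src C ` A \<longrightarrow>
                  act (counit C) (germ (slice_sg C) A (point_char C x), x) = tgt C (slice_at C A x)
                  \<and> rho1 (counit C) (germ (slice_sg C) A (point_char C x), x) = slice_at C A x)"
    if "ample_category C"
  proof -
    interpret ample_category C by fact
    show ?thesis using counit_values by (simp add: anc_counit rho0_counit)
  qed
  have A: "adjunction_laws i S T U V C D E B"
    if "preBoolean_lu S" "preBoolean_lu T" "preBoolean_lu U" "preBoolean_lu V"
      "ample_category C" "ample_category D" "ample_category E" "ample_category B"
    using adjunction_laws_holds that by blast
  \<comment> \<open>The hom sets do not change, so the laws for range semigroups, and then for the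
    etale ones, are instances of the general ones. What part (2) adds is that the two constructions
    preserve the smaller classes of objects.\<close>
  have B: "adjunction_laws i S T U V C D E B"
    if "preBoolean_range S pS" "preBoolean_range T pT" "preBoolean_range U pU" "preBoolean_range V pV"
      "strongly_ample_category C" "strongly_ample_category D"
      "strongly_ample_category E" "strongly_ample_category B"
    using that by (intro A preBoolean_range.preBoolean_lu strongly_ample_category.axioms(1))
  have C: "adjunction_laws i S T U V C D E B"
    if "etale_preBoolean_range S pS" "etale_preBoolean_range T pT"
      "etale_preBoolean_range U pU" "etale_preBoolean_range V pV"
      "biample_category C" "biample_category D" "biample_category E" "biample_category B"
    using that by (intro B etale_preBoolean_range.axioms(1) biample_category.strongly_ample)
  note pbr = preBoolean_lu.ample_germ [of S] preBoolean_range.preBoolean_lu [of S pS]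
    preBoolean_range.strongly_ample_germ [of S pS] etale_preBoolean_range.axioms(1) [of S pS]
    etale_preBoolean_range.biample_germ [of S pS]
  note ac = ample_category.preBoolean_lu_slice [of C] ample_category.counit_iso [of C]
    strongly_ample_category.axioms(1) [of C] strongly_ample_category.preBoolean_range_slice [of C]
    biample_category.strongly_ample [of C] biample_category.etale_slice [of C]
  show ?thesis
    by (intro conjI impI; (elim conjE)?; rule vals A B C pbr ac; assumption)
qed

end
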